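(* Let $1<\alpha\le 2$, let $L$ be the spectrally positive $\alpha$-stable Lévy process normalized by $\ln \mathbb{E}[e^{i\lambda L_1}]=(i\lambda)^\alpha e^{-i\pi\alpha\,\mathrm{sgn}(\lambda)}$ ($\lambda\in\mathbb{R}$), let $L^{\uparrow}$ be the process $L$ started from $0$ and conditioned to stay positive, and set $\mathcal{A}^{\uparrow}=\int_0^1 L^{\uparrow}_t\,dt$. Let $$\Phi_\alpha(x)= \frac{1}{\pi}\sum_{n=0}^{+\infty} \frac{(-1)^{n}}{n!}\Gamma\left(\frac{1+n}{1+\alpha}\right)\sin\left(\pi\frac{1+n}{1+\alpha}\right) (1+\alpha)^{\frac{n-\alpha}{1+\alpha}} x^n,$$ $$\Psi_\alpha(x)= \frac{1}{\pi}\sum_{n=0}^{+\infty} \frac{(-1)^{n}}{n!}\Gamma\left(\frac{1+n}{1+\alpha}\right)\cos\left(\pi\frac{1+n}{1+\alpha}\right) (1+\alpha)^{\frac{n-\alpha}{1+\alpha}} x^n.$$ Then for every $\lambda>0$, $$\int_0^{+\infty}e^{-\lambda t}\,\mathbb{E}\left[e^{- t^{1+\frac{1}{\alpha}}\mathcal{A}^\uparrow }\right] dt = \pi \lambda\,\frac{ \Phi_\alpha'(\lambda)\Psi_\alpha(\lambda) -\Psi_\alpha'(\lambda)\Phi_\alpha(\lambda)}{\Phi_\alpha(\lambda)}- \frac{\Phi_\alpha'(\lambda)}{\Phi_\alpha(\lambda)}.$$ In particular, for $1<\alpha<2$, as $x\to+\infty$, $$\mathbb{P}(\mathcal{A}^\uparrow>x)\sim\frac{\Gamma(1+\alpha)}{\Gamma\left(1+\alpha-\frac{1}{\alpha}\right)\Gamma\left(2-\alpha\right)}\,x^{1-\alpha},$$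 where $\sim$ means that the ratio of both sides tends to $1$.
   Context: $L$ is an $\alpha$-stable Lévy process without negative jumps, $1<\alpha\le 2$, realized on the Skorokhod space of càdlàg paths. Powers of complex numbers are principal branches; the normalization is equivalent to $\mathbb{E}[e^{-\lambda L_1}]=e^{\lambda^\alpha}$ for $\lambda\ge0$ (so for $\alpha=2$, $L=\sqrt2\,B$ with $B$ a standard Brownian motion). $\mathbb{P}_x$ (with expectation $\mathbb{E}_x$) is the law of $L$ started at $L_0=x$, $\mathbb{P}=\mathbb{P}_0$, $(\mathcal{F}_t)_{t\ge0}$ is the natural filtration, and $T_0=\inf\{t\ge0: L_t=0\}$. Conditioning to stay positive: for $x>0$, the law $\mathbb{P}_x^{\uparrow}$ of $L$ started at $x$ and conditioned to stay positive is given by the $h$-transform $$\mathbb{P}_x^{\uparrow}(\Lambda_t) = \frac{1}{x}\,\mathbb{E}_x\left[L_t\, 1_{\Lambda_t}\, 1_{\{T_0>t\}}\right],\qquad \Lambda_t\in\mathcal{F}_t,\ t\ge0.$$ These laws converge weakly in the Skorokhod sense as $x\downarrow0$ to a law $\mathbb{P}_0^{\uparrow}$, and $L^{\uparrow}$ denotes a process with law $\mathbb{P}_0^{\uparrow}$. *)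

theory Defs
  imports "HOL-Probability.Probability" "HOL-Real_Asymp.Real_Asymp"
begin

definition cadlag :: "(real \<Rightarrow> real) \<Rightarrow> bool" where
  "cadlag w \<longleftrightarrow> (\<forall>t\<ge>0. (w \<longlongrightarrow> w t) (at_right t)) \<and> (\<forall>t>0. \<exists>l. (w \<longlongrightarrow> l) (at_left t))"

(* Paths are indexed by [0,\<infinity>); membership in extensional {0..} makes equality in this set
   coincide with equality on [0,\<infinity>). *)
definition cadlag_paths :: "(real \<Rightarrow> real) set" where
  "cadlag_paths = {w \<in> extensional {0..}. cadlag w}"

definition path_space :: "(real \<Rightarrow> real) measure" where
  "path_space = restrict_space (\<Pi>\<^sub>M t\<in>{0..}. borel) cadlag_paths"

definition natural_filtration :: "real \<Rightarrow> (real \<Rightarrow> real) set set" where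
  "natural_filtration t =
     sigma_sets cadlag_paths {{w \<in> cadlag_paths. w s \<in> B} | s B. 0 \<le> s \<and> s \<le> t \<and> B \<in> sets borel}"

(* J1 convergence on [0,\<infinity>). A strictly increasing bijection of [0,\<infinity>) onto itself is
   automatically continuous, so r n ranges over exactly the usual time changes. *)
definition skorokhod_converges :: "(nat \<Rightarrow> real \<Rightarrow> real) \<Rightarrow> (real \<Rightarrow> real) \<Rightarrow> bool" where
  "skorokhod_converges u w \<longleftrightarrow>
     (\<exists>r :: nat \<Rightarrow> real \<Rightarrow> real.
        (\<forall>n. strict_mono_on {0..} (r n) \<and> bij_betw (r n) {0..} {0..}) \<and>
        uniform_limit {0..} r (\<lambda>s. s) sequentially \<and>
        (\<forall>N. uniform_limit {0..N} (\<lambda>n s. u n (r n s)) w sequentially))"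

(* The J1 topology is metrizable, hence determined by its convergent sequences: its open sets
   are the sequentially open ones. *)
definition skorokhod_open :: "(real \<Rightarrow> real) set \<Rightarrow> bool" where
  "skorokhod_open U \<longleftrightarrow> U \<subseteq> cadlag_paths \<and>
     (\<forall>u w. w \<in> U \<and> (\<forall>n. u n \<in> cadlag_paths) \<and> skorokhod_converges u w
        \<longrightarrow> (\<forall>\<^sub>F n in sequentially. u n \<in> U))"

definition skorokhod_topology :: "(real \<Rightarrow> real) topology" where
  "skorokhod_topology = topology skorokhod_open"

lemma istopology_skorokhod_open: "istopology skorokhod_open"
  unfolding istopology_def
proof (intro conjI allI impI)
  fix S T assume "skorokhod_open S" "skorokhod_open T"
  then show "skorokhod_open (S \<inter> T)"
    unfolding skorokhod_open_def Int_iff eventually_conj_iff by blast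
next
  fix K assume K: "\<forall>S\<in>K. skorokhod_open S"
  show "skorokhod_open (\<Union>K)"
    unfolding skorokhod_open_def
  proof (intro conjI allI impI)
    show "\<Union>K \<subseteq> cadlag_paths"
      using K unfolding skorokhod_open_def by blast
  next
    fix u w
    assume w: "w \<in> \<Union>K \<and> (\<forall>n. u n \<in> cadlag_paths) \<and> skorokhod_converges u w"
    then obtain S where S: "S \<in> K" "w \<in> S" by blast
    then have "\<forall>\<^sub>F n in sequentially. u n \<in> S"
      using K w unfolding skorokhod_open_def by blast
    then show "\<forall>\<^sub>F n in sequentially. u n \<in> \<Union>K"
      using S by (auto elim: eventually_mono)
  qed
qed

lemma openin_skorokhod_topology: "openin skorokhod_topology U \<longleftrightarrow> skorokhod_open U"
  by (simp add: skorokhod_topology_def topology_inverse'[OF istopology_skorokhod_open])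

lemma topspace_skorokhod_topology: "topspace skorokhod_topology = cadlag_paths"
proof -
  have "skorokhod_open cadlag_paths"
    by (simp add: skorokhod_open_def)
  then show ?thesis
    unfolding topspace_def openin_skorokhod_topology
    by (auto simp: skorokhod_open_def)
qed

definition skorokhod_weak_conv ::
    "('i \<Rightarrow> (real \<Rightarrow> real) measure) \<Rightarrow> (real \<Rightarrow> real) measure \<Rightarrow> 'i filter \<Rightarrow> bool" where
  "skorokhod_weak_conv Q Q0 F \<longleftrightarrow>
     (\<forall>f. continuous_map skorokhod_topology euclideanreal f \<and> bounded (f ` cadlag_paths)
        \<longrightarrow> ((\<lambda>i. integral\<^sup>L (Q i) f) \<longlongrightarrow> integral\<^sup>L Q0 f) F)"

definition path_law :: "(real \<Rightarrow> real) measure \<Rightarrow> bool" where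
  "path_law P \<longleftrightarrow> prob_space P \<and> sets P = sets path_space"

definition levy_law :: "(real \<Rightarrow> real) measure \<Rightarrow> bool" where
  "levy_law P \<longleftrightarrow> path_law P \<and>
     (AE w in P. w 0 = 0) \<and>
     (\<forall>(t :: nat \<Rightarrow> real) n. 0 \<le> t 0 \<and> mono t \<longrightarrow>
        prob_space.indep_vars P (\<lambda>_. borel) (\<lambda>i w. w (t (Suc i)) - w (t i)) {..<n}) \<and>
     (\<forall>s\<ge>0. \<forall>h\<ge>0. distr P borel (\<lambda>w. w (s + h) - w s) = distr P borel (\<lambda>w. w h))"

definition stable_law :: "real \<Rightarrow> (real \<Rightarrow> real) measure \<Rightarrow> bool" where
  "stable_law \<alpha> P \<longleftrightarrow> levy_law P \<and>
     (\<forall>c>0. \<forall>t\<ge>0. distr P borel (\<lambda>w. w (c * t)) = distr P borel (\<lambda>w. c powr (1 / \<alpha>) * w t))"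

definition no_negative_jumps :: "(real \<Rightarrow> real) \<Rightarrow> bool" where
  "no_negative_jumps w \<longleftrightarrow> (\<forall>t>0. Lim (at_left t) w \<le> w t)"

(* The last conjunct is ln E[exp(i \<theta> L_1)] = (i \<theta>)^\<alpha> exp(-i \<pi> \<alpha> sgn \<theta>) for the continuous
   logarithm vanishing at \<theta> = 0; the principal logarithm would be wrong for large \<theta>. *)
definition normalized_spectrally_positive_stable_law :: "real \<Rightarrow> (real \<Rightarrow> real) measure \<Rightarrow> bool" where
  "normalized_spectrally_positive_stable_law \<alpha> P \<longleftrightarrow> stable_law \<alpha> P \<and>
     (AE w in P. no_negative_jumps w) \<and>
     (\<forall>\<theta>::real. char (distr P borel (\<lambda>w. w 1)) \<theta> =
        exp ((\<i> * complex_of_real \<theta>) powr complex_of_real \<alpha>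
             * exp (- \<i> * complex_of_real (pi * \<alpha> * sgn \<theta>))))"

definition law_started_at :: "(real \<Rightarrow> real) measure \<Rightarrow> real \<Rightarrow> (real \<Rightarrow> real) measure" where
  "law_started_at P x = distr P path_space (\<lambda>w. \<lambda>t\<in>{0..}. x + w t)"

definition hitting_time_zero :: "(real \<Rightarrow> real) \<Rightarrow> ereal" where
  "hitting_time_zero w = Inf (ereal ` {t. 0 \<le> t \<and> w t = 0})"

(* The integral is taken over the completion since the event {hitting_time_zero > t} need only be
   measurable up to a null set, and the Bochner integral of a non-measurable function is 0 by convention. *)
definition conditioned_positive_law ::
    "(real \<Rightarrow> real) measure \<Rightarrow> real \<Rightarrow> (real \<Rightarrow> real) measure \<Rightarrow> bool" where
  "conditioned_positive_law P x Q \<longleftrightarrow> path_law Q \<and>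
     (\<forall>t\<ge>0. \<forall>\<Lambda>\<in>natural_filtration t.
        measure Q \<Lambda> = 1 / x * (\<integral>w. w t * indicator \<Lambda> w * indicator {w. ereal t < hitting_time_zero w} w
                                 \<partial>completion (law_started_at P x)))"

definition path_area :: "(real \<Rightarrow> real) \<Rightarrow> real" where
  "path_area w = (LINT t:{0..1}|lborel. w t)"

definition Phi :: "real \<Rightarrow> real \<Rightarrow> real" where
  "Phi \<alpha> x = 1 / pi * (\<Sum>n. (-1) ^ n / fact n * Gamma ((1 + real n) / (1 + \<alpha>))
      * sin (pi * ((1 + real n) / (1 + \<alpha>))) * (1 + \<alpha>) powr ((real n - \<alpha>) / (1 + \<alpha>)) * x ^ n)"

definition Psi :: "real \<Rightarrow> real \<Rightarrow> real" where
  "Psi \<alpha> x = 1 / pi * (\<Sum>n. (-1) ^ n / fact n * Gamma ((1 + real n) / (1 + \<alpha>))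
      * cos (pi * ((1 + real n) / (1 + \<alpha>))) * (1 + \<alpha>) powr ((real n - \<alpha>) / (1 + \<alpha>)) * x ^ n)"

end

theory Submission
  imports Defs "HOL-Complex_Analysis.Complex_Analysis"
begin

text \<open>Kill the path, started at x, on going below zero and discount it at rate q plus its current position. A martingale
  argument, carried out in discrete time with the characteristic function and extended from the imaginary axis to the
  half plane Re z > 0 by reflection, gives p = exp(-zx) + \<integral> (z^\<alpha> - q - y) exp(-zy) \<nu>(dy), where \<nu> is the discounted occupation
  measure and p the discounted passage probability. Multiplying by exp(-qz + z^(\<alpha>+1)/(\<alpha>+1)) and integrating along the ray
  of argument \<pi>/(1+\<alpha>) turns this into p W(q) = W(x+q) - \<nu>(\<real>) with W = \<pi>(\<Psi> + \<i>\<Phi>), which determines p = \<Phi>(x+q)/\<Phi>(q), the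
  mass and the mean of \<nu>. The mean divided by x is the Laplace transform, in t, of the discounted area under the
  h-transform started at x; scaling reduces time t to time 1, and x \<rightarrow> 0 gives the formula.

  For the tail, barrier functions for p and the same identity integrated over real z give the behaviour of the formula
  for large \<lambda>. A Tauberian theorem turns this into the behaviour near zero of the Laplace transform of the area, and a
  second application into its tail.\<close>

section \<open>A Tauberian theorem for monotone densities\<close>

text \<open>The normalization gives the characteristic function only; finite exponential moments of
  the path are not at hand. On the imaginary axis the exponential has modulus one, so the discrete
  martingale is bounded. What is continued to Re z > 0 is the identity and not the martingale, which
  is possible because \<nu> lives on the nonnegative half line. The factor z^\<alpha> - q - y is the
  logarithmic derivative of exp(-(q+y)z + z^(\<alpha>+1)/(\<alpha>+1)). Each y therefore contributes
  an exact derivative, whose integral from 0 to infinity is -1 whatever y is. On the chosen ray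
  z^(\<alpha>+1) = -r^(\<alpha>+1), which gives convergence, and the ray stays in Re z \<ge> 0
  because \<alpha> \<ge> 1. The resulting equation is complex while p and the mass of \<nu> are
  real: its imaginary part determines p, its real part then the mass, and the identity at z = 0 the
  mean. The hitting event in the h-transform is known up to completion only, so it is squeezed
  between survival events at nearby levels; the law started at 0 is only a weak limit, so its
  functionals are kept bounded and continuous.\<close>

lemma exp_moment_convergence:
  fixes U :: "'i \<Rightarrow> real \<Rightarrow> real" and V :: "real \<Rightarrow> real" and h :: "real \<Rightarrow> real"
  assumes U: "\<forall>\<^sub>F i in F. set_integrable lborel {0..} (\<lambda>t. exp (- t) * U i t) \<and> (\<forall>t\<ge>0. 0 \<le> U i t)"
    and V: "set_integrable lborel {0..} (\<lambda>t. exp (- t) * V t)" "\<And>t. 0 \<le> t \<Longrightarrow> 0 \<le> V t"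
    and lim: "\<And>k::nat. ((\<lambda>i. LINT t:{0..}|lborel. exp (- t) ^ k * (exp (- t) * U i t)) \<longlongrightarrow>
                   (LINT t:{0..}|lborel. exp (- t) ^ k * (exp (- t) * V t))) F"
    and h: "continuous_on {0..1} h"
  shows "((\<lambda>i. LINT t:{0..}|lborel. h (exp (- t)) * (exp (- t) * U i t)) \<longlongrightarrow>
          (LINT t:{0..}|lborel. h (exp (- t)) * (exp (- t) * V t))) F"
proof -
  define I where "I f u = (LINT t:{0..}|lborel. f (exp (- t)) * (exp (- t) * u t))" for f u :: "real \<Rightarrow> real"
  have intg: "set_integrable lborel {0..} (\<lambda>t. f (exp (- t)) * (exp (- t) * u t))"
    if f: "continuous_on {0..1} f" and u: "set_integrable lborel {0..} (\<lambda>t. exp (- t) * u t)" for f u :: "real \<Rightarrow> real"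
  proof -
    obtain B where B: "\<And>y. y \<in> {0..1} \<Longrightarrow> norm (f y) \<le> B"
      using compact_imp_bounded[OF compact_continuous_image[OF f compact_Icc]]
      unfolding bounded_iff by blast
    have c: "continuous_on {0..} (\<lambda>t. f (exp (- t)))"
      by (rule continuous_on_compose2[OF f]) (auto intro!: continuous_intros)
    have m: "(\<lambda>t. indicator {0..} t *\<^sub>R f (exp (- t))) \<in> borel_measurable lborel"
      using borel_measurable_continuous_on_indicator[OF _ c] by simp
    have "integrable lborel (\<lambda>t. (indicator {0..} t *\<^sub>R f (exp (- t))) * (indicator {0..} t *\<^sub>R (exp (- t) * u t)))"
    proof (rule Bochner_Integration.integrable_bound)
      show "integrable lborel (\<lambda>t. B * (indicator {0..} t *\<^sub>R (exp (- t) * u t)))"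
        using u unfolding set_integrable_def by (rule integrable_mult_right)
      show "(\<lambda>t. (indicator {0..} t *\<^sub>R f (exp (- t))) * (indicator {0..} t *\<^sub>R (exp (- t) * u t)))
             \<in> borel_measurable lborel"
        by (rule borel_measurable_times[OF m borel_measurable_integrable[OF u[unfolded set_integrable_def]]])
      show "AE t in lborel. norm ((indicator {0..} t *\<^sub>R f (exp (- t))) * (indicator {0..} t *\<^sub>R (exp (- t) * u t)))
          \<le> norm (B * (indicator {0..} t *\<^sub>R (exp (- t) * u t)))"
      proof (rule AE_I2)
        fix t :: real
        have "0 \<le> t \<Longrightarrow> \<bar>f (exp (- t))\<bar> \<le> \<bar>B\<bar>" using B[of "exp (- t)"] by auto
        then show "norm ((indicator {0..} t *\<^sub>R f (exp (- t))) * (indicator {0..} t *\<^sub>R (exp (- t) * u t)))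
          \<le> norm (B * (indicator {0..} t *\<^sub>R (exp (- t) * u t)))"
          by (auto simp: indicator_def abs_mult intro!: mult_right_mono)
      qed
    qed
    then show ?thesis
      unfolding set_integrable_def by (rule back_subst[where P="integrable lborel"]) (auto simp: indicator_def)
  qed
  \<comment> \<open>A uniform error e on [0,1] costs at most e times the total mass, because the
    measures exp(-t) u(t) dt are positive. Since exp(-t) takes values in [0,1], Weierstrass
    approximation then reduces h to polynomials in exp(-t).\<close>
  have approx: "\<bar>I h u - I p u\<bar> \<le> e * I (\<lambda>_. 1) u"
    if p: "continuous_on {0..1} p" and e: "\<And>y. y \<in> {0..1} \<Longrightarrow> \<bar>h y - p y\<bar> \<le> e"
      and u: "set_integrable lborel {0..} (\<lambda>t. exp (- t) * u t)" "\<And>t. 0 \<le> t \<Longrightarrow> 0 \<le> u t" for p u e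
  proof -
    have 1: "I h u - I p u = (LINT t:{0..}|lborel. (h (exp (- t)) - p (exp (- t))) * (exp (- t) * u t))"
      unfolding I_def left_diff_distrib by (rule set_integral_diff(2)[symmetric, OF intg[OF h u(1)] intg[OF p u(1)]])
    have i: "set_integrable lborel {0..} (\<lambda>t. (h (exp (- t)) - p (exp (- t))) * (exp (- t) * u t))"
      using intg[OF continuous_on_diff[OF h p] u(1)] by simp
    have "norm (LINT t:{0..}|lborel. (h (exp (- t)) - p (exp (- t))) * (exp (- t) * u t))
       \<le> (LINT t:{0..}|lborel. norm ((h (exp (- t)) - p (exp (- t))) * (exp (- t) * u t)))"
      by (rule set_integral_norm_bound[OF i])
    also have "\<dots> \<le> (LINT t:{0..}|lborel. e * (exp (- t) * u t))"
    proof (rule set_integral_mono)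
      show "set_integrable lborel {0..} (\<lambda>t. norm ((h (exp (- t)) - p (exp (- t))) * (exp (- t) * u t)))"
        by (rule set_integrable_norm[OF i])
      show "set_integrable lborel {0..} (\<lambda>t. e * (exp (- t) * u t))" using u(1) by simp
      fix t :: real assume "t \<in> {0..}"
      then show "norm ((h (exp (- t)) - p (exp (- t))) * (exp (- t) * u t)) \<le> e * (exp (- t) * u t)"
        using e[of "exp (- t)"] u(2)[of t] by (auto simp: abs_mult intro!: mult_right_mono)
    qed
    also have "\<dots> = e * I (\<lambda>_. 1) u" unfolding I_def by simp
    finally show ?thesis unfolding 1 by simp
  qed
  have poly: "((\<lambda>i. I p (U i)) \<longlongrightarrow> I p V) F" if "real_polynomial_function p" for p
  proof -
    from that[unfolded real_polynomial_function_iff_sum]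
    obtain a n where p: "p = (\<lambda>x. \<Sum>k\<le>n. a k * x ^ k)" by (elim exE)
    have ex: "I p u = (\<Sum>k\<le>n. a k * I (\<lambda>y. y ^ k) u)" if u: "set_integrable lborel {0..} (\<lambda>t. exp (- t) * u t)" for u
    proof -
      have "I p u = (LINT t:{0..}|lborel. (\<Sum>k\<le>n. a k * (exp (- t) ^ k * (exp (- t) * u t))))"
        unfolding I_def p sum_distrib_right mult.assoc ..
      also have "\<dots> = (\<Sum>k\<le>n. (LINT t:{0..}|lborel. a k * (exp (- t) ^ k * (exp (- t) * u t))))"
        unfolding set_lebesgue_integral_def scaleR_sum_right
      proof (rule Bochner_Integration.integral_sum)
        fix k
        have "set_integrable lborel {0..} (\<lambda>t. (a k * exp (- t) ^ k) * (exp (- t) * u t))"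
          by (rule intg[OF _ u, of "\<lambda>y. a k * y ^ k"]) (intro continuous_intros)
        then show "integrable lborel (\<lambda>t. indicator {0..} t *\<^sub>R (a k * (exp (- t) ^ k * (exp (- t) * u t))))"
          by (simp add: set_integrable_def mult.assoc)
      qed
      finally show ?thesis unfolding I_def by simp
    qed
    have "((\<lambda>i. \<Sum>k\<le>n. a k * I (\<lambda>y. y ^ k) (U i)) \<longlongrightarrow> (\<Sum>k\<le>n. a k * I (\<lambda>y. y ^ k) V)) F"
      using lim unfolding I_def by (intro tendsto_intros)
    then have "((\<lambda>i. \<Sum>k\<le>n. a k * I (\<lambda>y. y ^ k) (U i)) \<longlongrightarrow> I p V) F" by (simp add: ex[OF V(1)])
    then show ?thesis
      by (rule Lim_transform_eventually) (use U in \<open>eventually_elim, auto simp: ex\<close>)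
  qed
  have one: "((\<lambda>i. I (\<lambda>_. 1) (U i)) \<longlongrightarrow> I (\<lambda>_. 1) V) F"
    by (rule poly) (rule real_polynomial_function.intros(2))
  have "((\<lambda>i. I h (U i)) \<longlongrightarrow> I h V) F"
  proof (rule tendstoI)
    fix e :: real assume e: "0 < e"
    \<comment> \<open>K strictly exceeds the limiting mass, hence eventually the masses along F;
      three errors of size e / 3 are budgeted.\<close>
    define K where "K = \<bar>I (\<lambda>_. 1) V\<bar> + 1"
    have K: "K > 0" by (simp add: K_def)
    define d where "d = e / (3 * K)"
    have d: "d > 0" using e K by (simp add: d_def)
    obtain p where p: "polynomial_function p" "\<And>y. y \<in> {0..1} \<Longrightarrow> norm (h y - p y) < d"
      using Stone_Weierstrass_polynomial_function[OF compact_Icc h d] by blast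
    have rp: "real_polynomial_function p" using p(1) by (simp add: real_polynomial_function_eq)
    have cp: "continuous_on {0..1} p" using p(1) by (rule continuous_on_polymonial_function)
    have pd: "\<bar>h y - p y\<bar> \<le> d" if "y \<in> {0..1}" for y using p(2)[OF that] by simp
    have dK: "d * K = e / 3" using K by (simp add: d_def)
    have "I (\<lambda>_. 1) V < K" by (simp add: K_def)
    then have "d * I (\<lambda>_. 1) V < d * K" using d by (rule mult_strict_left_mono)
    then have 3: "\<bar>I h V - I p V\<bar> < e / 3"
      using approx[OF cp pd V] dK by linarith
    have 1: "\<forall>\<^sub>F i in F. I (\<lambda>_. 1) (U i) < K"
      using order_tendstoD(2)[OF one] by (simp add: K_def)
    have 2: "\<forall>\<^sub>F i in F. dist (I p (U i)) (I p V) < e / 3"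
      by (rule tendstoD[OF poly[OF rp]]) (use e in simp)
    show "\<forall>\<^sub>F i in F. dist (I h (U i)) (I h V) < e"
      using U 1 2
    proof eventually_elim
      case (elim i)
      have "\<bar>I h (U i) - I p (U i)\<bar> \<le> d * I (\<lambda>_. 1) (U i)"
        using elim by (intro approx[OF cp pd]) auto
      also have "\<dots> \<le> d * K" using elim d by (intro mult_left_mono) auto
      finally show ?case using 3 elim(3) dK unfolding dist_real_def by linarith
    qed
  qed
  then show ?thesis unfolding I_def .
qed

lemma Gamma_laplace_integral:
  fixes a s :: real
  assumes a: "a > -1" and s: "s > 0"
  shows "set_integrable lborel {0..} (\<lambda>t. t powr a * exp (- s * t))"
    and "(LINT t:{0..}|lborel. t powr a * exp (- s * t)) = Gamma (a + 1) * s powr (- a - 1)"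
proof -
  have "((\<lambda>t. t powr (a + 1 - 1) / exp t) has_integral Gamma (a + 1)) {0..}"
    by (rule Gamma_integral_real) (use a in simp)
  then have n: "(\<integral>\<^sup>+ x. ennreal (indicator {0..} x * (x powr a / exp x)) \<partial>lborel) = ennreal (Gamma (a + 1))"
    by (intro nn_integral_has_integral_lebesgue) auto
  have G: "Gamma (a + 1) > 0" using a by (intro Gamma_real_pos) auto
  have hb1: "has_bochner_integral lborel (\<lambda>x. indicator {0..} x * (x powr a / exp x)) (Gamma (a + 1))"
    by (rule has_bochner_integral_nn_integral[OF _ _ _ n]) (use G in auto)
  have "has_bochner_integral lborel (\<lambda>x. indicator {0..} (0 + s * x) * ((0 + s * x) powr a / exp (0 + s * x)))
      (Gamma (a + 1) /\<^sub>R \<bar>s\<bar>)"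
    by (rule lborel_has_bochner_integral_real_affine_iff[THEN iffD1, OF _ hb1]) (use s in simp)
  \<comment> \<open>The dilation produces (s x)^a; the factor \<open>s powr (-a)\<close> removes s^a
    again.\<close>
  then have "has_bochner_integral lborel (\<lambda>x. s powr (-a) *\<^sub>R (indicator {0..} (0 + s * x) * ((0 + s * x) powr a / exp (0 + s * x))))
      (s powr (-a) *\<^sub>R (Gamma (a + 1) /\<^sub>R \<bar>s\<bar>))"
    by (rule has_bochner_integral_scaleR_right)
  then have "has_bochner_integral lborel (\<lambda>x. indicator {0..} x *\<^sub>R (x powr a * exp (- s * x)))
      (Gamma (a + 1) * s powr (- a - 1))"
  proof (rule has_bochner_integral_cong[OF refl _ _, THEN iffD1, rotated -1])
    fix x
    show "s powr (-a) *\<^sub>R (indicator {0..} (0 + s * x) * ((0 + s * x) powr a / exp (0 + s * x))) =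
       indicator {0..} x *\<^sub>R (x powr a * exp (- s * x))"
      using s by (auto simp: indicator_def powr_mult zero_le_mult_iff exp_minus field_simps powr_minus)
    show "s powr (-a) *\<^sub>R (Gamma (a + 1) /\<^sub>R \<bar>s\<bar>) = Gamma (a + 1) * s powr (- a - 1)"
      using s by (simp add: powr_diff powr_minus divide_simps)
  qed
  then show "set_integrable lborel {0..} (\<lambda>t. t powr a * exp (- s * t))"
    and "(LINT t:{0..}|lborel. t powr a * exp (- s * t)) = Gamma (a + 1) * s powr (- a - 1)"
    unfolding set_integrable_def set_lebesgue_integral_def
    by (auto simp: has_bochner_integral_iff)
qed

text \<open>Karamata's argument. The transforms identify the limit of the measures exp(-t) U(t) dt
  as the one with U(t) = C t^b. Since U is monotone, U(1) is squeezed between its averages just left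
  and just right of 1, and these tend to numbers near C. The rescaling usual in Tauberian theorems
  is hidden in the index i, so one statement serves both the behaviour near 0 and the behaviour near
  infinity.\<close>

lemma monotone_density_tauberian:
  fixes U :: "'i \<Rightarrow> real \<Rightarrow> real" and b C :: real
  assumes b: "b > -1" and C: "C \<ge> 0"
    and U: "\<forall>\<^sub>F i in F. set_integrable lborel {0..} (\<lambda>t. exp (- t) * U i t) \<and> (\<forall>t\<ge>0. 0 \<le> U i t)"
    and mono: "(\<forall>\<^sub>F i in F. mono_on {0..} (U i)) \<or> (\<forall>\<^sub>F i in F. antimono_on {0..} (U i))"
    and lim: "\<And>s. s > 0 \<Longrightarrow> ((\<lambda>i. LINT t:{0..}|lborel. exp (- s * t) * U i t) \<longlongrightarrow>
                   C * Gamma (b + 1) * s powr (- b - 1)) F"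
  shows "((\<lambda>i. U i 1) \<longlongrightarrow> C) F"
proof -
  define V where "V t = C * t powr b" for t
  have Vi: "set_integrable lborel {0..} (\<lambda>t. exp (- t) * V t)"
    using set_integrable_mult_right[of C, OF Gamma_laplace_integral(1)[OF b, of 1]]
    by (simp add: V_def mult_ac)
  have Vl: "(LINT t:{0..}|lborel. exp (- s * t) * V t) = C * Gamma (b + 1) * s powr (- b - 1)" if "s > 0" for s
  proof -
    have "(LINT t:{0..}|lborel. exp (- s * t) * V t) = (LINT t:{0..}|lborel. C * (t powr b * exp (- s * t)))"
      by (simp add: V_def mult_ac)
    also have "\<dots> = C * (LINT t:{0..}|lborel. t powr b * exp (- s * t))" by (rule set_integral_mult_right)
    finally show ?thesis using Gamma_laplace_integral(2)[OF b that] by simp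
  qed
  \<comment> \<open>The moments of exp(-t) are the Laplace transforms at the integers k + 1.\<close>
  have ek: "exp (- t) ^ k * (exp (- t) * x) = exp (- real (Suc k) * t) * x" for t x :: real and k
  proof -
    have "exp (- t) ^ k * exp (- t) = exp (- real (Suc k) * t)"
      using exp_of_nat_mult[of "Suc k" "- t"] by (metis minus_mult_commute power_Suc2)
    then show ?thesis by (metis mult.assoc)
  qed
  have cont: "((\<lambda>i. LINT t:{0..}|lborel. h (exp (- t)) * (exp (- t) * U i t)) \<longlongrightarrow>
          (LINT t:{0..}|lborel. h (exp (- t)) * (exp (- t) * V t))) F"
    if "continuous_on {0..1} h" for h
  proof (rule exp_moment_convergence[OF U Vi _ _ that])
    show "0 \<le> V t" for t using C by (simp add: V_def)
    show "((\<lambda>i. LINT t:{0..}|lborel. exp (- t) ^ k * (exp (- t) * U i t)) \<longlongrightarrow>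
                   (LINT t:{0..}|lborel. exp (- t) ^ k * (exp (- t) * V t))) F" for k
      unfolding ek Vl[of "real (Suc k)", OF of_nat_0_less_iff[THEN iffD2, OF zero_less_Suc]]
      by (rule lim) simp
  qed
  \<comment> \<open>A normalized tent on [x, y] is a continuous function of exp(-t), so averages
    against it converge.\<close>
  have bump: "\<exists>g. (\<forall>t. 0 \<le> g t) \<and> (\<forall>t. t \<notin> {x..y} \<longrightarrow> g t = 0) \<and> integrable lborel g \<and> (LINT t|lborel. g t) = 1 \<and>
      ((\<lambda>i. LINT t|lborel. g t * U i t) \<longlongrightarrow> (LINT t|lborel. g t * V t)) F \<and>
      (\<forall>\<^sub>F i in F. integrable lborel (\<lambda>t. g t * U i t)) \<and> integrable lborel (\<lambda>t. g t * V t)"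
    if xy: "0 < x" "x < y" for x y :: real
  proof -
    define g0 where "g0 t = max 0 (min (t - x) (y - t))" for t :: real
    have g0c: "continuous_on S g0" for S unfolding g0_def by (intro continuous_intros)
    have g00: "g0 t = 0" if "t \<notin> {x..y}" for t using that by (auto simp: g0_def)
    have g0nn: "0 \<le> g0 t" for t by (simp add: g0_def)
    have supp: "g0 t = indicator {x..y} t *\<^sub>R g0 t" for t using g00 by (auto simp: indicator_def)
    have g0i: "integrable lborel g0"
      using borel_integrable_compact[OF compact_Icc g0c, of x y] unfolding supp[symmetric] .
    define m where "m = (LINT t|lborel. g0 t)"
    define d where "d = (y - x) / 4"
    have d: "d > 0" using xy by (simp add: d_def)
    have "(LINT t|lborel. indicator {x+d..y-d} t * d) \<le> m"
      unfolding m_def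
    proof (rule integral_mono)
      show "integrable lborel (\<lambda>t. indicator {x+d..y-d} t * d)" by (intro integrable_mult_left integrable_real_indicator) (auto simp: emeasure_lborel_Icc_eq)
      fix t show "indicator {x+d..y-d} t * d \<le> g0 t" using d by (auto simp: indicator_def g0_def)
    qed (rule g0i)
    moreover have "(LINT t|lborel. indicator {x+d..y-d} t * d) = (y - x) / 2 * d"
      using xy by (simp add: d_def field_simps)
    ultimately have m: "m > 0" using d xy by (smt (verit) mult_pos_pos half_gt_zero)
    define g where "g t = g0 t / m" for t
    \<comment> \<open>The test function in the variable z = exp(-t). Cutting z off at exp(-y) avoids
      the singularity at z = 0 and changes nothing, since the tent vanishes beyond y.\<close>
    define h where "h z = g (- ln (max z (exp (- y)))) / max z (exp (- y))" for z
    have hc: "continuous_on {0..1} h"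
      unfolding h_def g_def
      by (intro continuous_intros continuous_on_compose2[OF g0c[of UNIV]]) (use m in \<open>auto simp: max_def\<close>)
    have gc: "continuous_on S g" for S unfolding g_def using m by (intro continuous_intros g0c) auto
    have hg: "h (exp (- t)) * (exp (- t) * u) = g t * u" for t u
    proof (cases "t \<le> y")
      case True
      then have "max (exp (- t)) (exp (- y)) = exp (- t)" by (simp add: max_def)
      then show ?thesis by (simp add: h_def)
    next
      case False
      then have "max (exp (- t)) (exp (- y)) = exp (- y)" by (simp add: max_def)
      moreover have "g t = 0" "g y = 0" using False g00[of t] by (auto simp: g_def g0_def)
      ultimately show ?thesis by (simp add: h_def)
    qed
    have ind: "indicator {0..} t *\<^sub>R (g t * u) = g t * u" for t u
      using xy g00[of t] by (auto simp: indicator_def g_def)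
    have gU: "((\<lambda>i. LINT t|lborel. g t * U i t) \<longlongrightarrow> (LINT t|lborel. g t * V t)) F"
      using cont[OF hc] unfolding hg set_lebesgue_integral_def ind .
    have gint: "integrable lborel (\<lambda>t. g t * u t)" if u: "set_integrable lborel {0..} (\<lambda>t. exp (- t) * u t)" for u
    proof -
      obtain B where B: "\<And>z. z \<in> {x..y} \<Longrightarrow> norm (g z * exp z) \<le> B"
        using compact_imp_bounded[OF compact_continuous_image[OF _ compact_Icc, of x y "\<lambda>z. g z * exp z"]]
            continuous_on_mult[OF gc continuous_on_exp[OF continuous_on_id]] unfolding bounded_iff by fastforce
      have "integrable lborel (\<lambda>t. (g t * exp t) * (indicator {0..} t *\<^sub>R (exp (- t) * u t)))"
      proof (rule Bochner_Integration.integrable_bound)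
        show "integrable lborel (\<lambda>t. \<bar>B\<bar> * (indicator {0..} t *\<^sub>R (exp (- t) * u t)))"
          using u unfolding set_integrable_def by (rule integrable_mult_right)
        have "(\<lambda>t. g t * exp t) \<in> borel_measurable borel"
          by (intro borel_measurable_continuous_onI continuous_on_mult gc continuous_intros)
        then have "(\<lambda>t. g t * exp t) \<in> borel_measurable lborel" by simp
        then show "(\<lambda>t. (g t * exp t) * (indicator {0..} t *\<^sub>R (exp (- t) * u t))) \<in> borel_measurable lborel"
          by (rule borel_measurable_times[OF _ borel_measurable_integrable[OF u[unfolded set_integrable_def]]])
        have "\<bar>g t * exp t\<bar> \<le> \<bar>B\<bar>" for t
          using B[of t] g00[of t] by (cases "t \<in> {x..y}") (auto simp: g_def)
        then show "AE t in lborel. norm ((g t * exp t) * (indicator {0..} t *\<^sub>R (exp (- t) * u t)))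
          \<le> norm (\<bar>B\<bar> * (indicator {0..} t *\<^sub>R (exp (- t) * u t)))"
          by (intro AE_I2) (auto simp: abs_mult intro!: mult_right_mono)
      qed
      then show ?thesis
      proof (rule back_subst[where P="integrable lborel"], intro ext)
        fix t show "(g t * exp t) * (indicator {0..} t *\<^sub>R (exp (- t) * u t)) = g t * u t"
          using ind[of t "u t"] by (auto simp: indicator_def exp_minus)
      qed
    qed
    have "\<forall>\<^sub>F i in F. integrable lborel (\<lambda>t. g t * U i t)"
      using U by eventually_elim (auto intro: gint)
    moreover have "integrable lborel g" "(LINT t|lborel. g t) = 1"
      using g0i m by (auto simp: g_def[abs_def] m_def)
    ultimately show ?thesis
      using g0nn g00 m gU gint[OF Vi] by (intro exI[of _ g]) (auto simp: g_def)
  qed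
  have powr1: "((\<lambda>y. C * y powr b) \<longlongrightarrow> C) (at 1)"
  proof -
    have "((\<lambda>y. C * y powr b) \<longlongrightarrow> C * 1 powr b) (at 1)" by (intro tendsto_intros) auto
    then show ?thesis by simp
  qed
  have bound: "\<exists>y0 x0 :: real. y0 > 1 \<and> 0 < x0 \<and> x0 < 1 \<and> (\<forall>t\<in>{x0..y0}. C - e < V t \<and> V t < C + e)"
    if e: "e > 0" for e :: real
  proof -
    from tendstoD[OF powr1 e] obtain d where d: "d > 0" "\<And>t. t \<noteq> 1 \<Longrightarrow> dist t 1 < d \<Longrightarrow> dist (V t) C < e"
      unfolding eventually_at V_def by blast
    have "C - e < V t \<and> V t < C + e" if t: "t \<in> {1 - min d 1 / 2..1 + min d 1 / 2}" for t
    proof (cases "t = 1")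
      case True then show ?thesis using e by (simp add: V_def)
    next
      case False
      have "min d 1 \<le> d" "0 < min d 1" using d by auto
      then have "dist t 1 < d" using t unfolding dist_real_def atLeastAtMost_iff by linarith
      then show ?thesis using d(2)[OF False] unfolding dist_real_def by auto
    qed
    then show ?thesis using d(1)
      by (intro exI[of _ "1 + min d 1 / 2"] exI[of _ "1 - min d 1 / 2"]) (auto simp: min_def)
  qed
  have avg: "\<forall>\<^sub>F i in F. \<exists>g. integrable lborel g \<and> integrable lborel (\<lambda>t. g t * U i t) \<and> (\<forall>t. 0 \<le> g t) \<and>
      (\<forall>t. t \<notin> {x..y} \<longrightarrow> g t = 0) \<and> (LINT t|lborel. g t) = 1 \<and> \<bar>(LINT t|lborel. g t * U i t) - C\<bar> < 2 * e"
    if xy: "0 < x" "x < y" and e: "\<And>t. t \<in> {x..y} \<Longrightarrow> C - e < V t \<and> V t < C + e" and epos: "e > 0" for x y e :: real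
  proof -
    obtain g where g: "\<And>t. 0 \<le> g t" "\<And>t. t \<notin> {x..y} \<Longrightarrow> g t = 0" "integrable lborel g" "(LINT t|lborel. g t) = 1"
      "((\<lambda>i. LINT t|lborel. g t * U i t) \<longlongrightarrow> (LINT t|lborel. g t * V t)) F"
      "\<forall>\<^sub>F i in F. integrable lborel (\<lambda>t. g t * U i t)" "integrable lborel (\<lambda>t. g t * V t)"
      using bump[OF xy] by auto
    have b1: "(LINT t|lborel. g t * V t) \<le> (LINT t|lborel. g t * (C + e))"
      using g e by (intro integral_mono integrable_mult_left)
        (auto, metis atLeastAtMost_iff less_eq_real_def mult_left_mono mult_zero_left)
    have b2: "(LINT t|lborel. g t * (C - e)) \<le> (LINT t|lborel. g t * V t)"
      using g e by (intro integral_mono integrable_mult_left)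
        (auto, metis atLeastAtMost_iff less_eq_real_def mult_left_mono mult_zero_left)
    have b3: "\<bar>(LINT t|lborel. g t * V t) - C\<bar> \<le> e"
      using b1 b2 g(3,4) by (simp add: abs_le_iff)
    from tendstoD[OF g(5) epos] g(6) show ?thesis
    proof eventually_elim
      case (elim i)
      have "\<bar>(LINT t|lborel. g t * U i t) - C\<bar> < 2 * e"
        using elim(1) b3 unfolding dist_real_def by linarith
      then show ?case using elim(2) g(1-4) by (intro exI[of _ g]) auto
    qed
  qed
  have cmp_le: "c \<le> (LINT t|lborel. g t * u t)"
    if "integrable lborel g" "integrable lborel (\<lambda>t. g t * u t)" "\<And>t. 0 \<le> g t" "\<And>t. t \<notin> {p..q} \<Longrightarrow> g t = 0"
      "(LINT t|lborel. g t) = 1" "\<And>t. t \<in> {p..q} \<Longrightarrow> c \<le> u t" for g u and c p q :: real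
  proof -
    have "(LINT t|lborel. g t * c) \<le> (LINT t|lborel. g t * u t)"
    proof (rule integral_mono)
      fix t show "g t * c \<le> g t * u t" using that(3,4,6)[of t] by (cases "t \<in> {p..q}") (auto intro: mult_left_mono)
    qed (use that in auto)
    then show ?thesis using that by simp
  qed
  have cmp_ge: "(LINT t|lborel. g t * u t) \<le> c"
    if "integrable lborel g" "integrable lborel (\<lambda>t. g t * u t)" "\<And>t. 0 \<le> g t" "\<And>t. t \<notin> {p..q} \<Longrightarrow> g t = 0"
      "(LINT t|lborel. g t) = 1" "\<And>t. t \<in> {p..q} \<Longrightarrow> u t \<le> c" for g u and c p q :: real
  proof -
    have "(LINT t|lborel. g t * u t) \<le> (LINT t|lborel. g t * c)"
    proof (rule integral_mono)
      fix t show "g t * u t \<le> g t * c" using that(3,4,6)[of t] by (cases "t \<in> {p..q}") (auto intro: mult_left_mono)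
    qed (use that in auto)
    then show ?thesis using that by simp
  qed
  show ?thesis
  proof (rule tendstoI)
    fix e :: real assume "0 < e"
    then have e2: "e / 2 > 0" by simp
    obtain y0 x0 where xy: "y0 > 1" "0 < x0" "x0 < 1" "\<And>t. t \<in> {x0..y0} \<Longrightarrow> C - e/2 < V t \<and> V t < C + e/2"
      using bound[OF e2] by blast
    have R: "\<forall>\<^sub>F i in F. \<exists>g. integrable lborel g \<and> integrable lborel (\<lambda>t. g t * U i t) \<and> (\<forall>t. 0 \<le> g t) \<and>
      (\<forall>t. t \<notin> {1..y0} \<longrightarrow> g t = 0) \<and> (LINT t|lborel. g t) = 1 \<and> \<bar>(LINT t|lborel. g t * U i t) - C\<bar> < 2 * (e/2)"
      by (rule avg) (use xy e2 in auto)
    have L: "\<forall>\<^sub>F i in F. \<exists>g. integrable lborel g \<and> integrable lborel (\<lambda>t. g t * U i t) \<and> (\<forall>t. 0 \<le> g t) \<and>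
      (\<forall>t. t \<notin> {x0..1} \<longrightarrow> g t = 0) \<and> (LINT t|lborel. g t) = 1 \<and> \<bar>(LINT t|lborel. g t * U i t) - C\<bar> < 2 * (e/2)"
      by (rule avg) (use xy e2 in auto)
    from mono have "\<forall>\<^sub>F i in F. mono_on {0..} (U i) \<or> antimono_on {0..} (U i)"
      by (auto elim: eventually_mono)
    then show "\<forall>\<^sub>F i in F. dist (U i 1) C < e"
      using R L
    proof eventually_elim
      case (elim i)
      then obtain g g' where g: "integrable lborel g" "integrable lborel (\<lambda>t. g t * U i t)" "\<And>t. 0 \<le> g t"
          "\<And>t. t \<notin> {1..y0} \<Longrightarrow> g t = 0" "(LINT t|lborel. g t) = 1" "\<bar>(LINT t|lborel. g t * U i t) - C\<bar> < e"
        and g': "integrable lborel g'" "integrable lborel (\<lambda>t. g' t * U i t)" "\<And>t. 0 \<le> g' t"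
          "\<And>t. t \<notin> {x0..1} \<Longrightarrow> g' t = 0" "(LINT t|lborel. g' t) = 1" "\<bar>(LINT t|lborel. g' t * U i t) - C\<bar> < e"
        by auto
      from elim(1) show ?case
      proof
        assume m: "mono_on {0..} (U i)"
        have "U i 1 \<le> (LINT t|lborel. g t * U i t)"
          using xy by (intro cmp_le[where p=1 and q=y0, OF g(1-5)] mono_onD[OF m]) auto
        moreover have "(LINT t|lborel. g' t * U i t) \<le> U i 1"
          using xy by (intro cmp_ge[where p=x0 and q=1, OF g'(1-5)] mono_onD[OF m]) auto
        ultimately show ?thesis using g(6) g'(6) unfolding dist_real_def by linarith
      next
        assume m: "antimono_on {0..} (U i)"
        have "U i 1 \<le> (LINT t|lborel. g' t * U i t)"
          using xy by (intro cmp_le[where p=x0 and q=1, OF g'(1-5)] monotone_onD[OF m]) auto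
        moreover have "(LINT t|lborel. g t * U i t) \<le> U i 1"
          using xy by (intro cmp_ge[where p=1 and q=y0, OF g(1-5)] monotone_onD[OF m]) auto
        ultimately show ?thesis using g(6) g'(6) unfolding dist_real_def by linarith
      qed
    qed
  qed
qed

section \<open>Cadlag paths\<close>

lemma cadlag_seq_right:
  assumes w: "cadlag w" and c: "0 \<le> c" and x: "(x \<longlongrightarrow> c) F" "\<And>n. c \<le> x n"
  shows "((\<lambda>n. w (x n)) \<longlongrightarrow> w c) F"
proof -
  have "continuous (at c within {c..}) w"
    using w c unfolding cadlag_def continuous_within at_within_Ici_at_right by blast
  then show ?thesis
    by (rule continuous_within_tendsto_compose') (use x in auto)
qed

lemma cadlag_locally_bounded:
  assumes w: "cadlag w" and c: "0 \<le> c"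
  shows "\<exists>d>0. \<exists>K. \<forall>s\<ge>0. \<bar>s - c\<bar> < d \<longrightarrow> \<bar>w s\<bar> \<le> K"
proof -
  have "(w \<longlongrightarrow> w c) (at_right c)" using w c by (auto simp: cadlag_def)
  from tendstoD[OF this zero_less_one] obtain b where b: "b > c" "\<And>s. c < s \<Longrightarrow> s < b \<Longrightarrow> dist (w s) (w c) < 1"
    unfolding eventually_at_right_field by blast
  obtain a L where a: "a < c" "\<And>s. 0 \<le> s \<Longrightarrow> a < s \<Longrightarrow> s < c \<Longrightarrow> \<bar>w s\<bar> \<le> L"
  proof (cases "c = 0")
    case True
    then show ?thesis using that[of "-1" 0] by auto
  next
    case False
    then have "0 < c" using c by simp
    then obtain l where "(w \<longlongrightarrow> l) (at_left c)" using w unfolding cadlag_def by blast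
    from tendstoD[OF this zero_less_one] obtain a where a: "a < c" "\<And>s. a < s \<Longrightarrow> s < c \<Longrightarrow> dist (w s) l < 1"
      unfolding eventually_at_left_field by blast
    show ?thesis
    proof (rule that[OF a(1)])
      fix s assume "a < s" "s < c"
      then show "\<bar>w s\<bar> \<le> \<bar>l\<bar> + 1" using a(2)[of s] by (auto simp: dist_real_def)
    qed
  qed
  define d where "d = min (c - a) (b - c)"
  have "\<bar>w s\<bar> \<le> max L (\<bar>w c\<bar> + 1)" if "0 \<le> s" "\<bar>s - c\<bar> < d" for s
  proof -
    consider "s < c" | "s = c" | "c < s" by linarith
    then show ?thesis
    proof cases
      case 1 then show ?thesis using a(2)[of s] that by (auto simp: d_def)
    next
      case 3 then show ?thesis using b(2)[of s] that by (auto simp: d_def dist_real_def)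
    qed auto
  qed
  then show ?thesis using a(1) b(1) by (intro exI[of _ d]) (auto simp: d_def)
qed

text \<open>One-sided limits bound the path near each time; bisection (\<open>Bolzano\<close>) glues
  the local bounds over the compact interval.\<close>

lemma cadlag_bounded:
  assumes w: "cadlag w"
  shows "\<exists>K\<ge>0. \<forall>s\<in>{0..t}. \<bar>w s\<bar> \<le> K"
proof (cases "0 \<le> t")
  case True
  \<comment> \<open>The premise 0 \<le> a keeps negative times, where the path is arbitrary, out of
    the bisection.\<close>
  define P where "P a b \<longleftrightarrow> 0 \<le> a \<longrightarrow> (\<exists>K\<ge>0. \<forall>s\<in>{a..b}. \<bar>w s\<bar> \<le> K)" for a b
  have "P 0 t"
    using True
  proof (rule Bolzano)
    fix a b c assume ab: "P a b" "P b c" "a \<le> b" "b \<le> c"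
    show "P a c"
      unfolding P_def
    proof
      assume "0 \<le> a"
      then obtain K L where KL: "K \<ge> 0" "L \<ge> 0" "\<forall>s\<in>{a..b}. \<bar>w s\<bar> \<le> K" "\<forall>s\<in>{b..c}. \<bar>w s\<bar> \<le> L"
        using ab unfolding P_def by auto
      have "\<bar>w s\<bar> \<le> K + L" if "s \<in> {a..c}" for s
      proof (cases "s \<le> b")
        case True then have "\<bar>w s\<bar> \<le> K" using KL that by auto
        then show ?thesis using KL by linarith
      next
        case False then have "\<bar>w s\<bar> \<le> L" using KL that by auto
        then show ?thesis using KL by linarith
      qed
      then show "\<exists>K\<ge>0. \<forall>s\<in>{a..c}. \<bar>w s\<bar> \<le> K"
        using KL by (intro exI[of _ "K + L"]) auto
    qed
  next
    fix x :: real assume "0 \<le> x" "x \<le> t"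
    then obtain d K where dK: "d > 0" "\<And>s. 0 \<le> s \<Longrightarrow> \<bar>s - x\<bar> < d \<Longrightarrow> \<bar>w s\<bar> \<le> K"
      using cadlag_locally_bounded[OF w, of x] by blast
    have "P a b" if ab: "a \<le> x \<and> x \<le> b \<and> b - a < d" for a b
      unfolding P_def
    proof
      assume "0 \<le> a"
      have "\<bar>w s\<bar> \<le> \<bar>K\<bar>" if "s \<in> {a..b}" for s
      proof -
        have "\<bar>w s\<bar> \<le> K" using \<open>0 \<le> a\<close> that ab by (intro dK(2)) auto
        then show ?thesis by linarith
      qed
      then show "\<exists>K\<ge>0. \<forall>s\<in>{a..b}. \<bar>w s\<bar> \<le> K" by (intro exI[of _ "\<bar>K\<bar>"]) auto
    qed
    then show "\<exists>d>0. \<forall>a b. a \<le> x \<and> x \<le> b \<and> b - a < d \<longrightarrow> P a b" using dK(1) by blast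
  qed
  then show ?thesis by (simp add: P_def)
qed (auto intro: exI[of _ 0])

text \<open>The gaps to the left of the points are pairwise disjoint, and each contains a
  rational.\<close>

lemma countable_left_isolated:
  fixes S :: "real set"
  assumes "\<And>t. t \<in> S \<Longrightarrow> \<exists>d<t. \<forall>s\<in>S. \<not> (d < s \<and> s < t)"
  shows "countable S"
proof -
  from assms obtain d where d: "\<And>t. t \<in> S \<Longrightarrow> d t < t" "\<And>t s. t \<in> S \<Longrightarrow> s \<in> S \<Longrightarrow> \<not> (d t < s \<and> s < t)"
    by metis
  have "\<exists>q\<in>\<rat>. d t < q \<and> q < t" if "t \<in> S" for t
    using Rats_dense_in_real[OF d(1)[OF that]] by blast
  then obtain f where f: "\<And>t. t \<in> S \<Longrightarrow> f t \<in> \<rat> \<and> d t < f t \<and> f t < t" by metis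
  have "inj_on f S"
  proof (rule inj_onI, rule ccontr)
    fix s t assume st: "s \<in> S" "t \<in> S" "f s = f t" "s \<noteq> t"
    then consider "s < t" | "t < s" by linarith
    then show False
    proof cases
      case 1 then show False using d(2)[OF st(2,1)] f[OF st(1)] f[OF st(2)] st(3) by auto
    next
      case 2 then show False using d(2)[OF st(1,2)] f[OF st(1)] f[OF st(2)] st(3) by auto
    qed
  qed
  moreover have "countable (f ` S)"
    by (rule countable_subset[OF _ countable_rat]) (use f in auto)
  ultimately show ?thesis using countable_image_inj_on by blast
qed

text \<open>At a discontinuity a rational level p separates the left limit from the value, which is
  also the right limit. Just before t the path is on the side of the left limit, so t is isolated
  from the left among the times with the same level and the same direction of the jump.\<close>

lemma cadlag_countable_discontinuities:
  assumes w: "cadlag w"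
  shows "countable {t. 0 < t \<and> \<not> isCont w t}"
proof -
  define Up where "Up p = {t. 0 < t \<and> p < w t \<and> (\<exists>l<p. (w \<longlongrightarrow> l) (at_left t))}" for p
  define Dn where "Dn p = {t. 0 < t \<and> w t < p \<and> (\<exists>l>p. (w \<longlongrightarrow> l) (at_left t))}" for p
  have "countable (Up p)" for p
  proof (rule countable_left_isolated)
    fix t assume "t \<in> Up p"
    then obtain l where l: "l < p" "(w \<longlongrightarrow> l) (at_left t)" by (auto simp: Up_def)
    from order_tendstoD(2)[OF l(2,1)] obtain d where "d < t" "\<forall>s>d. s < t \<longrightarrow> w s < p"
      unfolding eventually_at_left_field by blast
    then show "\<exists>d<t. \<forall>s\<in>Up p. \<not> (d < s \<and> s < t)" by (intro exI[of _ d]) (force simp: Up_def)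
  qed
  moreover have "countable (Dn p)" for p
  proof (rule countable_left_isolated)
    fix t assume "t \<in> Dn p"
    then obtain l where l: "l > p" "(w \<longlongrightarrow> l) (at_left t)" by (auto simp: Dn_def)
    from order_tendstoD(1)[OF l(2,1)] obtain d where "d < t" "\<forall>s>d. s < t \<longrightarrow> w s > p"
      unfolding eventually_at_left_field by blast
    then show "\<exists>d<t. \<forall>s\<in>Dn p. \<not> (d < s \<and> s < t)" by (intro exI[of _ d]) (force simp: Dn_def)
  qed
  ultimately have "countable ((\<Union>p\<in>\<rat>. Up p) \<union> (\<Union>p\<in>\<rat>. Dn p))"
    by (intro countable_Un countable_UN countable_rat)
  moreover have "{t. 0 < t \<and> \<not> isCont w t} \<subseteq> (\<Union>p\<in>\<rat>. Up p) \<union> (\<Union>p\<in>\<rat>. Dn p)"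
  proof safe
    fix t assume t: "0 < t" "\<not> isCont w t" "t \<notin> (\<Union>p\<in>\<rat>. Dn p)"
    obtain l where l: "(w \<longlongrightarrow> l) (at_left t)" using w t by (auto simp: cadlag_def)
    have r: "(w \<longlongrightarrow> w t) (at_right t)" using w t by (auto simp: cadlag_def)
    have "l \<noteq> w t" using t(2) l r unfolding isCont_def filterlim_at_split by auto
    moreover have "\<not> w t < l"
    proof
      assume "w t < l"
      from Rats_dense_in_real[OF this] obtain p where "p \<in> \<rat>" "w t < p" "p < l" by blast
      then show False using t l by (auto simp: Dn_def)
    qed
    ultimately have "l < w t" by linarith
    from Rats_dense_in_real[OF this] obtain p where "p \<in> \<rat>" "l < p" "p < w t" by blast
    then show "t \<in> (\<Union>p\<in>\<rat>. Up p)" using t l by (auto simp: Up_def)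
  qed
  ultimately show ?thesis by (rule countable_subset[rotated])
qed

lemma cadlag_AE_isCont:
  assumes "cadlag w"
  shows "AE s in lborel. 0 < s \<longrightarrow> isCont w s"
proof -
  have "AE s in lborel. s \<notin> {t. 0 < t \<and> \<not> isCont w t}"
    by (rule AE_not_in, rule countable_imp_null_set_lborel, rule cadlag_countable_discontinuities[OF assms])
  then show ?thesis by eventually_elim auto
qed

section \<open>Measurability on the path space, and integrability of single paths\<close>

lemma space_path_space: "space path_space = cadlag_paths"
  unfolding path_space_def by (auto simp: space_restrict_space space_PiM cadlag_paths_def PiE_def)

lemma measurable_path_eval [measurable (raw)]:
  assumes "0 \<le> s" shows "(\<lambda>w. w s) \<in> borel_measurable path_space"
  unfolding path_space_def using assms
  by (intro measurable_restrict_space1 measurable_component_singleton) auto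

text \<open>The path is sampled at countably many grid times, and right continuity gives the limit.
  Clamping to [0, t] keeps every sample among the times where evaluation is measurable, so the
  result also applies to the \<sigma>-algebra of the path up to time t.\<close>

lemma path_eval_joint_measurable:
  assumes t: "0 \<le> t" and N: "\<And>s. s \<in> {0..t} \<Longrightarrow> (\<lambda>w. w s) \<in> borel_measurable N" "space N \<subseteq> cadlag_paths"
  shows "(\<lambda>(w, s). w (max 0 (min t s))) \<in> borel_measurable (N \<Otimes>\<^sub>M borel)"
proof -
  \<comment> \<open>The + 1 selects the right endpoint of the grid cell: the samples must approach s
    from above.\<close>
  define c where "c n k = max 0 (min t ((real_of_int k + 1) / real (Suc n)))" for n and k :: int
  have c: "c n k \<in> {0..t}" for n k using t by (auto simp: c_def)
  have lim: "(\<lambda>n. w (c n \<lfloor>s * real (Suc n)\<rfloor>)) \<longlonglongrightarrow> w (max 0 (min t s))" if w: "cadlag w" for w s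
  proof (rule cadlag_seq_right[OF w])
    show "0 \<le> max 0 (min t s)" by simp
    have b1: "s \<le> (real_of_int \<lfloor>s * real (Suc n)\<rfloor> + 1) / real (Suc n)" for n
    proof -
      have "s * real (Suc n) \<le> real_of_int \<lfloor>s * real (Suc n)\<rfloor> + 1" by linarith
      then show ?thesis by (simp add: pos_le_divide_eq)
    qed
    have b2: "(real_of_int \<lfloor>s * real (Suc n)\<rfloor> + 1) / real (Suc n) \<le> s + 1 / real (Suc n)" for n
    proof -
      have "real_of_int \<lfloor>s * real (Suc n)\<rfloor> + 1 \<le> s * real (Suc n) + 1" by linarith
      then have "(real_of_int \<lfloor>s * real (Suc n)\<rfloor> + 1) / real (Suc n) \<le> (s * real (Suc n) + 1) / real (Suc n)"
        by (rule divide_right_mono) simp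
      then show ?thesis by (simp add: add_divide_distrib)
    qed
    have "(\<lambda>n. (real_of_int \<lfloor>s * real (Suc n)\<rfloor> + 1) / real (Suc n)) \<longlonglongrightarrow> s"
    proof (rule tendsto_sandwich[of "\<lambda>_. s" _ _ "\<lambda>n. s + 1 / real (Suc n)"])
      show "(\<lambda>n. s + 1 / real (Suc n)) \<longlonglongrightarrow> s"
        using tendsto_add[OF tendsto_const LIMSEQ_Suc[OF lim_1_over_n], of s] by simp
    qed (use b1 b2 in auto)
    then show "(\<lambda>n. c n \<lfloor>s * real (Suc n)\<rfloor>) \<longlonglongrightarrow> max 0 (min t s)"
      unfolding c_def by (intro tendsto_intros)
    show "max 0 (min t s) \<le> c n \<lfloor>s * real (Suc n)\<rfloor>" for n
      unfolding c_def using b1[of n] by linarith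
  qed
  show ?thesis
  proof (rule borel_measurable_LIMSEQ_real)
    show "(\<lambda>n. (\<lambda>(w, s). w (c n \<lfloor>s * real (Suc n)\<rfloor>)) x) \<longlonglongrightarrow> (\<lambda>(w, s). w (max 0 (min t s))) x"
      if "x \<in> space (N \<Otimes>\<^sub>M borel)" for x
    proof -
      have "cadlag (fst x)" using that N(2) by (auto simp: space_pair_measure cadlag_paths_def)
      then show ?thesis unfolding case_prod_beta by (rule lim)
    qed
    show "(\<lambda>(w, s). w (c n \<lfloor>s * real (Suc n)\<rfloor>)) \<in> borel_measurable (N \<Otimes>\<^sub>M borel)" for n
      unfolding case_prod_beta
    proof (rule measurable_compose_countable[where f = "\<lambda>k x. fst x (c n k)"])
      show "(\<lambda>x. fst x (c n k)) \<in> borel_measurable (N \<Otimes>\<^sub>M borel)" for k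
        by (rule measurable_compose[OF measurable_fst N(1)[OF c]])
    qed measurable
  qed
qed

lemma cadlag_restrict:
  assumes w: "cadlag w" shows "restrict w {0..} \<in> cadlag_paths"
proof -
  have eq: "(restrict w {0..} \<longlongrightarrow> l) (at_right s) \<longleftrightarrow> (w \<longlongrightarrow> l) (at_right s)" if "0 \<le> s" for s l
    by (rule tendsto_cong) (use that in \<open>auto simp: eventually_at_right_field intro!: exI[of _ "s + 1"]\<close>)
  have eq': "(restrict w {0..} \<longlongrightarrow> l) (at_left s) \<longleftrightarrow> (w \<longlongrightarrow> l) (at_left s)" if "0 < s" for s l
    by (rule tendsto_cong) (use that in \<open>auto simp: eventually_at_left_field intro!: exI[of _ "0"]\<close>)
  show ?thesis using w eq eq' unfolding cadlag_paths_def cadlag_def by auto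
qed

text \<open>Measurability in s is obtained from joint measurability by fixing the path.\<close>

lemma cadlag_set_integrable:
  assumes w: "cadlag w"
  shows "set_integrable lborel {0..t} w"
proof (cases "0 \<le> t")
  case True
  define v where "v = restrict w {0..}"
  have v: "v \<in> cadlag_paths" unfolding v_def by (rule cadlag_restrict[OF w])
  have "(\<lambda>s. (\<lambda>(w, s). w (max 0 (min t s))) (v, s)) \<in> borel_measurable borel"
    by (rule measurable_compose[OF measurable_Pair1' path_eval_joint_measurable[OF True measurable_path_eval]])
      (auto simp: space_path_space v)
  then have m: "(\<lambda>s. v (max 0 (min t s))) \<in> borel_measurable borel" by simp
  obtain K where K: "K \<ge> 0" "\<And>s. s \<in> {0..t} \<Longrightarrow> \<bar>w s\<bar> \<le> K" using cadlag_bounded[OF w] by blast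
  have eq: "indicator {0..t} s *\<^sub>R w s = indicator {0..t} s * v (max 0 (min t s))" for s
    by (auto simp: indicator_def v_def min_def max_def)
  show ?thesis
    unfolding set_integrable_def eq
  proof (rule Bochner_Integration.integrable_bound)
    show "integrable lborel (\<lambda>s. indicator {0..t} s * K)"
      by (intro integrable_mult_left integrable_real_indicator) (auto simp: emeasure_lborel_Icc_eq)
    show "AE s in lborel. norm (indicator {0..t} s * v (max 0 (min t s))) \<le> norm (indicator {0..t} s * K)"
      unfolding eq[symmetric] using K by (intro AE_I2) (auto simp: indicator_def)
  qed (use m in measurable)
qed (simp add: set_integrable_def)

section \<open>The Airy-type integral behind Phi and Psi\<close>

text \<open>This is exp(z^(1+\<alpha>)/(1+\<alpha>)) at the point z at distance r from 0 on the ray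
  of argument \<pi>/(1+\<alpha>).\<close>

definition airy_weight :: "real \<Rightarrow> real \<Rightarrow> real" where
  "airy_weight \<alpha> r = exp (- (r powr (1 + \<alpha>) / (1 + \<alpha>)))"

definition airy_ray :: "real \<Rightarrow> complex" where
  "airy_ray \<alpha> = cis (pi / (1 + \<alpha>))"

text \<open>The contour integral of exp(-yz + z^(1+\<alpha>)/(1+\<alpha>)) dz along that ray,
  starting from 0. For \<alpha> = 2 its imaginary part is \<pi> times the Airy function Ai.\<close>

definition airy_W :: "real \<Rightarrow> real \<Rightarrow> complex" where
  "airy_W \<alpha> y = (LINT r:{0..}|lborel. exp (- (of_real (y * r) * airy_ray \<alpha>)) * (airy_ray \<alpha> * of_real (airy_weight \<alpha> r)))"

lemma airy_weight_measurable [measurable]: "airy_weight \<alpha> \<in> borel_measurable borel"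
  unfolding airy_weight_def[abs_def] by measurable

lemma airy_weight_pos: "0 < airy_weight \<alpha> r" "0 \<le> airy_weight \<alpha> r" "airy_weight \<alpha> r \<noteq> 0"
  by (auto simp: airy_weight_def)

text \<open>Power substitutions and the fundamental theorem of calculus are applied on the open half
  line, the Laplace transforms are taken on the closed one.\<close>

lemma set_integral_Ici_Ioi:
  fixes f :: "real \<Rightarrow> 'a :: {banach, second_countable_topology}"
  assumes [measurable]: "f \<in> borel_measurable borel"
  shows "set_integrable lborel {0..} f \<longleftrightarrow> set_integrable lborel {0<..} f"
    and "(LINT r:{0..}|lborel. f r) = (LINT r:{0<..}|lborel. f r)"
proof -
  have ae: "AE r in lborel. indicator {0..} r *\<^sub>R f r = indicator {0<..} r *\<^sub>R f r"
    using AE_lborel_singleton[of "0::real"] by eventually_elim (auto simp: indicator_def)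
  show "set_integrable lborel {0..} f \<longleftrightarrow> set_integrable lborel {0<..} f"
    unfolding set_integrable_def by (rule integrable_cong_AE[OF _ _ ae]) auto
  show "(LINT r:{0..}|lborel. f r) = (LINT r:{0<..}|lborel. f r)"
    unfolding set_lebesgue_integral_def by (rule integral_cong_AE[OF _ _ ae]) auto
qed

text \<open>The substitution s = r^(1+\<alpha>)/(1+\<alpha>), ds = r^\<alpha> dr, gives a Gamma
  integral with parameter b = (1+n)/(1+\<alpha>). These moments are the source of the coefficients
  of \<open>Phi\<close> and \<open>Psi\<close>.\<close>

lemma airy_weight_moment:
  assumes \<alpha>: "1 < \<alpha>"
  shows "set_integrable lborel {0..} (\<lambda>r. r ^ n * airy_weight \<alpha> r)" (is ?i)
    and "(LINT r:{0..}|lborel. r ^ n * airy_weight \<alpha> r) =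
      (1 + \<alpha>) powr ((real n - \<alpha>) / (1 + \<alpha>)) * Gamma ((1 + real n) / (1 + \<alpha>))" (is ?v)
proof -
  define b where "b = (1 + real n) / (1 + \<alpha>)"
  have b: "b > 0" using \<alpha> by (simp add: b_def)
  define f where "f s = s powr (b - 1) * exp (- 1 * s)" for s :: real
  define g where "g r = r powr (1 + \<alpha>) / (1 + \<alpha>)" for r :: real
  have [measurable]: "f \<in> borel_measurable borel" unfolding f_def[abs_def] by measurable
  have fi: "set_integrable lborel {0<..} f"
    using Gamma_laplace_integral(1)[of "b - 1" 1] b
    by (subst set_integral_Ici_Ioi(1)[symmetric]) (auto simp: f_def[abs_def])
  have fv: "(LINT s:{0<..}|lborel. f s) = Gamma b"
    using Gamma_laplace_integral(2)[of "b - 1" 1] b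
    by (subst set_integral_Ici_Ioi(2)[symmetric]) (auto simp: f_def[abs_def])
  have im: "g ` {0<..} = {0<..}"
  proof safe
    fix s :: real assume "0 < s"
    then show "s \<in> g ` {0<..}" using \<alpha>
      by (intro image_eqI[of _ _ "((1 + \<alpha>) * s) powr (1 / (1 + \<alpha>))"]) (auto simp: g_def powr_powr)
  qed (use \<alpha> in \<open>auto simp: g_def\<close>)
  have inj: "inj_on g {0<..}"
    by (rule inj_on_inverseI[where g = "\<lambda>s. ((1 + \<alpha>) * s) powr (1 / (1 + \<alpha>))"])
      (use \<alpha> in \<open>auto simp: g_def powr_powr\<close>)
  have deriv: "(g has_real_derivative r powr \<alpha>) (at r within {0<..})" if "r \<in> {0<..}" for r
    unfolding g_def using that \<alpha> by (auto intro!: derivative_eq_intros simp: powr_diff)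
  have "f absolutely_integrable_on (g ` {0<..}) \<and> integral (g ` {0<..}) f = Gamma b"
    unfolding im using fi fv set_borel_integral_eq_integral[OF fi]
    by (auto simp: set_integrable_def integrable_completion)
  then have "(\<lambda>r. \<bar>r powr \<alpha>\<bar> * f (g r)) absolutely_integrable_on {0<..} \<and>
      integral {0<..} (\<lambda>r. \<bar>r powr \<alpha>\<bar> * f (g r)) = Gamma b"
    by (subst has_absolute_integral_change_of_variables_1'[OF _ deriv inj]) auto
  moreover have [measurable]: "(\<lambda>r. \<bar>r powr \<alpha>\<bar> * f (g r)) \<in> borel_measurable borel"
    unfolding g_def by measurable
  ultimately have 1: "set_integrable lborel {0<..} (\<lambda>r. \<bar>r powr \<alpha>\<bar> * f (g r))"
    and 2: "integral {0<..} (\<lambda>r. \<bar>r powr \<alpha>\<bar> * f (g r)) = Gamma b"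
    by (auto simp: set_integrable_def integrable_completion)
  \<comment> \<open>Since (1+\<alpha>)(b-1) = n - \<alpha>, the powers of r combine to r^n and the
    powers of 1+\<alpha> to a constant.\<close>
  have eq: "\<bar>r powr \<alpha>\<bar> * f (g r) = (1 + \<alpha>) powr (1 - b) * (r ^ n * airy_weight \<alpha> r)" if "r > 0" for r
  proof -
    have "(1 + \<alpha>) * (b - 1) = real n - \<alpha>" using \<alpha> by (simp add: b_def field_simps)
    then have "(g r) powr (b - 1) = r powr (real n - \<alpha>) * (1 + \<alpha>) powr (- (b - 1))"
      unfolding g_def powr_divide powr_powr powr_minus by (simp add: divide_inverse)
    moreover have "r powr \<alpha> * r powr (real n - \<alpha>) = r ^ n"
      using that by (simp add: powr_add[symmetric] powr_realpow)
    ultimately show ?thesis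
      by (simp add: f_def g_def airy_weight_def)
  qed
  have "set_integrable lborel {0<..} (\<lambda>r. (1 + \<alpha>) powr (1 - b) * (r ^ n * airy_weight \<alpha> r))"
    using 1 by (subst set_integrable_cong[OF refl refl eq[symmetric]]) auto
  then have 3: "set_integrable lborel {0<..} (\<lambda>r. r ^ n * airy_weight \<alpha> r)"
    using \<alpha> by (subst (asm) set_integrable_mult_right_iff) auto
  then show ?i by (subst set_integral_Ici_Ioi(1)) auto
  have "Gamma b = (LINT r:{0<..}|lborel. \<bar>r powr \<alpha>\<bar> * f (g r))"
    using 2 set_borel_integral_eq_integral(2)[OF 1] by simp
  also have "\<dots> = (LINT r:{0<..}|lborel. (1 + \<alpha>) powr (1 - b) * (r ^ n * airy_weight \<alpha> r))"
    by (rule set_lebesgue_integral_cong) (simp, intro allI impI eq, simp)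
  also have "\<dots> = (1 + \<alpha>) powr (1 - b) * (LINT r:{0..}|lborel. r ^ n * airy_weight \<alpha> r)"
    by (subst set_integral_Ici_Ioi(2)) auto
  finally have "(LINT r:{0..}|lborel. r ^ n * airy_weight \<alpha> r) = Gamma b * (1 + \<alpha>) powr (b - 1)"
    using \<alpha> by (simp add: powr_diff divide_simps mult_ac split: if_splits)
  moreover have "b - 1 = (real n - \<alpha>) / (1 + \<alpha>)" using \<alpha> by (simp add: b_def field_simps)
  ultimately show ?v by (simp add: b_def mult_ac)
qed

lemma airy_weight_exp_integrable:
  assumes \<alpha>: "1 < \<alpha>" "\<alpha> \<le> 2" and K: "K \<ge> 0"
  shows "set_integrable lborel {0..} (\<lambda>r. exp (K * r) * airy_weight \<alpha> r)"
proof -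
  \<comment> \<open>C bounds (K+1) r - r^(1+\<alpha>)/(1+\<alpha>) for r \<ge> 0: for r \<le> 1 it
    is at most K + 1; otherwise r^(1+\<alpha>)/(1+\<alpha>) \<ge> r^2/3, and completing the square
    leaves 3/4 (K+1)^2.\<close>
  define C where "C = K + 1 + 3 * (K + 1)\<^sup>2"
  have e: "set_integrable lborel {0..} (\<lambda>r. exp C * exp (- r))"
  proof (rule set_integrable_mult_right)
    have "integrable lborel (\<lambda>x::real. x ^ 0 * exp (- x) * indicator {0<..} x)"
      using has_bochner_integral_I0i_power_exp_m[of 0] by (rule integrable.intros)
    then have "set_integrable lborel {0<..} (\<lambda>r::real. exp (- r))"
      unfolding set_integrable_def by (rule back_subst[where P="integrable lborel"]) (auto simp: fun_eq_iff)
    then show "set_integrable lborel {0..} (\<lambda>r::real. exp (- r))"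
      by (subst set_integral_Ici_Ioi(1)) auto
  qed
  show ?thesis
  proof (rule set_integrable_bound[OF e])
    show "AE r in lborel. r \<in> {0..} \<longrightarrow> norm (exp (K * r) * airy_weight \<alpha> r) \<le> norm (exp C * exp (- r))"
    proof (intro AE_I2 impI)
      fix r :: real assume "r \<in> {0..}"
      then have r: "0 \<le> r" by simp
      have "(K + 1) * r - r powr (1 + \<alpha>) / (1 + \<alpha>) \<le> C"
      proof (cases "r \<le> 1")
        case True
        have "(K + 1) * r \<le> K + 1" using True K by (simp add: mult_left_le)
        moreover have "0 \<le> r powr (1 + \<alpha>) / (1 + \<alpha>)" using \<alpha> by simp
        moreover have "0 \<le> (K + 1)\<^sup>2" by simp
        ultimately show ?thesis unfolding C_def by linarith
      next
        case False
        then have "r powr 2 \<le> r powr (1 + \<alpha>)" using \<alpha> by (intro powr_mono) auto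
        then have "r\<^sup>2 \<le> r powr (1 + \<alpha>)" using False by (simp add: powr_numeral)
        then have "r\<^sup>2 / 3 \<le> r powr (1 + \<alpha>) / (1 + \<alpha>)" using \<alpha> False by (intro frac_le) auto
        moreover have "(r - 3 / 2 * (K + 1))\<^sup>2 / 3 = r\<^sup>2 / 3 - (K + 1) * r + 3 / 4 * (K + 1)\<^sup>2"
          by (simp add: power2_eq_square field_simps)
        then have "(K + 1) * r - r\<^sup>2 / 3 \<le> 3 / 4 * (K + 1)\<^sup>2"
          using zero_le_power2[of "r - 3 / 2 * (K + 1)"] by linarith
        moreover have "0 \<le> (K + 1)\<^sup>2" by simp
        ultimately show ?thesis unfolding C_def using K by linarith
      qed
      then show "norm (exp (K * r) * airy_weight \<alpha> r) \<le> norm (exp C * exp (- r))"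
        by (simp add: airy_weight_def exp_add[symmetric] algebra_simps)
    qed
  qed (auto simp: set_borel_measurable_def)
qed

lemma airy_weight_integrable:
  assumes \<alpha>: "1 < \<alpha>" "\<alpha> \<le> 2"
  shows "set_integrable lborel {0..} (airy_weight \<alpha>)"
    and "set_integrable lborel {0..} (\<lambda>r. r powr \<alpha> * airy_weight \<alpha> r)"
proof -
  show "set_integrable lborel {0..} (airy_weight \<alpha>)"
    using airy_weight_moment(1)[of \<alpha> 0] \<alpha> by simp
  have e: "set_integrable lborel {0..} (\<lambda>r. exp (\<alpha> * r) * airy_weight \<alpha> r)"
    using airy_weight_exp_integrable[OF \<alpha>, of \<alpha>] \<alpha> by simp
  show "set_integrable lborel {0..} (\<lambda>r. r powr \<alpha> * airy_weight \<alpha> r)"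
  proof (rule set_integrable_bound[OF e])
    show "AE r in lborel. r \<in> {0..} \<longrightarrow> norm (r powr \<alpha> * airy_weight \<alpha> r) \<le> norm (exp (\<alpha> * r) * airy_weight \<alpha> r)"
    proof (intro AE_I2 impI)
      fix r :: real assume "r \<in> {0..}"
      have "r powr \<alpha> \<le> exp (\<alpha> * r)"
      proof (cases "r = 0")
        case False
        then have "ln r \<le> r" using \<open>r \<in> {0..}\<close> ln_le_minus_one[of r] by auto
        then show ?thesis using False \<alpha> by (simp add: powr_def)
      qed simp
      then show "norm (r powr \<alpha> * airy_weight \<alpha> r) \<le> norm (exp (\<alpha> * r) * airy_weight \<alpha> r)"
        by (simp add: abs_mult airy_weight_pos mult_right_mono)
    qed
  qed (auto simp: set_borel_measurable_def)
qed

lemma airy_ray_pow: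
  shows "airy_ray \<alpha> ^ n = cis (pi * (real n / (1 + \<alpha>)))"
  unfolding airy_ray_def Complex.DeMoivre by (simp add: field_simps)

text \<open>The arguments add up to (1+\<alpha>) times \<pi>/(1+\<alpha>), that is \<pi>. The angle
  of the ray is below \<pi>, so the principal logarithm is the expected one.\<close>

lemma airy_ray_powr:
  assumes \<alpha>: "1 < \<alpha>" and r: "r > 0"
  shows "(of_real r * airy_ray \<alpha>) powr of_real \<alpha> * airy_ray \<alpha> = - of_real (r powr \<alpha>)"
proof -
  define t where "t = pi / (1 + \<alpha>)"
  have t: "0 < t" "t < pi" using \<alpha> by (auto simp: t_def divide_simps)
  have e: "of_real r * airy_ray \<alpha> = exp (of_real (ln r) + \<i> * of_real t)"
    using r by (simp add: airy_ray_def t_def exp_add cis_conv_exp exp_of_real)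
  have L: "Ln (of_real r * airy_ray \<alpha>) = of_real (ln r) + \<i> * of_real t"
    unfolding e by (rule Ln_exp) (use t in auto)
  have "(1 + \<alpha>) * t = pi" using \<alpha> by (simp add: t_def)
  then have "t + \<alpha> * t = pi" by (simp add: distrib_right)
  have "(of_real r * airy_ray \<alpha>) powr of_real \<alpha> * airy_ray \<alpha> =
      exp (of_real \<alpha> * (of_real (ln r) + \<i> * of_real t)) * exp (\<i> * of_real t)"
    using r L by (simp add: powr_def airy_ray_def t_def cis_conv_exp)
  also have "\<dots> = exp (of_real (\<alpha> * ln r) + \<i> * of_real (t + \<alpha> * t))"
    by (simp add: exp_add[symmetric] algebra_simps)
  also have "\<dots> = - of_real (r powr \<alpha>)"
    unfolding \<open>t + \<alpha> * t = pi\<close> exp_add using r by (simp add: powr_def exp_of_real[symmetric])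
  finally show ?thesis .
qed

text \<open>The exponential series is integrated term by term, dominated by exp(|y| r) times the
  weight. The n-th term carries the power n + 1 of the ray because dz contributes one
  factor.\<close>

lemma airy_W_sums:
  assumes \<alpha>: "1 < \<alpha>" "\<alpha> \<le> 2"
  shows "(\<lambda>n. of_real ((- y) ^ n / fact n * (Gamma ((1 + real n) / (1 + \<alpha>)) * (1 + \<alpha>) powr ((real n - \<alpha>) / (1 + \<alpha>))))
      * airy_ray \<alpha> ^ Suc n) sums airy_W \<alpha> y"
proof -
  let ?I = "\<lambda>n. (LINT r:{0..}|lborel. r ^ n * airy_weight \<alpha> r)"
  define f where "f n r = indicator {0..} r *\<^sub>R
     (of_real (r ^ n * airy_weight \<alpha> r) * (of_real ((- y) ^ n / fact n) * airy_ray \<alpha> ^ Suc n))" for n r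
  have nray: "norm (airy_ray \<alpha>) = 1" by (simp add: airy_ray_def)
  have fint: "integrable lborel (f n)" for n
  proof -
    have "integrable lborel (\<lambda>r. complex_of_real (indicator {0..} r *\<^sub>R (r ^ n * airy_weight \<alpha> r)))"
      using airy_weight_moment(1)[OF \<alpha>(1), of n] unfolding set_integrable_def by (rule integrable_of_real)
    then have "set_integrable lborel {0..} (\<lambda>r. complex_of_real (r ^ n * airy_weight \<alpha> r))"
      unfolding set_integrable_def by (simp add: scaleR_conv_of_real)
    then show ?thesis unfolding f_def set_integrable_def[symmetric]
      by (rule set_integrable_mult_left)
  qed
  have fval: "(LINT r|lborel. f n r) = of_real (?I n) * (of_real ((- y) ^ n / fact n) * airy_ray \<alpha> ^ Suc n)" for n
    unfolding f_def set_lebesgue_integral_def[symmetric] set_integral_mult_left set_integral_complex_of_real ..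
  have nf: "norm (f n r) = indicator {0..} r *\<^sub>R (r ^ n * airy_weight \<alpha> r * (\<bar>y\<bar> ^ n / fact n))" for n r
    by (auto simp: f_def norm_mult norm_power nray norm_divide indicator_def airy_weight_pos abs_mult)
  have fex: "f n r = (indicator {0..} r *\<^sub>R (airy_ray \<alpha> * of_real (airy_weight \<alpha> r))) *
      ((- (of_real (y * r) * airy_ray \<alpha>)) ^ n /\<^sub>R fact n)" for n r
    by (auto simp: f_def indicator_def power_minus' power_mult_distrib scaleR_conv_of_real field_simps)
  have nfex: "norm (f n r) = (indicator {0..} r * airy_weight \<alpha> r) * ((\<bar>y\<bar> * \<bar>r\<bar>) ^ n /\<^sub>R fact n)" for n r
    unfolding nf by (auto simp: indicator_def field_simps power_mult_distrib)
  have "(\<lambda>n. LINT r|lborel. f n r) sums (LINT r|lborel. (\<Sum>n. f n r))"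
  proof (rule sums_integral[OF fint])
    show "AE r in lborel. summable (\<lambda>n. norm (f n r))"
      unfolding nfex by (intro AE_I2 summable_mult summable_exp_generic)
    show "summable (\<lambda>n. LINT r|lborel. norm (f n r))"
    proof (rule summableI_nonneg_bounded)
      fix n
      have "(\<Sum>i<n. LINT r|lborel. norm (f i r)) = (LINT r|lborel. (\<Sum>i<n. norm (f i r)))"
        by (rule Bochner_Integration.integral_sum[symmetric]) (use fint in auto)
      also have "\<dots> \<le> (LINT r:{0..}|lborel. exp (\<bar>y\<bar> * r) * airy_weight \<alpha> r)"
        unfolding set_lebesgue_integral_def
      proof (rule integral_mono)
        show "integrable lborel (\<lambda>r. \<Sum>i<n. norm (f i r))" using fint by auto
        show "integrable lborel (\<lambda>r. indicator {0..} r *\<^sub>R (exp (\<bar>y\<bar> * r) * airy_weight \<alpha> r))"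
          using airy_weight_exp_integrable[OF \<alpha>, of "\<bar>y\<bar>"] by (simp add: set_integrable_def)
        fix r :: real
        have "(\<Sum>i<n. norm (f i r)) = (indicator {0..} r * airy_weight \<alpha> r) * (\<Sum>i<n. (\<bar>y\<bar> * \<bar>r\<bar>) ^ i /\<^sub>R fact i)"
          unfolding nfex sum_distrib_left ..
        also have "\<dots> \<le> (indicator {0..} r * airy_weight \<alpha> r) * exp (\<bar>y\<bar> * \<bar>r\<bar>)"
          unfolding exp_def by (intro mult_left_mono sum_le_suminf summable_exp_generic)
            (auto simp: airy_weight_pos)
        also have "\<dots> = indicator {0..} r *\<^sub>R (exp (\<bar>y\<bar> * r) * airy_weight \<alpha> r)"
          by (auto simp: indicator_def)
        finally show "(\<Sum>i<n. norm (f i r)) \<le> indicator {0..} r *\<^sub>R (exp (\<bar>y\<bar> * r) * airy_weight \<alpha> r)" .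
      qed
      finally show "(\<Sum>i<n. LINT r|lborel. norm (f i r)) \<le> (LINT r:{0..}|lborel. exp (\<bar>y\<bar> * r) * airy_weight \<alpha> r)" .
    qed simp
  qed
  moreover have "(LINT r|lborel. (\<Sum>n. f n r)) = airy_W \<alpha> y"
  proof -
    have "(\<Sum>n. f n r) = (indicator {0..} r *\<^sub>R (airy_ray \<alpha> * of_real (airy_weight \<alpha> r))) *
        exp (- (of_real (y * r) * airy_ray \<alpha>))" for r
      unfolding fex exp_def by (rule suminf_mult[OF summable_exp_generic])
    then show ?thesis
      unfolding airy_W_def set_lebesgue_integral_def by (auto intro!: Bochner_Integration.integral_cong simp: mult_ac)
  qed
  ultimately show ?thesis
    unfolding fval airy_weight_moment(2)[OF \<alpha>(1)] by (simp add: mult_ac)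
qed

lemma airy_W_Phi_Psi_sums:
  assumes \<alpha>: "1 < \<alpha>" "\<alpha> \<le> 2"
  shows "(\<lambda>n. (-1) ^ n / fact n * Gamma ((1 + real n) / (1 + \<alpha>)) * sin (pi * ((1 + real n) / (1 + \<alpha>)))
            * (1 + \<alpha>) powr ((real n - \<alpha>) / (1 + \<alpha>)) * y ^ n) sums Im (airy_W \<alpha> y)"
    and "(\<lambda>n. (-1) ^ n / fact n * Gamma ((1 + real n) / (1 + \<alpha>)) * cos (pi * ((1 + real n) / (1 + \<alpha>)))
            * (1 + \<alpha>) powr ((real n - \<alpha>) / (1 + \<alpha>)) * y ^ n) sums Re (airy_W \<alpha> y)"
proof -
  have c: "Im (complex_of_real a * cis t) = a * sin t" "Re (complex_of_real a * cis t) = a * cos t" for a t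
    by simp_all
  show "(\<lambda>n. (-1) ^ n / fact n * Gamma ((1 + real n) / (1 + \<alpha>)) * sin (pi * ((1 + real n) / (1 + \<alpha>)))
            * (1 + \<alpha>) powr ((real n - \<alpha>) / (1 + \<alpha>)) * y ^ n) sums Im (airy_W \<alpha> y)"
    using sums_Im[OF airy_W_sums[OF \<alpha>, of y]]
    unfolding airy_ray_pow c power_minus[of y] of_nat_Suc by (simp add: mult_ac add.commute)
  show "(\<lambda>n. (-1) ^ n / fact n * Gamma ((1 + real n) / (1 + \<alpha>)) * cos (pi * ((1 + real n) / (1 + \<alpha>)))
            * (1 + \<alpha>) powr ((real n - \<alpha>) / (1 + \<alpha>)) * y ^ n) sums Re (airy_W \<alpha> y)"
    using sums_Re[OF airy_W_sums[OF \<alpha>, of y]]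
    unfolding airy_ray_pow c power_minus[of y] of_nat_Suc by (simp add: mult_ac add.commute)
qed

lemma airy_W_Phi_Psi:
  assumes \<alpha>: "1 < \<alpha>" "\<alpha> \<le> 2"
  shows "Im (airy_W \<alpha> y) = pi * Phi \<alpha> y" "Re (airy_W \<alpha> y) = pi * Psi \<alpha> y"
  using airy_W_Phi_Psi_sums[OF \<alpha>, of y] by (auto simp: Phi_def Psi_def sums_iff)

text \<open>Both power series converge everywhere, by \<open>airy_W_Phi_Psi_sums\<close>.\<close>

lemma Phi_Psi_differentiable:
  assumes \<alpha>: "1 < \<alpha>" "\<alpha> \<le> 2"
  shows "(Phi \<alpha> has_real_derivative deriv (Phi \<alpha>) y) (at y)"
    and "(Psi \<alpha> has_real_derivative deriv (Psi \<alpha>) y) (at y)"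
proof -
  have "Phi \<alpha> field_differentiable at y"
    unfolding Phi_def[abs_def] field_differentiable_def
    by (rule exI, rule DERIV_cmult, rule termdiffs_strong_converges_everywhere)
      (use airy_W_Phi_Psi_sums(1)[OF \<alpha>] in \<open>auto simp: sums_iff\<close>)
  then show "(Phi \<alpha> has_real_derivative deriv (Phi \<alpha>) y) (at y)"
    by (simp add: field_differentiable_derivI)
  have "Psi \<alpha> field_differentiable at y"
    unfolding Psi_def[abs_def] field_differentiable_def
    by (rule exI, rule DERIV_cmult, rule termdiffs_strong_converges_everywhere)
      (use airy_W_Phi_Psi_sums(2)[OF \<alpha>] in \<open>auto simp: sums_iff\<close>)
  then show "(Psi \<alpha> has_real_derivative deriv (Psi \<alpha>) y) (at y)"
    by (simp add: field_differentiable_derivI)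
qed

text \<open>Serves to exclude that \<open>Phi\<close> vanishes identically on the positive
  axis.\<close>

lemma Phi_zero_pos:
  assumes \<alpha>: "1 < \<alpha>" "\<alpha> \<le> 2"
  shows "Phi \<alpha> 0 > 0"
proof -
  have "pi / (1 + \<alpha>) < pi" using \<alpha> by (simp add: divide_simps)
  then have "sin (pi / (1 + \<alpha>)) > 0" using \<alpha> by (intro sin_gt_zero) auto
  moreover have "Gamma (1 / (1 + \<alpha>)) > 0" using \<alpha> by (intro Gamma_real_pos) auto
  moreover have "Phi \<alpha> 0 = 1 / pi * (Gamma (1 / (1 + \<alpha>)) * sin (pi / (1 + \<alpha>)) * (1 + \<alpha>) powr (- \<alpha> / (1 + \<alpha>)))"
    unfolding Phi_def powser_zero by simp
  ultimately show ?thesis using \<alpha> by (simp del: powr_minus_divide)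
qed

text \<open>With z the point at distance r on the ray, the integrand is the derivative in r of
  exp(-sz + z^(1+\<alpha>)/(1+\<alpha>)), which runs from 1 at the origin to 0 at infinity.\<close>

lemma airy_W_kernel:
  assumes \<alpha>: "1 < \<alpha>" "\<alpha> \<le> 2" and s: "0 \<le> s"
  shows "(LINT r:{0..}|lborel. ((of_real r * airy_ray \<alpha>) powr of_real \<alpha> - of_real s) *
     exp (- (of_real (s * r) * airy_ray \<alpha>)) * (airy_ray \<alpha> * of_real (airy_weight \<alpha> r))) = -1"
proof -
  define c where "c = airy_ray \<alpha>"
  have nc: "norm c = 1" by (simp add: c_def airy_ray_def)
  have "0 \<le> pi / (1 + \<alpha>)" "pi / (1 + \<alpha>) \<le> pi / 2" using \<alpha> by (auto simp: divide_simps)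
  then have Rec: "0 \<le> Re c" unfolding c_def airy_ray_def by (auto intro!: cos_ge_zero)
  define f where "f r = - (of_real s * c + of_real (r powr \<alpha>)) * exp (- (of_real (s * r) * c)) * of_real (airy_weight \<alpha> r)" for r
  define F where "F r = exp (- (of_real (s * r) * c)) * of_real (airy_weight \<alpha> r)" for r
  have nexp: "norm (exp (- (of_real (s * r) * c))) \<le> 1" if "0 \<le> r" for r
    using that s Rec by simp
  have fm [measurable]: "f \<in> borel_measurable borel" unfolding f_def[abs_def] by measurable
  have fi: "set_integrable lborel {0<..} f"
  proof -
    have "set_integrable lborel {0..} f"
    proof (rule set_integrable_bound)
      show "set_integrable lborel {0..} (\<lambda>r. s * airy_weight \<alpha> r + r powr \<alpha> * airy_weight \<alpha> r)"
        by (intro set_integral_add set_integrable_mult_right airy_weight_integrable \<alpha>)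
      show "AE r in lborel. r \<in> {0..} \<longrightarrow> norm (f r) \<le> norm (s * airy_weight \<alpha> r + r powr \<alpha> * airy_weight \<alpha> r)"
      proof (intro AE_I2 impI)
        fix r :: real assume "r \<in> {0..}"
        then have r: "0 \<le> r" by simp
        have "norm (f r) = norm (of_real s * c + of_real (r powr \<alpha>)) * norm (exp (- (of_real (s * r) * c))) * airy_weight \<alpha> r"
          unfolding f_def norm_mult norm_minus_cancel norm_of_real abs_of_nonneg[OF airy_weight_pos(2)] ..
        also have "\<dots> \<le> (norm (of_real s * c) + norm (complex_of_real (r powr \<alpha>))) * 1 * airy_weight \<alpha> r"
          by (intro mult_mono norm_triangle_ineq nexp r mult_nonneg_nonneg) (auto simp: airy_weight_pos)
        also have "\<dots> = s * airy_weight \<alpha> r + r powr \<alpha> * airy_weight \<alpha> r"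
          using s by (simp add: norm_mult nc distrib_right)
        finally show "norm (f r) \<le> norm (s * airy_weight \<alpha> r + r powr \<alpha> * airy_weight \<alpha> r)" by simp
      qed
    qed (auto simp: set_borel_measurable_def)
    then show ?thesis by (subst (asm) set_integral_Ici_Ioi(1)) auto
  qed
  have "(LBINT r=0..\<infinity>. f r) = 0 - 1"
  proof (rule interval_integral_FTC_integrable)
    show "(0::ereal) < \<infinity>" by simp
    fix r :: real assume r: "(0::ereal) < ereal r" "ereal r < \<infinity>"
    then have r0: "r > 0" by simp
    have "((\<lambda>r. r powr (1 + \<alpha>) / (1 + \<alpha>)) has_real_derivative r powr \<alpha>) (at r)"
      using r0 \<alpha> by (auto intro!: derivative_eq_intros simp: powr_diff)
    from DERIV_chain2[OF DERIV_exp DERIV_minus[OF this]]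
    have "(airy_weight \<alpha> has_real_derivative airy_weight \<alpha> r * - (r powr \<alpha>)) (at r)"
      unfolding airy_weight_def[abs_def] .
    note d1 = has_vector_derivative_of_real[OF this]
    have "((\<lambda>z. exp (- (of_real s * z * c))) has_field_derivative (- (of_real s * c)) * exp (- (of_real s * of_real r * c)))
        (at (of_real r))"
      by (auto intro!: derivative_eq_intros)
    from has_vector_derivative_mult[OF has_vector_derivative_real_field[OF this] d1]
    show "(F has_vector_derivative f r) (at r)"
      unfolding F_def[abs_def] f_def of_real_mult of_real_minus by (simp add: algebra_simps)
    show "isCont f r" unfolding f_def airy_weight_def using r0 \<alpha> by (intro continuous_intros) auto
  next
    show "set_integrable lborel (einterval 0 \<infinity>) f" using fi by (simp add: zero_ereal_def)
    have "((F \<circ> real_of_ereal) \<longlongrightarrow> 1) (at_right (ereal 0))"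
    proof (subst ereal_tendsto_simps)
      have nn: "eventually (\<lambda>r::real. 0 \<le> r) (at_right 0)"
        by (auto simp: eventually_at_right_field intro!: exI[of _ 1])
      have "(F \<longlongrightarrow> F 0) (at_right 0)"
        unfolding F_def airy_weight_def using \<alpha> nn by (intro tendsto_eq_intros refl) auto
      then show "(F \<longlongrightarrow> 1) (at_right 0)" using \<alpha> by (simp add: F_def airy_weight_def)
    qed
    then show "((F \<circ> real_of_ereal) \<longlongrightarrow> 1) (at_right 0)" by (simp add: zero_ereal_def)
    show "((F \<circ> real_of_ereal) \<longlongrightarrow> 0) (at_left \<infinity>)"
    proof (subst ereal_tendsto_simps, rule Lim_null_comparison)
      show "\<forall>\<^sub>F r in at_top. norm (F r) \<le> airy_weight \<alpha> r"
        using eventually_ge_at_top[of 0]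
      proof eventually_elim
        case (elim r)
        have "norm (F r) = norm (exp (- (of_real (s * r) * c))) * airy_weight \<alpha> r"
          unfolding F_def by (simp add: norm_mult airy_weight_pos del: norm_exp_eq_Re)
        also have "\<dots> \<le> 1 * airy_weight \<alpha> r" by (intro mult_right_mono nexp elim) (simp add: airy_weight_pos)
        finally show ?case by simp
      qed
      show "(airy_weight \<alpha> \<longlongrightarrow> 0) at_top"
        unfolding airy_weight_def using \<alpha> by real_asymp
    qed
  qed
  then have "(LINT r:{0<..}|lborel. f r) = -1"
    using interval_lebesgue_integral_0_infty(2)[of lborel f] by simp
  moreover have "(LINT r:{0..}|lborel. ((of_real r * airy_ray \<alpha>) powr of_real \<alpha> - of_real s) *
     exp (- (of_real (s * r) * airy_ray \<alpha>)) * (airy_ray \<alpha> * of_real (airy_weight \<alpha> r))) = (LINT r:{0..}|lborel. f r)"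
  proof (rule set_lebesgue_integral_cong)
    show "\<forall>r. r \<in> {0..} \<longrightarrow> ((of_real r * airy_ray \<alpha>) powr of_real \<alpha> - of_real s) *
     exp (- (of_real (s * r) * airy_ray \<alpha>)) * (airy_ray \<alpha> * of_real (airy_weight \<alpha> r)) = f r"
    proof (intro allI impI)
      fix r :: real assume "r \<in> {0..}"
      \<comment> \<open>At r = 0 both sides vanish, by the convention that powers of 0 are
        0.\<close>
      have "(of_real r * c) powr of_real \<alpha> * c = - of_real (r powr \<alpha>)"
        using airy_ray_powr[OF \<alpha>(1), of r] \<open>r \<in> {0..}\<close> \<alpha> by (cases "r = 0") (auto simp: c_def)
      then have "((of_real r * c) powr of_real \<alpha> - of_real s) * c = - (of_real s * c + of_real (r powr \<alpha>))"
        by (simp add: algebra_simps)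
      moreover have "u * v * (c * z) = u * c * v * z" for u v z by (simp only: mult_ac)
      ultimately show "((of_real r * airy_ray \<alpha>) powr of_real \<alpha> - of_real s) *
     exp (- (of_real (s * r) * airy_ray \<alpha>)) * (airy_ray \<alpha> * of_real (airy_weight \<alpha> r)) = f r"
        unfolding f_def c_def[symmetric] by (simp only:)
    qed
  qed simp
  ultimately show ?thesis by (subst (asm) set_integral_Ici_Ioi(2)[symmetric]) auto
qed

section \<open>Riemann sums along a killed path\<close>

text \<open>Survival means staying in the closed half line. For right-continuous paths this can be
  tested on countably many times, and all grid positions of a surviving path pass the test.\<close>

definition alive :: "real \<Rightarrow> (real \<Rightarrow> real) \<Rightarrow> real \<Rightarrow> bool" where
  "alive x w s \<longleftrightarrow> (\<forall>r\<in>{0..s}. 0 \<le> x + w r)"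

definition discount :: "real \<Rightarrow> real \<Rightarrow> (real \<Rightarrow> real) \<Rightarrow> real \<Rightarrow> real" where
  "discount q x w s = exp (- (LINT r:{0..s}|lborel. q + x + w r))"

text \<open>Riemann sums become integrals of step functions, so that dominated convergence is
  available.\<close>

lemma step_function_integral:
  fixes f :: "nat \<Rightarrow> 'a :: {banach, second_countable_topology}"
  assumes h: "h > 0"
  shows "has_bochner_integral lborel (\<lambda>s. indicator {0..<real n * h} s *\<^sub>R f (nat \<lfloor>s / h\<rfloor>)) (\<Sum>k<n. h *\<^sub>R f k)"
proof -
  have fl: "nat \<lfloor>s / h\<rfloor> = k" if "real k * h \<le> s" "s < real (Suc k) * h" for s k
  proof -
    have "\<lfloor>s / h\<rfloor> = int k" using that h by (intro floor_unique) (auto simp: field_simps)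
    then show ?thesis by simp
  qed
  have "has_bochner_integral lborel (\<lambda>s. indicator {real k * h..<real (Suc k) * h} s *\<^sub>R f k) (h *\<^sub>R f k)" for k
  proof -
    have "has_bochner_integral lborel (indicator {real k * h..<real (Suc k) * h} :: real \<Rightarrow> real) (measure lborel {real k * h..<real (Suc k) * h})"
      by (rule has_bochner_integral_real_indicator) (use h in auto)
    then have "has_bochner_integral lborel (indicator {real k * h..<real (Suc k) * h} :: real \<Rightarrow> real) h"
      using h by (simp add: measure_def algebra_simps)
    then show ?thesis by (rule has_bochner_integral_scaleR_left)
  qed
  then have "has_bochner_integral lborel (\<lambda>s. \<Sum>k<n. indicator {real k * h..<real (Suc k) * h} s *\<^sub>R f k) (\<Sum>k<n. h *\<^sub>R f k)"
    by (intro has_bochner_integral_sum)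
  moreover have "(\<Sum>k<n. indicator {real k * h..<real (Suc k) * h} s *\<^sub>R f k) =
      indicator {0..<real n * h} s *\<^sub>R f (nat \<lfloor>s / h\<rfloor>)" for s
  proof (induction n)
    case (Suc n)
    have "indicator {0..<real (Suc n) * h} s = (indicator {0..<real n * h} s + indicator {real n * h..<real (Suc n) * h} s :: real)"
    proof -
      have split: "indicator {0..<a + h} s = (indicator {0..<a} s + indicator {a..<a + h} s :: real)" if "0 \<le> a" for a
        using that h by (auto simp: indicator_def)
      have "real (Suc n) * h = real n * h + h" by (simp add: distrib_right)
      then show ?thesis using split[of "real n * h"] h by (simp only:) simp
    qed
    then show ?case using Suc fl[of n s] by (auto simp: scaleR_add_left indicator_def)
  qed simp
  ultimately show ?thesis by simp
qed

lemma triangle_indicator_measurable: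
  "(\<lambda>p :: real \<times> real. indicator {0..fst p} (snd p) :: real) \<in> borel_measurable (borel \<Otimes>\<^sub>M borel)"
proof -
  have "closed {p :: real \<times> real. 0 \<le> snd p \<and> snd p \<le> fst p}"
    by (intro closed_Collect_conj closed_Collect_le continuous_intros)
  then have "(indicator {p :: real \<times> real. 0 \<le> snd p \<and> snd p \<le> fst p} :: real \<times> real \<Rightarrow> real) \<in> borel_measurable borel"
    by (intro borel_measurable_indicator borel_closed)
  moreover have "(\<lambda>p :: real \<times> real. indicator {0..fst p} (snd p) :: real) = indicator {p :: real \<times> real. 0 \<le> snd p \<and> snd p \<le> fst p}"
    by (auto simp: indicator_def)
  ultimately show ?thesis unfolding borel_prod by (simp only:)
qed

lemma primitive_measurable:
  fixes v :: "real \<Rightarrow> real"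
  assumes v: "v \<in> borel_measurable borel"
  shows "(\<lambda>s. LINT r|lborel. indicator {0..s} r *\<^sub>R v r) \<in> borel_measurable borel"
proof (rule sigma_finite_measure.borel_measurable_lebesgue_integral[OF sigma_finite_lborel])
  have "(\<lambda>p. indicator {0..fst p} (snd p) *\<^sub>R v (snd p)) \<in> borel_measurable (borel \<Otimes>\<^sub>M borel)"
    by (intro borel_measurable_scaleR triangle_indicator_measurable measurable_compose[OF measurable_snd v])
  then show "(\<lambda>(s, r). indicator {0..s} r *\<^sub>R v r) \<in> borel_measurable (borel \<Otimes>\<^sub>M lborel)"
    by (subst measurable_cong_sets[OF sets_pair_measure_cong[OF refl sets_lborel] refl]) (simp add: case_prod_beta)
qed

text \<open>The derivative of exp has modulus at most 1 on the left half plane, which is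
  convex.\<close>

lemma norm_exp_minus_one_le:
  fixes z :: complex
  assumes "Re z \<le> 0"
  shows "norm (exp z - 1) \<le> norm z"
proof -
  have "norm (exp z - exp 0) \<le> 1 * norm (z - 0)"
  proof (rule field_differentiable_bound[where S = "{z. Re z \<le> 0}" and f' = exp])
    show "convex {z. Re z \<le> 0}" by (rule convex_halfspace_Re_le)
    show "(exp has_field_derivative exp z) (at z within {z. Re z \<le> 0})" for z :: complex
      by (auto intro!: derivative_eq_intros)
  qed (use assms in auto)
  then show ?thesis by simp
qed

lemma tendsto_exp_difference_quotient:
  fixes c :: "nat \<Rightarrow> complex" and h :: "nat \<Rightarrow> real"
  assumes c: "c \<longlonglongrightarrow> l" and h: "h \<longlonglongrightarrow> 0" "\<And>n. h n > 0"
  shows "(\<lambda>n. (exp (of_real (h n) * c n) - 1) / of_real (h n)) \<longlonglongrightarrow> l"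
proof -
  \<comment> \<open>The removable singularity is filled by the value 1, so that indices with
    \<open>c n = 0\<close> are covered by the same limit.\<close>
  define \<phi> where "\<phi> w = (if w = 0 then 1 else (exp w - 1) / w)" for w :: complex
  have "((\<lambda>w. (exp w - exp 0) / (w - 0)) \<longlongrightarrow> exp (0::complex)) (at 0)"
    using DERIV_exp[of "0::complex"] unfolding has_field_derivative_iff .
  then have "(\<phi> \<longlongrightarrow> exp 0) (at 0)"
    by (rule Lim_transform_eventually) (auto simp: \<phi>_def eventually_at_filter)
  then have "(\<phi> \<longlongrightarrow> \<phi> 0) (at 0)" by (simp add: \<phi>_def)
  then have cont: "isCont \<phi> 0" unfolding isCont_def .
  have "(\<lambda>n. of_real (h n) * c n) \<longlonglongrightarrow> of_real 0 * l"
    by (intro tendsto_intros c h)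
  then have "(\<lambda>n. of_real (h n) * c n) \<longlonglongrightarrow> 0" by simp
  from isCont_tendsto_compose[OF cont this] have "(\<lambda>n. \<phi> (of_real (h n) * c n) * c n) \<longlonglongrightarrow> \<phi> 0 * l"
    by (intro tendsto_intros c)
  moreover have "\<phi> (of_real (h n) * c n) * c n = (exp (of_real (h n) * c n) - 1) / of_real (h n)" for n
    using h(2)[of n] by (auto simp: \<phi>_def)
  ultimately show ?thesis by (simp add: \<phi>_def)
qed

text \<open>The minimum of n and the first index satisfying B. A value below n certifies B at that
  index; the value n leaves open whether \<open>B n\<close> holds.\<close>

primrec stop_index :: "(nat \<Rightarrow> bool) \<Rightarrow> nat \<Rightarrow> nat" where
  "stop_index B 0 = 0"
| "stop_index B (Suc n) = (if \<forall>j\<le>n. \<not> B j then Suc n else stop_index B n)"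

lemma stop_index_le: "stop_index B n \<le> n"
  by (induction n) (auto intro: le_SucI)

lemma stop_index_minimal: "k < stop_index B n \<Longrightarrow> \<not> B k"
  by (induction n) (auto split: if_splits)

lemma stop_index_eq: "(\<And>j. j < n \<Longrightarrow> \<not> B j) \<Longrightarrow> stop_index B n = n"
  by (induction n) auto

lemma stop_index_less: "stop_index B n < n \<Longrightarrow> B (stop_index B n)"
proof (induction n)
  case (Suc n)
  show ?case
  proof (cases "\<forall>j\<le>n. \<not> B j")
    case False
    then have eq: "stop_index B (Suc n) = stop_index B n" by auto
    show ?thesis
    proof (cases "stop_index B n < n")
      case True then show ?thesis using Suc.IH eq by simp
    next
      case 2: False
      then have n: "stop_index B n = n" using stop_index_le[of B n] by simp
      then have "\<not> B j" if "j < n" for j using stop_index_minimal[of j B n] that by simp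
      then have "B n" using False by (metis le_neq_implies_less)
      then show ?thesis using n eq by simp
    qed
  qed (use Suc.prems in auto)
qed simp

text \<open>Optional stopping in algebraic form: the k-th increment is switched on by a condition on
  the indices up to k, which independence of the next increment can exploit.\<close>

lemma stop_index_telescope:
  fixes Z :: "nat \<Rightarrow> 'a :: ab_group_add"
  shows "Z (stop_index B n) = Z 0 + (\<Sum>k<n. if \<forall>j\<le>k. \<not> B j then Z (Suc k) - Z k else 0)"
proof (induction n)
  case (Suc n)
  show ?case
  proof (cases "\<forall>j\<le>n. \<not> B j")
    case True
    then have "stop_index B n = n" by (intro stop_index_eq) auto
    then show ?thesis using Suc True by simp
  next
    case False
    then show ?thesis using Suc by auto
  qed
qed simp

section \<open>Limits along uniform grids for one fixed cadlag path\<close>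

context
  fixes w :: "real \<Rightarrow> real" and t :: real and h :: "nat \<Rightarrow> real" and g :: "nat \<Rightarrow> real \<Rightarrow> real"
  assumes w: "cadlag w" and t: "0 < t"
  defines "h \<equiv> \<lambda>n. t / real (Suc n)"
  defines "g \<equiv> \<lambda>n s. real (nat \<lfloor>s / h n\<rfloor>) * h n"
begin

lemma grid_step_pos: "h n > 0" using t by (simp add: h_def)

lemma grid_step_tendsto: "h \<longlonglongrightarrow> 0"
  unfolding h_def using tendsto_mult[OF tendsto_const LIMSEQ_Suc[OF lim_1_over_n], of t] by simp

lemma grid_time_le: "0 \<le> s \<Longrightarrow> g n s \<le> s" "0 \<le> s \<Longrightarrow> s - h n < g n s" "0 \<le> g n s"
proof -
  assume s: "0 \<le> s"
  have f: "real (nat \<lfloor>s / h n\<rfloor>) = real_of_int \<lfloor>s / h n\<rfloor>" using s grid_step_pos[of n] by simp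
  have "real_of_int \<lfloor>s / h n\<rfloor> \<le> s / h n" by simp
  then show "g n s \<le> s" unfolding g_def f by (rule pos_le_divide_eq[OF grid_step_pos, THEN iffD1])
  have "s / h n < real_of_int \<lfloor>s / h n\<rfloor> + 1" by simp
  then have "s < (real_of_int \<lfloor>s / h n\<rfloor> + 1) * h n" by (rule pos_divide_less_eq[OF grid_step_pos, THEN iffD1])
  then show "s - h n < g n s" unfolding g_def f by (simp add: distrib_right)
next
  show "0 \<le> g n s" unfolding g_def using grid_step_pos[of n] by simp
qed

lemma grid_time_tendsto: assumes "0 \<le> s" shows "(\<lambda>n. g n s) \<longlonglongrightarrow> s"
proof (rule tendsto_sandwich[of "\<lambda>n. s - h n" _ _ "\<lambda>_. s"])
  show "(\<lambda>n. s - h n) \<longlonglongrightarrow> s" using tendsto_diff[OF tendsto_const grid_step_tendsto, of s] by simp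
qed (use grid_time_le(1,2)[OF assms] in \<open>auto intro!: always_eventually less_imp_le\<close>)

lemma grid_value_tendsto:
  assumes "0 \<le> s" "isCont w s" shows "(\<lambda>n. w (g n s)) \<longlonglongrightarrow> w s"
  using isCont_tendsto_compose[OF assms(2) grid_time_tendsto[OF assms(1)]] .

lemma grid_measurable [measurable]: "(\<lambda>s. f (nat \<lfloor>s / h n\<rfloor>)) \<in> borel_measurable borel"
  by measurable

text \<open>Grid times approach r from the left, so sampled values tend to w(r) where w has no jump,
  which is almost everywhere; boundedness of the path on [0, s] provides the domination.\<close>

lemma grid_discount_tendsto:
  assumes s: "0 \<le> s"
  shows "(\<lambda>n. \<Sum>j<nat \<lfloor>s / h n\<rfloor>. h n * (c + w (real j * h n))) \<longlonglongrightarrow> (LINT r:{0..s}|lborel. c + w r)"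
proof -
  obtain K where K: "\<And>r. r \<in> {0..s} \<Longrightarrow> \<bar>w r\<bar> \<le> K" using cadlag_bounded[OF w] by blast
  have eq: "(\<Sum>j<nat \<lfloor>s / h n\<rfloor>. h n * (c + w (real j * h n))) =
      (LINT r|lborel. indicator {0..<g n s} r *\<^sub>R (c + w (g n r)))" for n
    using has_bochner_integral_integral_eq[OF step_function_integral[OF grid_step_pos[of n], of "nat \<lfloor>s / h n\<rfloor>" "\<lambda>j. c + w (real j * h n)"]]
    unfolding g_def by simp
  have cm: "set_borel_measurable lborel {0..s} (\<lambda>r. c + w r)"
  proof -
    have "set_integrable lborel {0..s} (\<lambda>r. c + w r)"
      by (intro set_integral_add cadlag_set_integrable[OF w])
        (auto simp: set_integrable_def emeasure_lborel_Icc_eq intro!: integrable_mult_left integrable_real_indicator)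
    then show ?thesis unfolding set_integrable_def set_borel_measurable_def by (rule borel_measurable_integrable)
  qed
  have gm: "(\<lambda>r. c + w (g n r)) \<in> borel_measurable borel" for n
    unfolding g_def by (rule grid_measurable)
  show ?thesis
    unfolding eq set_lebesgue_integral_def
  proof (rule integral_dominated_convergence)
    show "(\<lambda>r. indicator {0..s} r *\<^sub>R (c + w r)) \<in> borel_measurable lborel"
      using cm unfolding set_borel_measurable_def .
    show "(\<lambda>r. indicator {0..<g n s} r *\<^sub>R (c + w (g n r))) \<in> borel_measurable lborel" for n
      using gm[of n] by measurable
    show "integrable lborel (\<lambda>r. indicator {0..s} r * (\<bar>c\<bar> + K))"
      by (intro integrable_mult_left integrable_real_indicator) (auto simp: emeasure_lborel_Icc_eq)
    show "AE r in lborel. norm (indicator {0..<g n s} r *\<^sub>R (c + w (g n r))) \<le> indicator {0..s} r * (\<bar>c\<bar> + K)" for n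
    proof (rule AE_I2)
      fix r
      show "norm (indicator {0..<g n s} r *\<^sub>R (c + w (g n r))) \<le> indicator {0..s} r * (\<bar>c\<bar> + K)"
      proof (cases "r \<in> {0..<g n s}")
        case True
        then have "0 \<le> r" "r \<le> s" using grid_time_le(1)[OF s, of n] by auto
        then have "g n r \<in> {0..s}" using grid_time_le(1)[of r n] grid_time_le(3)[of n r] by auto
        then have "\<bar>c + w (g n r)\<bar> \<le> \<bar>c\<bar> + K" using K[of "g n r"] by linarith
        then show ?thesis using True \<open>0 \<le> r\<close> \<open>r \<le> s\<close> by (simp add: indicator_def)
      next
        case False
        have "0 \<le> indicator {0..s} r * (\<bar>c\<bar> + K)" using K[of 0] s by (auto simp: indicator_def)
        then show ?thesis using False by simp
      qed
    qed
    show "AE r in lborel. (\<lambda>n. indicator {0..<g n s} r *\<^sub>R (c + w (g n r))) \<longlonglongrightarrow> indicator {0..s} r *\<^sub>R (c + w r)"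
      using cadlag_AE_isCont[OF w] AE_lborel_singleton[of s] AE_lborel_singleton[of "0::real"]
    proof eventually_elim
      case (elim r)
      consider "r < 0" | "0 < r" "r < s" | "s < r" using elim by linarith
      then show ?case
      proof cases
        case 1 then show ?thesis by simp
      next
        case 3 then have "\<And>n. r \<notin> {0..<g n s}" using grid_time_le(1)[OF s] by (auto simp: not_less) (meson dual_order.trans less_imp_le)
        then show ?thesis using 3 by simp
      next
        case 2
        have "\<forall>\<^sub>F n in sequentially. r < g n s" by (rule order_tendstoD(1)[OF grid_time_tendsto[OF s] 2(2)])
        moreover have "(\<lambda>n. c + w (g n r)) \<longlonglongrightarrow> c + w r"
          using 2 elim by (intro tendsto_intros grid_value_tendsto) auto
        ultimately have "(\<lambda>n. indicator {0..<g n s} r *\<^sub>R (c + w (g n r))) \<longlonglongrightarrow> c + w r"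
          by (elim Lim_transform_eventually, elim eventually_mono) (use 2 in auto)
        then show ?thesis using 2 by simp
      qed
    qed
  qed
qed

text \<open>A path that is negative somewhere before s stays negative for a while by right
  continuity, and a fine grid detects this. The excluded case is a path that survives every earlier
  time and dies exactly at s.\<close>

lemma grid_alive_eventually:
  assumes s: "0 \<le> s" and "\<not> (\<not> alive x w s \<and> (\<forall>r<s. alive x w r))"
  shows "\<forall>\<^sub>F n in sequentially. (\<forall>j\<le>nat \<lfloor>s / h n\<rfloor>. 0 \<le> x + w (real j * h n)) \<longleftrightarrow> alive x w s"
proof (cases "alive x w s")
  case True
  have "0 \<le> x + w (real j * h n)" if "j \<le> nat \<lfloor>s / h n\<rfloor>" for j n
  proof -
    have "real j * h n \<le> g n s" unfolding g_def using that grid_step_pos[of n] by (intro mult_right_mono) auto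
    then have "real j * h n \<le> s" using grid_time_le(1)[OF s, of n] by linarith
    then show ?thesis using True grid_step_pos[of n] by (auto simp: alive_def)
  qed
  then show ?thesis using True by (intro always_eventually) auto
next
  case False
  then obtain r0 where "r0 < s" "\<not> alive x w r0" using assms by auto
  then obtain r where r: "0 \<le> r" "r < s" "x + w r < 0" by (force simp: alive_def not_le)
  have "(w \<longlongrightarrow> w r) (at_right r)" using w r by (auto simp: cadlag_def)
  then have "((\<lambda>r. x + w r) \<longlongrightarrow> x + w r) (at_right r)" by (intro tendsto_intros)
  from order_tendstoD(2)[OF this r(3)] obtain b where b: "b > r" "\<And>y. r < y \<Longrightarrow> y < b \<Longrightarrow> x + w y < 0"
    unfolding eventually_at_right_field by blast
  define m where "m = min b s"
  have m: "r < m" "m \<le> s" "\<And>y. r < y \<Longrightarrow> y < m \<Longrightarrow> x + w y < 0" using b r by (auto simp: m_def)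
  \<comment> \<open>The grid time below p converges to p, hence eventually lies in (r, m), where the
    path is negative.\<close>
  define p where "p = (r + m) / 2"
  have p: "r < p" "p < m" using m by (auto simp: p_def)
  have "\<forall>\<^sub>F n in sequentially. r < g n p" using order_tendstoD(1)[OF grid_time_tendsto[of p] p(1)] p r by auto
  then show ?thesis
  proof eventually_elim
    case (elim n)
    have "g n p < m" using grid_time_le(1)[of p n] p r by auto
    then have neg: "x + w (g n p) < 0" using m(3) elim by auto
    have "nat \<lfloor>p / h n\<rfloor> \<le> nat \<lfloor>s / h n\<rfloor>"
      using p m grid_step_pos[of n] by (intro nat_mono floor_mono divide_right_mono) auto
    then show ?case using neg False unfolding g_def by (auto simp: not_le)
  qed
qed

text \<open>Each summand is the mesh times a difference quotient of exp. The sign conditions on z,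
  \<psi> and q bound all three factors as long as the path survives: discount and exponential by 1,
  the quotient by the modulus of its limit.\<close>

lemma grid_sum_tendsto:
  fixes z \<psi> :: complex and x q :: real
  assumes z: "Re z \<ge> 0" and \<psi>: "Re \<psi> \<le> 0" and q: "q \<ge> 0"
  shows "(\<lambda>n. \<Sum>k<Suc n. if \<forall>j\<le>k. 0 \<le> x + w (real j * h n) then
        of_real (exp (- (\<Sum>j<k. h n * (q + x + w (real j * h n))))) * exp (- (z * of_real (x + w (real k * h n)))) *
        (exp (of_real (h n) * (\<psi> - of_real (q + x + w (real k * h n)))) - 1) else 0)
     \<longlonglongrightarrow> (LINT s:{0..t}|lborel. if alive x w s then
        of_real (discount q x w s) * exp (- (z * of_real (x + w s))) * (\<psi> - of_real (q + x + w s)) else 0)"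
proof -
  obtain K where K: "K \<ge> 0" "\<And>r. r \<in> {0..t} \<Longrightarrow> \<bar>w r\<bar> \<le> K" using cadlag_bounded[OF w] by blast
  define f where "f n k = (if \<forall>j\<le>k. 0 \<le> x + w (real j * h n) then
        of_real (exp (- (\<Sum>j<k. h n * (q + x + w (real j * h n))))) * exp (- (z * of_real (x + w (real k * h n)))) *
        ((exp (of_real (h n) * (\<psi> - of_real (q + x + w (real k * h n)))) - 1) / of_real (h n)) else 0)" for n k
  define F where "F s = (if alive x w s then
        of_real (discount q x w s) * exp (- (z * of_real (x + w s))) * (\<psi> - of_real (q + x + w s)) else 0)" for s
  have Sn: "real (Suc n) * h n = t" for n by (simp add: h_def)
  have eq: "(\<Sum>k<Suc n. if \<forall>j\<le>k. 0 \<le> x + w (real j * h n) then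
        of_real (exp (- (\<Sum>j<k. h n * (q + x + w (real j * h n))))) * exp (- (z * of_real (x + w (real k * h n)))) *
        (exp (of_real (h n) * (\<psi> - of_real (q + x + w (real k * h n)))) - 1) else 0) =
     (LINT s|lborel. indicator {0..<t} s *\<^sub>R f n (nat \<lfloor>s / h n\<rfloor>))" for n
  proof -
    have "(LINT s|lborel. indicator {0..<t} s *\<^sub>R f n (nat \<lfloor>s / h n\<rfloor>)) = (\<Sum>k<Suc n. h n *\<^sub>R f n k)"
      using has_bochner_integral_integral_eq[OF step_function_integral[OF grid_step_pos[of n], of "Suc n" "f n"]]
      unfolding Sn .
    also have "\<dots> = (\<Sum>k<Suc n. if \<forall>j\<le>k. 0 \<le> x + w (real j * h n) then
        of_real (exp (- (\<Sum>j<k. h n * (q + x + w (real j * h n))))) * exp (- (z * of_real (x + w (real k * h n)))) *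
        (exp (of_real (h n) * (\<psi> - of_real (q + x + w (real k * h n)))) - 1) else 0)"
      using grid_step_pos[of n] by (intro sum.cong refl) (auto simp: f_def scaleR_conv_of_real)
    finally show ?thesis ..
  qed
  have lim: "AE s in lborel. (\<lambda>n. indicator {0..<t} s *\<^sub>R f n (nat \<lfloor>s / h n\<rfloor>)) \<longlonglongrightarrow> indicator {0..t} s *\<^sub>R F s"
  proof -
    \<comment> \<open>The times at which the path dies exactly; two different ones would contradict
      each other, so this set has at most one point and is negligible.\<close>
    define E where "E = {s. 0 \<le> s \<and> \<not> alive x w s \<and> (\<forall>r<s. alive x w r)}"
    have "\<exists>e. E \<subseteq> {e}"
    proof (cases "E = {}")
      case False
      then obtain e where e: "e \<in> E" by blast
      have "s = e" if "s \<in> E" for s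
        using that e unfolding E_def by (cases s e rule: linorder_cases) auto
      then show ?thesis by blast
    qed auto
    then obtain e where E: "E \<subseteq> {e}" by blast
    show ?thesis
      using cadlag_AE_isCont[OF w] AE_lborel_singleton[of t] AE_lborel_singleton[of e] AE_lborel_singleton[of "0::real"]
    proof eventually_elim
      case (elim s)
      show ?case
      proof (cases "0 < s \<and> s < t")
        case False
        then have "s \<notin> {0..<t}" "s \<notin> {0..t}" using elim by auto
        then show ?thesis by simp
      next
        case True
        then have s: "0 \<le> s" and c: "isCont w s" using elim by auto
        have "s \<notin> E" using E elim by auto
        then have al: "\<forall>\<^sub>F n in sequentially. (\<forall>j\<le>nat \<lfloor>s / h n\<rfloor>. 0 \<le> x + w (real j * h n)) \<longleftrightarrow> alive x w s"
          using s by (intro grid_alive_eventually) (auto simp: E_def)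
        have gv: "(\<lambda>n. w (real (nat \<lfloor>s / h n\<rfloor>) * h n)) \<longlonglongrightarrow> w s"
          using grid_value_tendsto[OF s c] unfolding g_def .
        have d: "(\<lambda>n. exp (- (\<Sum>j<nat \<lfloor>s / h n\<rfloor>. h n * (q + x + w (real j * h n))))) \<longlonglongrightarrow> discount q x w s"
          unfolding discount_def by (intro tendsto_intros grid_discount_tendsto[OF s])
        have "(\<lambda>n. if alive x w s then
            of_real (exp (- (\<Sum>j<nat \<lfloor>s / h n\<rfloor>. h n * (q + x + w (real j * h n))))) *
            exp (- (z * of_real (x + w (real (nat \<lfloor>s / h n\<rfloor>) * h n)))) *
            ((exp (of_real (h n) * (\<psi> - of_real (q + x + w (real (nat \<lfloor>s / h n\<rfloor>) * h n)))) - 1) / of_real (h n)) else 0)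
           \<longlonglongrightarrow> F s"
        proof (cases "alive x w s")
          case True
          have e1: "(\<lambda>n. exp (- (z * of_real (x + w (real (nat \<lfloor>s / h n\<rfloor>) * h n))))) \<longlonglongrightarrow> exp (- (z * of_real (x + w s)))"
            by (intro tendsto_intros gv)
          have "(\<lambda>n. \<psi> - of_real (q + x + w (real (nat \<lfloor>s / h n\<rfloor>) * h n))) \<longlonglongrightarrow> \<psi> - of_real (q + x + w s)"
            by (intro tendsto_intros gv)
          note q1 = tendsto_exp_difference_quotient[OF this grid_step_tendsto grid_step_pos]
          show ?thesis unfolding F_def if_P[OF True]
            by (rule tendsto_mult[OF tendsto_mult[OF tendsto_of_real[OF d] e1] q1])
        qed (simp add: F_def)
        then have "(\<lambda>n. f n (nat \<lfloor>s / h n\<rfloor>)) \<longlonglongrightarrow> F s"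
          by (rule Lim_transform_eventually) (use al in eventually_elim, simp only: f_def)
        then show ?thesis using True by simp
      qed
    qed
  qed
  define C where "C = norm \<psi> + q + \<bar>x\<bar> + K"
  have bound: "norm (f n (nat \<lfloor>s / h n\<rfloor>)) \<le> C" if s: "0 \<le> s" "s < t" for n s
  proof (cases "\<forall>j\<le>nat \<lfloor>s / h n\<rfloor>. 0 \<le> x + w (real j * h n)")
    case True
    define k where "k = nat \<lfloor>s / h n\<rfloor>"
    have pos: "0 \<le> x + w (real j * h n)" if "j \<le> k" for j using True that by (simp add: k_def)
    have "real k * h n \<in> {0..t}" using grid_time_le(1)[OF s(1), of n] grid_time_le(3)[of n s] s unfolding g_def k_def by auto
    then have wK: "\<bar>w (real k * h n)\<bar> \<le> K" by (rule K(2))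
    have a: "0 \<le> (\<Sum>j<k. h n * (q + x + w (real j * h n)))"
    proof (intro sum_nonneg mult_nonneg_nonneg)
      fix j assume "j \<in> {..<k}"
      then show "0 \<le> q + x + w (real j * h n)" using pos[of j] q by auto
    qed (use grid_step_pos[of n] in simp)
    define c where "c = \<psi> - of_real (q + x + w (real k * h n))"
    have "Re c \<le> 0" using \<psi> pos[of k] q by (simp add: c_def)
    then have "norm (exp (of_real (h n) * c) - 1) \<le> norm (of_real (h n) * c)"
      using grid_step_pos[of n] by (intro norm_exp_minus_one_le) (simp add: mult_nonneg_nonpos)
    then have b: "norm ((exp (of_real (h n) * c) - 1) / of_real (h n)) \<le> norm c"
      using grid_step_pos[of n] by (simp add: norm_divide norm_mult pos_divide_le_eq mult.commute)
    have c: "norm c \<le> C"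
    proof -
      have "norm c \<le> norm \<psi> + norm (complex_of_real (q + x + w (real k * h n)))" unfolding c_def by (rule norm_triangle_ineq4)
      also have "\<dots> \<le> C" using wK q unfolding C_def norm_of_real by linarith
      finally show ?thesis .
    qed
    have e: "norm (exp (- (z * of_real (x + w (real k * h n))))) \<le> 1"
      using z pos[of k] by (simp del: of_real_add)
    have "norm (f n k) = norm (exp (- (\<Sum>j<k. h n * (q + x + w (real j * h n))))) *
        norm (exp (- (z * of_real (x + w (real k * h n))))) * norm ((exp (of_real (h n) * c) - 1) / of_real (h n))"
    proof -
      have A: "\<forall>j\<le>k. 0 \<le> x + w (real j * h n)" using pos by blast
      show ?thesis unfolding f_def c_def if_P[OF A] norm_mult norm_of_real real_norm_def ..
    qed
    also have "\<dots> \<le> 1 * 1 * C"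
      by (intro mult_mono e order_trans[OF b c]) (use a c in \<open>auto intro: order_trans[OF norm_ge_zero]\<close>)
    finally show ?thesis by (simp add: k_def)
  next
    case False
    then show ?thesis using q K by (auto simp: f_def C_def)
  qed
  have stepm: "(\<lambda>s. indicator {0..<t} s *\<^sub>R f n (nat \<lfloor>s / h n\<rfloor>)) \<in> borel_measurable lborel" for n
    using grid_measurable[of "f n" n] by measurable
  have AEm: "(\<lambda>s. indicator {0..t} s *\<^sub>R F s) \<in> borel_measurable lborel"
  proof -
    \<comment> \<open>Survival times form an interval, hence a Borel set.\<close>
    have iv: "is_interval {s. 0 \<le> s \<and> alive x w s}"
      unfolding is_interval_1 alive_def by auto
    have am: "{s. 0 \<le> s \<and> alive x w s} \<in> sets borel"
      using iv by (rule real_interval_borel_measurable)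
    have wm: "(\<lambda>s. indicator {0..t} s *\<^sub>R w s) \<in> borel_measurable lborel"
      using cadlag_set_integrable[OF w, of t] unfolding set_integrable_def by (rule borel_measurable_integrable)
    define v where "v s = indicator {0..t} s *\<^sub>R w s" for s
    have vm [measurable]: "v \<in> borel_measurable borel" using wm unfolding v_def[abs_def] by simp
    have dm: "(\<lambda>s. exp (- (LINT r|lborel. indicator {0..s} r *\<^sub>R (q + x + v r)))) \<in> borel_measurable borel"
    proof -
      have [measurable]: "(\<lambda>s. LINT r|lborel. indicator {0..s} r *\<^sub>R (q + x + v r)) \<in> borel_measurable borel"
        by (rule primitive_measurable) measurable
      show ?thesis by measurable
    qed
    have disc: "discount q x w s = exp (- (LINT r|lborel. indicator {0..s} r *\<^sub>R (q + x + v r)))" if "s \<in> {0..t}" for s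
      unfolding discount_def set_lebesgue_integral_def using that
      by (intro arg_cong[where f="\<lambda>a. exp (- a)"] Bochner_Integration.integral_cong) (auto simp: v_def indicator_def)
    have "(\<lambda>s. indicator {0..t} s *\<^sub>R (if s \<in> {s. 0 \<le> s \<and> alive x w s} then
        of_real (exp (- (LINT r|lborel. indicator {0..s} r *\<^sub>R (q + x + v r)))) * exp (- (z * of_real (x + v s))) *
        (\<psi> - of_real (q + x + v s)) else 0)) \<in> borel_measurable lborel"
      using am dm by measurable
    moreover have "indicator {0..t} s *\<^sub>R (if s \<in> {s. 0 \<le> s \<and> alive x w s} then
        of_real (exp (- (LINT r|lborel. indicator {0..s} r *\<^sub>R (q + x + v r)))) * exp (- (z * of_real (x + v s))) *
        (\<psi> - of_real (q + x + v s)) else 0) = indicator {0..t} s *\<^sub>R F s" for s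
      using disc[of s] by (auto simp: F_def v_def indicator_def)
    ultimately show ?thesis by (simp only:)
  qed
  have "(\<lambda>n. LINT s|lborel. indicator {0..<t} s *\<^sub>R f n (nat \<lfloor>s / h n\<rfloor>)) \<longlonglongrightarrow> (LINT s|lborel. indicator {0..t} s *\<^sub>R F s)"
  proof (rule integral_dominated_convergence[OF AEm stepm _ lim])
    show "integrable lborel (\<lambda>r. indicator {0..t} r * C)"
      by (intro integrable_mult_left integrable_real_indicator) (auto simp: emeasure_lborel_Icc_eq)
    show "AE s in lborel. norm (indicator {0..<t} s *\<^sub>R f n (nat \<lfloor>s / h n\<rfloor>)) \<le> indicator {0..t} s * C" for n
      using bound by (intro AE_I2) (auto simp: indicator_def C_def q K)
  qed
  then show ?thesis unfolding eq F_def set_lebesgue_integral_def .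
qed

text \<open>Let \<tau> be the infimum of the times with x + w < 0. Right continuity gives x +
  w(\<tau>) \<le> 0 and the absence of negative jumps gives \<ge> 0, so the path is at level zero at
  \<tau>. A fine grid that stops does so shortly after \<tau>, where the path is still close to
  zero.\<close>

lemma grid_overshoot:
  assumes nn: "no_negative_jumps w" and x: "0 < x + w 0" and d: "d > 0"
  shows "\<forall>\<^sub>F n in sequentially. stop_index (\<lambda>j. x + w (real j * h n) < 0) (Suc n) < Suc n \<longrightarrow>
           \<bar>x + w (real (stop_index (\<lambda>j. x + w (real j * h n) < 0) (Suc n)) * h n)\<bar> < d"
proof -
  define S where "S = {s. 0 \<le> s \<and> s \<le> t \<and> x + w s < 0}"
  define \<sigma> where "\<sigma> n = stop_index (\<lambda>j. x + w (real j * h n) < 0) (Suc n)" for n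
  have Sn: "real (Suc n) * h n = t" for n by (simp add: h_def)
  have \<sigma>S: "real (\<sigma> n) * h n \<in> S" if "\<sigma> n < Suc n" for n
  proof -
    have "real (\<sigma> n) * h n \<le> real (Suc n) * h n" using that grid_step_pos[of n] by (intro mult_right_mono) auto
    then show ?thesis using stop_index_less[OF that[unfolded \<sigma>_def]] grid_step_pos[of n] unfolding S_def Sn \<sigma>_def by auto
  qed
  show ?thesis
  proof (cases "S = {}")
    case True
    then show ?thesis using \<sigma>S unfolding \<sigma>_def by (intro always_eventually) blast
  next
    case False
    define \<tau> where "\<tau> = Inf S"
    have bb: "bdd_below S" unfolding S_def by (rule bdd_belowI[of _ 0]) auto
    have \<tau>le: "\<tau> \<le> s" if "s \<in> S" for s unfolding \<tau>_def by (rule cInf_lower[OF that bb])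
    have \<tau>0: "0 \<le> \<tau>" unfolding \<tau>_def by (rule cInf_greatest[OF False]) (auto simp: S_def)
    have ex: "\<exists>s\<in>S. s < y" if "\<tau> < y" for y
      using that cInf_less_iff[OF False bb] unfolding \<tau>_def by blast
    have \<tau>t: "\<tau> \<le> t" using False \<tau>le unfolding S_def by force
    have rc: "((\<lambda>r. x + w r) \<longlongrightarrow> x + w \<tau>) (at_right \<tau>)"
      using w \<tau>0 by (intro tendsto_intros) (auto simp: cadlag_def)
    have "x + w \<tau> = 0"
    proof (rule antisym)
      show "x + w \<tau> \<le> 0"
      proof (rule ccontr)
        assume "\<not> x + w \<tau> \<le> 0"
        then have pos: "0 < x + w \<tau>" by simp
        from order_tendstoD(1)[OF rc this] obtain b where b: "b > \<tau>" "\<And>y. \<tau> < y \<Longrightarrow> y < b \<Longrightarrow> 0 < x + w y"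
          unfolding eventually_at_right_field by blast
        from ex[OF b(1)] obtain s where "s \<in> S" "s < b" by blast
        then show False using b(2)[of s] pos \<tau>le[of s] by (cases "s = \<tau>") (auto simp: S_def)
      qed
      show "0 \<le> x + w \<tau>"
      proof (cases "\<tau> = 0")
        case False
        then have \<tau>p: "0 < \<tau>" using \<tau>0 by simp
        then obtain l where l: "(w \<longlongrightarrow> l) (at_left \<tau>)" using w unfolding cadlag_def by blast
        have "Lim (at_left \<tau>) w = l" by (rule tendsto_Lim[OF _ l]) simp
        then have "l \<le> w \<tau>" using nn \<tau>p unfolding no_negative_jumps_def by auto
        moreover have "- x \<le> l"
        proof (rule tendsto_lowerbound[OF l])
          show "\<forall>\<^sub>F s in at_left \<tau>. - x \<le> w s"
            unfolding eventually_at_left_field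
          proof (intro exI[of _ 0] conjI \<tau>p allI impI)
            fix s assume s: "0 < s" "s < \<tau>"
            then have "s \<notin> S" using \<tau>le[of s] by auto
            then show "- x \<le> w s" using s \<tau>t by (auto simp: S_def)
          qed
        qed simp
        ultimately show ?thesis by linarith
      qed (use x in auto)
    qed
    then have rc0: "((\<lambda>r. x + w r) \<longlongrightarrow> 0) (at_right \<tau>)" using rc by simp
    from tendstoD[OF rc0 d] obtain b where b: "b > \<tau>" "\<And>y. \<tau> < y \<Longrightarrow> y < b \<Longrightarrow> \<bar>x + w y\<bar> < d"
      unfolding eventually_at_right_field by (auto simp: dist_real_def)
    then have bd: "\<bar>x + w y\<bar> < d" if "\<tau> \<le> y" "y < b" for y
      using that \<open>x + w \<tau> = 0\<close> d by (cases "y = \<tau>") auto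
    obtain r where r: "r \<in> S" "r < b" using ex[OF b(1)] by blast
    have fin: "\<sigma> n < Suc n \<longrightarrow> \<bar>x + w (real (\<sigma> n) * h n)\<bar> < d" if "real (\<sigma> n) * h n < b" for n
      using \<sigma>S[of n] \<tau>le[of "real (\<sigma> n) * h n"] bd that by auto
    show ?thesis
    proof (cases "r = t")
      \<comment> \<open>There is no room for a grid point to the right of r here; but every stopping
        time is at most t = r < b.\<close>
      case True
      have "real (\<sigma> n) * h n < b" if "\<sigma> n < Suc n" for n
        using \<sigma>S[OF that] True r(2) by (auto simp: S_def)
      then show ?thesis using fin unfolding \<sigma>_def by (intro always_eventually) blast
    next
      case False
      then have rt: "0 \<le> r" "r < t" "x + w r < 0" using r by (auto simp: S_def)
      have "((\<lambda>r. x + w r) \<longlongrightarrow> x + w r) (at_right r)"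
        using w rt by (intro tendsto_intros) (auto simp: cadlag_def)
      from order_tendstoD(2)[OF this rt(3)] obtain c where c: "c > r" "\<And>y. r < y \<Longrightarrow> y < c \<Longrightarrow> x + w y < 0"
        unfolding eventually_at_right_field by blast
      \<comment> \<open>The path is negative on (r, c), so the grid time below p eventually forces
        the discrete path to stop before b.\<close>
      define p where "p = (r + min c (min b t)) / 2"
      have "r < min c (min b t)" using c rt r by auto
      moreover have "min c (min b t) \<le> c" "min c (min b t) \<le> b" "min c (min b t) \<le> t" by auto
      ultimately have "r < p \<and> p < min c (min b t)" unfolding p_def by auto
      then have p: "r < p" "p < c" "p < b" "p < t" by auto
      have "\<forall>\<^sub>F n in sequentially. r < g n p" using order_tendstoD(1)[OF grid_time_tendsto[of p] p(1)] p rt by auto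
      then show ?thesis
      proof eventually_elim
        case (elim n)
        have gp: "g n p \<le> p" using grid_time_le(1)[of p n] p rt by auto
        then have neg: "x + w (g n p) < 0" using c(2)[of "g n p"] elim p by auto
        have "\<sigma> n \<le> nat \<lfloor>p / h n\<rfloor>"
          using stop_index_minimal[of "nat \<lfloor>p / h n\<rfloor>" "\<lambda>j. x + w (real j * h n) < 0" "Suc n"] neg
          unfolding \<sigma>_def g_def by (meson not_less)
        then have "real (\<sigma> n) * h n \<le> g n p"
          unfolding g_def using grid_step_pos[of n] by (intro mult_right_mono) auto
        then have "real (\<sigma> n) * h n < b" using gp p by linarith
        then show ?case using fin[of n] unfolding \<sigma>_def by simp
      qed
    qed
  qed
qed

end

section \<open>Discounted first passage of a discretised path\<close>

lemma Ln_imaginary: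
  assumes "u \<noteq> 0"
  shows "Ln (\<i> * of_real u) = of_real (ln \<bar>u\<bar>) + \<i> * of_real (sgn u * pi / 2)"
proof -
  have "exp (of_real (ln \<bar>u\<bar>) + \<i> * of_real (sgn u * pi / 2)) = of_real \<bar>u\<bar> * cis (sgn u * pi / 2)"
    using assms unfolding exp_add cis_conv_exp exp_of_real by simp
  also have "\<dots> = \<i> * of_real u"
    using assms by (cases "u > 0") (auto simp: complex_eq_iff)
  finally have e: "\<i> * of_real u = exp (of_real (ln \<bar>u\<bar>) + \<i> * of_real (sgn u * pi / 2))" by simp
  show ?thesis unfolding e by (rule Ln_exp) (use assms pi_gt_zero in \<open>auto simp: sgn_if\<close>)
qed

locale spectrally_positive_stable = prob_space P for P :: "(real \<Rightarrow> real) measure" +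
  fixes \<alpha> :: real
  assumes \<alpha>: "1 < \<alpha>" "\<alpha> \<le> 2"
    and law: "normalized_spectrally_positive_stable_law \<alpha> P"
begin

lemma levy: "levy_law P"
  using law by (simp add: normalized_spectrally_positive_stable_law_def stable_law_def)

lemma sets_P [measurable_cong]: "sets P = sets path_space"
  using levy by (simp add: levy_law_def path_law_def)

lemma space_P: "space P = cadlag_paths"
  using sets_eq_imp_space_eq[OF sets_P] by (simp add: space_path_space)

lemma cadlag_P: "w \<in> space P \<Longrightarrow> cadlag w"
  by (simp add: space_P cadlag_paths_def)

lemma eval_measurable: "0 \<le> s \<Longrightarrow> (\<lambda>w. w s) \<in> borel_measurable P"
  using measurable_path_eval measurable_cong_sets[OF sets_P refl] by blast

lemma start_zero: "AE w in P. w 0 = 0"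
  using levy by (simp add: levy_law_def)

lemma AE_no_negative_jumps: "AE w in P. no_negative_jumps w"
  using law by (simp add: normalized_spectrally_positive_stable_law_def)

text \<open>The angle \<alpha> \<pi>/2 lies between \<pi>/2 and \<pi>, where cos is
  nonpositive.\<close>

lemma exponent_real_nonpos: "Re ((\<i> * of_real u) powr of_real \<alpha>) \<le> 0"
proof (cases "u = 0")
  case False
  note L = Ln_imaginary[OF False]
  have "Re ((\<i> * of_real u) powr of_real \<alpha>) = exp (\<alpha> * ln \<bar>u\<bar>) * cos (\<alpha> * (sgn u * pi / 2))"
    using False unfolding powr_def L by (simp add: Re_exp)
  moreover have "cos (\<alpha> * (sgn u * pi / 2)) = cos (\<alpha> * pi / 2)"
    using False by (auto simp: sgn_if)
  moreover have "cos (\<alpha> * pi / 2) \<le> 0"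
  proof -
    have "0 \<le> sin (\<alpha> * pi / 2 - pi / 2)"
      by (rule sin_ge_zero) (use \<alpha> pi_gt_zero in \<open>auto simp: field_simps mult_right_mono\<close>)
    then show ?thesis by (simp add: sin_diff)
  qed
  ultimately show ?thesis by (simp add: mult_nonneg_nonpos)
qed simp

text \<open>The factor exp(-i \<pi> \<alpha> sgn \<theta>) of the normalization turns (i
  \<theta>)^\<alpha> into (-i \<theta>)^\<alpha>. At \<theta> = -v this is (i v)^\<alpha>, and
  scaling with v = h^(1/\<alpha>) u brings out the factor h.\<close>

lemma increment_laplace_zero:
  assumes h: "h > 0"
  shows "(LINT w|P. exp (- (\<i> * of_real u * of_real (w h)))) = exp (of_real h * ((\<i> * of_real u) powr of_real \<alpha>))"
proof -
  define v where "v = h powr (1 / \<alpha>) * u"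
  have st: "distr P borel (\<lambda>w. w h) = distr P borel (\<lambda>w. h powr (1 / \<alpha>) * w 1)"
  proof -
    have "\<forall>c>0. \<forall>t\<ge>0. distr P borel (\<lambda>w. w (c * t)) = distr P borel (\<lambda>w. c powr (1 / \<alpha>) * w t)"
      using law by (simp add: normalized_spectrally_positive_stable_law_def stable_law_def)
    from this[rule_format, of h 1] h show ?thesis by simp
  qed
  have "(LINT w|P. exp (- (\<i> * of_real u * of_real (w h)))) = (LINT y|distr P borel (\<lambda>w. w h). exp (- (\<i> * of_real u * of_real y)))"
    by (subst integral_distr) (use eval_measurable[of h] h in auto)
  also have "\<dots> = (LINT y|distr P borel (\<lambda>w. w 1). exp (- (\<i> * of_real u * of_real (h powr (1 / \<alpha>) * y))))"
    unfolding st using eval_measurable[of 1] by (subst (1 2) integral_distr) auto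
  also have "\<dots> = char (distr P borel (\<lambda>w. w 1)) (- v)"
    unfolding char_def v_def by (intro Bochner_Integration.integral_cong) (auto simp: mult_ac)
  also have "\<dots> = exp ((\<i> * of_real (- v)) powr of_real \<alpha> * exp (- \<i> * of_real (pi * \<alpha> * sgn (- v))))"
    using law by (simp add: normalized_spectrally_positive_stable_law_def)
  also have "(\<i> * of_real (- v)) powr of_real \<alpha> * exp (- \<i> * of_real (pi * \<alpha> * sgn (- v))) =
      of_real h * ((\<i> * of_real u) powr of_real \<alpha>)"
  proof (cases "u = 0")
    case False
    note L = Ln_imaginary
    have v: "v \<noteq> 0" "- v \<noteq> 0" "\<bar>- v\<bar> = h powr (1 / \<alpha>) * \<bar>u\<bar>" "sgn (- v) = - sgn u"
      using False h by (auto simp: v_def abs_mult sgn_mult)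
    have lnv: "ln \<bar>- v\<bar> = ln h / \<alpha> + ln \<bar>u\<bar>"
      unfolding v(3) using False h \<alpha> by (simp add: ln_mult ln_powr)
    have p: "(\<i> * of_real y) powr of_real \<alpha> = exp (of_real \<alpha> * (of_real (ln \<bar>y\<bar>) + \<i> * of_real (sgn y * pi / 2)))"
      if "y \<noteq> 0" for y :: real
      unfolding powr_def L[OF that] using that by simp
    have "(\<i> * of_real (- v)) powr of_real \<alpha> * exp (- \<i> * of_real (pi * \<alpha> * sgn (- v))) =
        exp (of_real \<alpha> * (of_real (ln h / \<alpha> + ln \<bar>u\<bar>) + \<i> * of_real (- sgn u * pi / 2)) + - \<i> * of_real (pi * \<alpha> * (- sgn u)))"
      unfolding p[OF v(2)] lnv unfolding v(4) exp_add[symmetric] ..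
    also have "of_real \<alpha> * (of_real (ln h / \<alpha> + ln \<bar>u\<bar>) + \<i> * of_real (- sgn u * pi / 2)) + - \<i> * of_real (pi * \<alpha> * (- sgn u)) =
       of_real (ln h) + of_real \<alpha> * (of_real (ln \<bar>u\<bar>) + \<i> * of_real (sgn u * pi / 2))"
      using \<alpha> by (simp add: field_simps)
    also have "exp \<dots> = of_real h * ((\<i> * of_real u) powr of_real \<alpha>)"
    proof -
      have "exp (complex_of_real (ln h)) = of_real h" using h by (metis exp_ln exp_of_real)
      then show ?thesis unfolding p[OF False] exp_add by simp
    qed
    finally show ?thesis .
  qed (simp add: v_def)
  finally show ?thesis .
qed

lemma increment_laplace:
  assumes h: "h > 0" and s: "s \<ge> 0"
  shows "(LINT w|P. exp (- (\<i> * of_real u * of_real (w (s + h) - w s)))) = exp (of_real h * ((\<i> * of_real u) powr of_real \<alpha>))"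
proof -
  have d: "distr P borel (\<lambda>w. w (s + h) - w s) = distr P borel (\<lambda>w. w h)"
    using levy h s by (simp add: levy_law_def)
  have m: "(\<lambda>w. w (s + h) - w s) \<in> borel_measurable P"
    using eval_measurable[of s] eval_measurable[of "s + h"] h s by (intro borel_measurable_diff) auto
  have "(LINT w|P. exp (- (\<i> * of_real u * of_real (w (s + h) - w s)))) =
      (LINT y|distr P borel (\<lambda>w. w (s + h) - w s). exp (- (\<i> * of_real u * of_real y)))"
    by (subst integral_distr[OF m]) auto
  also have "\<dots> = (LINT w|P. exp (- (\<i> * of_real u * of_real (w h))))"
    unfolding d by (subst integral_distr) (use eval_measurable[of h] h in auto)
  finally show ?thesis unfolding increment_laplace_zero[OF h] .
qed

lemma grid_increments_indep:
  assumes h: "h > 0"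
  shows "indep_vars (\<lambda>_. borel) (\<lambda>i w. w (real (Suc i) * h) - w (real i * h)) {..<n}"
proof -
  have "mono (\<lambda>i. real i * h)" using h by (intro monoI mult_right_mono) auto
  moreover have "\<forall>(t :: nat \<Rightarrow> real) n. 0 \<le> t 0 \<and> mono t \<longrightarrow> indep_vars (\<lambda>_. borel) (\<lambda>i w. w (t (Suc i)) - w (t i)) {..<n}"
    using levy unfolding levy_law_def by blast
  from this[rule_format, of "\<lambda>i. real i * h" n] h show ?thesis using calculation by simp
qed

text \<open>Grouping the first k increments into one random variable with values in a product space
  makes a function of the past independent of the next increment.\<close>

lemma past_times_increment:
  fixes G :: "(nat \<Rightarrow> real) \<Rightarrow> complex"
  assumes h: "h > 0" and G: "G \<in> borel_measurable (\<Pi>\<^sub>M i\<in>{..<k}. borel)" and B: "\<And>v. norm (G v) \<le> B"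
  defines "\<xi> \<equiv> \<lambda>i w. w (real (Suc i) * h) - w (real i * h)"
  shows "(LINT w|P. G (\<lambda>i\<in>{..<k}. \<xi> i w) * exp (- (\<i> * of_real u * of_real (\<xi> k w)))) =
     (LINT w|P. G (\<lambda>i\<in>{..<k}. \<xi> i w)) * exp (of_real h * ((\<i> * of_real u) powr of_real \<alpha>))"
proof -
  have "indep_vars (\<lambda>_. borel) \<xi> {..<Suc k}" unfolding \<xi>_def by (rule grid_increments_indep[OF h])
  then have "indep_var (\<Pi>\<^sub>M i\<in>{..<k}. borel) (\<lambda>w. \<lambda>i\<in>{..<k}. \<xi> i w) (\<Pi>\<^sub>M i\<in>{k}. borel) (\<lambda>w. \<lambda>i\<in>{k}. \<xi> i w)"
    by (rule indep_var_restrict) auto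
  then have "indep_var borel (G \<circ> (\<lambda>w. \<lambda>i\<in>{..<k}. \<xi> i w)) borel ((\<lambda>v. exp (- (\<i> * of_real u * of_real (v k)))) \<circ> (\<lambda>w. \<lambda>i\<in>{k}. \<xi> i w))"
  proof (rule indep_var_compose[OF _ G])
    have [measurable]: "(\<lambda>v. v k) \<in> borel_measurable (\<Pi>\<^sub>M i\<in>{k}. borel)"
      by (rule measurable_component_singleton) simp
    show "(\<lambda>v. exp (- (\<i> * of_real u * of_real (v k)))) \<in> borel_measurable (\<Pi>\<^sub>M i\<in>{k}. borel)"
      by measurable
  qed
  then have ind: "indep_var borel (\<lambda>w. G (\<lambda>i\<in>{..<k}. \<xi> i w)) borel (\<lambda>w. exp (- (\<i> * of_real u * of_real (\<xi> k w))))"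
    by (simp add: o_def)
  have m1: "(\<lambda>w. G (\<lambda>i\<in>{..<k}. \<xi> i w)) \<in> borel_measurable P" using indep_var_rv1[OF ind] .
  have m2: "(\<lambda>w. exp (- (\<i> * of_real u * of_real (\<xi> k w)))) \<in> borel_measurable P" using indep_var_rv2[OF ind] .
  have "(LINT w|P. G (\<lambda>i\<in>{..<k}. \<xi> i w) * exp (- (\<i> * of_real u * of_real (\<xi> k w)))) =
     (LINT w|P. G (\<lambda>i\<in>{..<k}. \<xi> i w)) * (LINT w|P. exp (- (\<i> * of_real u * of_real (\<xi> k w))))"
  proof (rule indep_var_lebesgue_integral[OF ind])
    show "integrable P (\<lambda>w. G (\<lambda>i\<in>{..<k}. \<xi> i w))"
      by (rule integrable_const_bound[where B=B, OF AE_I2[OF B] m1])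
    show "integrable P (\<lambda>w. exp (- (\<i> * of_real u * of_real (\<xi> k w))))"
      by (rule integrable_const_bound[where B=1, OF _ m2]) simp
  qed
  also have "(LINT w|P. exp (- (\<i> * of_real u * of_real (\<xi> k w)))) = exp (of_real h * ((\<i> * of_real u) powr of_real \<alpha>))"
    using increment_laplace[OF h, of "real k * h" u] h unfolding \<xi>_def by (simp add: distrib_right add.commute)
  finally show ?thesis .
qed

definition grid_alive :: "real \<Rightarrow> real \<Rightarrow> (real \<Rightarrow> real) \<Rightarrow> nat \<Rightarrow> bool" where
  "grid_alive x h w k \<longleftrightarrow> (\<forall>j\<le>k. 0 \<le> x + w (real j * h))"

definition grid_discount :: "real \<Rightarrow> real \<Rightarrow> real \<Rightarrow> (real \<Rightarrow> real) \<Rightarrow> nat \<Rightarrow> real" where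
  "grid_discount q x h w k = exp (- (\<Sum>j<k. h * (q + x + w (real j * h))))"

lemma grid_discount_le_1:
  assumes "h > 0" "q \<ge> 0" "\<And>j. j < k \<Longrightarrow> 0 \<le> x + w (real j * h)"
  shows "grid_discount q x h w k \<le> exp (- (real k * h * q))" "grid_discount q x h w k \<le> 1"
proof -
  have "(\<Sum>j<k. h * q) \<le> (\<Sum>j<k. h * (q + x + w (real j * h)))"
    using assms by (intro sum_mono mult_left_mono) (auto simp: add.assoc)
  then show "grid_discount q x h w k \<le> exp (- (real k * h * q))" by (simp add: grid_discount_def mult_ac)
  also have "\<dots> \<le> 1" using assms by simp
  finally show "grid_discount q x h w k \<le> 1" .
qed

lemma grid_measurables:
  assumes h: "h > 0"
  shows "(\<lambda>w. w (real j * h)) \<in> borel_measurable P"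
    and "Measurable.pred P (\<lambda>w. grid_alive x h w k)"
    and "(\<lambda>w. grid_discount q x h w k) \<in> borel_measurable P"
proof -
  show [measurable]: "(\<lambda>w. w (real j * h)) \<in> borel_measurable P" for j
    by (rule eval_measurable) (use h in simp)
  show "Measurable.pred P (\<lambda>w. grid_alive x h w k)" unfolding grid_alive_def by measurable
  show "(\<lambda>w. grid_discount q x h w k) \<in> borel_measurable P" unfolding grid_discount_def by measurable
qed

text \<open>One step of the martingale. Survival up to k and even the discount at
  \<open>Suc k\<close> involve positions up to k only, hence the first k increments, so the
  exponential of the next increment splits off.\<close>

lemma grid_step_expectation:
  fixes u :: real and k :: nat
  assumes h: "h > 0" and q: "q \<ge> 0"
  defines "z \<equiv> \<i> * of_real u" and "\<psi> \<equiv> (\<i> * of_real u) powr of_real \<alpha>"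
  shows "(LINT w|P. (if grid_alive x h w k then of_real (grid_discount q x h w (Suc k)) * exp (- (z * of_real (x + w (real (Suc k) * h)))) else 0)) =
     (LINT w|P. (if grid_alive x h w k then of_real (grid_discount q x h w (Suc k)) * exp (- (z * of_real (x + w (real k * h)))) * exp (of_real h * \<psi>) else 0))"
proof -
  define \<xi> where "\<xi> i w = w (real (Suc i) * h) - w (real i * h)" for i :: nat and w :: "real \<Rightarrow> real"
  \<comment> \<open>Positions as partial sums of increments; they agree with the path because it
    starts at 0 almost surely.\<close>
  define Y where "Y j v = (\<Sum>i<j. v i)" for j and v :: "nat \<Rightarrow> real"
  define G where "G v = (if \<forall>j\<in>{..k}. 0 \<le> x + Y j v then
       of_real (exp (- (\<Sum>j<Suc k. h * (q + x + Y j v)))) * exp (- (z * of_real (x + Y k v))) else 0)" for v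
  have Ym: "Y j \<in> borel_measurable (\<Pi>\<^sub>M i\<in>{..<k}. borel)" if "j \<le> k" for j
    unfolding Y_def using that by (intro borel_measurable_sum measurable_component_singleton) auto
  have Gm: "G \<in> borel_measurable (\<Pi>\<^sub>M i\<in>{..<k}. borel)"
  proof -
    have [measurable]: "Y k \<in> borel_measurable (\<Pi>\<^sub>M i\<in>{..<k}. borel)" by (rule Ym) simp
    have p: "Measurable.pred (\<Pi>\<^sub>M i\<in>{..<k}. borel) (\<lambda>v. \<forall>j\<in>{..k}. 0 \<le> x + Y j v)"
    proof (rule pred_intros_finite(3))
      fix j assume "j \<in> {..k}"
      then have [measurable]: "Y j \<in> borel_measurable (\<Pi>\<^sub>M i\<in>{..<k}. borel)" using Ym by simp
      show "Measurable.pred (\<Pi>\<^sub>M i\<in>{..<k}. borel) (\<lambda>v. 0 \<le> x + Y j v)" by measurable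
    qed simp
    have s: "(\<lambda>v. \<Sum>j<Suc k. h * (q + x + Y j v)) \<in> borel_measurable (\<Pi>\<^sub>M i\<in>{..<k}. borel)"
      by (intro borel_measurable_sum borel_measurable_times borel_measurable_add borel_measurable_const Ym) auto
    show ?thesis unfolding G_def using p s by measurable
  qed
  have nz: "norm (exp (- (z * of_real r))) = 1" for r by (simp add: z_def)
  have GB: "norm (G v) \<le> 1" for v
  proof (cases "\<forall>j\<in>{..k}. 0 \<le> x + Y j v")
    case True
    have "0 \<le> (\<Sum>j<Suc k. h * (q + x + Y j v))"
    proof (intro sum_nonneg mult_nonneg_nonneg)
      fix j assume "j \<in> {..<Suc k}"
      then have "0 \<le> x + Y j v" using True by auto
      then show "0 \<le> q + x + Y j v" using q by simp
    qed (use h in auto)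
    moreover have "norm (G v) = exp (- (\<Sum>j<Suc k. h * (q + x + Y j v)))"
      unfolding G_def if_P[OF True] norm_mult nz by (simp del: of_real_exp)
    ultimately show ?thesis by simp
  qed (auto simp: G_def)
  have Yw: "Y j (\<lambda>i\<in>{..<k}. \<xi> i w) = w (real j * h)" if "j \<le> k" "w 0 = 0" for j w
  proof -
    have "Y j (\<lambda>i\<in>{..<k}. \<xi> i w) = (\<Sum>i<j. \<xi> i w)" unfolding Y_def using that by (intro sum.cong) auto
    also have "\<dots> = w (real j * h) - w (real 0 * h)" unfolding \<xi>_def by (rule sum_lessThan_telescope)
    finally show ?thesis using that by simp
  qed
  have Gw: "G (\<lambda>i\<in>{..<k}. \<xi> i w) = (if grid_alive x h w k then of_real (grid_discount q x h w (Suc k)) * exp (- (z * of_real (x + w (real k * h)))) else 0)"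
    if "w 0 = 0" for w
  proof -
    have Y': "Y j (\<lambda>i\<in>{..<k}. \<xi> i w) = w (real j * h)" if "j \<le> k" for j using Yw that \<open>w 0 = 0\<close> by blast
    have "(\<forall>j\<in>{..k}. 0 \<le> x + Y j (\<lambda>i\<in>{..<k}. \<xi> i w)) \<longleftrightarrow> grid_alive x h w k"
      unfolding grid_alive_def using Y' by auto
    moreover have "(\<Sum>j<Suc k. h * (q + x + Y j (\<lambda>i\<in>{..<k}. \<xi> i w))) = (\<Sum>j<Suc k. h * (q + x + w (real j * h)))"
      using Y' by (intro sum.cong) auto
    ultimately show ?thesis unfolding G_def grid_discount_def using Y'[of k] by (simp del: of_real_exp sum.lessThan_Suc)
  qed
  note [measurable] = grid_measurables[OF h]
  have \<xi>m [measurable]: "\<xi> i \<in> borel_measurable P" for i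
    unfolding \<xi>_def by (intro borel_measurable_diff grid_measurables(1)[OF h])
  have rm: "(\<lambda>w. \<lambda>i\<in>{..<k}. \<xi> i w) \<in> measurable P (\<Pi>\<^sub>M i\<in>{..<k}. borel)"
    by (intro measurable_restrict) (rule \<xi>m)
  have Gwm: "(\<lambda>w. G (\<lambda>i\<in>{..<k}. \<xi> i w)) \<in> borel_measurable P"
    by (rule measurable_compose[OF rm Gm])
  have "(LINT w|P. (if grid_alive x h w k then of_real (grid_discount q x h w (Suc k)) * exp (- (z * of_real (x + w (real (Suc k) * h)))) else 0)) =
      (LINT w|P. G (\<lambda>i\<in>{..<k}. \<xi> i w) * exp (- (\<i> * of_real u * of_real (\<xi> k w))))"
  proof (rule integral_cong_AE)
    show "AE w in P. (if grid_alive x h w k then of_real (grid_discount q x h w (Suc k)) * exp (- (z * of_real (x + w (real (Suc k) * h)))) else 0)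
       = G (\<lambda>i\<in>{..<k}. \<xi> i w) * exp (- (\<i> * of_real u * of_real (\<xi> k w)))"
      using start_zero
    proof eventually_elim
      case (elim w)
      have "exp (- (z * of_real (x + w (real (Suc k) * h)))) =
          exp (- (z * of_real (x + w (real k * h)))) * exp (- (\<i> * of_real u * of_real (\<xi> k w)))"
        unfolding exp_add[symmetric] \<xi>_def z_def by (simp add: algebra_simps)
      then show ?case using Gw[of w] elim by simp
    qed
  qed (use Gwm in measurable)
  also have "\<dots> = (LINT w|P. G (\<lambda>i\<in>{..<k}. \<xi> i w)) * exp (of_real h * \<psi>)"
    unfolding \<psi>_def \<xi>_def by (rule past_times_increment[OF h Gm GB])
  also have "\<dots> = (LINT w|P. G (\<lambda>i\<in>{..<k}. \<xi> i w) * exp (of_real h * \<psi>))" by simp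
  also have "\<dots> = (LINT w|P. (if grid_alive x h w k then of_real (grid_discount q x h w (Suc k)) * exp (- (z * of_real (x + w (real k * h)))) * exp (of_real h * \<psi>) else 0))"
  proof (rule integral_cong_AE)
    show "AE w in P. G (\<lambda>i\<in>{..<k}. \<xi> i w) * exp (of_real h * \<psi>) =
       (if grid_alive x h w k then of_real (grid_discount q x h w (Suc k)) * exp (- (z * of_real (x + w (real k * h)))) * exp (of_real h * \<psi>) else 0)"
      using start_zero by eventually_elim (simp add: Gw)
  qed (use Gwm in measurable)
  finally show ?thesis .
qed

lemma stop_index_measurable:
  assumes h: "h > 0"
  shows "(\<lambda>w. stop_index (\<lambda>j. x + w (real j * h) < 0) n) \<in> measurable P (count_space UNIV)"
proof (induction n)
  case (Suc n)
  note [measurable] = grid_measurables(1)[OF h] and [measurable] = Suc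
  have "Measurable.pred P (\<lambda>w. \<forall>j\<le>n. \<not> x + w (real j * h) < 0)" by measurable
  then show ?case unfolding stop_index.simps by (intro measurable_If Suc) auto
qed simp

lemma grid_discount_Suc:
  "grid_discount q x h w (Suc k) = grid_discount q x h w k * exp (- (h * (q + x + w (real k * h))))"
  by (simp add: grid_discount_def exp_add[symmetric])

text \<open>The stopped value is telescoped and every step is averaged by
  \<open>grid_step_expectation\<close>. Next to the discount lost in the step this leaves the factor
  exp(h (\<psi> - q - position)) - 1.\<close>

lemma discrete_identity:
  fixes u :: real and n :: nat
  assumes h: "h > 0" and q: "q \<ge> 0"
  defines "z \<equiv> \<i> * of_real u" and "\<psi> \<equiv> (\<i> * of_real u) powr of_real \<alpha>"
  shows "(LINT w|P. of_real (grid_discount q x h w (stop_index (\<lambda>j. x + w (real j * h) < 0) n)) *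
            exp (- (z * of_real (x + w (real (stop_index (\<lambda>j. x + w (real j * h) < 0) n) * h))))) =
     exp (- (z * of_real x)) +
     (LINT w|P. (\<Sum>k<n. if \<forall>j\<le>k. 0 \<le> x + w (real j * h) then
        of_real (exp (- (\<Sum>j<k. h * (q + x + w (real j * h))))) * exp (- (z * of_real (x + w (real k * h)))) *
        (exp (of_real h * (\<psi> - of_real (q + x + w (real k * h)))) - 1) else 0))"
proof -
  define Z where "Z k w = complex_of_real (grid_discount q x h w k) * exp (- (z * of_real (x + w (real k * h))))" for k w
  define V where "V k w = (if grid_alive x h w k then complex_of_real (grid_discount q x h w (Suc k)) *
      exp (- (z * of_real (x + w (real k * h)))) * exp (of_real h * \<psi>) else 0)" for k w
  define S where "S k w = (if grid_alive x h w k then Z k w * (exp (of_real h * (\<psi> - of_real (q + x + w (real k * h)))) - 1) else 0)" for k w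
  note [measurable] = grid_measurables[OF h]
  have nz: "norm (exp (- (z * of_real r))) = 1" for r by (simp add: z_def)
  have n\<psi>: "norm (exp (of_real h * \<psi>)) \<le> 1"
    using exponent_real_nonpos[of u] h by (simp add: \<psi>_def mult_nonneg_nonpos)
  have D: "norm (complex_of_real (grid_discount q x h w k)) \<le> 1" if "\<And>j. j < k \<Longrightarrow> 0 \<le> x + w (real j * h)" for k w
  proof -
    have "grid_discount q x h w k \<le> 1" by (rule grid_discount_le_1(2)[OF h q]) (rule that)
    then show ?thesis by (simp add: grid_discount_def del: of_real_exp)
  qed
  have nZ: "norm (Z k w) \<le> 1" if "\<And>j. j < k \<Longrightarrow> 0 \<le> x + w (real j * h)" for k w
    unfolding Z_def norm_mult nz mult_1_right by (rule D) (rule that)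
  have Zm: "Z k \<in> borel_measurable P" for k unfolding Z_def by measurable
  have i1: "integrable P (\<lambda>w. if grid_alive x h w k then Z k w else 0)" for k
  proof (rule integrable_const_bound[where B=1])
    show "AE w in P. norm (if grid_alive x h w k then Z k w else 0) \<le> 1"
      by (intro AE_I2) (auto simp: grid_alive_def intro!: nZ)
  qed (use Zm in measurable)
  have i2: "integrable P (\<lambda>w. if grid_alive x h w k then Z (Suc k) w else 0)" for k
  proof (rule integrable_const_bound[where B=1])
    show "AE w in P. norm (if grid_alive x h w k then Z (Suc k) w else 0) \<le> 1"
      by (intro AE_I2) (auto simp: grid_alive_def intro!: nZ)
  qed (use Zm in measurable)
  have i3: "integrable P (V k)" for k
  proof (rule integrable_const_bound[where B=1])
    show "AE w in P. norm (V k w) \<le> 1"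
    proof (rule AE_I2)
      fix w show "norm (V k w) \<le> 1"
      proof (cases "grid_alive x h w k")
        case True
        then have "norm (complex_of_real (grid_discount q x h w (Suc k))) \<le> 1" by (intro D) (auto simp: grid_alive_def)
        then show ?thesis unfolding V_def if_P[OF True] norm_mult nz mult_1_right
          by (rule mult_le_one) (use n\<psi> in auto)
      qed (simp add: V_def)
    qed
  qed (unfold V_def, measurable)
  have VS: "V k w - (if grid_alive x h w k then Z k w else 0) = S k w" for k w
  proof -
    have "exp (of_real h * (\<psi> - of_real (q + x + w (real k * h)))) =
        exp (of_real h * \<psi>) * complex_of_real (exp (- (h * (q + x + w (real k * h)))))"
      unfolding exp_of_real[symmetric] exp_add[symmetric] by (simp add: algebra_simps)
    then show ?thesis unfolding V_def S_def Z_def grid_discount_Suc by (auto simp: algebra_simps simp del: of_real_exp)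
  qed
  have iS: "integrable P (S k)" for k
    using Bochner_Integration.integrable_diff[OF i3[of k] i1[of k]] unfolding VS .
  have "(LINT w|P. Z (stop_index (\<lambda>j. x + w (real j * h) < 0) n) w) =
      (LINT w|P. Z 0 w + (\<Sum>k<n. (if grid_alive x h w k then Z (Suc k) w else 0) - (if grid_alive x h w k then Z k w else 0)))"
    by (subst stop_index_telescope) (auto intro!: Bochner_Integration.integral_cong sum.cong simp: grid_alive_def not_less)
  also have "\<dots> = (LINT w|P. Z 0 w) + (LINT w|P. (\<Sum>k<n. (if grid_alive x h w k then Z (Suc k) w else 0) - (if grid_alive x h w k then Z k w else 0)))"
  proof (rule Bochner_Integration.integral_add)
    show "integrable P (Z 0)"
      by (rule integrable_const_bound[where B=1, OF AE_I2 Zm]) (auto intro!: nZ)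
  qed (use i1 i2 in auto)
  also have "(LINT w|P. Z 0 w) = (LINT w|P. exp (- (z * of_real x)))"
  proof (rule integral_cong_AE[OF Zm])
    show "AE w in P. Z 0 w = exp (- (z * of_real x))"
      using start_zero by eventually_elim (simp add: Z_def grid_discount_def)
  qed simp
  also have "\<dots> = exp (- (z * of_real x))" by (simp add: prob_space)
  also have "(LINT w|P. (\<Sum>k<n. (if grid_alive x h w k then Z (Suc k) w else 0) - (if grid_alive x h w k then Z k w else 0))) =
      (\<Sum>k<n. (LINT w|P. (if grid_alive x h w k then Z (Suc k) w else 0)) - (LINT w|P. (if grid_alive x h w k then Z k w else 0)))"
    using i1 i2 by (simp add: Bochner_Integration.integral_sum Bochner_Integration.integral_diff)
  also have "\<dots> = (\<Sum>k<n. (LINT w|P. V k w) - (LINT w|P. (if grid_alive x h w k then Z k w else 0)))"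
    using grid_step_expectation[OF h q, of x _ u] unfolding Z_def V_def z_def \<psi>_def by simp
  also have "\<dots> = (\<Sum>k<n. LINT w|P. S k w)"
    using i1 i3 by (simp add: VS flip: Bochner_Integration.integral_diff)
  also have "\<dots> = (LINT w|P. (\<Sum>k<n. S k w))"
    using iS by (simp add: Bochner_Integration.integral_sum)
  finally show ?thesis
    unfolding Z_def S_def grid_alive_def grid_discount_def .
qed

text \<open>Positions are unbounded over the paths, so a bound uniform in w must avoid them. The
  \<psi>-part of a step costs at most h times the modulus of \<psi>, and the discount parts
  telescope.\<close>

lemma grid_sum_bound:
  fixes w :: "real \<Rightarrow> real" and z \<psi> :: complex
  assumes h: "h > 0" and q: "q \<ge> 0" and z: "Re z \<ge> 0" and \<psi>: "Re \<psi> \<le> 0"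
  shows "norm (\<Sum>k<n. if \<forall>j\<le>k. 0 \<le> x + w (real j * h) then
        of_real (exp (- (\<Sum>j<k. h * (q + x + w (real j * h))))) * exp (- (z * of_real (x + w (real k * h)))) *
        (exp (of_real h * (\<psi> - of_real (q + x + w (real k * h)))) - 1) else 0) \<le> real n * h * norm \<psi> + 1"
proof -
  define D where "D k = grid_discount q x h w k" for k
  have D0: "0 \<le> D k" for k by (simp add: D_def grid_discount_def)
  define A where "A k \<longleftrightarrow> grid_alive x h w k" for k
  \<comment> \<open>The losses of discount along the stopped path add up to \<open>D 0\<close> minus
    the stopped discount, hence to at most 1.\<close>
  have tel: "D (stop_index (\<lambda>j. x + w (real j * h) < 0) n) = D 0 + (\<Sum>k<n. if A k then D (Suc k) - D k else 0)"
    unfolding A_def grid_alive_def by (subst stop_index_telescope) (simp add: not_less)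
  have "D 0 = 1" by (simp add: D_def grid_discount_def)
  then have tel1: "(\<Sum>k<n. if A k then D k - D (Suc k) else 0) \<le> 1"
  proof -
    have "(\<Sum>k<n. if A k then D k - D (Suc k) else 0) = - (\<Sum>k<n. if A k then D (Suc k) - D k else 0)"
      unfolding sum_negf[symmetric] by (intro sum.cong) auto
    then show ?thesis using tel D0[of "stop_index (\<lambda>j. x + w (real j * h) < 0) n"] \<open>D 0 = 1\<close> by linarith
  qed
  have "norm (\<Sum>k<n. if A k then
        of_real (D k) * exp (- (z * of_real (x + w (real k * h)))) *
        (exp (of_real h * (\<psi> - of_real (q + x + w (real k * h)))) - 1) else 0)
    \<le> (\<Sum>k<n. h * norm \<psi> + (if A k then D k - D (Suc k) else 0))"
  proof (rule sum_norm_le)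
    fix k
    show "norm (if A k then of_real (D k) * exp (- (z * of_real (x + w (real k * h)))) *
        (exp (of_real h * (\<psi> - of_real (q + x + w (real k * h)))) - 1) else 0)
       \<le> h * norm \<psi> + (if A k then D k - D (Suc k) else 0)"
    proof (cases "A k")
      case True
      then have pos: "\<And>j. j \<le> k \<Longrightarrow> 0 \<le> x + w (real j * h)" by (auto simp: A_def grid_alive_def)
      have D1: "D k \<le> 1" unfolding D_def by (rule grid_discount_le_1(2)[OF h q]) (use pos in auto)
      define a where "a = q + x + w (real k * h)"
      have a: "a \<ge> 0" using pos[of k] q by (simp add: a_def)
      have e: "norm (exp (- (z * of_real (x + w (real k * h))))) \<le> 1" using z pos[of k] by (simp del: of_real_add)
      have b: "norm (exp (of_real h * \<psi>) - 1) \<le> h * norm \<psi>"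
        using norm_exp_minus_one_le[of "of_real h * \<psi>"] h \<psi> by (simp add: norm_mult mult_nonneg_nonpos)
      have split: "exp (of_real h * (\<psi> - of_real a)) - 1 =
          complex_of_real (exp (- (h * a))) * (exp (of_real h * \<psi>) - 1) + of_real (exp (- (h * a)) - 1)"
      proof -
        have "exp (of_real h * (\<psi> - of_real a)) = complex_of_real (exp (- (h * a))) * exp (of_real h * \<psi>)"
          unfolding exp_of_real[symmetric] exp_add[symmetric] by (simp add: algebra_simps)
        then show ?thesis by (simp add: algebra_simps)
      qed
      have ea: "exp (- (h * a)) \<le> 1" "0 \<le> exp (- (h * a))" using a h by auto
      have "norm (exp (of_real h * (\<psi> - of_real a)) - 1) \<le>
          norm (complex_of_real (exp (- (h * a))) * (exp (of_real h * \<psi>) - 1)) + norm (complex_of_real (exp (- (h * a)) - 1))"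
        unfolding split by (rule norm_triangle_ineq)
      also have "\<dots> = exp (- (h * a)) * norm (exp (of_real h * \<psi>) - 1) + (1 - exp (- (h * a)))"
        using ea unfolding norm_mult norm_of_real by simp
      also have "\<dots> \<le> 1 * (h * norm \<psi>) + (1 - exp (- (h * a)))"
        by (intro add_mono mult_mono b ea) auto
      finally have c: "norm (exp (of_real h * (\<psi> - of_real a)) - 1) \<le> h * norm \<psi> + (1 - exp (- (h * a)))" by simp
      have "norm (of_real (D k) * exp (- (z * of_real (x + w (real k * h)))) * (exp (of_real h * (\<psi> - of_real a)) - 1))
          \<le> D k * 1 * (h * norm \<psi> + (1 - exp (- (h * a))))"
        unfolding norm_mult norm_of_real abs_of_nonneg[OF D0]
        by (intro mult_mono order_refl e c mult_nonneg_nonneg) (auto simp: D0)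
      also have "\<dots> = D k * (h * norm \<psi>) + (D k - D (Suc k))"
        unfolding D_def grid_discount_Suc a_def[symmetric] by (simp add: algebra_simps)
      also have "\<dots> \<le> h * norm \<psi> + (D k - D (Suc k))"
        using D1 D0[of k] h by (intro add_mono order_refl) (simp add: mult_left_le_one_le)
      finally show ?thesis using True by (simp add: a_def)
    qed (use h in simp)
  qed
  also have "\<dots> \<le> real n * h * norm \<psi> + 1" using tel1 by (simp add: sum.distrib)
  finally show ?thesis unfolding D_def A_def grid_alive_def grid_discount_def .
qed

end

context spectrally_positive_stable
begin

lemma path_sum_measurable:
  assumes h: "h > 0"
  shows "(\<lambda>w. \<Sum>k<n. if \<forall>j\<le>k. 0 \<le> x + w (real j * h) then
        of_real (exp (- (\<Sum>j<k. h * (q + x + w (real j * h))))) * exp (- (z * of_real (x + w (real k * h)))) *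
        (exp (of_real h * (\<psi> - of_real (q + x + w (real k * h)))) - 1) else 0 :: complex) \<in> borel_measurable P"
proof -
  note [measurable] = grid_measurables[OF h]
  show ?thesis by measurable
qed

text \<open>The continuous-time limit of the sums in \<open>discrete_identity\<close>.\<close>

definition path_functional :: "real \<Rightarrow> real \<Rightarrow> complex \<Rightarrow> complex \<Rightarrow> real \<Rightarrow> (real \<Rightarrow> real) \<Rightarrow> complex" where
  "path_functional q x z \<psi> t w = (LINT s:{0..t}|lborel. if alive x w s then
        of_real (discount q x w s) * exp (- (z * of_real (x + w s))) * (\<psi> - of_real (q + x + w s)) else 0)"

text \<open>Dominated convergence over the paths with the constant of \<open>grid_sum_bound\<close>;
  that constant also survives in the limit, pathwise.\<close>

lemma path_functional_expectation:
  assumes t: "t > 0" and q: "q \<ge> 0" and z: "Re z \<ge> 0" and \<psi>: "Re \<psi> \<le> 0"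
  defines "h \<equiv> \<lambda>n. t / real (Suc n)"
  shows "path_functional q x z \<psi> t \<in> borel_measurable P"
    and "\<And>w. w \<in> space P \<Longrightarrow> norm (path_functional q x z \<psi> t w) \<le> t * norm \<psi> + 1"
    and "(\<lambda>n. LINT w|P. (\<Sum>k<Suc n. if \<forall>j\<le>k. 0 \<le> x + w (real j * h n) then
        of_real (exp (- (\<Sum>j<k. h n * (q + x + w (real j * h n))))) * exp (- (z * of_real (x + w (real k * h n)))) *
        (exp (of_real (h n) * (\<psi> - of_real (q + x + w (real k * h n)))) - 1) else 0))
      \<longlonglongrightarrow> (LINT w|P. path_functional q x z \<psi> t w)"
proof -
  define S where "S n w = (\<Sum>k<Suc n. if \<forall>j\<le>k. 0 \<le> x + w (real j * h n) then
        of_real (exp (- (\<Sum>j<k. h n * (q + x + w (real j * h n))))) * exp (- (z * of_real (x + w (real k * h n)))) *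
        (exp (of_real (h n) * (\<psi> - of_real (q + x + w (real k * h n)))) - 1) else 0)" for n and w :: "real \<Rightarrow> real"
  have h: "h n > 0" for n using t by (simp add: h_def)
  have hn: "real (Suc n) * h n = t" for n by (simp add: h_def)
  have Sm: "S n \<in> borel_measurable P" for n unfolding S_def by (rule path_sum_measurable[OF h])
  have Slim: "(\<lambda>n. S n w) \<longlonglongrightarrow> path_functional q x z \<psi> t w" if "w \<in> space P" for w
    unfolding S_def path_functional_def h_def by (rule grid_sum_tendsto[OF cadlag_P[OF that] t z \<psi> q])
  have Sb: "norm (S n w) \<le> t * norm \<psi> + 1" for n w
    unfolding S_def hn[of n, symmetric] by (rule grid_sum_bound[OF h q z \<psi>])
  show m: "path_functional q x z \<psi> t \<in> borel_measurable P"
    by (rule borel_measurable_LIMSEQ_metric[OF Sm Slim])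
  show "norm (path_functional q x z \<psi> t w) \<le> t * norm \<psi> + 1" if "w \<in> space P" for w
    by (rule LIMSEQ_le_const2[OF tendsto_norm[OF Slim[OF that]]]) (use Sb in auto)
  have "(\<lambda>n. LINT w|P. S n w) \<longlonglongrightarrow> (LINT w|P. path_functional q x z \<psi> t w)"
    by (rule integral_dominated_convergence[where w="\<lambda>_. t * norm \<psi> + 1", OF m Sm])
      (use Slim Sb in \<open>auto intro!: AE_I2\<close>)
  then show "(\<lambda>n. LINT w|P. (\<Sum>k<Suc n. if \<forall>j\<le>k. 0 \<le> x + w (real j * h n) then
        of_real (exp (- (\<Sum>j<k. h n * (q + x + w (real j * h n))))) * exp (- (z * of_real (x + w (real k * h n)))) *
        (exp (of_real (h n) * (\<psi> - of_real (q + x + w (real k * h n)))) - 1) else 0))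
      \<longlonglongrightarrow> (LINT w|P. path_functional q x z \<psi> t w)"
    unfolding S_def .
qed

text \<open>Without negative jumps the discretised process overshoots zero by a vanishing amount, so the exponential
  at the stopping time may be replaced by 1 up to the event of surviving until time t.\<close>

lemma imaginary_core_bound:
  fixes u :: real
  assumes t: "t > 0" and q: "q > 0" and x: "x > 0"
  defines "z \<equiv> \<i> * of_real u" and "\<psi> \<equiv> (\<i> * of_real u) powr of_real \<alpha>"
  shows "norm ((1 + (LINT w|P. path_functional q x 0 0 t w)) -
     (exp (- (z * of_real x)) + (LINT w|P. path_functional q x z \<psi> t w))) \<le> 2 * exp (- (t * q))"
proof -
  define h where "h n = t / real (Suc n)" for n
  have h: "h n > 0" for n using t by (simp add: h_def)
  have hn: "real (Suc n) * h n = t" for n by (simp add: h_def)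
  define st where "st n w = stop_index (\<lambda>j. x + w (real j * h n) < 0) (Suc n)" for n w
  define D where "D n w = grid_discount q x (h n) w (st n w)" for n w
  define X where "X n w = x + w (real (st n w) * h n)" for n w
  have nz: "norm (exp (- (z * of_real r))) = 1" for r by (simp add: z_def)
  have Re\<psi>: "Re \<psi> \<le> 0" unfolding \<psi>_def by (rule exponent_real_nonpos)
  have Rez: "Re z \<ge> 0" by (simp add: z_def)
  have D0: "0 \<le> D n w" for n w by (simp add: D_def grid_discount_def)
  have alive: "0 \<le> x + w (real j * h n)" if "j < st n w" for j n w
    using stop_index_minimal[OF that[unfolded st_def]] by simp
  have D1: "D n w \<le> 1" for n w
    unfolding D_def by (rule grid_discount_le_1(2)[OF h]) (use q alive in auto)
  have Dt: "D n w \<le> exp (- (t * q))" if "st n w = Suc n" for n w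
  proof -
    have "D n w \<le> exp (- (real (st n w) * h n * q))"
      unfolding D_def by (rule grid_discount_le_1(1)[OF h]) (use q alive in auto)
    then show ?thesis using that hn[of n] by simp
  qed
  have stm: "st n \<in> measurable P (count_space UNIV)" for n
    unfolding st_def by (rule stop_index_measurable[OF h])
  have Dm [measurable]: "D n \<in> borel_measurable P" for n
    unfolding D_def[abs_def] by (rule measurable_compose_countable[OF grid_measurables(3)[OF h] stm])
  have Xm [measurable]: "X n \<in> borel_measurable P" for n
    unfolding X_def[abs_def]
    by (intro borel_measurable_add borel_measurable_const measurable_compose_countable[OF grid_measurables(1)[OF h] stm])
  have id: "(LINT w|P. of_real (D n w) * exp (- (z * of_real (X n w)))) =
     exp (- (z * of_real x)) +
     (LINT w|P. (\<Sum>k<Suc n. if \<forall>j\<le>k. 0 \<le> x + w (real j * h n) then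
        of_real (exp (- (\<Sum>j<k. h n * (q + x + w (real j * h n))))) * exp (- (z * of_real (x + w (real k * h n)))) *
        (exp (of_real (h n) * (\<psi> - of_real (q + x + w (real k * h n)))) - 1) else 0))" for n
    unfolding D_def X_def st_def z_def \<psi>_def by (rule discrete_identity[OF h]) (use q in simp)
  \<comment> \<open>The case u = 0: the exponential is 1 and the exponent is 0, so the mean stopped
    discount satisfies an identity of its own, to be compared with the one for u.\<close>
  have id0: "(LINT w|P. of_real (D n w)) =
     1 + (LINT w|P. (\<Sum>k<Suc n. if \<forall>j\<le>k. 0 \<le> x + w (real j * h n) then
        of_real (exp (- (\<Sum>j<k. h n * (q + x + w (real j * h n))))) * exp (- (0 * of_real (x + w (real k * h n)))) *
        (exp (of_real (h n) * (0 - of_real (q + x + w (real k * h n)))) - 1) else 0 :: complex))" for n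
  proof -
    have "(LINT w|P. of_real (D n w) * exp (- ((\<i> * of_real 0) * of_real (X n w)))) =
     exp (- ((\<i> * of_real 0) * of_real x)) +
     (LINT w|P. (\<Sum>k<Suc n. if \<forall>j\<le>k. 0 \<le> x + w (real j * h n) then
        of_real (exp (- (\<Sum>j<k. h n * (q + x + w (real j * h n))))) * exp (- ((\<i> * of_real 0) * of_real (x + w (real k * h n)))) *
        (exp (of_real (h n) * ((\<i> * of_real 0) powr of_real \<alpha> - of_real (q + x + w (real k * h n)))) - 1) else 0 :: complex))"
      unfolding D_def X_def st_def by (rule discrete_identity[OF h]) (use q in simp)
    moreover have "\<i> * of_real 0 = (0 :: complex)" "(0 :: complex) powr of_real \<alpha> = 0" by simp_all
    ultimately show ?thesis by (simp only: exp_zero mult_zero_left mult_1_right minus_zero)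
  qed
  \<comment> \<open>The price of replacing the exponential by 1 when the grid stops early; it
    vanishes in the limit by \<open>grid_overshoot\<close>. When the grid does not stop early, the
    discount is at most exp(-t q) and pays for the difference.\<close>
  define R where "R n w = (if st n w < Suc n then norm (exp (- (z * of_real (X n w))) - 1) else 0)" for n w
  have R2: "\<bar>R n w\<bar> \<le> 2" for n w
    using norm_triangle_ineq4[of "exp (- (z * of_real (X n w)))" 1] unfolding nz by (simp add: R_def)
  have Rm [measurable]: "R n \<in> borel_measurable P" for n
  proof -
    have "Measurable.pred P (\<lambda>w. st n w < Suc n)"
      by (rule measurable_compose[OF stm, of "\<lambda>k. k < Suc n"]) simp
    then have "{w \<in> space P. st n w < Suc n} \<in> sets P" by (simp add: pred_def)
    then show ?thesis unfolding R_def[abs_def] by (rule measurable_If[rotated 2]) measurable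
  qed
  have Rlim: "(\<lambda>n. LINT w|P. R n w) \<longlonglongrightarrow> (LINT w|P. 0)"
  proof (rule integral_dominated_convergence[where w="\<lambda>_. 2"])
    show "AE w in P. (\<lambda>n. R n w) \<longlonglongrightarrow> 0"
      using AE_no_negative_jumps start_zero AE_space
    proof eventually_elim
      case (elim w)
      show ?case
      proof (rule tendstoI)
        fix e :: real assume e: "e > 0"
        have "isCont (\<lambda>y. exp (- (z * of_real y)) - 1) (0::real)" by (intro continuous_intros)
        then have "\<exists>d>0. \<forall>y. \<bar>y\<bar> < d \<longrightarrow> norm (exp (- (z * of_real y)) - 1) < e"
          using e unfolding continuous_at_eps_delta by (auto simp: dist_norm)
        then obtain d where d: "d > 0" "\<And>y. \<bar>y\<bar> < d \<Longrightarrow> norm (exp (- (z * of_real y)) - 1) < e" by blast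
        have "\<forall>\<^sub>F n in sequentially. st n w < Suc n \<longrightarrow> \<bar>X n w\<bar> < d"
          unfolding st_def X_def h_def
          by (rule grid_overshoot[OF cadlag_P[OF elim(3)] t elim(1) _ d(1)]) (use x elim in simp)
        then show "\<forall>\<^sub>F n in sequentially. dist (R n w) 0 < e"
          by eventually_elim (use d(2) e in \<open>auto simp: R_def\<close>)
      qed
    qed
  qed (use R2 in \<open>auto intro!: AE_I2\<close>)
  have ineq: "norm ((LINT w|P. complex_of_real (D n w)) - (LINT w|P. of_real (D n w) * exp (- (z * of_real (X n w)))))
      \<le> (LINT w|P. R n w) + 2 * exp (- (t * q))" for n
  proof -
    have i1: "integrable P (\<lambda>w. complex_of_real (D n w))"
      by (rule integrable_const_bound[where B=1]) (use D0 D1 in \<open>auto intro!: AE_I2\<close>)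
    have i2: "integrable P (\<lambda>w. complex_of_real (D n w) * exp (- (z * of_real (X n w))))"
      by (rule integrable_const_bound[where B=1]) (use D0 D1 in \<open>auto intro!: AE_I2 simp: norm_mult nz simp del: norm_exp_eq_Re\<close>)
    have iR: "integrable P (R n)" by (rule integrable_const_bound[where B=2, OF AE_I2 Rm]) (use R2 in auto)
    have "norm ((LINT w|P. complex_of_real (D n w)) - (LINT w|P. of_real (D n w) * exp (- (z * of_real (X n w))))) =
        norm (LINT w|P. complex_of_real (D n w) - of_real (D n w) * exp (- (z * of_real (X n w))))"
      by (simp only: Bochner_Integration.integral_diff[OF i1 i2])
    also have "\<dots> \<le> (LINT w|P. norm (complex_of_real (D n w) - of_real (D n w) * exp (- (z * of_real (X n w)))))"
      by (rule integral_norm_bound)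
    also have "\<dots> \<le> (LINT w|P. R n w + 2 * exp (- (t * q)))"
    proof (rule integral_mono)
      show "integrable P (\<lambda>w. norm (complex_of_real (D n w) - of_real (D n w) * exp (- (z * of_real (X n w)))))"
        by (intro integrable_norm Bochner_Integration.integrable_diff i1 i2)
      show "integrable P (\<lambda>w. R n w + 2 * exp (- (t * q)))" using iR by simp
      fix w
      have eq: "norm (complex_of_real (D n w) - of_real (D n w) * exp (- (z * of_real (X n w)))) =
          D n w * norm (exp (- (z * of_real (X n w))) - 1)"
      proof -
        have "complex_of_real (D n w) - of_real (D n w) * exp (- (z * of_real (X n w))) =
            of_real (D n w) * (1 - exp (- (z * of_real (X n w))))" by (simp add: right_diff_distrib)
        then show ?thesis using D0[of n w] by (simp only: norm_mult norm_of_real abs_of_nonneg norm_minus_commute)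
      qed
      have n2: "norm (exp (- (z * of_real (X n w))) - 1) \<le> 2"
        using norm_triangle_ineq4[of "exp (- (z * of_real (X n w)))" 1] unfolding nz by simp
      show "norm (complex_of_real (D n w) - of_real (D n w) * exp (- (z * of_real (X n w)))) \<le> R n w + 2 * exp (- (t * q))"
      proof (cases "st n w < Suc n")
        case True
        have "D n w * norm (exp (- (z * of_real (X n w))) - 1) \<le> 1 * norm (exp (- (z * of_real (X n w))) - 1)"
          by (intro mult_right_mono D1) simp
        then show ?thesis unfolding eq R_def if_P[OF True] by (simp add: add_increasing2 del: norm_exp_eq_Re)
      next
        case False
        then have "st n w = Suc n" using stop_index_le[of _ "Suc n"] unfolding st_def by (meson le_antisym not_less)
        from Dt[OF this] have "D n w * norm (exp (- (z * of_real (X n w))) - 1) \<le> exp (- (t * q)) * 2"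
          by (intro mult_mono n2) auto
        then show ?thesis unfolding eq R_def if_not_P[OF False] by simp
      qed
    qed
    also have "\<dots> = (LINT w|P. R n w) + 2 * exp (- (t * q))" using iR by (simp add: prob_space)
    finally show ?thesis .
  qed
  have L0: "(\<lambda>n. LINT w|P. complex_of_real (D n w)) \<longlonglongrightarrow> 1 + (LINT w|P. path_functional q x 0 0 t w)"
    unfolding id0 h_def by (intro tendsto_intros path_functional_expectation(3)[OF t]) (use q in auto)
  have L1: "(\<lambda>n. LINT w|P. of_real (D n w) * exp (- (z * of_real (X n w)))) \<longlonglongrightarrow>
      exp (- (z * of_real x)) + (LINT w|P. path_functional q x z \<psi> t w)"
    unfolding id h_def by (intro tendsto_intros path_functional_expectation(3)[OF t _ Rez Re\<psi>]) (use q in auto)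
  have "(\<lambda>n. (LINT w|P. R n w) + 2 * exp (- (t * q))) \<longlonglongrightarrow> 0 + 2 * exp (- (t * q))"
    using Rlim by (intro tendsto_intros) simp
  from LIMSEQ_le[OF tendsto_norm[OF tendsto_diff[OF L0 L1]] this] ineq show ?thesis by auto
qed

end

section \<open>The occupation measure before first passage\<close>

lemma path_eval_jointly_measurable:
  assumes N: "\<And>s. 0 \<le> s \<Longrightarrow> (\<lambda>w. w s) \<in> borel_measurable N" "space N \<subseteq> cadlag_paths"
  shows "(\<lambda>x. fst x (max 0 (snd x))) \<in> borel_measurable (N \<Otimes>\<^sub>M borel)"
proof (rule borel_measurable_LIMSEQ_real)
  show "(\<lambda>x. fst x (max 0 (min (real n) (snd x)))) \<in> borel_measurable (N \<Otimes>\<^sub>M borel)" for n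
    using path_eval_joint_measurable[of "real n" N] N by (simp add: case_prod_beta)
  show "(\<lambda>n. fst x (max 0 (min (real n) (snd x)))) \<longlonglongrightarrow> fst x (max 0 (snd x))" for x :: "(real \<Rightarrow> real) \<times> real"
  proof (rule tendsto_eventually)
    show "\<forall>\<^sub>F n in sequentially. fst x (max 0 (min (real n) (snd x))) = fst x (max 0 (snd x))"
      using eventually_ge_at_top[of "nat \<lceil>snd x\<rceil>"]
    proof eventually_elim
      case (elim n)
      then have "snd x \<le> real n" by linarith
      then show ?case by (simp add: min_absorb2)
    qed
  qed
qed

text \<open>A negative value before s persists to the right and is seen at a rational below s. The
  endpoint is tested separately, since a negative value at s need not be visible earlier.\<close>

lemma alive_iff_rational:
  assumes w: "cadlag w" and s: "0 \<le> s"
  shows "alive x w s \<longleftrightarrow> 0 \<le> x + w (max 0 s) \<and>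
    (\<forall>p :: rat. 0 \<le> real_of_rat p \<and> real_of_rat p < s \<longrightarrow> 0 \<le> x + w (max 0 (real_of_rat p)))" (is "_ \<longleftrightarrow> ?R")
proof
  assume "alive x w s" then show ?R using s by (auto simp: alive_def max_def)
next
  assume R: ?R
  show "alive x w s"
    unfolding alive_def
  proof
    fix r assume r: "r \<in> {0..s}"
    show "0 \<le> x + w r"
    proof (cases "r = s")
      case False
      then have rs: "r < s" "0 \<le> r" using r by auto
      show ?thesis
      proof (rule ccontr)
        assume "\<not> 0 \<le> x + w r"
        moreover have "((\<lambda>r. x + w r) \<longlongrightarrow> x + w r) (at_right r)"
          using w rs by (intro tendsto_intros) (auto simp: cadlag_def)
        ultimately have "\<forall>\<^sub>F y in at_right r. x + w y < 0" by (intro order_tendstoD(2)) auto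
        then obtain b where b: "b > r" "\<And>y. r < y \<Longrightarrow> y < b \<Longrightarrow> x + w y < 0"
          unfolding eventually_at_right_field by blast
        obtain p where p: "r < real_of_rat p" "real_of_rat p < min b s"
          using of_rat_dense[of r "min b s"] b rs by auto
        then have "x + w (real_of_rat p) < 0" using b by auto
        moreover have "0 \<le> real_of_rat p \<and> real_of_rat p < s"
        proof
          show "0 \<le> real_of_rat p" using p(1) rs(2) by linarith
        qed (use p in simp)
        then have "0 \<le> x + w (max 0 (real_of_rat p))" using R by blast
        moreover have "max 0 (real_of_rat p) = real_of_rat p" using p(1) rs(2) by linarith
        ultimately show False by simp
      qed
    qed (use R s in \<open>auto simp: max_def\<close>)
  qed
qed

lemma alive_jointly_measurable:
  assumes N: "\<And>s. 0 \<le> s \<Longrightarrow> (\<lambda>w. w s) \<in> borel_measurable N" "space N \<subseteq> cadlag_paths"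
  shows "Measurable.pred (N \<Otimes>\<^sub>M borel) (\<lambda>p. 0 \<le> snd p \<and> alive x (fst p) (snd p))"
proof -
  note [measurable] = path_eval_jointly_measurable[OF N]
  have [measurable]: "(\<lambda>p. fst p (max 0 (real_of_rat r))) \<in> borel_measurable (N \<Otimes>\<^sub>M (borel :: real measure))" for r
    by (rule measurable_compose[OF measurable_fst N(1)]) simp
  have "Measurable.pred (N \<Otimes>\<^sub>M borel) (\<lambda>p. 0 \<le> snd p \<and> 0 \<le> x + fst p (max 0 (snd p)) \<and>
     (\<forall>r :: rat. 0 \<le> real_of_rat r \<and> real_of_rat r < snd p \<longrightarrow> 0 \<le> x + fst p (max 0 (real_of_rat r))))"
    by measurable
  then show ?thesis
  proof (rule measurable_cong[THEN iffD1, rotated])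
    fix p assume "p \<in> space (N \<Otimes>\<^sub>M (borel :: real measure))"
    then have "cadlag (fst p)" using N(2) by (auto simp: space_pair_measure cadlag_paths_def)
    then show "(0 \<le> snd p \<and> 0 \<le> x + fst p (max 0 (snd p)) \<and>
     (\<forall>r :: rat. 0 \<le> real_of_rat r \<and> real_of_rat r < snd p \<longrightarrow> 0 \<le> x + fst p (max 0 (real_of_rat r)))) =
      (0 \<le> snd p \<and> alive x (fst p) (snd p))"
      using alive_iff_rational[of "fst p" "snd p" x] by auto
  qed
qed

lemma path_integral_jointly_measurable:
  fixes f :: "real \<Rightarrow> real"
  assumes N: "\<And>s. 0 \<le> s \<Longrightarrow> (\<lambda>w. w s) \<in> borel_measurable N" "space N \<subseteq> cadlag_paths"
    and f: "f \<in> borel_measurable borel"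
  shows "(\<lambda>p. LINT r:{0..snd p}|lborel. f (fst p r)) \<in> borel_measurable (N \<Otimes>\<^sub>M borel)"
proof -
  have eq: "(LINT r:{0..s}|lborel. f (v r)) = (LINT r|lborel. indicator {0..s} r *\<^sub>R f (v (max 0 r)))" for s v
    unfolding set_lebesgue_integral_def by (intro Bochner_Integration.integral_cong) (auto simp: indicator_def max_def)
  have tri: "(\<lambda>x :: ((real \<Rightarrow> real) \<times> real) \<times> real. indicator {0..snd (fst x)} (snd x) :: real) \<in> borel_measurable ((N \<Otimes>\<^sub>M borel) \<Otimes>\<^sub>M borel)"
    using measurable_compose[OF _ triangle_indicator_measurable, of "\<lambda>x :: ((real \<Rightarrow> real) \<times> real) \<times> real. (snd (fst x), snd x)" "(N \<Otimes>\<^sub>M borel) \<Otimes>\<^sub>M borel"]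
    by simp
  have ev: "(\<lambda>x. fst (fst x) (max 0 (snd x))) \<in> borel_measurable ((N \<Otimes>\<^sub>M borel) \<Otimes>\<^sub>M borel)"
    using measurable_compose[OF _ path_eval_jointly_measurable[OF N], of "\<lambda>x. (fst (fst x), snd x)" "(N \<Otimes>\<^sub>M borel) \<Otimes>\<^sub>M borel"]
    by simp
  have "(\<lambda>x. indicator {0..snd (fst x)} (snd x) *\<^sub>R f (fst (fst x) (max 0 (snd x)))) \<in> borel_measurable ((N \<Otimes>\<^sub>M borel) \<Otimes>\<^sub>M borel)"
    by (intro borel_measurable_scaleR tri measurable_compose[OF ev f])
  then have "(\<lambda>(p, r). indicator {0..snd p} r *\<^sub>R f (fst p (max 0 r))) \<in> borel_measurable ((N \<Otimes>\<^sub>M borel) \<Otimes>\<^sub>M lborel)"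
    by (subst measurable_cong_sets[OF sets_pair_measure_cong[OF refl sets_lborel] refl]) (simp add: case_prod_beta)
  from sigma_finite_measure.borel_measurable_lebesgue_integral[OF sigma_finite_lborel this]
  show ?thesis unfolding eq .
qed

context spectrally_positive_stable
begin

definition survival_density :: "real \<Rightarrow> real \<Rightarrow> (real \<Rightarrow> real) \<times> real \<Rightarrow> real" where
  "survival_density q x p = (if 0 \<le> snd p \<and> alive x (fst p) (snd p) then discount q x (fst p) (snd p) else 0)"

text \<open>The measure \<nu>: expected discounted time spent near y before passage. Since the
  discount decays at rate q plus position, the integral of q + y is the expected discount lost
  before passage. The \<open>max 0\<close> makes evaluation total and changes nothing where the
  density is positive.\<close>

definition occupation :: "real \<Rightarrow> real \<Rightarrow> real measure" where
  "occupation q x = distr (density (P \<Otimes>\<^sub>M lborel) (\<lambda>p. ennreal (survival_density q x p))) borel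
     (\<lambda>p. x + fst p (max 0 (snd p)))"

lemma sets_P_lborel: "sets (P \<Otimes>\<^sub>M lborel) = sets (P \<Otimes>\<^sub>M borel)"
  by (rule sets_pair_measure_cong) auto

lemma measurable_P_lborel: "measurable (P \<Otimes>\<^sub>M lborel) N = measurable (P \<Otimes>\<^sub>M borel) N"
  by (rule measurable_cong_sets[OF sets_P_lborel refl])

lemma pair_P: "pair_sigma_finite P lborel"
  by unfold_locales

lemma eval_joint: "(\<lambda>p. fst p (max 0 (snd p))) \<in> borel_measurable (P \<Otimes>\<^sub>M lborel)"
  unfolding measurable_P_lborel by (rule path_eval_jointly_measurable) (use eval_measurable space_P in auto)

lemma survival_density_measurable: "survival_density q x \<in> borel_measurable (P \<Otimes>\<^sub>M lborel)"
proof -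
  have a: "Measurable.pred (P \<Otimes>\<^sub>M borel) (\<lambda>p. 0 \<le> snd p \<and> alive x (fst p) (snd p))"
    by (rule alive_jointly_measurable) (use eval_measurable space_P in auto)
  have i: "(\<lambda>p. LINT r:{0..snd p}|lborel. (\<lambda>y. q + x + y) (fst p r)) \<in> borel_measurable (P \<Otimes>\<^sub>M borel)"
    by (rule path_integral_jointly_measurable) (use eval_measurable space_P in auto)
  then have [measurable]: "(\<lambda>p. discount q x (fst p) (snd p)) \<in> borel_measurable (P \<Otimes>\<^sub>M borel)"
    unfolding discount_def by measurable
  have "{p \<in> space (P \<Otimes>\<^sub>M borel). 0 \<le> snd p \<and> alive x (fst p) (snd p)} \<in> sets (P \<Otimes>\<^sub>M borel)"
    using a by (simp only: pred_def)
  then show ?thesis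
    unfolding measurable_P_lborel survival_density_def[abs_def] by (rule measurable_If[rotated 2]) measurable
qed

lemma survival_density_nonneg: "0 \<le> survival_density q x p"
  by (simp add: survival_density_def discount_def)

lemma sets_occupation: "sets (occupation q x) = sets borel" "space (occupation q x) = UNIV"
  by (simp_all add: occupation_def)

lemma nn_integral_occupation:
  assumes f: "f \<in> borel_measurable borel"
  shows "(\<integral>\<^sup>+y. f y \<partial>occupation q x) =
    (\<integral>\<^sup>+w. (\<integral>\<^sup>+s. ennreal (survival_density q x (w, s)) * f (x + w (max 0 s)) \<partial>lborel) \<partial>P)"
proof -
  have Xm: "(\<lambda>p. x + fst p (max 0 (snd p))) \<in> borel_measurable (P \<Otimes>\<^sub>M lborel)"
    by (intro borel_measurable_add borel_measurable_const eval_joint)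
  have sm: "(\<lambda>p. ennreal (survival_density q x p)) \<in> borel_measurable (P \<Otimes>\<^sub>M lborel)"
    by (rule measurable_compose[OF survival_density_measurable]) simp
  have fm: "(\<lambda>p. f (x + fst p (max 0 (snd p)))) \<in> borel_measurable (P \<Otimes>\<^sub>M lborel)"
    by (rule measurable_compose[OF Xm f])
  have "(\<integral>\<^sup>+y. f y \<partial>occupation q x) = (\<integral>\<^sup>+p. ennreal (survival_density q x p) * f (x + fst p (max 0 (snd p))) \<partial>(P \<Otimes>\<^sub>M lborel))"
    unfolding occupation_def using Xm f by (simp add: nn_integral_distr nn_integral_density[OF sm fm])
  also have "\<dots> = (\<integral>\<^sup>+w. (\<integral>\<^sup>+s. ennreal (survival_density q x (w, s)) * f (x + w (max 0 s)) \<partial>lborel) \<partial>P)"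
  proof -
    have "(\<lambda>p. ennreal (survival_density q x p) * f (x + fst p (max 0 (snd p)))) \<in> borel_measurable (P \<Otimes>\<^sub>M lborel)"
      using sm fm by measurable
    from sigma_finite_measure.nn_integral_fst[OF sigma_finite_lborel this] show ?thesis by simp
  qed
  finally show ?thesis .
qed

lemma AE_occupation_nonneg: "AE y in occupation q x. 0 \<le> y"
proof -
  have "(\<integral>\<^sup>+y. indicator {..<0} y \<partial>occupation q x) = 0"
  proof (subst nn_integral_occupation)
    have "ennreal (survival_density q x (w, s)) * indicator {..<0} (x + w (max 0 s)) = 0" for w s
      by (auto simp: survival_density_def alive_def indicator_def dest!: bspec[of _ _ s])
    then show "(\<integral>\<^sup>+w. (\<integral>\<^sup>+s. ennreal (survival_density q x (w, s)) * indicator {..<0} (x + w (max 0 s)) \<partial>lborel) \<partial>P) = 0"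
      by (simp only: nn_integral_const mult_zero_left)
  qed simp
  then have "AE y in occupation q x. indicator {..<0} y = (0::ennreal)"
    by (subst (asm) nn_integral_0_iff_AE) (auto simp: sets_occupation cong: measurable_cong_sets)
  then show ?thesis by eventually_elim (auto simp: indicator_def split: if_splits)
qed

lemma path_survival_integrable:
  assumes w: "w \<in> space P" and q: "q \<ge> 0"
  shows "integrable lborel (\<lambda>s. indicator {0..t} s * (survival_density q x (w, s) * (q + x + w (max 0 s))))"
proof -
  obtain K where K: "K \<ge> 0" "\<And>s. s \<in> {0..t} \<Longrightarrow> \<bar>w s\<bar> \<le> K" using cadlag_bounded[OF cadlag_P[OF w]] by blast
  have m1: "(\<lambda>s. survival_density q x (w, s)) \<in> borel_measurable lborel"
    by (rule measurable_compose[OF measurable_Pair1'[OF w] survival_density_measurable])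
  have m2: "(\<lambda>s. w (max 0 s)) \<in> borel_measurable lborel"
    using measurable_compose[OF measurable_Pair1'[OF w] eval_joint] by simp
  show ?thesis
  proof (rule Bochner_Integration.integrable_bound)
    show "integrable lborel (\<lambda>s. indicator {0..t} s * (q + \<bar>x\<bar> + K))"
      by (intro integrable_mult_left integrable_real_indicator) (auto simp: emeasure_lborel_Icc_eq)
    show "(\<lambda>s. indicator {0..t} s * (survival_density q x (w, s) * (q + x + w (max 0 s)))) \<in> borel_measurable lborel"
      using m1 m2 by measurable
    show "AE s in lborel. norm (indicator {0..t} s * (survival_density q x (w, s) * (q + x + w (max 0 s))))
        \<le> norm (indicator {0..t} s * (q + \<bar>x\<bar> + K))"
    proof (rule AE_I2)
      fix s
      show "norm (indicator {0..t} s * (survival_density q x (w, s) * (q + x + w (max 0 s))))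
        \<le> norm (indicator {0..t} s * (q + \<bar>x\<bar> + K))"
      proof (cases "s \<in> {0..t} \<and> alive x w s")
        case True
        have "0 \<le> (LINT r:{0..s}|lborel. q + x + w r)"
          unfolding set_lebesgue_integral_def
          by (rule Bochner_Integration.integral_nonneg) (use True q in \<open>auto simp: alive_def indicator_def add.assoc\<close>)
        then have d: "survival_density q x (w, s) \<le> 1"
          by (simp add: survival_density_def discount_def)
        have "\<bar>w s\<bar> \<le> K" using True by (intro K(2)) auto
        then have "\<bar>q + x + w s\<bar> \<le> q + \<bar>x\<bar> + K" using q by linarith
        then have "\<bar>survival_density q x (w, s)\<bar> * \<bar>q + x + w s\<bar> \<le> 1 * (q + \<bar>x\<bar> + K)"
          using d survival_density_nonneg[of q x "(w, s)"] by (intro mult_mono) auto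
        then show ?thesis using True q K by (simp add: abs_mult)
      qed (auto simp: survival_density_def indicator_def)
    qed
  qed
qed

text \<open>Along one path the integrand is minus the derivative of the discount, so the total
  cannot exceed 1. Instead of differentiating, the bound of \<open>path_functional\<close> at z =
  \<psi> = 0 is used, which is 1 for every t.\<close>

lemma path_survival_le_1:
  assumes w: "w \<in> space P" and q: "q \<ge> 0"
  shows "(\<integral>\<^sup>+s. ennreal (survival_density q x (w, s)) * ennreal (q + (x + w (max 0 s))) \<partial>lborel) \<le> 1"
proof -
  define k where "k s = survival_density q x (w, s) * (q + x + w (max 0 s))" for s
  have m1: "(\<lambda>s. survival_density q x (w, s)) \<in> borel_measurable lborel"
    by (rule measurable_compose[OF measurable_Pair1'[OF w] survival_density_measurable])
  have m2: "(\<lambda>s. w (max 0 s)) \<in> borel_measurable lborel"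
    using measurable_compose[OF measurable_Pair1'[OF w] eval_joint] by simp
  have km [measurable]: "k \<in> borel_measurable lborel" unfolding k_def using m1 m2 by measurable
  have k0: "0 \<le> k s" for s
    unfolding k_def using q by (auto simp: survival_density_def alive_def discount_def intro!: mult_nonneg_nonneg)
      (metis add.assoc add_nonneg_nonneg atLeastAtMost_iff max.absorb2 order_refl)
  have kn: "k s = 0" if "s < 0" for s using that by (simp add: k_def survival_density_def)
  have le: "(LINT s|lborel. indicator {0..t} s * k s) \<le> 1" if t: "t > 0" for t
  proof -
    have "path_functional q x 0 0 t w = (LINT s|lborel. complex_of_real (- (indicator {0..t} s * k s)))"
      unfolding path_functional_def set_lebesgue_integral_def
      by (intro Bochner_Integration.integral_cong) (auto simp: k_def survival_density_def indicator_def algebra_simps)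
    also have "\<dots> = of_real (- (LINT s|lborel. indicator {0..t} s * k s))"
      by (simp only: integral_complex_of_real Bochner_Integration.integral_minus)
    finally have "norm (path_functional q x 0 0 t w) = \<bar>LINT s|lborel. indicator {0..t} s * k s\<bar>" by (simp only: norm_of_real abs_minus_cancel)
    then show ?thesis using path_functional_expectation(2)[OF t q, of 0 0 w x] w by simp
  qed
  have "(\<integral>\<^sup>+s. ennreal (k s) \<partial>lborel) = (\<integral>\<^sup>+s. (SUP n. ennreal (indicator {0..real (Suc n)} s * k s)) \<partial>lborel)"
  proof (rule nn_integral_cong)
    fix s
    show "ennreal (k s) = (SUP n. ennreal (indicator {0..real (Suc n)} s * k s))"
    proof (rule antisym)
      show "ennreal (k s) \<le> (SUP n. ennreal (indicator {0..real (Suc n)} s * k s))"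
      proof (cases "s < 0")
        case False
        have "s \<le> real (Suc (nat \<lceil>s\<rceil>))" by linarith
        then show ?thesis using False by (intro SUP_upper2[of "nat \<lceil>s\<rceil>"]) (auto simp: indicator_def)
      qed (simp add: kn)
      show "(SUP n. ennreal (indicator {0..real (Suc n)} s * k s)) \<le> ennreal (k s)"
        by (rule SUP_least) (use k0[of s] in \<open>auto simp: indicator_def\<close>)
    qed
  qed
  also have "\<dots> = (SUP n. (\<integral>\<^sup>+s. ennreal (indicator {0..real (Suc n)} s * k s) \<partial>lborel))"
    by (rule nn_integral_monotone_convergence_SUP)
      (use k0 in \<open>auto simp: incseq_def le_fun_def indicator_def intro!: ennreal_leI\<close>)
  also have "\<dots> \<le> 1"
  proof (rule SUP_least)
    fix n
    have "(\<integral>\<^sup>+s. ennreal (indicator {0..real (Suc n)} s * k s) \<partial>lborel) = ennreal (LINT s|lborel. indicator {0..real (Suc n)} s * k s)"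
      by (rule nn_integral_eq_integral) (use path_survival_integrable[OF w q, of "real (Suc n)" x] k0 in \<open>auto simp: k_def\<close>)
    also have "\<dots> \<le> 1" using le[of "real (Suc n)"] by (simp add: ennreal_le_1)
    finally show "(\<integral>\<^sup>+s. ennreal (indicator {0..real (Suc n)} s * k s) \<partial>lborel) \<le> 1" .
  qed
  also have "(\<integral>\<^sup>+s. ennreal (k s) \<partial>lborel) = (\<integral>\<^sup>+s. ennreal (survival_density q x (w, s)) * ennreal (q + (x + w (max 0 s))) \<partial>lborel)"
    by (intro nn_integral_cong) (simp add: k_def ennreal_mult'[OF survival_density_nonneg] add.assoc)
  finally show ?thesis .
qed

lemma occupation_moment_le_1:
  assumes q: "q \<ge> 0"
  shows "(\<integral>\<^sup>+y. ennreal (q + y) \<partial>occupation q x) \<le> 1"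
proof -
  have "(\<integral>\<^sup>+y. ennreal (q + y) \<partial>occupation q x) \<le> (\<integral>\<^sup>+w. 1 \<partial>P)"
  proof (subst nn_integral_occupation)
    show "(\<integral>\<^sup>+w. (\<integral>\<^sup>+s. ennreal (survival_density q x (w, s)) * ennreal (q + (x + w (max 0 s))) \<partial>lborel) \<partial>P) \<le> (\<integral>\<^sup>+w. 1 \<partial>P)"
      by (rule nn_integral_mono) (rule path_survival_le_1[OF _ q])
  qed simp
  then show ?thesis by (simp add: emeasure_space_1)
qed

text \<open>q times the mass is at most the integral of q + y, hence at most 1.\<close>

lemma occupation_integrable:
  assumes q: "q > 0"
  shows "integrable (occupation q x) (\<lambda>y. q + y)" and "finite_measure (occupation q x)"
proof -
  have "(\<integral>\<^sup>+y. ennreal q \<partial>occupation q x) \<le> (\<integral>\<^sup>+y. ennreal (q + y) \<partial>occupation q x)"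
    by (rule nn_integral_mono_AE) (use AE_occupation_nonneg in \<open>eventually_elim, auto intro!: ennreal_leI\<close>)
  then have "ennreal q * emeasure (occupation q x) (space (occupation q x)) \<le> 1"
    using occupation_moment_le_1[of q x] q by (auto intro: order_trans)
  then have "emeasure (occupation q x) (space (occupation q x)) \<noteq> \<infinity>"
    using q by (auto simp: ennreal_mult_top top_unique)
  then show "finite_measure (occupation q x)" by (rule finite_measureI)
  have "AE y in occupation q x. 0 \<le> q + y"
    using AE_occupation_nonneg by eventually_elim (use q in auto)
  then show "integrable (occupation q x) (\<lambda>y. q + y)"
    using occupation_moment_le_1[of q x] q
    by (intro integrableI_nonneg) (auto simp: sets_occupation intro: le_less_trans cong: measurable_cong_sets)
qed

end

section \<open>Laplace transforms as functions on the right half plane\<close>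

lemma laplace_transform_continuous:
  fixes g :: "real \<Rightarrow> real"
  assumes N: "sets N = sets borel" "AE y in N. 0 \<le> y" and g: "integrable N g"
  shows "continuous_on {z. 0 \<le> Re z} (\<lambda>z. LINT y|N. exp (- (z * of_real y)) * of_real (g y))"
  unfolding continuous_on_sequentially
proof (intro allI ballI impI)
  fix Z :: "nat \<Rightarrow> complex" and z
  assume "z \<in> {z. 0 \<le> Re z}" and Z: "(\<forall>n. Z n \<in> {z. 0 \<le> Re z}) \<and> Z \<longlonglongrightarrow> z"
  have [measurable]: "g \<in> borel_measurable N" using g by (rule borel_measurable_integrable)
  note [measurable_cong] = N(1)
  have "(\<lambda>n. LINT y|N. exp (- (Z n * of_real y)) * of_real (g y)) \<longlonglongrightarrow> (LINT y|N. exp (- (z * of_real y)) * of_real (g y))"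
  proof (rule integral_dominated_convergence[where w="\<lambda>y. \<bar>g y\<bar>"])
    show "AE y in N. norm (exp (- (Z n * of_real y)) * of_real (g y)) \<le> \<bar>g y\<bar>" for n
      using N(2)
    proof eventually_elim
      case (elim y)
      have "norm (exp (- (Z n * of_real y))) \<le> 1" using Z elim by simp
      then have "norm (exp (- (Z n * of_real y))) * \<bar>g y\<bar> \<le> 1 * \<bar>g y\<bar>" by (rule mult_right_mono) simp
      then show ?case by (simp only: norm_mult norm_of_real mult_1_left)
    qed
    show "AE y in N. (\<lambda>n. exp (- (Z n * of_real y)) * of_real (g y)) \<longlonglongrightarrow> exp (- (z * of_real y)) * of_real (g y)"
      by (intro AE_I2 tendsto_intros) (use Z in auto)
    show "integrable N (\<lambda>y. \<bar>g y\<bar>)" using g by simp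
  qed measurable
  then show "((\<lambda>z. LINT y|N. exp (- (z * of_real y)) * of_real (g y)) \<circ> Z) \<longlonglongrightarrow> (LINT y|N. exp (- (z * of_real y)) * of_real (g y))"
    by (simp add: o_def)
qed

text \<open>Differentiation produces a factor y that need not be integrable together with g. For Re
  z \<ge> \<rho> > 0 it is absorbed by y exp(-\<rho> y) \<le> 1/\<rho>, which bounds all difference
  quotients near the point.\<close>

lemma laplace_transform_holomorphic:
  fixes g :: "real \<Rightarrow> real"
  assumes N: "sets N = sets borel" "AE y in N. 0 \<le> y" and g: "integrable N g"
  shows "(\<lambda>z. LINT y|N. exp (- (z * of_real y)) * of_real (g y)) holomorphic_on {z. 0 < Re z}"
proof (rule holomorphic_onI, rule field_differentiable_at_within)
  fix z0 :: complex assume "z0 \<in> {z. 0 < Re z}"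
  \<comment> \<open>Half the distance to the imaginary axis: displacements shorter than \<rho> stay
    in Re z \<ge> \<rho>.\<close>
  define \<rho> where "\<rho> = Re z0 / 2"
  have \<rho>: "\<rho> > 0" using \<open>z0 \<in> _\<close> by (simp add: \<rho>_def)
  note [measurable_cong] = N(1)
  have gm [measurable]: "g \<in> borel_measurable N" using g by (rule borel_measurable_integrable)
  have exb: "norm (exp (- (z * of_real y))) \<le> 1" if "0 \<le> Re z" "0 \<le> y" for z :: complex and y using that by simp
  have int: "integrable N (\<lambda>y. exp (- (z * of_real y)) * of_real (g y))" if "0 \<le> Re z" for z :: complex
  proof (rule Bochner_Integration.integrable_bound[OF g])
    show "AE y in N. norm (exp (- (z * of_real y)) * of_real (g y)) \<le> norm (g y)"
      using N(2)
    proof eventually_elim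
      case (elim y)
      have "norm (exp (- (z * of_real y))) * \<bar>g y\<bar> \<le> 1 * \<bar>g y\<bar>" by (intro mult_right_mono exb that elim) simp
      then show ?case by (simp only: norm_mult norm_of_real mult_1_left real_norm_def)
    qed
  qed measurable
  define L where "L z = (LINT y|N. exp (- (z * of_real y)) * of_real (g y))" for z :: complex
  define dq where "dq k y = (exp (- ((z0 + k) * of_real y)) - exp (- (z0 * of_real y))) / k" for k :: complex and y :: real
  have dqb: "norm (dq k y) \<le> 1 / \<rho>" if k: "k \<noteq> 0" "norm k < \<rho>" and y: "0 \<le> y" for k y
  proof -
    have "norm (exp (- ((z0 + k) * of_real y)) - exp (- (z0 * of_real y))) \<le> (1 / \<rho>) * norm ((z0 + k) - z0)"
    proof (rule field_differentiable_bound[where S = "{z. \<rho> \<le> Re z}" and f' = "\<lambda>z. - of_real y * exp (- (z * of_real y))"])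
      show "convex {z. \<rho> \<le> Re z}" using convex_halfspace_Re_ge[of \<rho>] by simp
      show "((\<lambda>z. exp (- (z * of_real y))) has_field_derivative - of_real y * exp (- (z * of_real y))) (at z within {z. \<rho> \<le> Re z})" for z
        by (auto intro!: derivative_eq_intros)
      fix z assume "z \<in> {z. \<rho> \<le> Re z}"
      then have z: "\<rho> \<le> Re z" by simp
      have "1 + \<rho> * y \<le> exp (\<rho> * y)" by (rule exp_ge_add_one_self)
      then have "\<rho> * y \<le> exp (\<rho> * y)" by linarith
      also have "\<dots> \<le> exp (Re z * y)" using z y by (simp add: mult_right_mono)
      finally have "y * exp (- (Re z * y)) \<le> 1 / \<rho>"
        using \<rho> by (simp add: exp_minus field_simps)
      then show "norm (- of_real y * exp (- (z * of_real y))) \<le> 1 / \<rho>" using y by (simp add: norm_mult)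
    next
      show "z0 \<in> {z. \<rho> \<le> Re z}" using \<rho> by (simp add: \<rho>_def)
      have "- norm k \<le> Re k" using complex_Re_le_cmod[of "- k"] by simp
      then show "z0 + k \<in> {z. \<rho> \<le> Re z}" using k by (simp add: \<rho>_def)
    qed
    then show ?thesis using k \<rho> by (simp add: dq_def norm_divide pos_divide_le_eq)
  qed
  have "((\<lambda>k. (L (z0 + k) - L z0) / k) \<longlongrightarrow> (LINT y|N. (- of_real y * exp (- (z0 * of_real y))) * of_real (g y))) (at 0)"
    unfolding tendsto_at_iff_sequentially
  proof (intro allI impI)
    fix K :: "nat \<Rightarrow> complex"
    assume K: "\<forall>n. K n \<in> UNIV - {0}" "K \<longlonglongrightarrow> 0"
    from order_tendstoD(2)[OF tendsto_norm_zero[OF K(2)] \<rho>] obtain n0 where n0: "\<And>n. n \<ge> n0 \<Longrightarrow> norm (K n) < \<rho>"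
      unfolding eventually_sequentially by blast
    have "(\<lambda>n. LINT y|N. dq (K (n + n0)) y * of_real (g y)) \<longlonglongrightarrow> (LINT y|N. (- of_real y * exp (- (z0 * of_real y))) * of_real (g y))"
    proof (rule integral_dominated_convergence[where w="\<lambda>y. (1 / \<rho>) * \<bar>g y\<bar>"])
      show "integrable N (\<lambda>y. (1 / \<rho>) * \<bar>g y\<bar>)" using g by simp
      show "AE y in N. norm (dq (K (n + n0)) y * of_real (g y)) \<le> (1 / \<rho>) * \<bar>g y\<bar>" for n
        using N(2)
      proof eventually_elim
        case (elim y)
        have "norm (dq (K (n + n0)) y) \<le> 1 / \<rho>" using K n0[of "n + n0"] elim by (intro dqb) auto
        then have "norm (dq (K (n + n0)) y) * \<bar>g y\<bar> \<le> (1 / \<rho>) * \<bar>g y\<bar>" by (rule mult_right_mono) simp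
        then show ?case by (simp only: norm_mult norm_of_real)
      qed
      show "AE y in N. (\<lambda>n. dq (K (n + n0)) y * of_real (g y)) \<longlonglongrightarrow> (- of_real y * exp (- (z0 * of_real y))) * of_real (g y)"
      proof (rule AE_I2)
        fix y
        have "((\<lambda>z. exp (- (z * of_real y))) has_field_derivative - of_real y * exp (- (z0 * of_real y))) (at z0)"
          by (auto intro!: derivative_eq_intros)
        then have "((\<lambda>k. dq k y) \<longlongrightarrow> - of_real y * exp (- (z0 * of_real y))) (at 0)"
          unfolding DERIV_def dq_def .
        then have "(\<lambda>n. dq (K n) y) \<longlonglongrightarrow> - of_real y * exp (- (z0 * of_real y))"
          using K unfolding tendsto_at_iff_sequentially by (auto simp: o_def)
        then show "(\<lambda>n. dq (K (n + n0)) y * of_real (g y)) \<longlonglongrightarrow> (- of_real y * exp (- (z0 * of_real y))) * of_real (g y)"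
          by (intro tendsto_mult tendsto_const LIMSEQ_ignore_initial_segment)
      qed
    qed (unfold dq_def, measurable)
    moreover have "(LINT y|N. dq (K (n + n0)) y * of_real (g y)) = (L (z0 + K (n + n0)) - L z0) / K (n + n0)" for n
    proof -
      have "- norm (K (n + n0)) \<le> Re (K (n + n0))" using complex_Re_le_cmod[of "- K (n + n0)"] by simp
      then have "0 \<le> Re (z0 + K (n + n0))" using n0[of "n + n0"] \<rho> by (simp add: \<rho>_def)
      from Bochner_Integration.integral_diff[OF int[OF this] int[of z0]]
      have "(L (z0 + K (n + n0)) - L z0) / K (n + n0) = (LINT y|N. exp (- ((z0 + K (n + n0)) * of_real y)) * of_real (g y) - exp (- (z0 * of_real y)) * of_real (g y)) / K (n + n0)"
        using \<rho> unfolding L_def by (simp add: \<rho>_def)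
      also have "\<dots> = (LINT y|N. dq (K (n + n0)) y * of_real (g y))"
        unfolding dq_def integral_divide_zero[symmetric]
        by (intro Bochner_Integration.integral_cong refl) (simp add: left_diff_distrib diff_divide_distrib)
      finally show ?thesis by simp
    qed
    ultimately have "(\<lambda>n. (L (z0 + K (n + n0)) - L z0) / K (n + n0)) \<longlonglongrightarrow> (LINT y|N. (- of_real y * exp (- (z0 * of_real y))) * of_real (g y))"
      by simp
    from LIMSEQ_offset[OF this]
    show "((\<lambda>k. (L (z0 + k) - L z0) / k) \<circ> K) \<longlonglongrightarrow> (LINT y|N. (- of_real y * exp (- (z0 * of_real y))) * of_real (g y))"
      by (simp add: o_def)
  qed
  then have "(L has_field_derivative (LINT y|N. (- of_real y * exp (- (z0 * of_real y))) * of_real (g y))) (at z0)"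
    unfolding DERIV_def .
  then show "(\<lambda>z. LINT y|N. exp (- (z * of_real y)) * of_real (g y)) field_differentiable at z0"
    unfolding L_def[abs_def] field_differentiable_def by blast
qed

text \<open>Extended by 0 to the left half plane the function is continuous across the imaginary
  axis, hence entire by pasting, and it vanishes on a nonempty open set.\<close>

lemma zero_on_half_plane:
  assumes hol: "H holomorphic_on {z. 0 < Re z}" and cont: "continuous_on {z. 0 \<le> Re z} H"
    and zero: "\<And>z. Re z = 0 \<Longrightarrow> H z = 0" and z: "0 \<le> Re z"
  shows "H z = 0"
proof -
  define f where "f z = (if 0 \<le> Re z then H z else 0)" for z
  have "continuous_on ({z. 0 \<le> Re z} \<union> {z. Re z \<le> 0}) f"
    unfolding f_def
    by (rule continuous_on_cases)
      (use cont zero in \<open>auto intro!: closed_halfspace_Re_ge closed_halfspace_Re_le\<close>)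
  moreover have "{z. 0 \<le> Re z} \<union> {z. Re z \<le> 0} = UNIV" by auto
  ultimately have fc: "continuous_on UNIV f" by simp
  have "f holomorphic_on UNIV"
  proof (rule holomorphic_on_paste_across_line[of UNIV "1::complex" _ 0])
    have "H holomorphic_on {z. 0 < 1 \<bullet> z}" using hol by (simp add: inner_complex_def)
    then show "f holomorphic_on UNIV \<inter> {z. 0 < 1 \<bullet> z}"
      unfolding Int_UNIV_left by (rule holomorphic_transform) (auto simp: f_def inner_complex_def)
    have "(\<lambda>_. 0) holomorphic_on {z :: complex. 1 \<bullet> z < 0}" by simp
    then show "f holomorphic_on UNIV \<inter> {z. 1 \<bullet> z < 0}"
      unfolding Int_UNIV_left by (rule holomorphic_transform) (auto simp: f_def inner_complex_def)
  qed (use fc in auto)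
  then have "f z = 0"
  proof (rule analytic_continuation[of f UNIV "{z. Re z < 0}" "-1" z])
    have "-1 \<in> {z. Re z < 0}" by simp
    then show "-1 islimpt {z. Re z < 0}"
      by (intro open_imp_islimpt) (auto intro: open_halfspace_Re_lt)
  qed (auto simp: f_def)
  then show ?thesis using z by (simp add: f_def)
qed

context spectrally_positive_stable
begin

text \<open>By Fubini the expectation is an integral over paths and times up to t of a function that
  is integrable over all times, so the cutoff can be removed.\<close>

lemma integral_occupation_limit:
  assumes q: "q > 0" and z: "0 \<le> Re z" and \<psi>: "Re \<psi> \<le> 0"
  shows "((\<lambda>t. LINT w|P. path_functional q x z \<psi> t w) \<longlongrightarrow>
      (LINT y|occupation q x. exp (- (z * of_real y)) * (\<psi> - of_real (q + y)))) (at_top :: real filter)"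
proof -
  define f where "f y = exp (- (z * of_real y)) * (\<psi> - of_real (q + y))" for y
  have fm [measurable]: "f \<in> borel_measurable borel" unfolding f_def[abs_def] by measurable
  have Xm: "(\<lambda>p. x + fst p (max 0 (snd p))) \<in> borel_measurable (P \<Otimes>\<^sub>M lborel)"
    by (intro borel_measurable_add borel_measurable_const eval_joint)
  have fXm: "(\<lambda>p. f (x + fst p (max 0 (snd p)))) \<in> borel_measurable (P \<Otimes>\<^sub>M lborel)"
    by (rule measurable_compose[OF Xm fm])
  have fi: "integrable (occupation q x) f"
  proof (rule Bochner_Integration.integrable_bound)
    interpret finite_measure "occupation q x" by (rule occupation_integrable(2)[OF q])
    show "integrable (occupation q x) (\<lambda>y. norm \<psi> + (q + y))"
      by (intro Bochner_Integration.integrable_add occupation_integrable(1)[OF q]) simp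
    show "f \<in> borel_measurable (occupation q x)" using sets_occupation by (simp cong: measurable_cong_sets)
    show "AE y in occupation q x. norm (f y) \<le> norm (norm \<psi> + (q + y))"
      using AE_occupation_nonneg
    proof eventually_elim
      case (elim y)
      have "norm (f y) = norm (exp (- (z * of_real y))) * norm (\<psi> - of_real (q + y))" by (simp only: f_def norm_mult)
      also have "\<dots> \<le> 1 * (norm \<psi> + norm (complex_of_real (q + y)))"
        by (intro mult_mono norm_triangle_ineq4) (use z elim in auto)
      also have "\<dots> = norm (norm \<psi> + (q + y))" using q elim unfolding norm_of_real by simp
      finally show ?case .
    qed
  qed
  define G where "G p = survival_density q x p *\<^sub>R f (x + fst p (max 0 (snd p)))" for p
  have Gm: "G \<in> borel_measurable (P \<Otimes>\<^sub>M lborel)"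
    unfolding G_def using survival_density_measurable fXm by measurable
  have Gi: "integrable (P \<Otimes>\<^sub>M lborel) G"
    using fi unfolding occupation_def G_def
    by (subst (asm) integrable_distr_eq, simp_all add: Xm)
      (subst (asm) integrable_density, auto simp: fXm survival_density_measurable survival_density_nonneg)
  have Gv: "(LINT y|occupation q x. f y) = (LINT p|(P \<Otimes>\<^sub>M lborel). G p)"
    unfolding occupation_def G_def
    by (subst integral_distr, simp_all add: Xm)
      (subst integral_density, auto simp: fXm survival_density_measurable survival_density_nonneg)
  have pf: "(LINT w|P. path_functional q x z \<psi> t w) = (LINT p|(P \<Otimes>\<^sub>M lborel). indicator {..t} (snd p) *\<^sub>R G p)" for t
  proof -
    have i: "integrable (P \<Otimes>\<^sub>M lborel) (\<lambda>p. indicator {..t} (snd p) *\<^sub>R G p)"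
    proof (rule Bochner_Integration.integrable_bound[OF Gi])
      have "(\<lambda>p. indicator {..t} (snd p) :: real) \<in> borel_measurable (P \<Otimes>\<^sub>M lborel)"
        unfolding measurable_P_lborel by measurable
      then show "(\<lambda>p. indicator {..t} (snd p) *\<^sub>R G p) \<in> borel_measurable (P \<Otimes>\<^sub>M lborel)" using Gm by measurable
    qed (auto simp: indicator_def)
    have "(LINT w|P. path_functional q x z \<psi> t w) = (LINT w|P. (LINT s|lborel. indicator {..t} s *\<^sub>R G (w, s)))"
      unfolding path_functional_def set_lebesgue_integral_def
      by (intro Bochner_Integration.integral_cong refl)
        (auto simp: G_def f_def survival_density_def indicator_def max_def scaleR_conv_of_real mult.assoc simp del: of_real_add)
    also have "\<dots> = (LINT p|(P \<Otimes>\<^sub>M lborel). indicator {..t} (snd p) *\<^sub>R G p)"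
      using pair_sigma_finite.integral_fst'[OF pair_P i] by simp
    finally show ?thesis .
  qed
  have "((\<lambda>t. LINT p|(P \<Otimes>\<^sub>M lborel). indicator {..t} (snd p) *\<^sub>R G p) \<longlongrightarrow> (LINT p|(P \<Otimes>\<^sub>M lborel). G p)) (at_top :: real filter)"
  proof (rule integral_dominated_convergence_at_top[where w="\<lambda>p. norm (G p)"])
    show "\<forall>\<^sub>F t in at_top. AE p in P \<Otimes>\<^sub>M lborel. norm (indicator {..t} (snd p) *\<^sub>R G p) \<le> norm (G p)"
      by (intro always_eventually allI AE_I2) (auto simp: indicator_def)
    show "AE p in P \<Otimes>\<^sub>M lborel. ((\<lambda>t. indicator {..t} (snd p) *\<^sub>R G p) \<longlongrightarrow> G p) at_top"
    proof (rule AE_I2, rule tendsto_eventually)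
      fix p
      show "\<forall>\<^sub>F t in at_top. indicator {..t} (snd p) *\<^sub>R G p = G p"
        using eventually_ge_at_top[of "snd p"] by eventually_elim simp
    qed
    show "(\<lambda>p. indicator {..t} (snd p) *\<^sub>R G p) \<in> borel_measurable (P \<Otimes>\<^sub>M lborel)" for t
    proof -
      have "(\<lambda>p. indicator {..t} (snd p) :: real) \<in> borel_measurable (P \<Otimes>\<^sub>M lborel)"
        unfolding measurable_P_lborel by measurable
      then show ?thesis using Gm by measurable
    qed
  qed (use Gm Gi in auto)
  then show ?thesis unfolding pf Gv[symmetric] f_def .
qed

text \<open>The discounted passage probability p, expressed as one minus the discount lost before
  passage, so that no passage time has to be introduced. It is the right-hand side of the identity
  at z = 0.\<close>

definition passage_transform :: "real \<Rightarrow> real \<Rightarrow> real" where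
  "passage_transform q x = 1 - (LINT y|occupation q x. q + y)"

text \<open>\<open>imaginary_core_bound\<close> compares the cases z and 0 up to 2 exp(-t q); both
  converge as t tends to infinity.\<close>

lemma occupation_core_imaginary:
  assumes q: "q > 0" and x: "x > 0" and z: "Re z = 0"
  shows "of_real (passage_transform q x) = exp (- (z * of_real x)) +
     (LINT y|occupation q x. exp (- (z * of_real y)) * (z powr of_real \<alpha> - of_real (q + y)))"
proof -
  define u where "u = Im z"
  have zu: "z = \<i> * of_real u" using z by (simp add: u_def complex_eq_iff)
  define \<psi> where "\<psi> = (\<i> * of_real u) powr of_real \<alpha>"
  have \<psi>: "Re \<psi> \<le> 0" unfolding \<psi>_def by (rule exponent_real_nonpos)
  have l0: "((\<lambda>t. LINT w|P. path_functional q x 0 0 t w) \<longlongrightarrow>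
      (LINT y|occupation q x. exp (- (0 * of_real y)) * (0 - of_real (q + y)))) (at_top :: real filter)"
    by (rule integral_occupation_limit[OF q]) auto
  have l1: "((\<lambda>t. LINT w|P. path_functional q x z \<psi> t w) \<longlongrightarrow>
      (LINT y|occupation q x. exp (- (z * of_real y)) * (\<psi> - of_real (q + y)))) (at_top :: real filter)"
    by (rule integral_occupation_limit[OF q]) (use z \<psi> in auto)
  have "((\<lambda>t. norm ((1 + (LINT w|P. path_functional q x 0 0 t w)) -
     (exp (- (z * of_real x)) + (LINT w|P. path_functional q x z \<psi> t w)))) \<longlongrightarrow>
     norm ((1 + (LINT y|occupation q x. exp (- (0 * of_real y)) * (0 - of_real (q + y)))) -
     (exp (- (z * of_real x)) + (LINT y|occupation q x. exp (- (z * of_real y)) * (\<psi> - of_real (q + y)))))) (at_top :: real filter)"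
    by (intro tendsto_intros l0 l1)
  moreover have "((\<lambda>t. norm ((1 + (LINT w|P. path_functional q x 0 0 t w)) -
     (exp (- (z * of_real x)) + (LINT w|P. path_functional q x z \<psi> t w)))) \<longlongrightarrow> 0) (at_top :: real filter)"
  proof (rule tendsto_sandwich[of "\<lambda>_. 0" _ _ "\<lambda>t. 2 * exp (- (t * q))"])
    show "((\<lambda>t. 2 * exp (- (t * q))) \<longlongrightarrow> 0) at_top" using q by real_asymp
    show "\<forall>\<^sub>F t in at_top. norm ((1 + (LINT w|P. path_functional q x 0 0 t w)) -
     (exp (- (z * of_real x)) + (LINT w|P. path_functional q x z \<psi> t w))) \<le> 2 * exp (- (t * q))"
      using eventually_gt_at_top[of 0]
    proof eventually_elim
      case (elim t)
      show ?case unfolding zu \<psi>_def by (rule imaginary_core_bound[OF elim q x])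
    qed
  qed auto
  ultimately have "norm ((1 + (LINT y|occupation q x. exp (- (0 * of_real y)) * (0 - of_real (q + y)))) -
     (exp (- (z * of_real x)) + (LINT y|occupation q x. exp (- (z * of_real y)) * (\<psi> - of_real (q + y))))) = 0"
    by (rule tendsto_unique[OF trivial_limit_at_top_linorder])
  moreover have "(LINT y|occupation q x. exp (- (0 * of_real y)) * (0 - of_real (q + y))) = complex_of_real (- (LINT y|occupation q x. q + y))"
    unfolding integral_complex_of_real[symmetric] Bochner_Integration.integral_minus[symmetric]
    by (intro Bochner_Integration.integral_cong) auto
  ultimately show ?thesis unfolding passage_transform_def zu \<psi>_def by simp
qed

text \<open>The difference of the two sides is built from the Laplace transforms of 1 and of q + y
  under \<nu>, both integrable; hence it is continuous on the closed half plane, holomorphic inside,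
  and zero on the boundary.\<close>

lemma occupation_core:
  assumes q: "q > 0" and x: "x > 0" and z: "0 \<le> Re z"
  shows "of_real (passage_transform q x) = exp (- (z * of_real x)) +
     (LINT y|occupation q x. exp (- (z * of_real y)) * (z powr of_real \<alpha> - of_real (q + y)))"
proof -
  interpret fin: finite_measure "occupation q x" by (rule occupation_integrable(2)[OF q])
  define L where "L g z = (LINT y|occupation q x. exp (- (z * of_real y)) * of_real (g y))" for g :: "real \<Rightarrow> real" and z :: complex
  have i1: "integrable (occupation q x) (\<lambda>_. 1::real)" by simp
  note i2 = occupation_integrable(1)[OF q, of x]
  have Li: "integrable (occupation q x) (\<lambda>y. exp (- (z * of_real y)) * of_real (g y))"
    if g: "integrable (occupation q x) g" and z: "0 \<le> Re z" for g :: "real \<Rightarrow> real" and z :: complex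
  proof (rule Bochner_Integration.integrable_bound[OF g])
    show "(\<lambda>y. exp (- (z * of_real y)) * of_real (g y)) \<in> borel_measurable (occupation q x)"
      using borel_measurable_integrable[OF g] sets_occupation by (simp cong: measurable_cong_sets)
    show "AE y in occupation q x. norm (exp (- (z * of_real y)) * of_real (g y)) \<le> norm (g y)"
      using AE_occupation_nonneg
    proof eventually_elim
      case (elim y)
      have "norm (exp (- (z * of_real y))) \<le> 1" using z elim by simp
      then have "norm (exp (- (z * of_real y))) * \<bar>g y\<bar> \<le> 1 * \<bar>g y\<bar>" by (rule mult_right_mono) simp
      then show ?case by (simp only: norm_mult norm_of_real mult_1_left real_norm_def)
    qed
  qed
  have split: "(LINT y|occupation q x. exp (- (z * of_real y)) * (z powr of_real \<alpha> - of_real (q + y))) =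
      z powr of_real \<alpha> * L (\<lambda>_. 1) z - L (\<lambda>y. q + y) z" if "0 \<le> Re z" for z :: complex
  proof -
    have "(LINT y|occupation q x. exp (- (z * of_real y)) * (z powr of_real \<alpha> - of_real (q + y))) =
       (LINT y|occupation q x. z powr of_real \<alpha> * (exp (- (z * of_real y)) * of_real 1) - exp (- (z * of_real y)) * of_real (q + y))"
      by (intro Bochner_Integration.integral_cong) (auto simp: algebra_simps)
    also have "\<dots> = z powr of_real \<alpha> * L (\<lambda>_. 1) z - L (\<lambda>y. q + y) z"
      unfolding L_def by (subst Bochner_Integration.integral_diff) (use Li[OF i1 that] Li[OF i2 that] in auto)
    finally show ?thesis .
  qed
  define H where "H z = of_real (passage_transform q x) - exp (- (z * of_real x)) - (z powr of_real \<alpha> * L (\<lambda>_. 1) z - L (\<lambda>y. q + y) z)" for z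
  have "H z = 0"
  proof (rule zero_on_half_plane[OF _ _ _ z])
    show "H holomorphic_on {z. 0 < Re z}"
      unfolding H_def L_def
      by (intro holomorphic_intros laplace_transform_holomorphic sets_occupation AE_occupation_nonneg i1 i2)
        (auto simp: complex_nonpos_Reals_iff)
    show "continuous_on {z. 0 \<le> Re z} H"
      unfolding H_def L_def
      by (intro continuous_intros laplace_transform_continuous sets_occupation AE_occupation_nonneg i1 i2)
        (use \<alpha> in auto)
    fix z :: complex assume "Re z = 0"
    then show "H z = 0" using occupation_core_imaginary[OF q x, of z] split[of z] by (simp add: H_def)
  qed
  moreover have "A - B - C = 0 \<Longrightarrow> A = B + C" for A B C :: complex by (simp add: algebra_simps)
  ultimately show ?thesis unfolding split[OF z] H_def by blast
qed

end

section \<open>The passage transform\<close>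

context spectrally_positive_stable
begin

text \<open>The identity is integrated along direction c against a weight and the order of
  integration is exchanged. It is used twice: with the Airy weight on the ray, and with exp(-q r) on
  the positive axis.\<close>

lemma occupation_core_integrated:
  fixes c :: complex and k :: "real \<Rightarrow> complex"
  assumes q: "q > 0" and x: "x > 0" and c: "0 \<le> Re c"
    and km [measurable]: "k \<in> borel_measurable borel" and k: "set_integrable lborel {0..} k"
    and k\<alpha>: "set_integrable lborel {0..} (\<lambda>r. (of_real r * c) powr of_real \<alpha> * k r)"
  shows "of_real (passage_transform q x) * (LINT r:{0..}|lborel. k r) =
     (LINT r:{0..}|lborel. exp (- (of_real (x * r) * c)) * k r) +
     (LINT y|occupation q x. (LINT r:{0..}|lborel. ((of_real r * c) powr of_real \<alpha> - of_real (q + y)) * exp (- (of_real (y * r) * c)) * k r))"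
proof -
  interpret fin: finite_measure "occupation q x" by (rule occupation_integrable(2)[OF q])
  interpret pr: pair_sigma_finite "occupation q x" lborel by unfold_locales
  note [measurable_cong] = sets_occupation(1)
  define F where "F y r = indicator {0..} r *\<^sub>R (((of_real r * c) powr of_real \<alpha> - of_real (q + y)) * exp (- (of_real (y * r) * c)) * k r)" for y r
  have Fm: "case_prod F \<in> borel_measurable (occupation q x \<Otimes>\<^sub>M lborel)"
    unfolding F_def by measurable
  have nexp: "norm (exp (- (of_real (y * r) * c))) \<le> 1" if "0 \<le> y" "0 \<le> r" for y r
    using that c by simp
  \<comment> \<open>The bound is affine in y, hence integrable under \<nu>, whose mass and first
    moment are finite.\<close>
  have nF: "norm (F y r) \<le> indicator {0..} r * norm ((of_real r * c) powr of_real \<alpha> * k r) + (q + y) * (indicator {0..} r * norm (k r))"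
    if y: "0 \<le> y" for y r
  proof (cases "0 \<le> r")
    case True
    have "norm (F y r) = norm ((of_real r * c) powr of_real \<alpha> - of_real (q + y)) * norm (exp (- (of_real (y * r) * c))) * norm (k r)"
      using True by (simp only: F_def norm_mult norm_scaleR indicator_def) simp
    also have "\<dots> \<le> (norm ((of_real r * c) powr of_real \<alpha>) + norm (complex_of_real (q + y))) * 1 * norm (k r)"
      by (intro mult_right_mono mult_mono norm_triangle_ineq4 nexp True y) auto
    also have "\<dots> = norm ((of_real r * c) powr of_real \<alpha> * k r) + (q + y) * norm (k r)"
      using y q unfolding norm_of_real norm_mult by (simp add: distrib_right)
    finally show ?thesis using True by simp
  qed (simp add: F_def)
  have ki: "integrable lborel (\<lambda>r. indicator {0..} r * norm (k r))"
    using integrable_norm[OF k[unfolded set_integrable_def]] by simp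
  have k\<alpha>i: "integrable lborel (\<lambda>r. indicator {0..} r * norm ((of_real r * c) powr of_real \<alpha> * k r))"
    using integrable_norm[OF k\<alpha>[unfolded set_integrable_def]] by simp
  have Fr: "integrable lborel (F y)" if y: "0 \<le> y" for y
  proof (rule Bochner_Integration.integrable_bound)
    show "integrable lborel (\<lambda>r. indicator {0..} r * norm ((of_real r * c) powr of_real \<alpha> * k r) + (q + y) * (indicator {0..} r * norm (k r)))"
      using ki k\<alpha>i by simp
    show "F y \<in> borel_measurable lborel" unfolding F_def by measurable
    show "AE r in lborel. norm (F y r) \<le> norm (indicator {0..} r * norm ((of_real r * c) powr of_real \<alpha> * k r) + (q + y) * (indicator {0..} r * norm (k r)))"
      using nF[OF y] by (intro AE_I2) (smt (verit) real_norm_def)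
  qed
  have Fi: "integrable (occupation q x \<Otimes>\<^sub>M lborel) (case_prod F)"
  proof (rule pr.Fubini_integrable[OF Fm])
    show "AE y in occupation q x. integrable lborel (\<lambda>r. case_prod F (y, r))"
      using AE_occupation_nonneg by eventually_elim (use Fr in simp)
    show "integrable (occupation q x) (\<lambda>y. LINT r|lborel. norm (case_prod F (y, r)))"
    proof (rule Bochner_Integration.integrable_bound)
      show "integrable (occupation q x) (\<lambda>y. (LINT r|lborel. indicator {0..} r * norm ((of_real r * c) powr of_real \<alpha> * k r)) +
          (q + y) * (LINT r|lborel. indicator {0..} r * norm (k r)))"
        by (intro Bochner_Integration.integrable_add integrable_mult_left occupation_integrable(1)[OF q]) simp
      have "(\<lambda>(y, r). norm (F y r)) \<in> borel_measurable (occupation q x \<Otimes>\<^sub>M lborel)"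
        using measurable_compose[OF Fm, of norm borel] by (simp add: case_prod_beta)
      from lborel.borel_measurable_lebesgue_integral[OF this]
      show "(\<lambda>y. LINT r|lborel. norm (case_prod F (y, r))) \<in> borel_measurable (occupation q x)" by simp
      show "AE y in occupation q x. norm (LINT r|lborel. norm (case_prod F (y, r))) \<le>
         norm ((LINT r|lborel. indicator {0..} r * norm ((of_real r * c) powr of_real \<alpha> * k r)) +
          (q + y) * (LINT r|lborel. indicator {0..} r * norm (k r)))"
        using AE_occupation_nonneg
      proof eventually_elim
        case (elim y)
        have "(LINT r|lborel. norm (F y r)) \<le> (LINT r|lborel. indicator {0..} r * norm ((of_real r * c) powr of_real \<alpha> * k r) + (q + y) * (indicator {0..} r * norm (k r)))"
          by (rule integral_mono) (use Fr[OF elim] ki k\<alpha>i nF[OF elim] in auto)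
        also have "\<dots> = (LINT r|lborel. indicator {0..} r * norm ((of_real r * c) powr of_real \<alpha> * k r)) +
          (q + y) * (LINT r|lborel. indicator {0..} r * norm (k r))"
          using ki k\<alpha>i by simp
        finally have "(LINT r|lborel. norm (F y r)) \<le> \<dots>" .
        moreover have "0 \<le> (LINT r|lborel. norm (F y r))" by simp
        ultimately show ?case by simp
      qed
    qed
  qed
  have "(LINT y|occupation q x. (LINT r:{0..}|lborel. ((of_real r * c) powr of_real \<alpha> - of_real (q + y)) * exp (- (of_real (y * r) * c)) * k r)) =
      (LINT y|occupation q x. (LINT r|lborel. F y r))"
    unfolding set_lebesgue_integral_def F_def ..
  also have "\<dots> = (LINT r|lborel. (LINT y|occupation q x. F y r))"
    by (rule pr.Fubini_integral[OF Fi, symmetric])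
  also have "\<dots> = (LINT r:{0..}|lborel. (of_real (passage_transform q x) - exp (- (of_real (x * r) * c))) * k r)"
    unfolding set_lebesgue_integral_def
  proof (intro Bochner_Integration.integral_cong refl)
    fix r :: real
    show "(LINT y|occupation q x. F y r) = indicator {0..} r *\<^sub>R ((of_real (passage_transform q x) - exp (- (of_real (x * r) * c))) * k r)"
    proof (cases "0 \<le> r")
      case True
      have "(LINT y|occupation q x. F y r) = (LINT y|occupation q x. (exp (- ((of_real r * c) * of_real y)) * ((of_real r * c) powr of_real \<alpha> - of_real (q + y))) * k r)"
        using True unfolding F_def by (intro Bochner_Integration.integral_cong refl) (simp add: mult_ac)
      also have "\<dots> = (LINT y|occupation q x. exp (- ((of_real r * c) * of_real y)) * ((of_real r * c) powr of_real \<alpha> - of_real (q + y))) * k r"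
        by simp
      also have "(LINT y|occupation q x. exp (- ((of_real r * c) * of_real y)) * ((of_real r * c) powr of_real \<alpha> - of_real (q + y))) =
          of_real (passage_transform q x) - exp (- ((of_real r * c) * of_real x))"
        using occupation_core[OF q x, of "of_real r * c"] True c by simp
      finally show ?thesis using True by (simp add: mult_ac)
    qed (simp add: F_def)
  qed
  also have "\<dots> = (LINT r:{0..}|lborel. of_real (passage_transform q x) * k r) - (LINT r:{0..}|lborel. exp (- (of_real (x * r) * c)) * k r)"
    unfolding left_diff_distrib
  proof (rule set_integral_diff(2))
    show "set_integrable lborel {0..} (\<lambda>r. of_real (passage_transform q x) * k r)" using k by simp
    show "set_integrable lborel {0..} (\<lambda>r. exp (- (of_real (x * r) * c)) * k r)"
    proof (rule set_integrable_bound[OF k])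
      show "AE r in lborel. r \<in> {0..} \<longrightarrow> norm (exp (- (of_real (x * r) * c)) * k r) \<le> norm (k r)"
      proof (intro AE_I2 impI)
        fix r :: real assume "r \<in> {0..}"
        then have "norm (exp (- (of_real (x * r) * c))) * norm (k r) \<le> 1 * norm (k r)"
          using x by (intro mult_right_mono nexp) auto
        then show "norm (exp (- (of_real (x * r) * c)) * k r) \<le> norm (k r)" by (simp only: norm_mult mult_1_left)
      qed
    qed (auto simp: set_borel_measurable_def)
  qed
  also have "(LINT r:{0..}|lborel. of_real (passage_transform q x) * k r) = of_real (passage_transform q x) * (LINT r:{0..}|lborel. k r)"
    by (rule set_integral_mult_right)
  finally show ?thesis by (simp add: algebra_simps)
qed

definition occupation_mass :: "real \<Rightarrow> real \<Rightarrow> real" where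
  "occupation_mass q x = measure (occupation q x) UNIV"

lemma integral_occupation_const:
  assumes q: "q > 0"
  shows "(LINT y|occupation q x. c) = occupation_mass q x *\<^sub>R (c :: 'b :: {banach, second_countable_topology})"
  by (simp add: occupation_mass_def sets_occupation)

text \<open>The factor exp(-q r c) of the weight merges with exp(-y r c), so the inner integral is
  that of \<open>airy_W_kernel\<close> at s = q + y. It is -1 for every y, and \<nu> enters through
  its mass alone.\<close>

lemma passage_transform_airy:
  assumes q: "q > 0" and x: "x > 0"
  shows "of_real (passage_transform q x) * airy_W \<alpha> q = airy_W \<alpha> (x + q) - of_real (occupation_mass q x)"
proof -
  define c where "c = airy_ray \<alpha>"
  define k where "k r = exp (- (of_real (q * r) * c)) * (c * of_real (airy_weight \<alpha> r))" for r
  have nc: "norm c = 1" by (simp add: c_def airy_ray_def)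
  have "0 \<le> pi / (1 + \<alpha>)" "pi / (1 + \<alpha>) \<le> pi / 2" using \<alpha> by (auto simp: divide_simps)
  then have Rec: "0 \<le> Re c" unfolding c_def airy_ray_def by (auto intro!: cos_ge_zero)
  have km: "k \<in> borel_measurable borel" unfolding k_def[abs_def] by measurable
  have nk: "norm (k r) \<le> airy_weight \<alpha> r" if "0 \<le> r" for r
  proof -
    have "norm (exp (- (of_real (q * r) * c))) \<le> 1" using that q Rec by simp
    then have "norm (exp (- (of_real (q * r) * c))) * airy_weight \<alpha> r \<le> 1 * airy_weight \<alpha> r"
      by (rule mult_right_mono) (rule airy_weight_pos)
    then show ?thesis unfolding k_def norm_mult nc norm_of_real abs_of_nonneg[OF airy_weight_pos(2)] by simp
  qed
  have ki: "set_integrable lborel {0..} k"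
    by (rule set_integrable_bound[OF airy_weight_integrable(1)[OF \<alpha>]])
      (use km nk airy_weight_pos in \<open>auto intro!: AE_I2 simp: set_borel_measurable_def\<close>)
  have k\<alpha>i: "set_integrable lborel {0..} (\<lambda>r. (of_real r * c) powr of_real \<alpha> * k r)"
  proof (rule set_integrable_bound[OF airy_weight_integrable(2)[OF \<alpha>]])
    show "AE r in lborel. r \<in> {0..} \<longrightarrow> norm ((of_real r * c) powr of_real \<alpha> * k r) \<le> norm (r powr \<alpha> * airy_weight \<alpha> r)"
    proof (intro AE_I2 impI)
      fix r :: real assume "r \<in> {0..}"
      then have r: "0 \<le> r" by simp
      have "norm ((of_real r * c) powr of_real \<alpha>) = r powr \<alpha>"
      proof (cases "r = 0")
        case False
        then have "norm ((of_real r * c) powr of_real \<alpha> * c) = norm (- complex_of_real (r powr \<alpha>))"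
          using airy_ray_powr[OF \<alpha>(1), of r] r unfolding c_def by simp
        then show ?thesis by (simp add: norm_mult nc)
      qed simp
      then show "norm ((of_real r * c) powr of_real \<alpha> * k r) \<le> norm (r powr \<alpha> * airy_weight \<alpha> r)"
        using nk[OF r] airy_weight_pos(2)[of \<alpha> r] by (simp add: norm_mult abs_mult mult_left_mono)
    qed
  qed (use km in \<open>auto simp: set_borel_measurable_def\<close>)
  have "of_real (passage_transform q x) * (LINT r:{0..}|lborel. k r) =
     (LINT r:{0..}|lborel. exp (- (of_real (x * r) * c)) * k r) +
     (LINT y|occupation q x. (LINT r:{0..}|lborel. ((of_real r * c) powr of_real \<alpha> - of_real (q + y)) * exp (- (of_real (y * r) * c)) * k r))"
    by (rule occupation_core_integrated[OF q x Rec km ki k\<alpha>i])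
  also have "(LINT r:{0..}|lborel. k r) = airy_W \<alpha> q"
    unfolding airy_W_def k_def c_def ..
  also have "(LINT r:{0..}|lborel. exp (- (of_real (x * r) * c)) * k r) = airy_W \<alpha> (x + q)"
    unfolding airy_W_def k_def c_def
    by (intro set_lebesgue_integral_cong) (auto simp: distrib_right exp_add exp_diff exp_minus field_simps)
  also have "(LINT y|occupation q x. (LINT r:{0..}|lborel. ((of_real r * c) powr of_real \<alpha> - of_real (q + y)) * exp (- (of_real (y * r) * c)) * k r)) =
      (LINT y|occupation q x. -1)"
  proof (rule integral_cong_AE)
    show "AE y in occupation q x. (LINT r:{0..}|lborel. ((of_real r * c) powr of_real \<alpha> - of_real (q + y)) * exp (- (of_real (y * r) * c)) * k r) = -1"
      using AE_occupation_nonneg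
    proof eventually_elim
      case (elim y)
      have "exp (- (of_real (y * r) * c)) * exp (- (of_real (q * r) * c)) = exp (- (of_real ((q + y) * r) * c))" for r
        unfolding exp_add[symmetric] by (simp add: algebra_simps)
      then have "((of_real r * c) powr of_real \<alpha> - of_real (q + y)) * exp (- (of_real (y * r) * c)) * k r =
          ((of_real r * c) powr of_real \<alpha> - of_real (q + y)) * exp (- (of_real ((q + y) * r) * c)) * (c * of_real (airy_weight \<alpha> r))" for r
        unfolding k_def by (simp only: mult.assoc[symmetric]) (simp only: mult.assoc)
      then have "(LINT r:{0..}|lborel. ((of_real r * c) powr of_real \<alpha> - of_real (q + y)) * exp (- (of_real (y * r) * c)) * k r) =
          (LINT r:{0..}|lborel. ((of_real r * c) powr of_real \<alpha> - of_real (q + y)) * exp (- (of_real ((q + y) * r) * c)) * (c * of_real (airy_weight \<alpha> r)))"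
        by (simp only:)
      then show ?case using airy_W_kernel[OF \<alpha>, of "q + y"] elim q unfolding c_def[symmetric] by (simp only: add_nonneg_nonneg less_imp_le)
    qed
    have [measurable]: "k \<in> borel_measurable borel" by (rule km)
    note [measurable_cong] = sets_occupation(1)
    show "(\<lambda>y. LINT r:{0..}|lborel. ((of_real r * c) powr of_real \<alpha> - of_real (q + y)) * exp (- (of_real (y * r) * c)) * k r) \<in> borel_measurable (occupation q x)"
      unfolding set_lebesgue_integral_def by measurable
  qed simp
  also have "\<dots> = - of_real (occupation_mass q x)"
    unfolding integral_occupation_const[OF q] by (simp add: scaleR_conv_of_real)
  finally show ?thesis by simp
qed

section \<open>Real arguments: barriers for the passage transform and explicit formulas\<close>

lemma occupation_core_real:
  assumes q: "q > 0" and x: "x > 0" and z: "0 \<le> z"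
  shows "passage_transform q x = exp (- (z * x)) + (LINT y|occupation q x. exp (- (z * y)) * (z powr \<alpha> - (q + y)))"
proof -
  have "complex_of_real (passage_transform q x) = exp (- (of_real z * of_real x)) +
     (LINT y|occupation q x. exp (- (of_real z * of_real y)) * (of_real z powr of_real \<alpha> - of_real (q + y)))"
    by (rule occupation_core[OF q x]) (use z in simp)
  also have "(LINT y|occupation q x. exp (- (complex_of_real z * of_real y)) * (of_real z powr of_real \<alpha> - of_real (q + y))) =
      (LINT y|occupation q x. complex_of_real (exp (- (z * y)) * (z powr \<alpha> - (q + y))))"
    using z by (intro Bochner_Integration.integral_cong) (auto simp: powr_of_real exp_of_real[symmetric])
  also have "\<dots> = of_real (LINT y|occupation q x. exp (- (z * y)) * (z powr \<alpha> - (q + y)))" by (rule integral_complex_of_real)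
  also have "exp (- (complex_of_real z * of_real x)) = of_real (exp (- (z * x)))" by (simp add: exp_of_real[symmetric])
  finally show ?thesis unfolding of_real_add[symmetric] of_real_eq_iff .
qed

lemma occupation_real_integrable:
  assumes q: "q > 0" and z: "0 \<le> z"
  shows "integrable (occupation q x) (\<lambda>y. exp (- (z * y)) * (z powr \<alpha> - (q + y)))"
proof (rule Bochner_Integration.integrable_bound)
  interpret fin: finite_measure "occupation q x" by (rule occupation_integrable(2)[OF q])
  show "integrable (occupation q x) (\<lambda>y. z powr \<alpha> + (q + y))"
    by (intro Bochner_Integration.integrable_add occupation_integrable(1)[OF q]) simp
  show "(\<lambda>y. exp (- (z * y)) * (z powr \<alpha> - (q + y))) \<in> borel_measurable (occupation q x)"
    using sets_occupation by (simp cong: measurable_cong_sets)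
  show "AE y in occupation q x. norm (exp (- (z * y)) * (z powr \<alpha> - (q + y))) \<le> norm (z powr \<alpha> + (q + y))"
    using AE_occupation_nonneg
  proof eventually_elim
    case (elim y)
    have "\<bar>exp (- (z * y))\<bar> * \<bar>z powr \<alpha> - (q + y)\<bar> \<le> 1 * (z powr \<alpha> + (q + y))"
      using z elim q by (intro mult_mono) (auto simp: abs_le_iff)
    also have "\<dots> \<le> \<bar>z powr \<alpha> + (q + y)\<bar>" by simp
    finally show ?case by (simp only: abs_mult real_norm_def)
  qed
qed

text \<open>At z = q^(1/\<alpha>) the factor z^\<alpha> - q - y reduces to -y, so the integral is
  nonpositive.\<close>

lemma passage_transform_upper:
  assumes q: "q > 0" and x: "x > 0"
  shows "passage_transform q x \<le> exp (- (q powr (1 / \<alpha>) * x))"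
proof -
  have "(q powr (1 / \<alpha>)) powr \<alpha> = q" using q \<alpha> by (simp add: powr_powr)
  then have "passage_transform q x = exp (- (q powr (1 / \<alpha>) * x)) + (LINT y|occupation q x. exp (- (q powr (1 / \<alpha>) * y)) * (q - (q + y)))"
    using occupation_core_real[OF q x, of "q powr (1 / \<alpha>)"] by simp
  moreover have "0 \<le> (LINT y|occupation q x. exp (- (q powr (1 / \<alpha>) * y)) * y)"
    by (rule integral_nonneg_AE) (use AE_occupation_nonneg in eventually_elim, simp)
  then have "(LINT y|occupation q x. exp (- (q powr (1 / \<alpha>) * y)) * (q - (q + y))) \<le> 0" by simp
  ultimately show ?thesis by linarith
qed

text \<open>The function y \<mapsto> exp(-ay) - exp(-ad), with d = a^\<alpha> - q, is a subsolution of the equation solved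
  by the passage transform.\<close>

lemma passage_transform_lower:
  assumes q: "q > 0" and x: "x > 0" and a: "a > 0" "q < a powr \<alpha>"
  shows "exp (- (a * x)) - exp (- (a * (a powr \<alpha> - q))) \<le> passage_transform q x * (1 - exp (- (a * (a powr \<alpha> - q))))"
proof -
  define d where "d = a powr \<alpha> - q"
  have d: "d > 0" using a by (simp add: d_def)
  define e where "e = exp (- (a * d))"
  have I: "0 \<le> (LINT y|occupation q x. exp (- (a * y)) * (a powr \<alpha> - (q + y)) - e * (exp (- (0 * y)) * (0 powr \<alpha> - (q + y))))"
  proof (rule integral_nonneg_AE)
    show "AE y in occupation q x. 0 \<le> exp (- (a * y)) * (a powr \<alpha> - (q + y)) - e * (exp (- (0 * y)) * (0 powr \<alpha> - (q + y)))"
      using AE_occupation_nonneg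
    proof eventually_elim
      case (elim y)
      have e0: "0 < e" by (simp add: e_def)
      \<comment> \<open>Up to d both terms are nonnegative; beyond d one has exp(-ay) \<le> e and y
        - d \<le> q + y.\<close>
      have "0 \<le> exp (- (a * y)) * (d - y) + e * (q + y)"
      proof (cases "y \<le> d")
        case True then show ?thesis using elim q e0 by (intro add_nonneg_nonneg mult_nonneg_nonneg) auto
      next
        case False
        then have "exp (- (a * y)) \<le> e" using a by (simp add: e_def)
        then have "exp (- (a * y)) * (y - d) \<le> e * (q + y)"
          using False d q e0 by (intro mult_mono) auto
        then show ?thesis by (simp add: algebra_simps)
      qed
      then show ?case using \<alpha> by (simp add: d_def algebra_simps)
    qed
  qed
  \<comment> \<open>The identity at z = a minus e times the identity at z = 0.\<close>
  have "passage_transform q x * (1 - e) = passage_transform q x - e * passage_transform q x" by (simp add: algebra_simps)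
  also have "\<dots> = (exp (- (a * x)) + (LINT y|occupation q x. exp (- (a * y)) * (a powr \<alpha> - (q + y)))) -
      e * (exp (- (0 * x)) + (LINT y|occupation q x. exp (- (0 * y)) * (0 powr \<alpha> - (q + y))))"
    using occupation_core_real[OF q x, of a] occupation_core_real[OF q x, of 0] a by simp
  also have "\<dots> = exp (- (a * x)) - e +
      (LINT y|occupation q x. exp (- (a * y)) * (a powr \<alpha> - (q + y)) - e * (exp (- (0 * y)) * (0 powr \<alpha> - (q + y))))"
  proof -
    have i: "integrable (occupation q x) (\<lambda>y. exp (- (a * y)) * (a powr \<alpha> - (q + y)))"
      "integrable (occupation q x) (\<lambda>y. exp (- (0 * y)) * (0 powr \<alpha> - (q + y)))"
      using a by (intro occupation_real_integrable[OF q]; simp)+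
    have "(LINT y|occupation q x. exp (- (a * y)) * (a powr \<alpha> - (q + y)) - e * (exp (- (0 * y)) * (0 powr \<alpha> - (q + y)))) =
       (LINT y|occupation q x. exp (- (a * y)) * (a powr \<alpha> - (q + y))) - e * (LINT y|occupation q x. exp (- (0 * y)) * (0 powr \<alpha> - (q + y)))"
      by (simp only: Bochner_Integration.integral_diff[OF i(1) integrable_mult_right[OF i(2)]] integral_mult_right_zero)
    then show ?thesis by (simp add: algebra_simps)
  qed
  finally show ?thesis using I unfolding e_def d_def by linarith
qed

text \<open>The barrier is used with a^\<alpha> = q + x + 1: it then vanishes at height x + 1 and is
  positive at the starting point x.\<close>

lemma passage_transform_pos:
  assumes q: "q > 0" and x: "x > 0"
  shows "passage_transform q x > 0"
proof -
  define a where "a = (q + x + 1) powr (1 / \<alpha>)"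
  have a: "a > 0" "a powr \<alpha> = q + x + 1" using q x \<alpha> by (auto simp: a_def powr_powr)
  have "exp (- (a * (x + 1))) < exp (- (a * x))" using a by simp
  moreover have "exp (- (a * x)) - exp (- (a * (x + 1))) \<le> passage_transform q x * (1 - exp (- (a * (x + 1))))"
    using passage_transform_lower[OF q x a(1)] a x by (simp add: add.assoc)
  ultimately have "0 < passage_transform q x * (1 - exp (- (a * (x + 1))))" by linarith
  moreover have "0 < 1 - exp (- (a * (x + 1)))" using a x by simp
  ultimately show ?thesis by (rule zero_less_mult_pos2)
qed

lemma passage_transform_Phi_product:
  assumes q: "q > 0" and x: "x > 0"
  shows "passage_transform q x * Phi \<alpha> q = Phi \<alpha> (x + q)"
    and "passage_transform q x * (pi * Psi \<alpha> q) = pi * Psi \<alpha> (x + q) - occupation_mass q x"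
  using arg_cong[OF passage_transform_airy[OF q x], of Im] arg_cong[OF passage_transform_airy[OF q x], of Re]
    airy_W_Phi_Psi[OF \<alpha>] by auto

text \<open>By the product formula a zero at q would spread over the positive axis: upward directly,
  downward because the passage transform is positive. Continuity would carry it to 0, where
  \<open>Phi\<close> is positive.\<close>

lemma Phi_nonzero:
  assumes q: "q > 0"
  shows "Phi \<alpha> q \<noteq> 0"
proof
  assume 0: "Phi \<alpha> q = 0"
  have "Phi \<alpha> y = 0" if y: "y > 0" for y
  proof (cases y q rule: linorder_cases)
    case less
    then show ?thesis using passage_transform_Phi_product(1)[OF y, of "q - y"] passage_transform_pos[OF y, of "q - y"] 0 by auto
  next
    case greater
    then show ?thesis using passage_transform_Phi_product(1)[OF q, of "y - q"] 0 by auto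
  qed (use 0 in simp)
  then have "\<forall>\<^sub>F y in at_right 0. Phi \<alpha> y = 0"
    by (auto simp: eventually_at_right_field intro: exI[of _ 1])
  then have "(Phi \<alpha> \<longlongrightarrow> 0) (at_right 0)" by (rule tendsto_eventually)
  moreover have "isCont (Phi \<alpha>) 0" by (rule DERIV_isCont[OF Phi_Psi_differentiable(1)[OF \<alpha>]])
  then have "(Phi \<alpha> \<longlongrightarrow> Phi \<alpha> 0) (at_right 0)"
    unfolding isCont_def filterlim_at_split by blast
  ultimately have "Phi \<alpha> 0 = 0" using tendsto_unique[OF trivial_limit_at_right_real] by blast
  then show False using Phi_zero_pos[OF \<alpha>] by simp
qed

lemma passage_transform_Phi:
  assumes q: "q > 0" and x: "x > 0"
  shows "passage_transform q x = Phi \<alpha> (x + q) / Phi \<alpha> q"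
    and "occupation_mass q x = pi * Psi \<alpha> (x + q) - pi * Psi \<alpha> q * (Phi \<alpha> (x + q) / Phi \<alpha> q)"
proof -
  show p: "passage_transform q x = Phi \<alpha> (x + q) / Phi \<alpha> q"
    using passage_transform_Phi_product(1)[OF q x] Phi_nonzero[OF q] by (simp add: field_simps)
  show "occupation_mass q x = pi * Psi \<alpha> (x + q) - pi * Psi \<alpha> q * (Phi \<alpha> (x + q) / Phi \<alpha> q)"
    using passage_transform_Phi_product(2)[OF q x] unfolding p by (simp add: algebra_simps)
qed

definition occupation_mean :: "real \<Rightarrow> real \<Rightarrow> real" where
  "occupation_mean q x = (LINT y|occupation q x. y)"

lemma occupation_id_integrable:
  assumes q: "q > 0"
  shows "integrable (occupation q x) (\<lambda>y. y)"
proof -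
  interpret fin: finite_measure "occupation q x" by (rule occupation_integrable(2)[OF q])
  have "integrable (occupation q x) (\<lambda>y. (q + y) - q)"
    by (intro Bochner_Integration.integrable_diff occupation_integrable(1)[OF q]) simp
  then show ?thesis by simp
qed

lemma occupation_mean_eq:
  assumes q: "q > 0"
  shows "occupation_mean q x = 1 - passage_transform q x - q * occupation_mass q x"
proof -
  interpret fin: finite_measure "occupation q x" by (rule occupation_integrable(2)[OF q])
  have "(LINT y|occupation q x. q + y) = (LINT y|occupation q x. q) + (LINT y|occupation q x. y)"
    by (rule Bochner_Integration.integral_add) (use occupation_id_integrable[OF q] in auto)
  then show ?thesis unfolding occupation_mean_def passage_transform_def integral_occupation_const[OF q] by simp
qed

lemma occupation_mean_Phi_Psi:
  assumes q: "q > 0" and x: "x > 0"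
  shows "occupation_mean q x = 1 - Phi \<alpha> (x + q) / Phi \<alpha> q -
     q * (pi * Psi \<alpha> (x + q) - pi * Psi \<alpha> q * (Phi \<alpha> (x + q) / Phi \<alpha> q))"
  unfolding occupation_mean_eq[OF q] passage_transform_Phi[OF q x] ..

text \<open>The right-hand side of the theorem; it arises as the derivative at x = 0 of the mean of
  \<nu>.\<close>

definition area_resolvent :: "real \<Rightarrow> real" where
  "area_resolvent l = pi * l * ((deriv (Phi \<alpha>) l * Psi \<alpha> l - deriv (Psi \<alpha>) l * Phi \<alpha> l) / Phi \<alpha> l)
             - deriv (Phi \<alpha>) l / Phi \<alpha> l"

text \<open>By the explicit formulas both quotients are combinations of the difference quotients of
  \<open>Phi\<close> and \<open>Psi\<close> at q with step x.\<close>

lemma passage_transform_derivative: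
  assumes q: "q > 0"
  shows "((\<lambda>x. (1 - passage_transform q x) / x) \<longlongrightarrow> - deriv (Phi \<alpha>) q / Phi \<alpha> q) (at_right 0)"
    and "((\<lambda>x. occupation_mean q x / x) \<longlongrightarrow> area_resolvent q) (at_right 0)"
proof -
  note P0 = Phi_nonzero[OF q]
  have dPhi: "((\<lambda>x. (Phi \<alpha> (x + q) - Phi \<alpha> q) / x) \<longlongrightarrow> deriv (Phi \<alpha>) q) (at_right 0)"
    using Phi_Psi_differentiable(1)[OF \<alpha>, of q] unfolding DERIV_def filterlim_at_split by (simp add: add.commute)
  have dPsi: "((\<lambda>x. (Psi \<alpha> (x + q) - Psi \<alpha> q) / x) \<longlongrightarrow> deriv (Psi \<alpha>) q) (at_right 0)"
    using Phi_Psi_differentiable(2)[OF \<alpha>, of q] unfolding DERIV_def filterlim_at_split by (simp add: add.commute)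
  have pos: "\<forall>\<^sub>F x :: real in at_right 0. x > 0" by (rule eventually_at_right_less)
  have "((\<lambda>x. - ((Phi \<alpha> (x + q) - Phi \<alpha> q) / x) / Phi \<alpha> q) \<longlongrightarrow> - deriv (Phi \<alpha>) q / Phi \<alpha> q) (at_right 0)"
    by (intro tendsto_intros dPhi P0)
  then show "((\<lambda>x. (1 - passage_transform q x) / x) \<longlongrightarrow> - deriv (Phi \<alpha>) q / Phi \<alpha> q) (at_right 0)"
  proof (rule Lim_transform_eventually)
    show "\<forall>\<^sub>F x in at_right 0. - ((Phi \<alpha> (x + q) - Phi \<alpha> q) / x) / Phi \<alpha> q = (1 - passage_transform q x) / x"
      using pos by eventually_elim (use P0 in \<open>simp add: passage_transform_Phi[OF q] field_simps\<close>)
  qed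
  have "((\<lambda>x. - ((Phi \<alpha> (x + q) - Phi \<alpha> q) / x) / Phi \<alpha> q - q * (pi * ((Psi \<alpha> (x + q) - Psi \<alpha> q) / x) -
       pi * Psi \<alpha> q * (((Phi \<alpha> (x + q) - Phi \<alpha> q) / x) / Phi \<alpha> q))) \<longlongrightarrow>
     - deriv (Phi \<alpha>) q / Phi \<alpha> q - q * (pi * deriv (Psi \<alpha>) q - pi * Psi \<alpha> q * (deriv (Phi \<alpha>) q / Phi \<alpha> q))) (at_right 0)"
    by (intro tendsto_intros dPhi dPsi P0)
  also have "- deriv (Phi \<alpha>) q / Phi \<alpha> q - q * (pi * deriv (Psi \<alpha>) q - pi * Psi \<alpha> q * (deriv (Phi \<alpha>) q / Phi \<alpha> q)) = area_resolvent q"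
    using P0 unfolding area_resolvent_def by (simp add: field_simps)
  finally show "((\<lambda>x. occupation_mean q x / x) \<longlongrightarrow> area_resolvent q) (at_right 0)"
  proof (rule Lim_transform_eventually)
    show "\<forall>\<^sub>F x in at_right 0. - ((Phi \<alpha> (x + q) - Phi \<alpha> q) / x) / Phi \<alpha> q - q * (pi * ((Psi \<alpha> (x + q) - Psi \<alpha> q) / x) -
       pi * Psi \<alpha> q * (((Phi \<alpha> (x + q) - Phi \<alpha> q) / x) / Phi \<alpha> q)) = occupation_mean q x / x"
      using pos
    proof eventually_elim
      case (elim x)
      show ?case unfolding occupation_mean_Phi_Psi[OF q elim] using elim P0 by (simp add: field_simps)
    qed
  qed
qed

end

section \<open>Asymptotics of the resolvent for large parameters\<close>

lemma exp_laplace_integral: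
  fixes s :: real
  assumes s: "s > 0"
  shows "set_integrable lborel {0..} (\<lambda>r. exp (- (s * r)))" and "(LINT r:{0..}|lborel. exp (- (s * r))) = 1 / s"
proof -
  \<comment> \<open>\<open>0 powr 0\<close> is 0 and not 1, so the Gamma integral with exponent 0
    matches the exponential on the open half line only.\<close>
  have i: "set_integrable lborel {0<..} (\<lambda>r. exp (- (s * r)))"
  proof -
    have "set_integrable lborel {0<..} (\<lambda>r. r powr 0 * exp (- s * r))"
      by (rule iffD1[OF set_integral_Ici_Ioi(1) Gamma_laplace_integral(1)]) (use s in auto)
    then show ?thesis unfolding set_integrable_def
      by (rule back_subst[where P="integrable lborel"]) (auto simp: fun_eq_iff indicator_def)
  qed
  then show "set_integrable lborel {0..} (\<lambda>r. exp (- (s * r)))" by (subst set_integral_Ici_Ioi(1)) auto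
  have "(LINT r:{0..}|lborel. exp (- (s * r))) = (LINT r:{0<..}|lborel. exp (- (s * r)))"
    by (rule set_integral_Ici_Ioi(2)) auto
  also have "\<dots> = (LINT r:{0<..}|lborel. r powr 0 * exp (- s * r))"
    by (intro set_lebesgue_integral_cong) auto
  also have "\<dots> = (LINT r:{0..}|lborel. r powr 0 * exp (- s * r))"
    by (rule set_integral_Ici_Ioi(2)[symmetric]) auto
  also have "\<dots> = 1 / s" using Gamma_laplace_integral(2)[of 0 s] s by (simp add: powr_minus divide_inverse)
  finally show "(LINT r:{0..}|lborel. exp (- (s * r))) = 1 / s" .
qed

context spectrally_positive_stable
begin

text \<open>The identity integrated over real z against exp(-qz). The kernel becomes a constant -1,
  which reproduces the mass of \<nu>, plus a term of size at most Gamma(\<alpha>+1) q^(-\<alpha>-1),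
  which governs the behaviour for large q.\<close>

lemma passage_transform_power:
  assumes q: "q > 0" and x: "x > 0"
  shows "passage_transform q x / q = 1 / (x + q) +
    (LINT y|occupation q x. Gamma (\<alpha> + 1) * (q + y) powr (- \<alpha> - 1) - 1)"
proof -
  define k where "k r = complex_of_real (exp (- (q * r)))" for r
  have km: "k \<in> borel_measurable borel" unfolding k_def[abs_def] by measurable
  have cint: "set_integrable lborel {0..} (\<lambda>r. complex_of_real (f r))" if "set_integrable lborel {0..} f" for f :: "real \<Rightarrow> real"
  proof -
    have "integrable lborel (\<lambda>r. complex_of_real (indicator {0..} r *\<^sub>R f r))"
      using that unfolding set_integrable_def by (rule integrable_of_real)
    then show ?thesis unfolding set_integrable_def by (simp add: scaleR_conv_of_real)
  qed
  have ki: "set_integrable lborel {0..} k" unfolding k_def[abs_def] by (rule cint[OF exp_laplace_integral(1)[OF q]])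
  have pw: "(of_real r * 1) powr of_real \<alpha> = complex_of_real (r powr \<alpha>)" if "0 \<le> r" for r
    using that by (simp add: powr_of_real)
  have "set_integrable lborel {0..} (\<lambda>r. complex_of_real (r powr \<alpha> * exp (- q * r)))"
    by (rule cint[OF Gamma_laplace_integral(1)]) (use q \<alpha> in auto)
  then have k\<alpha>i: "set_integrable lborel {0..} (\<lambda>r. (of_real r * 1) powr of_real \<alpha> * k r)"
    unfolding set_integrable_def
    by (rule back_subst[where P="integrable lborel"]) (auto simp: fun_eq_iff indicator_def k_def powr_of_real)
  have "of_real (passage_transform q x) * (LINT r:{0..}|lborel. k r) =
     (LINT r:{0..}|lborel. exp (- (of_real (x * r) * 1)) * k r) +
     (LINT y|occupation q x. (LINT r:{0..}|lborel. ((of_real r * 1) powr of_real \<alpha> - of_real (q + y)) * exp (- (of_real (y * r) * 1)) * k r))"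
    by (rule occupation_core_integrated[OF q x _ km ki k\<alpha>i]) simp
  also have "(LINT r:{0..}|lborel. k r) = of_real (1 / q)"
    unfolding k_def set_integral_complex_of_real exp_laplace_integral(2)[OF q] ..
  also have "(LINT r:{0..}|lborel. exp (- (of_real (x * r) * 1)) * k r) = (LINT r:{0..}|lborel. complex_of_real (exp (- ((x + q) * r))))"
    by (intro set_lebesgue_integral_cong) (auto simp: k_def exp_of_real[symmetric] exp_add[symmetric] algebra_simps)
  also have "\<dots> = of_real (1 / (x + q))"
    unfolding set_integral_complex_of_real using exp_laplace_integral(2)[of "x + q"] q x by simp
  also have "(LINT y|occupation q x. (LINT r:{0..}|lborel. ((of_real r * 1) powr of_real \<alpha> - of_real (q + y)) * exp (- (of_real (y * r) * 1)) * k r)) =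
     (LINT y|occupation q x. complex_of_real (Gamma (\<alpha> + 1) * (q + y) powr (- \<alpha> - 1) - 1))"
  proof (rule integral_cong_AE)
    show "AE y in occupation q x. (LINT r:{0..}|lborel. ((of_real r * 1) powr of_real \<alpha> - of_real (q + y)) * exp (- (of_real (y * r) * 1)) * k r) =
       complex_of_real (Gamma (\<alpha> + 1) * (q + y) powr (- \<alpha> - 1) - 1)"
      using AE_occupation_nonneg
    proof eventually_elim
      case (elim y)
      then have s: "q + y > 0" using q by simp
      have "(LINT r:{0..}|lborel. ((of_real r * 1) powr of_real \<alpha> - of_real (q + y)) * exp (- (of_real (y * r) * 1)) * k r) =
         (LINT r:{0..}|lborel. complex_of_real (r powr \<alpha> * exp (- (q + y) * r) - (q + y) * exp (- ((q + y) * r))))"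
      proof (intro set_lebesgue_integral_cong allI impI)
        fix r :: real assume "r \<in> {0..}"
        then have r: "(of_real r * 1) powr of_real \<alpha> = complex_of_real (r powr \<alpha>)" by (intro pw) simp
        have "exp (- (of_real (y * r) * 1)) * k r = complex_of_real (exp (- ((q + y) * r)))"
          unfolding k_def exp_of_real[symmetric] exp_add[symmetric] by (simp add: algebra_simps)
        then have "((of_real r * 1) powr of_real \<alpha> - of_real (q + y)) * exp (- (of_real (y * r) * 1)) * k r =
            (complex_of_real (r powr \<alpha>) - of_real (q + y)) * complex_of_real (exp (- ((q + y) * r)))"
          by (simp only: r mult.assoc[of "complex_of_real (r powr \<alpha>) - of_real (q + y)"])
        also have "\<dots> = complex_of_real ((r powr \<alpha> - (q + y)) * exp (- ((q + y) * r)))"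
          by (simp only: of_real_mult of_real_diff)
        also have "(r powr \<alpha> - (q + y)) * exp (- ((q + y) * r)) = r powr \<alpha> * exp (- (q + y) * r) - (q + y) * exp (- ((q + y) * r))"
          by (simp only: left_diff_distrib mult_minus_left)
        finally show "((of_real r * 1) powr of_real \<alpha> - of_real (q + y)) * exp (- (of_real (y * r) * 1)) * k r =
            complex_of_real (r powr \<alpha> * exp (- (q + y) * r) - (q + y) * exp (- ((q + y) * r)))" .
      qed simp
      also have "\<dots> = of_real ((LINT r:{0..}|lborel. r powr \<alpha> * exp (- (q + y) * r)) - (LINT r:{0..}|lborel. (q + y) * exp (- ((q + y) * r))))"
        unfolding set_integral_complex_of_real
        by (subst set_integral_diff(2)) (use Gamma_laplace_integral(1)[of \<alpha> "q + y"] exp_laplace_integral(1)[OF s] \<alpha> s in auto)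
      also have "(LINT r:{0..}|lborel. (q + y) * exp (- ((q + y) * r))) = (q + y) * (LINT r:{0..}|lborel. exp (- ((q + y) * r)))"
        by (rule set_integral_mult_right)
      also have "\<dots> = 1" using exp_laplace_integral(2)[OF s] s by simp
      also have "(LINT r:{0..}|lborel. r powr \<alpha> * exp (- (q + y) * r)) = Gamma (\<alpha> + 1) * (q + y) powr (- \<alpha> - 1)"
        by (rule Gamma_laplace_integral(2)) (use \<alpha> s in auto)
      finally show ?case .
    qed
    note [measurable] = km and [measurable_cong] = sets_occupation(1)
    show "(\<lambda>y. LINT r:{0..}|lborel. ((of_real r * 1) powr of_real \<alpha> - of_real (q + y)) * exp (- (of_real (y * r) * 1)) * k r) \<in> borel_measurable (occupation q x)"
      unfolding set_lebesgue_integral_def by measurable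
    show "(\<lambda>y. complex_of_real (Gamma (\<alpha> + 1) * (q + y) powr (- \<alpha> - 1) - 1)) \<in> borel_measurable (occupation q x)"
      by measurable
  qed
  also have "\<dots> = of_real (LINT y|occupation q x. Gamma (\<alpha> + 1) * (q + y) powr (- \<alpha> - 1) - 1)"
    by (rule integral_complex_of_real)
  finally have "complex_of_real (passage_transform q x * (1 / q)) = of_real (1 / (x + q) + (LINT y|occupation q x. Gamma (\<alpha> + 1) * (q + y) powr (- \<alpha> - 1) - 1))"
    by (simp only: of_real_mult of_real_add)
  then show ?thesis unfolding of_real_eq_iff by simp
qed

lemma Bernoulli_powr_minus:
  fixes s b :: real
  assumes "0 \<le> s" "b > 0"
  shows "1 - b * s \<le> (1 + s) powr (- b)"
proof -
  have "ln (1 + s) \<le> s" using assms by (intro ln_add_one_self_le_self) 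
  then have "- (b * s) \<le> - (b * ln (1 + s))" using assms by simp
  have "1 - b * s \<le> exp (- (b * s))" using exp_ge_add_one_self[of "- (b * s)"] by simp
  also have "\<dots> \<le> exp (- (b * ln (1 + s)))" using \<open>- (b * s) \<le> _\<close> by simp
  also have "\<dots> = (1 + s) powr (- b)" using assms by (simp add: powr_def)
  finally show ?thesis .
qed

text \<open>\<open>passage_transform_power\<close> and the formula for the mean combine to mean =
  x/(x+q) - q G K, with K the integral of (q+y)^(-\<alpha>-1). K is bounded above by taking out
  q^(-\<alpha>-2), below by Bernoulli's inequality, and the bounds are expressed by 1 - p and the
  mean again.\<close>

lemma occupation_mean_bounds:
  assumes q: "q > 0" and x: "x > 0"
  defines "G \<equiv> Gamma (\<alpha> + 1)"
  shows "occupation_mean q x \<ge> x / (x + q) - G * q powr (- \<alpha> - 1) * (1 - passage_transform q x)"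
    and "occupation_mean q x \<le> x / (x + q) - G * q powr (- \<alpha> - 1) * ((1 - passage_transform q x) - (\<alpha> + 2) * occupation_mean q x)"
    and "occupation_mean q x \<le> x / (x + q)"
proof -
  interpret fin: finite_measure "occupation q x" by (rule occupation_integrable(2)[OF q])
  note [measurable_cong] = sets_occupation(1)
  define p where "p = passage_transform q x"
  define m where "m = occupation_mass q x"
  define U where "U = occupation_mean q x"
  have G: "G > 0" unfolding G_def using \<alpha> by (intro Gamma_real_pos) simp
  define K where "K = (LINT y|occupation q x. (q + y) powr (- \<alpha> - 1))"
  have Kb: "(q + y) powr (- \<alpha> - 1) \<le> q powr (- \<alpha> - 2) * (q + y)" if "0 \<le> y" for y
  proof -
    have "(q + y) powr (- \<alpha> - 1) = (q + y) powr (- \<alpha> - 2) * (q + y)"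
    proof -
      have e: "1 + (- \<alpha> - 2) = - \<alpha> - 1" by simp
      show ?thesis using powr_mult_base[of "q + y" "- \<alpha> - 2", unfolded e] q that by (simp add: mult.commute)
    qed
    also have "\<dots> \<le> q powr (- \<alpha> - 2) * (q + y)"
      using q that \<alpha> by (intro mult_right_mono powr_mono2') auto
    finally show ?thesis .
  qed
  have Ki: "integrable (occupation q x) (\<lambda>y. (q + y) powr (- \<alpha> - 1))"
  proof (rule Bochner_Integration.integrable_bound)
    show "integrable (occupation q x) (\<lambda>y. q powr (- \<alpha> - 2) * (q + y))" by (intro integrable_mult_right occupation_integrable(1)[OF q])
    show "AE y in occupation q x. norm ((q + y) powr (- \<alpha> - 1)) \<le> norm (q powr (- \<alpha> - 2) * (q + y))"
      using AE_occupation_nonneg by eventually_elim (use Kb q in auto)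
  qed measurable
  have K0: "0 \<le> K" unfolding K_def by simp
  have mean: "U = 1 - p - q * m" unfolding U_def p_def m_def by (rule occupation_mean_eq[OF q])
  have "p / q = 1 / (x + q) + (G * K - m)"
    unfolding p_def passage_transform_power[OF q x] K_def m_def G_def
    using Ki integral_occupation_const[OF q, where c="1::real" and x=x] by simp
  then have "p = q / (x + q) + q * (G * K) - q * m" using q by (simp add: field_simps)
  moreover have "q / (x + q) = 1 - x / (x + q)" using q x by (simp add: field_simps)
  ultimately have U: "U = x / (x + q) - q * (G * K)" unfolding mean by simp
  show "occupation_mean q x \<le> x / (x + q)" using U G K0 q unfolding U_def by simp
  have mom: "(LINT y|occupation q x. q + y) = 1 - p" by (simp add: p_def passage_transform_def)
  have "K \<le> (LINT y|occupation q x. q powr (- \<alpha> - 2) * (q + y))"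
    unfolding K_def
  proof (rule integral_mono_AE[OF Ki])
    show "integrable (occupation q x) (\<lambda>y. q powr (- \<alpha> - 2) * (q + y))"
      by (intro integrable_mult_right occupation_integrable(1)[OF q])
    show "AE y in occupation q x. (q + y) powr (- \<alpha> - 1) \<le> q powr (- \<alpha> - 2) * (q + y)"
      using AE_occupation_nonneg by eventually_elim (rule Kb)
  qed
  then have K1: "K \<le> q powr (- \<alpha> - 2) * (1 - p)" by (simp add: mom)
  have "1 + (- \<alpha> - 2) = - \<alpha> - 1" by simp
  from powr_mult_base[of q "- \<alpha> - 2", unfolded this]
  have qq: "q * q powr (- \<alpha> - 2) = q powr (- \<alpha> - 1)" using q by simp
  have "q * (G * K) \<le> q * (G * (q powr (- \<alpha> - 2) * (1 - p)))" using q G K1 by (intro mult_left_mono) auto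
  also have "\<dots> = G * (q * q powr (- \<alpha> - 2)) * (1 - p)" by (simp only: mult_ac)
  also have "\<dots> = G * q powr (- \<alpha> - 1) * (1 - p)" unfolding qq ..
  finally show "occupation_mean q x \<ge> x / (x + q) - G * q powr (- \<alpha> - 1) * (1 - passage_transform q x)"
    using U unfolding U_def p_def by linarith
  have "(LINT y|occupation q x. q powr (- \<alpha> - 1) * (1 - (\<alpha> + 1) / q * y)) \<le> K"
    unfolding K_def
  proof (rule integral_mono_AE[OF _ Ki])
    show "integrable (occupation q x) (\<lambda>y. q powr (- \<alpha> - 1) * (1 - (\<alpha> + 1) / q * y))"
      by (intro integrable_mult_right Bochner_Integration.integrable_diff occupation_id_integrable[OF q]) auto
    show "AE y in occupation q x. q powr (- \<alpha> - 1) * (1 - (\<alpha> + 1) / q * y) \<le> (q + y) powr (- \<alpha> - 1)"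
      using AE_occupation_nonneg
    proof eventually_elim
      case (elim y)
      have "1 - (\<alpha> + 1) * (y / q) \<le> (1 + y / q) powr (- (\<alpha> + 1))"
        by (rule Bernoulli_powr_minus) (use elim q \<alpha> in auto)
      then have "q powr (- \<alpha> - 1) * (1 - (\<alpha> + 1) * (y / q)) \<le> q powr (- \<alpha> - 1) * (1 + y / q) powr (- \<alpha> - 1)"
        by (intro mult_left_mono) auto
      also have "\<dots> = (q * (1 + y / q)) powr (- \<alpha> - 1)" using q elim by (simp add: powr_mult)
      also have "q * (1 + y / q) = q + y" using q by (simp add: field_simps)
      finally show ?case by simp
    qed
  qed
  also have "(LINT y|occupation q x. q powr (- \<alpha> - 1) * (1 - (\<alpha> + 1) / q * y)) = q powr (- \<alpha> - 1) * (m - (\<alpha> + 1) / q * U)"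
    using occupation_id_integrable[OF q, of x] integral_occupation_const[OF q, where c="1::real" and x=x]
    by (simp add: U_def m_def occupation_mean_def)
  finally have K2: "q powr (- \<alpha> - 1) * (m - (\<alpha> + 1) / q * U) \<le> K" .
  \<comment> \<open>One more copy of the mean comes from q m = 1 - p - U, whence the constant
    \<alpha> + 2.\<close>
  have "q * (m - (\<alpha> + 1) / q * U) = q * m - (\<alpha> + 1) * U" using q by (simp add: right_diff_distrib)
  also have "\<dots> = (1 - p) - (\<alpha> + 2) * U" using mean by (simp add: algebra_simps)
  finally have "q * (m - (\<alpha> + 1) / q * U) = (1 - p) - (\<alpha> + 2) * U" .
  then have "G * q powr (- \<alpha> - 1) * ((1 - p) - (\<alpha> + 2) * U) = q * (G * (q powr (- \<alpha> - 1) * (m - (\<alpha> + 1) / q * U)))"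
    by (metis mult.assoc mult.left_commute)
  also have "\<dots> \<le> q * (G * K)" using q G K2 by (intro mult_left_mono) auto
  finally show "occupation_mean q x \<le> x / (x + q) - G * q powr (- \<alpha> - 1) * ((1 - passage_transform q x) - (\<alpha> + 2) * occupation_mean q x)"
    using U unfolding U_def p_def by linarith
qed

text \<open>Minus the logarithmic derivative of \<open>Phi\<close>: the rate at which the passage
  transform decays in x at x = 0.\<close>

definition log_decay :: "real \<Rightarrow> real" where
  "log_decay q = - deriv (Phi \<alpha>) q / Phi \<alpha> q"

text \<open>Both barriers take the value 1 at x = 0, like the passage transform, so the inequalities
  can be differentiated there.\<close>

lemma log_decay_bounds:
  assumes q: "q > 0"
  shows "q powr (1 / \<alpha>) \<le> log_decay q"
    and "\<And>a. a > 0 \<Longrightarrow> q < a powr \<alpha> \<Longrightarrow> log_decay q \<le> a / (1 - exp (- (a * (a powr \<alpha> - q))))"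
proof -
  have lim: "((\<lambda>x. (1 - passage_transform q x) / x) \<longlongrightarrow> log_decay q) (at_right 0)"
    using passage_transform_derivative(1)[OF q] unfolding log_decay_def .
  have pos: "\<forall>\<^sub>F x :: real in at_right 0. x > 0" by (rule eventually_at_right_less)
  have ed: "((\<lambda>x. (1 - exp (- (b * x))) / x) \<longlongrightarrow> b) (at_right 0)" for b :: real
  proof -
    have "((\<lambda>x. 1 - exp (- (b * x))) has_real_derivative b) (at 0)" by (auto intro!: derivative_eq_intros)
    then show ?thesis unfolding DERIV_def filterlim_at_split by simp
  qed
  show "q powr (1 / \<alpha>) \<le> log_decay q"
  proof (rule tendsto_le[OF trivial_limit_at_right_real lim ed])
    show "\<forall>\<^sub>F x in at_right 0. (1 - exp (- (q powr (1 / \<alpha>) * x))) / x \<le> (1 - passage_transform q x) / x"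
      using pos by eventually_elim (use passage_transform_upper[OF q] in \<open>auto intro!: divide_right_mono\<close>)
  qed
  fix a assume a: "a > 0" "q < a powr \<alpha>"
  define e where "e = exp (- (a * (a powr \<alpha> - q)))"
  have e: "0 < 1 - e" unfolding e_def using a by simp
  show "log_decay q \<le> a / (1 - exp (- (a * (a powr \<alpha> - q))))"
    unfolding e_def[symmetric]
  proof (rule tendsto_le[OF trivial_limit_at_right_real _ lim])
    show "((\<lambda>x. ((1 - exp (- (a * x))) / x) / (1 - e)) \<longlongrightarrow> a / (1 - e)) (at_right 0)"
      by (intro tendsto_intros ed) (use e in simp)
    show "\<forall>\<^sub>F x in at_right 0. (1 - passage_transform q x) / x \<le> ((1 - exp (- (a * x))) / x) / (1 - e)"
      using pos
    proof eventually_elim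
      case (elim x)
      have "exp (- (a * x)) - e \<le> passage_transform q x * (1 - e)"
        unfolding e_def by (rule passage_transform_lower[OF q elim a])
      then have "(1 - passage_transform q x) * (1 - e) \<le> 1 - exp (- (a * x))" by (simp add: algebra_simps)
      then have "1 - passage_transform q x \<le> (1 - exp (- (a * x))) / (1 - e)" using e by (simp add: pos_le_divide_eq)
      then have "(1 - passage_transform q x) / x \<le> ((1 - exp (- (a * x))) / (1 - e)) / x" using elim by (intro divide_right_mono) auto
      then show ?case by (simp add: mult.commute)
    qed
  qed
qed

lemma log_decay_asymptotics: "((\<lambda>q. log_decay q * q powr (- 1 / \<alpha>)) \<longlongrightarrow> 1) at_top"
proof (rule tendsto_sandwich[of "\<lambda>_. 1" _ _ "\<lambda>q. (1 + q powr (- 1 / 2)) / (1 - exp (- (q powr (1 / 2))))"])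
  show "\<forall>\<^sub>F q in at_top. 1 \<le> log_decay q * q powr (- 1 / \<alpha>)"
    using eventually_gt_at_top[of 0]
  proof eventually_elim
    case (elim q)
    have "q powr (1 / \<alpha>) * q powr (- 1 / \<alpha>) \<le> log_decay q * q powr (- 1 / \<alpha>)"
      by (intro mult_right_mono log_decay_bounds elim) simp
    then show ?case using elim by (simp add: powr_add[symmetric])
  qed
  show "\<forall>\<^sub>F q in at_top. log_decay q * q powr (- 1 / \<alpha>) \<le> (1 + q powr (- 1 / 2)) / (1 - exp (- (q powr (1 / 2))))"
    using eventually_ge_at_top[of 1]
  proof eventually_elim
    case (elim q)
    \<comment> \<open>With a = q^(1/\<alpha>) (1 + d) the excess a^\<alpha> - q is at least q d =
      q^(1/2), which tends to infinity, while a remains asymptotic to q^(1/\<alpha>).\<close>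
    define d where "d = q powr (- 1 / 2)"
    define a where "a = q powr (1 / \<alpha>) * (1 + d)"
    have d: "d > 0" using elim by (simp add: d_def)
    have qa: "1 \<le> q powr (1 / \<alpha>)" using elim \<alpha> by (simp add: ge_one_powr_ge_zero)
    have a: "a > 0" using elim d by (simp add: a_def)
    have "(1 + d) powr 1 \<le> (1 + d) powr \<alpha>" using d \<alpha> by (intro powr_mono) auto
    then have "q * (1 + d) \<le> q * (1 + d) powr \<alpha>" using elim d by simp
    also have "\<dots> = a powr \<alpha>" using elim d \<alpha> by (simp add: a_def powr_mult powr_powr)
    finally have "q * d \<le> a powr \<alpha> - q" by (simp add: algebra_simps)
    moreover have "q * d = q powr (1 / 2)" using elim powr_mult_base[of q "- 1 / 2"] by (simp add: d_def)
    ultimately have ad: "q powr (1 / 2) \<le> a powr \<alpha> - q" by simp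
    moreover have "q powr (1 / 2) > 0" using elim by simp
    ultimately have qa2: "q < a powr \<alpha>" by linarith
    have "1 \<le> a" using qa d unfolding a_def by (smt (verit) mult_left_le mult_le_cancel_left1)
    then have "q powr (1 / 2) \<le> a * (a powr \<alpha> - q)"
      using ad qa2 by (smt (verit) mult_le_cancel_right1)
    then have ee: "1 - exp (- (q powr (1 / 2))) \<le> 1 - exp (- (a * (a powr \<alpha> - q)))" by simp
    have e0: "0 < 1 - exp (- (q powr (1 / 2)))" using elim by simp
    have "log_decay q \<le> a / (1 - exp (- (a * (a powr \<alpha> - q))))" by (rule log_decay_bounds(2)) (use elim a qa2 in auto)
    also have "\<dots> \<le> a / (1 - exp (- (q powr (1 / 2))))"
    proof (rule divide_left_mono[OF ee])
      show "0 < (1 - exp (- (a * (a powr \<alpha> - q)))) * (1 - exp (- (q powr (1 / 2))))"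
        by (rule mult_pos_pos) (use e0 ee in linarith)+
    qed (use a in simp)
    finally have "log_decay q * q powr (- 1 / \<alpha>) \<le> a / (1 - exp (- (q powr (1 / 2)))) * q powr (- 1 / \<alpha>)"
      by (rule mult_right_mono) simp
    also have "\<dots> = (q powr (1 / \<alpha>) * q powr (- 1 / \<alpha>)) * (1 + d) / (1 - exp (- (q powr (1 / 2))))" by (simp add: a_def)
    also have "q powr (1 / \<alpha>) * q powr (- 1 / \<alpha>) = 1" using elim by (simp add: powr_add[symmetric])
    finally show ?case by (simp add: d_def)
  qed
  show "((\<lambda>q :: real. (1 + q powr (- 1 / 2)) / (1 - exp (- (q powr (1 / 2))))) \<longlongrightarrow> 1) at_top" by real_asymp
qed simp

text \<open>The bounds on the mean of \<nu> are divided by x and passed to the limit x \<rightarrow>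
  0.\<close>

lemma area_resolvent_bounds:
  assumes q: "q > 0"
  shows "1 / q - area_resolvent q \<le> Gamma (\<alpha> + 1) * q powr (- \<alpha> - 1) * log_decay q"
    and "Gamma (\<alpha> + 1) * q powr (- \<alpha> - 1) * (log_decay q - (\<alpha> + 2) / q) \<le> 1 / q - area_resolvent q"
proof -
  define G where "G = Gamma (\<alpha> + 1)"
  have G: "G > 0" unfolding G_def using \<alpha> by (intro Gamma_real_pos) simp
  have lim: "((\<lambda>x. (1 - passage_transform q x) / x) \<longlongrightarrow> log_decay q) (at_right 0)"
    using passage_transform_derivative(1)[OF q] unfolding log_decay_def .
  note limU = passage_transform_derivative(2)[OF q]
  have pos: "\<forall>\<^sub>F x :: real in at_right 0. x > 0" by (rule eventually_at_right_less)
  have limx: "((\<lambda>x. 1 / (x + q)) \<longlongrightarrow> 1 / q) (at_right 0)"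
    using q by (auto intro!: tendsto_eq_intros)
  have A1: "area_resolvent q \<le> 1 / q"
  proof (rule tendsto_le[OF trivial_limit_at_right_real limx limU])
    show "\<forall>\<^sub>F x in at_right 0. occupation_mean q x / x \<le> 1 / (x + q)"
      using pos by eventually_elim (use occupation_mean_bounds(3)[OF q] q in \<open>auto simp: field_simps\<close>)
  qed
  have "1 / q - G * q powr (- \<alpha> - 1) * log_decay q \<le> area_resolvent q"
  proof (rule tendsto_le[OF trivial_limit_at_right_real limU])
    show "((\<lambda>x. 1 / (x + q) - G * q powr (- \<alpha> - 1) * ((1 - passage_transform q x) / x)) \<longlongrightarrow> 1 / q - G * q powr (- \<alpha> - 1) * log_decay q) (at_right 0)"
      by (intro tendsto_intros lim limx)
    show "\<forall>\<^sub>F x in at_right 0. 1 / (x + q) - G * q powr (- \<alpha> - 1) * ((1 - passage_transform q x) / x) \<le> occupation_mean q x / x"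
      using pos
    proof eventually_elim
      case (elim x)
      have "(x / (x + q) - c * b) / x = 1 / (x + q) - c * (b / x)" for b c using elim by (simp add: diff_divide_distrib)
      moreover have "(x / (x + q) - G * q powr (- \<alpha> - 1) * (1 - passage_transform q x)) / x \<le> occupation_mean q x / x"
        using occupation_mean_bounds(1)[OF q elim] elim unfolding G_def by (intro divide_right_mono) auto
      ultimately show ?case by simp
    qed
  qed
  then show "1 / q - area_resolvent q \<le> Gamma (\<alpha> + 1) * q powr (- \<alpha> - 1) * log_decay q" unfolding G_def by linarith
  have "area_resolvent q \<le> 1 / q - G * q powr (- \<alpha> - 1) * (log_decay q - (\<alpha> + 2) * area_resolvent q)"
  proof (rule tendsto_le[OF trivial_limit_at_right_real _ limU])
    show "((\<lambda>x. 1 / (x + q) - G * q powr (- \<alpha> - 1) * ((1 - passage_transform q x) / x - (\<alpha> + 2) * (occupation_mean q x / x))) \<longlongrightarrow>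
       1 / q - G * q powr (- \<alpha> - 1) * (log_decay q - (\<alpha> + 2) * area_resolvent q)) (at_right 0)"
      by (intro tendsto_intros lim limx limU)
    show "\<forall>\<^sub>F x in at_right 0. occupation_mean q x / x \<le>
        1 / (x + q) - G * q powr (- \<alpha> - 1) * ((1 - passage_transform q x) / x - (\<alpha> + 2) * (occupation_mean q x / x))"
      using pos
    proof eventually_elim
      case (elim x)
      have "(x / (x + q) - c * (b - d * e)) / x = 1 / (x + q) - c * (b / x - d * (e / x))" for b c d e
        using elim by (simp add: diff_divide_distrib right_diff_distrib mult.assoc)
      moreover have "occupation_mean q x / x \<le> (x / (x + q) - G * q powr (- \<alpha> - 1) * ((1 - passage_transform q x) - (\<alpha> + 2) * occupation_mean q x)) / x"
        using occupation_mean_bounds(2)[OF q elim] elim unfolding G_def by (intro divide_right_mono) auto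
      ultimately show ?case by simp
    qed
  qed
  \<comment> \<open>The resolvent inside the bound is replaced by 1 / q, which is negligible against
    \<open>log_decay\<close> for large q.\<close>
  moreover have "G * q powr (- \<alpha> - 1) * (log_decay q - (\<alpha> + 2) / q) \<le> G * q powr (- \<alpha> - 1) * (log_decay q - (\<alpha> + 2) * area_resolvent q)"
  proof (intro mult_left_mono diff_left_mono)
    show "(\<alpha> + 2) * area_resolvent q \<le> (\<alpha> + 2) / q" using mult_left_mono[OF A1, of "\<alpha> + 2"] \<alpha> by simp
  qed (use G in auto)
  ultimately show "Gamma (\<alpha> + 1) * q powr (- \<alpha> - 1) * (log_decay q - (\<alpha> + 2) / q) \<le> 1 / q - area_resolvent q"
    unfolding G_def by linarith
qed

text \<open>The kernel contributes q^(-\<alpha>-1) and \<open>log_decay\<close> contributes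
  q^(1/\<alpha>); the correction becomes (\<alpha>+2) q^(-1-1/\<alpha>) after rescaling and
  vanishes.\<close>

lemma area_resolvent_asymptotics:
  "((\<lambda>q. (1 / q - area_resolvent q) * q powr (\<alpha> + 1 - 1 / \<alpha>)) \<longlongrightarrow> Gamma (\<alpha> + 1)) at_top"
proof -
  define G where "G = Gamma (\<alpha> + 1)"
  have e: "q powr (- \<alpha> - 1) * q powr (\<alpha> + 1 - 1 / \<alpha>) = q powr (- 1 / \<alpha>)" if "q > 0" for q
    using that by (simp add: powr_add[symmetric])
  show ?thesis
  proof (rule tendsto_sandwich[of "\<lambda>q. G * (log_decay q * q powr (- 1 / \<alpha>) - (\<alpha> + 2) / q * q powr (- 1 / \<alpha>))" _ _
        "\<lambda>q. G * (log_decay q * q powr (- 1 / \<alpha>))"])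
    show "\<forall>\<^sub>F q in at_top. G * (log_decay q * q powr (- 1 / \<alpha>) - (\<alpha> + 2) / q * q powr (- 1 / \<alpha>)) \<le> (1 / q - area_resolvent q) * q powr (\<alpha> + 1 - 1 / \<alpha>)"
      using eventually_gt_at_top[of 0]
    proof eventually_elim
      case (elim q)
      have "G * (log_decay q * q powr (- 1 / \<alpha>) - (\<alpha> + 2) / q * q powr (- 1 / \<alpha>)) =
         G * q powr (- \<alpha> - 1) * (log_decay q - (\<alpha> + 2) / q) * q powr (\<alpha> + 1 - 1 / \<alpha>)"
        unfolding e[OF elim, symmetric] by (simp add: algebra_simps)
      also have "\<dots> \<le> (1 / q - area_resolvent q) * q powr (\<alpha> + 1 - 1 / \<alpha>)"
        unfolding G_def by (intro mult_right_mono area_resolvent_bounds(2) elim) simp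
      finally show ?case .
    qed
    show "\<forall>\<^sub>F q in at_top. (1 / q - area_resolvent q) * q powr (\<alpha> + 1 - 1 / \<alpha>) \<le> G * (log_decay q * q powr (- 1 / \<alpha>))"
      using eventually_gt_at_top[of 0]
    proof eventually_elim
      case (elim q)
      have "(1 / q - area_resolvent q) * q powr (\<alpha> + 1 - 1 / \<alpha>) \<le> G * q powr (- \<alpha> - 1) * log_decay q * q powr (\<alpha> + 1 - 1 / \<alpha>)"
        unfolding G_def by (intro mult_right_mono area_resolvent_bounds(1) elim) simp
      also have "\<dots> = G * (log_decay q * q powr (- 1 / \<alpha>))" unfolding e[OF elim, symmetric] by (simp add: mult_ac)
      finally show ?case .
    qed
    have z: "((\<lambda>q. (\<alpha> + 2) / q * q powr (- 1 / \<alpha>)) \<longlongrightarrow> 0) at_top"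
    proof (rule tendsto_mult_zero)
      show "((\<lambda>q. (\<alpha> + 2) / q) \<longlongrightarrow> 0) at_top"
        by (rule tendsto_divide_0[OF tendsto_const filterlim_at_top_imp_at_infinity[OF filterlim_ident]])
      show "((\<lambda>q :: real. q powr (- 1 / \<alpha>)) \<longlongrightarrow> 0) at_top"
        by (rule tendsto_neg_powr[OF _ filterlim_ident]) (use \<alpha> in auto)
    qed
    have "((\<lambda>q. G * (log_decay q * q powr (- 1 / \<alpha>) - (\<alpha> + 2) / q * q powr (- 1 / \<alpha>))) \<longlongrightarrow> G * (1 - 0)) at_top"
      by (intro tendsto_intros log_decay_asymptotics z)
    then show "((\<lambda>q. G * (log_decay q * q powr (- 1 / \<alpha>) - (\<alpha> + 2) / q * q powr (- 1 / \<alpha>))) \<longlongrightarrow> Gamma (\<alpha> + 1)) at_top"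
      by (simp add: G_def)
    have "((\<lambda>q. G * (log_decay q * q powr (- 1 / \<alpha>))) \<longlongrightarrow> G * 1) at_top"
      by (intro tendsto_intros log_decay_asymptotics)
    then show "((\<lambda>q. G * (log_decay q * q powr (- 1 / \<alpha>))) \<longlongrightarrow> Gamma (\<alpha> + 1)) at_top" by (simp add: G_def)
  qed
qed

end

section \<open>Scaling invariance of the law\<close>

lemma cadlag_affine:
  assumes w: "cadlag w" and c: "c > 0" shows "cadlag (\<lambda>s. x + a * w (s / c))"
  unfolding cadlag_def
proof (intro conjI allI impI)
  fix t :: real assume "0 \<le> t"
  have "filterlim (\<lambda>s. s / c) (at_right (t / c)) (at_right t)"
    unfolding filterlim_at using c
    by (auto intro!: tendsto_intros simp: eventually_at_filter divide_strict_right_mono)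
  moreover have "(w \<longlongrightarrow> w (t / c)) (at_right (t / c))" using w c \<open>0 \<le> t\<close> by (simp add: cadlag_def)
  ultimately have "((\<lambda>s. w (s / c)) \<longlongrightarrow> w (t / c)) (at_right t)" by (rule filterlim_compose[rotated])
  then show "((\<lambda>s. x + a * w (s / c)) \<longlongrightarrow> x + a * w (t / c)) (at_right t)" by (intro tendsto_intros)
next
  fix t :: real assume "0 < t"
  have "filterlim (\<lambda>s. s / c) (at_left (t / c)) (at_left t)"
    unfolding filterlim_at using c
    by (auto intro!: tendsto_intros simp: eventually_at_filter divide_strict_right_mono)
  moreover obtain l where "(w \<longlongrightarrow> l) (at_left (t / c))" using w c \<open>0 < t\<close> unfolding cadlag_def by (meson divide_pos_pos)
  ultimately have "((\<lambda>s. w (s / c)) \<longlongrightarrow> l) (at_left t)" by (rule filterlim_compose[rotated])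
  then show "\<exists>l. ((\<lambda>s. x + a * w (s / c)) \<longlongrightarrow> l) (at_left t)" by (intro exI[of _ "x + a * l"] tendsto_intros)
qed

lemma path_affine_measurable:
  assumes c: "c > 0"
  shows "(\<lambda>w. \<lambda>s\<in>{0..}. x + a * w (s / c)) \<in> measurable path_space path_space"
proof -
  have "(\<lambda>w. \<lambda>s\<in>{0..}. x + a * w (s / c)) \<in> measurable path_space (\<Pi>\<^sub>M t\<in>{0..}. borel)"
  proof (rule measurable_restrict)
    fix s :: real assume "s \<in> {0..}"
    then have [measurable]: "(\<lambda>w. w (s / c)) \<in> borel_measurable path_space" using c by (intro measurable_path_eval) simp
    show "(\<lambda>w. x + a * w (s / c)) \<in> borel_measurable path_space" by measurable
  qed
  moreover have "(\<lambda>s\<in>{0..}. x + a * w (s / c)) \<in> cadlag_paths" if "w \<in> space path_space" for w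
    using that by (intro cadlag_restrict cadlag_affine c) (simp add: space_path_space cadlag_paths_def)
  ultimately have "(\<lambda>w. \<lambda>s\<in>{0..}. x + a * w (s / c)) \<in> measurable path_space (restrict_space (\<Pi>\<^sub>M t\<in>{0..}. borel) cadlag_paths)"
    by (intro measurable_restrict_space2 Pi_I)
  then show ?thesis by (simp only: path_space_def)
qed

text \<open>Paths carry the trace of the product \<sigma>-algebra, which is generated by
  finite-dimensional cylinders.\<close>

lemma path_measure_eqI:
  assumes M: "sets M = sets path_space" "prob_space M" and N: "sets N = sets path_space" "prob_space N"
    and eq: "\<And>J A. finite J \<Longrightarrow> J \<subseteq> {0..} \<Longrightarrow> (\<And>j. j \<in> J \<Longrightarrow> A j \<in> sets borel) \<Longrightarrow>
      emeasure M {w \<in> cadlag_paths. \<forall>j\<in>J. w j \<in> A j} = emeasure N {w \<in> cadlag_paths. \<forall>j\<in>J. w j \<in> A j}"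
  shows "M = N"
proof -
  let ?\<Pi> = "\<Pi>\<^sub>M t\<in>{0..}. (borel :: real measure)"
  have id: "(\<lambda>w. w) \<in> measurable path_space ?\<Pi>"
    unfolding path_space_def by (rule measurable_restrict_space1) simp
  have spM: "space M = cadlag_paths" and spN: "space N = cadlag_paths"
    using sets_eq_imp_space_eq[OF M(1)] sets_eq_imp_space_eq[OF N(1)] by (simp_all add: space_path_space)
  have idM: "(\<lambda>w. w) \<in> measurable M ?\<Pi>" and idN: "(\<lambda>w. w) \<in> measurable N ?\<Pi>"
    using id measurable_cong_sets[OF M(1) refl] measurable_cong_sets[OF N(1) refl] by auto
  have D: "distr M ?\<Pi> (\<lambda>w. w) = distr N ?\<Pi> (\<lambda>w. w)"
  proof (rule measure_eqI_PiM_infinite)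
    show "finite_measure (distr M ?\<Pi> (\<lambda>w. w))"
      using prob_space.prob_space_distr[OF M(2) idM] by (simp add: prob_space.finite_measure)
    fix A :: "real \<Rightarrow> real set" and J :: "real set"
    assume J: "finite J" "J \<subseteq> {0..}" and A: "\<And>i. i \<in> J \<Longrightarrow> A i \<in> sets borel"
    have S: "prod_emb {0..} (\<lambda>_. borel) J (Pi\<^sub>E J A) \<in> sets ?\<Pi>" using J A by (intro sets_PiM_I) auto
    have "(\<lambda>w. w) -` prod_emb {0..} (\<lambda>_. borel) J (Pi\<^sub>E J A) \<inter> cadlag_paths = {w \<in> cadlag_paths. \<forall>j\<in>J. w j \<in> A j}"
      using J by (auto simp: prod_emb_def PiE_iff cadlag_paths_def extensional_def)
    then show "emeasure (distr M ?\<Pi> (\<lambda>w. w)) (prod_emb {0..} (\<lambda>_. borel) J (Pi\<^sub>E J A)) =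
        emeasure (distr N ?\<Pi> (\<lambda>w. w)) (prod_emb {0..} (\<lambda>_. borel) J (Pi\<^sub>E J A))"
      unfolding emeasure_distr[OF idM S] emeasure_distr[OF idN S] spM spN using eq[OF J A] by simp
  qed auto
  show ?thesis
  proof (rule measure_eqI)
    fix A assume "A \<in> sets M"
    then obtain B where B: "B \<in> sets ?\<Pi>" "A = cadlag_paths \<inter> B"
      unfolding M(1) path_space_def sets_restrict_space by auto
    have "A = (\<lambda>w. w) -` B \<inter> cadlag_paths" using B by auto
    then show "emeasure M A = emeasure N A"
      using emeasure_distr[OF idM B(1)] emeasure_distr[OF idN B(1)] unfolding spM spN D by simp
  qed (use M N in simp)
qed

text \<open>Independence of increments is formulated along increasing sequences; a finite set of
  times is placed on such a sequence, started at 0 and frozen after the last time.\<close>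

lemma finite_times_sequence:
  fixes J :: "real set"
  assumes J: "finite J" "J \<subseteq> {0..}"
  shows "\<exists>(t :: nat \<Rightarrow> real) n. mono t \<and> t 0 = 0 \<and> (\<forall>j\<in>J. \<exists>k\<le>n. j = t k)"
proof -
  define xs where "xs = sorted_list_of_set (insert 0 J)"
  have "sorted xs" unfolding xs_def by (rule sorted_sorted_list_of_set)
  moreover have "set xs = insert 0 J" unfolding xs_def by (rule set_sorted_list_of_set) (use J in simp)
  ultimately have xs: "sorted xs" "set xs = insert 0 J" "xs \<noteq> []" by auto
  define t where "t i = xs ! min i (length xs - 1)" for i
  have l: "min i (length xs - 1) < length xs" for i using xs(3) by (cases xs) auto
  have m: "mono t"
  proof (rule monoI)
    fix i j :: nat assume "i \<le> j"
    then have "min i (length xs - 1) \<le> min j (length xs - 1)" by simp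
    then show "t i \<le> t j" unfolding t_def by (rule sorted_nth_mono[OF xs(1) _ l])
  qed
  have "t 0 = 0"
  proof (rule antisym)
    have "0 \<in> set xs" unfolding xs(2) by simp
    then obtain k where "k < length xs" "xs ! k = 0" unfolding in_set_conv_nth by blast
    then have "t k = 0" unfolding t_def by (simp add: min_absorb1)
    then show "t 0 \<le> 0" using monoD[OF m, of 0 k] by simp
    have "t 0 \<in> set xs" unfolding t_def by (rule nth_mem[OF l])
    then have "t 0 \<in> insert 0 J" unfolding xs(2) .
    then consider "t 0 = 0" | "t 0 \<in> J" by blast
    then show "0 \<le> t 0"
    proof cases
      case 2
      then have "t 0 \<in> {0..}" using J(2) by blast
      then show ?thesis by simp
    qed simp
  qed
  moreover have "\<exists>k\<le>length xs. j = t k" if "j \<in> J" for j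
  proof -
    have "j \<in> set xs" unfolding xs(2) using that by simp
    then obtain k where k: "k < length xs" "xs ! k = j" unfolding in_set_conv_nth by blast
    then have "t k = j" unfolding t_def by (simp add: min_absorb1)
    then show ?thesis using k(1) less_imp_le by blast
  qed
  ultimately show ?thesis using m by blast
qed

context spectrally_positive_stable
begin

definition path_scaling :: "real \<Rightarrow> (real \<Rightarrow> real) \<Rightarrow> real \<Rightarrow> real" where
  "path_scaling c w = (\<lambda>s\<in>{0..}. 0 + c powr (1 / \<alpha>) * w (s / c))"

lemma path_scaling_measurable: "c > 0 \<Longrightarrow> path_scaling c \<in> measurable P path_space"
  unfolding path_scaling_def[abs_def] measurable_cong_sets[OF sets_P refl] by (rule path_affine_measurable)

lemma increments_indep:
  assumes "mono t" "0 \<le> t 0"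
  shows "indep_vars (\<lambda>_. borel) (\<lambda>i w. w (t (Suc i)) - w (t i)) {..<n::nat}"
proof -
  have "\<forall>(t :: nat \<Rightarrow> real) n. 0 \<le> t 0 \<and> mono t \<longrightarrow> indep_vars (\<lambda>_. borel) (\<lambda>i w. w (t (Suc i)) - w (t i)) {..<n}"
    using levy unfolding levy_law_def by (elim conjE)
  from this[rule_format, of t n] assms show ?thesis by simp
qed

text \<open>Stability provides one-dimensional laws only. Independent stationary increments make the
  joint law of the increments a product of such laws, and positions are partial sums of
  increments.\<close>

lemma law_scaling_invariant:
  assumes c: "c > 0"
  shows "distr P path_space (path_scaling c) = P"
proof (rule path_measure_eqI)
  show "prob_space (distr P path_space (path_scaling c))" by (rule prob_space_distr[OF path_scaling_measurable[OF c]])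
  show "sets P = sets path_space" by (rule sets_P)
  show "prob_space P" by unfold_locales
  fix J and A :: "real \<Rightarrow> real set" assume J: "finite J" "J \<subseteq> {0..}" and A: "\<And>j. j \<in> J \<Longrightarrow> A j \<in> sets borel"
  obtain t :: "nat \<Rightarrow> real" and n where t: "mono t" "t 0 = 0" "\<And>j. j \<in> J \<Longrightarrow> \<exists>k\<le>n. j = t k"
    using finite_times_sequence[OF J] by blast
  then have "\<forall>j\<in>J. \<exists>k. k \<le> n \<and> t k = j" by metis
  then obtain k where k: "\<And>j. j \<in> J \<Longrightarrow> k j \<le> n" "\<And>j. j \<in> J \<Longrightarrow> t (k j) = j" by metis
  have t0: "0 \<le> t i" for i using monoD[OF t(1), of 0 i] t(2) by simp
  define X where "X i w = w (t (Suc i)) - w (t i)" for i and w :: "real \<Rightarrow> real"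
  define X' where "X' i w = X i (path_scaling c w)" for i w
  have X'_eq: "X' i w = c powr (1 / \<alpha>) * (w (t (Suc i) / c) - w (t i / c))" for i w
    using t0 by (simp add: X'_def X_def path_scaling_def right_diff_distrib)
  let ?I = "{..<Suc n}"
  have ind: "indep_vars (\<lambda>_. borel) X ?I" unfolding X_def by (rule increments_indep) (use t in auto)
  have "indep_vars (\<lambda>_. borel) (\<lambda>i w. w (t (Suc i) / c) - w (t i / c)) ?I"
    by (rule increments_indep[of "\<lambda>i. t i / c"]) (use t c in \<open>auto simp: mono_def divide_right_mono\<close>)
  then have ind': "indep_vars (\<lambda>_. borel) X' ?I"
    unfolding X'_eq[abs_def] by (rule indep_vars_compose2[where Y="\<lambda>i x. c powr (1 / \<alpha>) * x"]) simp
  have marg: "distr P borel (X i) = distr P borel (X' i)" for i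
  proof -
    define h where "h = t (Suc i) - t i"
    have h: "0 \<le> h" using monoD[OF t(1), of i "Suc i"] by (simp add: h_def)
    have st: "distr P borel (\<lambda>w. w (s + h) - w s) = distr P borel (\<lambda>w. w h)" if "0 \<le> s" "0 \<le> h" for s h
      using levy that by (simp add: levy_law_def)
    have sc: "distr P borel (\<lambda>w. w (c * r)) = distr P borel (\<lambda>w. c powr (1 / \<alpha>) * w r)" if "0 \<le> r" for r
      using law c that by (simp add: normalized_spectrally_positive_stable_law_def stable_law_def)
    have hc: "0 \<le> h / c" "c * (h / c) = h" "t i / c + h / c = t (Suc i) / c" "t i + h = t (Suc i)" "0 \<le> t i / c" "0 \<le> t (Suc i) / c"
    proof -
      show "0 \<le> h / c" "c * (h / c) = h" "0 \<le> t i / c" "0 \<le> t (Suc i) / c" using c h t0 by simp_all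
      show "t i / c + h / c = t (Suc i) / c" "t i + h = t (Suc i)" by (simp_all add: h_def diff_divide_distrib)
    qed
    have m1: "(\<lambda>w. w (h / c)) \<in> borel_measurable P" by (rule eval_measurable[OF hc(1)])
    have m2: "(\<lambda>w. w (t (Suc i) / c) - w (t i / c)) \<in> borel_measurable P"
      by (intro borel_measurable_diff eval_measurable hc)
    have "distr P borel (X i) = distr P borel (\<lambda>w. w h)"
      using st[OF t0[of i] h] unfolding X_def[abs_def] hc(4) .
    also have "\<dots> = distr P borel (\<lambda>w. c powr (1 / \<alpha>) * w (h / c))"
      using sc[OF hc(1)] unfolding hc(2) .
    also have "\<dots> = distr (distr P borel (\<lambda>w. w (h / c))) borel (\<lambda>y. c powr (1 / \<alpha>) * y)"
      by (subst distr_distr[OF _ m1]) (simp_all add: o_def)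
    also have "distr P borel (\<lambda>w. w (h / c)) = distr P borel (\<lambda>w. w (t (Suc i) / c) - w (t i / c))"
      using st[OF hc(5,1), symmetric] unfolding hc(3) .
    also have "distr \<dots> borel (\<lambda>y. c powr (1 / \<alpha>) * y) = distr P borel (X' i)"
      unfolding X'_eq[abs_def] by (subst distr_distr[OF _ m2]) (simp_all add: o_def)
    finally show ?thesis .
  qed
  have Xm: "X i \<in> borel_measurable P" "X' i \<in> borel_measurable P" for i
  proof -
    show "X i \<in> borel_measurable P"
      unfolding X_def[abs_def] by (intro borel_measurable_diff eval_measurable t0)
    have "0 \<le> t i / c" "0 \<le> t (Suc i) / c" using t0 c by simp_all
    then show "X' i \<in> borel_measurable P"
      unfolding X'_eq[abs_def] by (intro borel_measurable_times borel_measurable_const borel_measurable_diff eval_measurable)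
  qed
  have ne: "?I \<noteq> {}" by auto
  have "distr P (\<Pi>\<^sub>M i\<in>?I. borel) (\<lambda>w. \<lambda>i\<in>?I. X i w) = (\<Pi>\<^sub>M i\<in>?I. distr P borel (X i))"
    by (rule indep_vars_iff_distr_eq_PiM'[THEN iffD1, OF ne Xm(1) ind])
  moreover have "distr P (\<Pi>\<^sub>M i\<in>?I. borel) (\<lambda>w. \<lambda>i\<in>?I. X' i w) = (\<Pi>\<^sub>M i\<in>?I. distr P borel (X' i))"
    by (rule indep_vars_iff_distr_eq_PiM'[THEN iffD1, OF ne Xm(2) ind'])
  ultimately have joint: "distr P (\<Pi>\<^sub>M i\<in>?I. borel) (\<lambda>w. \<lambda>i\<in>?I. X i w) = distr P (\<Pi>\<^sub>M i\<in>?I. borel) (\<lambda>w. \<lambda>i\<in>?I. X' i w)"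
    by (simp only: marg)
  \<comment> \<open>The cylinder event in terms of increments: the position at j is the sum of the
    first \<open>k j\<close> of them, almost surely, because the path starts at 0.\<close>
  define B where "B = {v \<in> space (\<Pi>\<^sub>M i\<in>?I. (borel :: real measure)). \<forall>j\<in>J. (\<Sum>i<k j. v i) \<in> A j}"
  have Bm: "B \<in> sets (\<Pi>\<^sub>M i\<in>?I. borel)"
    unfolding B_def
  proof (rule sets.sets_Collect_finite_All[OF _ J(1)])
    fix j assume j: "j \<in> J"
    have "(\<lambda>v. \<Sum>i<k j. v i) \<in> borel_measurable (\<Pi>\<^sub>M i\<in>?I. (borel :: real measure))"
      by (intro borel_measurable_sum measurable_component_singleton) (use k(1)[OF j] in auto)
    from measurable_sets[OF this A[OF j]]
    show "{v \<in> space (\<Pi>\<^sub>M i\<in>?I. (borel :: real measure)). (\<Sum>i<k j. v i) \<in> A j} \<in> sets (\<Pi>\<^sub>M i\<in>?I. borel)"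
      by (simp add: vimage_def Int_def conj_commute)
  qed
  have XB: "(\<lambda>i\<in>?I. X i w) \<in> B \<longleftrightarrow> (\<forall>j\<in>J. w j \<in> A j)" if "w 0 = 0" for w
  proof -
    have "(\<Sum>i<k j. (\<lambda>i\<in>?I. X i w) i) = w j" if "j \<in> J" for j
    proof -
      have "(\<Sum>i<k j. (\<lambda>i\<in>?I. X i w) i) = (\<Sum>i<k j. w (t (Suc i)) - w (t i))"
        using k(1)[OF that] by (intro sum.cong) (auto simp: X_def)
      also have "\<dots> = w (t (k j)) - w (t 0)" by (rule sum_lessThan_telescope)
      finally show ?thesis using k(2)[OF that] t(2) \<open>w 0 = 0\<close> by simp
    qed
    then show ?thesis by (auto simp: B_def space_PiM PiE_iff)
  qed
  define C where "C = {w \<in> cadlag_paths. \<forall>j\<in>J. w j \<in> A j}"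
  have Cm: "C \<in> sets path_space"
  proof -
    have "{w \<in> space path_space. \<forall>j\<in>J. w j \<in> A j} \<in> sets path_space"
    proof (rule sets.sets_Collect_finite_All[OF _ J(1)])
      fix j assume j: "j \<in> J"
      then have "0 \<le> j" using J(2) by auto
      from measurable_sets[OF measurable_path_eval[OF this] A[OF j]]
      show "{w \<in> space path_space. w j \<in> A j} \<in> sets path_space" by (simp add: vimage_def Int_def conj_commute)
    qed
    then show ?thesis by (simp add: C_def space_path_space)
  qed
  have rm: "(\<lambda>w. \<lambda>i\<in>?I. X i w) \<in> measurable P (\<Pi>\<^sub>M i\<in>?I. borel)" "(\<lambda>w. \<lambda>i\<in>?I. X' i w) \<in> measurable P (\<Pi>\<^sub>M i\<in>?I. borel)"
    by (intro measurable_restrict Xm)+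
  have "emeasure P C = emeasure P ((\<lambda>w. \<lambda>i\<in>?I. X i w) -` B \<inter> space P)"
  proof (rule emeasure_eq_AE)
    show "AE w in P. w \<in> C \<longleftrightarrow> w \<in> (\<lambda>w. \<lambda>i\<in>?I. X i w) -` B \<inter> space P"
      using start_zero AE_space
    proof eventually_elim
      case (elim w)
      show ?case
        unfolding C_def mem_Collect_eq Int_iff vimage_eq XB[of w, OF elim(1)] using elim(2) space_P by blast
    qed
    show "C \<in> sets P" using Cm unfolding sets_P .
    show "(\<lambda>w. \<lambda>i\<in>?I. X i w) -` B \<inter> space P \<in> sets P" by (rule measurable_sets[OF rm(1) Bm])
  qed
  also have "\<dots> = emeasure (distr P (\<Pi>\<^sub>M i\<in>?I. borel) (\<lambda>w. \<lambda>i\<in>?I. X i w)) B" by (rule emeasure_distr[OF rm(1) Bm, symmetric])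
  also have "\<dots> = emeasure P ((\<lambda>w. \<lambda>i\<in>?I. X' i w) -` B \<inter> space P)" unfolding joint by (rule emeasure_distr[OF rm(2) Bm])
  also have "\<dots> = emeasure P (path_scaling c -` C \<inter> space P)"
  proof (rule emeasure_eq_AE)
    show "AE w in P. w \<in> (\<lambda>w. \<lambda>i\<in>?I. X' i w) -` B \<inter> space P \<longleftrightarrow> w \<in> path_scaling c -` C \<inter> space P"
      using start_zero AE_space
    proof eventually_elim
      case (elim w)
      have "path_scaling c w 0 = 0" using elim by (simp add: path_scaling_def)
      moreover have "path_scaling c w \<in> cadlag_paths"
        using measurable_space[OF path_scaling_measurable[OF c] elim(2)] by (simp add: space_path_space)
      ultimately show ?case
        unfolding C_def Int_iff vimage_eq mem_Collect_eq X'_def using XB[of "path_scaling c w"] by blast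
    qed
    show "path_scaling c -` C \<inter> space P \<in> sets P" by (rule measurable_sets[OF path_scaling_measurable[OF c] Cm])
    show "(\<lambda>w. \<lambda>i\<in>?I. X' i w) -` B \<inter> space P \<in> sets P" by (rule measurable_sets[OF rm(2) Bm])
  qed
  also have "\<dots> = emeasure (distr P path_space (path_scaling c)) C"
    by (rule emeasure_distr[OF path_scaling_measurable[OF c] Cm, symmetric])
  finally have "emeasure (distr P path_space (path_scaling c)) C = emeasure P C" by (rule sym)
  then show "emeasure (distr P path_space (path_scaling c)) {w \<in> cadlag_paths. \<forall>j\<in>J. w j \<in> A j} = emeasure P {w \<in> cadlag_paths. \<forall>j\<in>J. w j \<in> A j}"
    unfolding C_def .
qed simp

end

section \<open>Skorokhod continuity of integral functionals\<close>

text \<open>The preimage y of s under the time change tends to s, and u(s) is close to w(y), hence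
  to w(s) by continuity of w at s.\<close>

lemma skorokhod_converges_pointwise:
  assumes conv: "skorokhod_converges u w" and s: "0 < s" and c: "isCont w s"
  shows "(\<lambda>n. u n s) \<longlonglongrightarrow> w s"
proof -
  obtain r :: "nat \<Rightarrow> real \<Rightarrow> real" where r: "\<And>n. bij_betw (r n) {0..} {0..}"
      "uniform_limit {0..} r (\<lambda>s. s) sequentially" "\<And>N. uniform_limit {0..N} (\<lambda>n s. u n (r n s)) w sequentially"
    using conv unfolding skorokhod_converges_def by blast
  have "\<exists>y\<ge>0. r n y = s" for n
    using bij_betw_imp_surj_on[OF r(1)[of n]] s by (metis atLeast_iff image_iff less_imp_le)
  then obtain y where y: "\<And>n. 0 \<le> y n" "\<And>n. r n (y n) = s" by metis
  have ylim: "y \<longlonglongrightarrow> s"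
  proof (rule tendstoI)
    fix e :: real assume "e > 0"
    from uniform_limitD[OF r(2) this] show "\<forall>\<^sub>F n in sequentially. dist (y n) s < e"
    proof eventually_elim
      case (elim n)
      then have "dist (r n (y n)) (y n) < e" using y(1)[of n] by auto
      then show ?case by (simp add: y(2) dist_commute)
    qed
  qed
  have d: "(\<lambda>n. u n s - w (y n)) \<longlonglongrightarrow> 0"
  proof (rule tendstoI)
    fix e :: real assume "e > 0"
    have "\<forall>\<^sub>F n in sequentially. y n < s + 1" by (rule order_tendstoD(2)[OF ylim]) simp
    with uniform_limitD[OF r(3)[of "s + 1"] \<open>e > 0\<close>] show "\<forall>\<^sub>F n in sequentially. dist (u n s - w (y n)) 0 < e"
    proof eventually_elim
      case (elim n)
      then have "dist (u n (r n (y n))) (w (y n)) < e" using y(1)[of n] by auto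
      then show ?case by (simp add: y(2) dist_real_def)
    qed
  qed
  have "(\<lambda>n. (u n s - w (y n)) + w (y n)) \<longlonglongrightarrow> 0 + w s"
    by (intro tendsto_add d isCont_tendsto_compose[OF c ylim])
  then show ?thesis by simp
qed

lemma skorokhod_converges_bounded:
  assumes conv: "skorokhod_converges u w" and w: "cadlag w"
  shows "\<exists>K\<ge>0. \<forall>\<^sub>F n in sequentially. \<forall>s\<in>{0..t}. \<bar>u n s\<bar> \<le> K"
proof -
  obtain r :: "nat \<Rightarrow> real \<Rightarrow> real" where r: "\<And>n. bij_betw (r n) {0..} {0..}"
      "uniform_limit {0..} r (\<lambda>s. s) sequentially" "\<And>N. uniform_limit {0..N} (\<lambda>n s. u n (r n s)) w sequentially"
    using conv unfolding skorokhod_converges_def by blast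
  \<comment> \<open>Once the time change moves times by less than 1, preimages of [0, t] lie in
    [0, t + 1].\<close>
  obtain K where K: "K \<ge> 0" "\<And>s. s \<in> {0..t + 1} \<Longrightarrow> \<bar>w s\<bar> \<le> K" using cadlag_bounded[OF w] by blast
  have "\<forall>\<^sub>F n in sequentially. \<forall>s\<in>{0..t}. \<bar>u n s\<bar> \<le> K + 1"
    using uniform_limitD[OF r(2) zero_less_one] uniform_limitD[OF r(3)[of "t + 1"] zero_less_one]
  proof eventually_elim
    case (elim n)
    show ?case
    proof
      fix s assume s: "s \<in> {0..t}"
      then obtain y where y: "0 \<le> y" "r n y = s"
        using bij_betw_imp_surj_on[OF r(1)[of n]] by (metis atLeastAtMost_iff atLeast_iff image_iff)
      have "dist (r n y) y < 1" using elim(1) y by auto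
      then have yt: "y \<in> {0..t + 1}" using y s by (auto simp: dist_real_def)
      then have "dist (u n (r n y)) (w y) < 1" using elim(2) by auto
      then show "\<bar>u n s\<bar> \<le> K + 1" using K(2)[OF yt] y by (auto simp: dist_real_def)
    qed
  qed
  then show ?thesis using K by (intro exI[of _ "K + 1"]) auto
qed

lemma cadlag_compose_measurable:
  fixes f :: "real \<Rightarrow> real"
  assumes w: "cadlag w" and f: "continuous_on UNIV f"
  shows "(\<lambda>s. indicator {0..t} s *\<^sub>R f (w s)) \<in> borel_measurable lborel"
proof -
  have v: "(\<lambda>s. indicator {0..t} s *\<^sub>R w s) \<in> borel_measurable lborel"
    using cadlag_set_integrable[OF w, of t] unfolding set_integrable_def by (rule borel_measurable_integrable)
  have "f \<in> borel_measurable borel" using f by (rule borel_measurable_continuous_onI)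
  then have "(\<lambda>s. indicator {0..t} s *\<^sub>R f (indicator {0..t} s *\<^sub>R w s)) \<in> borel_measurable lborel"
    by (intro borel_measurable_scaleR measurable_compose[OF v]) auto
  moreover have "indicator {0..t} s *\<^sub>R f (indicator {0..t} s *\<^sub>R w s) = indicator {0..t} s *\<^sub>R f (w s)" for s
    by (auto simp: indicator_def)
  ultimately show ?thesis by (simp only:)
qed

text \<open>Values converge outside the countably many jump times of the limit, and eventually all
  paths share a bound on [0, t].\<close>

lemma skorokhod_integral_tendsto:
  fixes f :: "real \<Rightarrow> real"
  assumes conv: "skorokhod_converges u w" and w: "cadlag w" and u: "\<And>n. cadlag (u n)" and f: "continuous_on UNIV f"
  shows "(\<lambda>n. LINT s:{0..t}|lborel. f (u n s)) \<longlonglongrightarrow> (LINT s:{0..t}|lborel. f (w s))"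
proof -
  obtain K where K: "K \<ge> 0" "\<forall>\<^sub>F n in sequentially. \<forall>s\<in>{0..t}. \<bar>u n s\<bar> \<le> K"
    using skorokhod_converges_bounded[OF conv w] by blast
  then obtain n0 where n0: "\<And>n s. n \<ge> n0 \<Longrightarrow> s \<in> {0..t} \<Longrightarrow> \<bar>u n s\<bar> \<le> K"
    unfolding eventually_sequentially by blast
  obtain B where B: "\<And>y. y \<in> {-K..K} \<Longrightarrow> norm (f y) \<le> B"
    using compact_imp_bounded[OF compact_continuous_image[OF continuous_on_subset[OF f] compact_Icc, of "-K" K]]
    unfolding bounded_iff by blast
  have "(\<lambda>n. LINT s|lborel. indicator {0..t} s *\<^sub>R f (u (n + n0) s)) \<longlonglongrightarrow> (LINT s|lborel. indicator {0..t} s *\<^sub>R f (w s))"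
  proof (rule integral_dominated_convergence)
    show "integrable lborel (\<lambda>s. indicator {0..t} s * B)"
      by (intro integrable_mult_left integrable_real_indicator) (auto simp: emeasure_lborel_Icc_eq)
    show "AE s in lborel. norm (indicator {0..t} s *\<^sub>R f (u (n + n0) s)) \<le> indicator {0..t} s * B" for n
    proof (rule AE_I2)
      fix s show "norm (indicator {0..t} s *\<^sub>R f (u (n + n0) s)) \<le> indicator {0..t} s * B"
        using n0[of "n + n0" s] B[of "u (n + n0) s"] by (auto simp: indicator_def abs_le_iff)
    qed
    show "AE s in lborel. (\<lambda>n. indicator {0..t} s *\<^sub>R f (u (n + n0) s)) \<longlonglongrightarrow> indicator {0..t} s *\<^sub>R f (w s)"
      using cadlag_AE_isCont[OF w] AE_lborel_singleton[of "0::real"]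
    proof eventually_elim
      case (elim s)
      show ?case
      proof (cases "s \<in> {0..t}")
        case True
        then have s: "0 < s" using elim by auto
        have "isCont f (w s)" using f by (simp add: continuous_on_eq_continuous_at)
        from isCont_tendsto_compose[OF this skorokhod_converges_pointwise[OF conv s]] elim s
        have "(\<lambda>n. f (u n s)) \<longlonglongrightarrow> f (w s)" by blast
        then show ?thesis by (intro tendsto_intros LIMSEQ_ignore_initial_segment)
      qed simp
    qed
  qed (use cadlag_compose_measurable[OF w f] cadlag_compose_measurable[OF u f] in auto)
  then show ?thesis unfolding set_lebesgue_integral_def by (rule LIMSEQ_offset)
qed

text \<open>The open sets are the sequentially open ones, so sequential continuity is
  enough.\<close>

lemma skorokhod_continuous_mapI:
  fixes F :: "(real \<Rightarrow> real) \<Rightarrow> real"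
  assumes "\<And>u w. w \<in> cadlag_paths \<Longrightarrow> (\<And>n. u n \<in> cadlag_paths) \<Longrightarrow> skorokhod_converges u w \<Longrightarrow> (\<lambda>n. F (u n)) \<longlonglongrightarrow> F w"
  shows "continuous_map skorokhod_topology euclideanreal F"
  unfolding continuous_map_def
proof (intro conjI allI impI)
  fix U assume "openin euclideanreal U"
  then have U: "open U" by simp
  show "openin skorokhod_topology {w \<in> topspace skorokhod_topology. F w \<in> U}"
    unfolding openin_skorokhod_topology topspace_skorokhod_topology skorokhod_open_def
  proof (intro conjI allI impI)
    fix u w assume a: "w \<in> {w \<in> cadlag_paths. F w \<in> U} \<and> (\<forall>n. u n \<in> cadlag_paths) \<and> skorokhod_converges u w"
    then have "(\<lambda>n. F (u n)) \<longlonglongrightarrow> F w" by (intro assms) auto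
    from topological_tendstoD[OF this U] a show "\<forall>\<^sub>F n in sequentially. u n \<in> {w \<in> cadlag_paths. F w \<in> U}" by auto
  qed auto
qed simp

lemma skorokhod_integral_continuous_map:
  fixes f g :: "real \<Rightarrow> real"
  assumes f: "continuous_on UNIV f" and g: "continuous_on UNIV g"
  shows "continuous_map skorokhod_topology euclideanreal (\<lambda>w. g (LINT s:{0..t}|lborel. f (w s)))"
proof (rule skorokhod_continuous_mapI)
  fix u w assume a: "w \<in> cadlag_paths" "\<And>n. u n \<in> cadlag_paths" "skorokhod_converges u w"
  have "isCont g (LINT s:{0..t}|lborel. f (w s))" using g by (simp add: continuous_on_eq_continuous_at)
  then show "(\<lambda>n. g (LINT s:{0..t}|lborel. f (u n s))) \<longlonglongrightarrow> g (LINT s:{0..t}|lborel. f (w s))"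
    by (rule isCont_tendsto_compose, intro skorokhod_integral_tendsto a f) (use a in \<open>auto simp: cadlag_paths_def\<close>)
qed

section \<open>Conditioning to stay positive\<close>

text \<open>The weight of the h-transform times the exponential of the area, for a path from 0
  shifted by x and killed below x - y. The levels x and y are kept apart so that y < x can
  approximate y = x; \<open>ennreal\<close> sends a negative weight to 0.\<close>

definition area_functional :: "real \<Rightarrow> real \<Rightarrow> real \<Rightarrow> real \<Rightarrow> (real \<Rightarrow> real) \<Rightarrow> ennreal" where
  "area_functional s x y t w = ennreal ((x + w t) * exp (- (s * (LINT r:{0..t}|lborel. x + w r)))) * indicator {w. alive y w t} w"

lemma area_functional_measurable:
  assumes t: "0 \<le> t"
  shows "area_functional s x y t \<in> borel_measurable path_space"
proof -
  have sp: "space path_space \<subseteq> cadlag_paths" by (simp add: space_path_space)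
  have p: "(\<lambda>w. (w, t)) \<in> measurable path_space (path_space \<Otimes>\<^sub>M borel)" by (rule measurable_Pair2') simp
  have [measurable]: "(\<lambda>w. w t) \<in> borel_measurable path_space" by (rule measurable_path_eval[OF t])
  have "(\<lambda>p. LINT r:{0..snd p}|lborel. x + fst p r) \<in> borel_measurable (path_space \<Otimes>\<^sub>M borel)"
    by (rule path_integral_jointly_measurable[OF measurable_path_eval sp]) simp_all
  from measurable_compose[OF p this]
  have [measurable]: "(\<lambda>w. LINT r:{0..t}|lborel. x + w r) \<in> borel_measurable path_space" by simp
  have "Measurable.pred (path_space \<Otimes>\<^sub>M borel) (\<lambda>p. 0 \<le> snd p \<and> alive y (fst p) (snd p))"
    by (rule alive_jointly_measurable[OF measurable_path_eval sp])
  from measurable_compose[OF p this]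
  have "Measurable.pred path_space (\<lambda>w. 0 \<le> t \<and> alive y w t)" by (simp only: fst_conv snd_conv)
  then have [measurable]: "Measurable.pred path_space (\<lambda>w. alive y w t)" by (simp only: t HOL.simp_thms)
  show ?thesis unfolding area_functional_def[abs_def] indicator_def mem_Collect_eq by measurable
qed

text \<open>Equals the area for nonnegative paths, but is nonnegative for every path, so that exp(-s
  area) is a bounded test functional before positivity is known.\<close>

definition clipped_area :: "(real \<Rightarrow> real) \<Rightarrow> real" where
  "clipped_area w = (LINT r:{0..1}|lborel. max (w r) 0)"

text \<open>A Skorokhod-continuous functional, bounded by the cutoff at 1, that vanishes exactly
  when the path is nonnegative at almost every time in [0, 1].\<close>

definition negative_part_area :: "(real \<Rightarrow> real) \<Rightarrow> real" where
  "negative_part_area w = (LINT r:{0..1}|lborel. min 1 (max (- w r) 0))"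

text \<open>The \<sigma>-algebra of the path up to time 1, packaged as a measure space so that
  measurability of functions can be stated. On its events the h-transform at time 1 determines the
  conditioned law.\<close>

definition filtration_measure :: "(real \<Rightarrow> real) measure" where
  "filtration_measure = sigma cadlag_paths {{w \<in> cadlag_paths. w s \<in> B} | s B. 0 \<le> s \<and> s \<le> 1 \<and> B \<in> sets borel}"

lemma sets_filtration_measure: "sets filtration_measure = natural_filtration 1"
  unfolding filtration_measure_def natural_filtration_def by (rule sets_measure_of) auto

lemma space_filtration_measure: "space filtration_measure = cadlag_paths"
  unfolding filtration_measure_def by (rule space_measure_of) auto

lemma eval_filtration_measurable:
  assumes "0 \<le> s" "s \<le> 1" shows "(\<lambda>w. w s) \<in> borel_measurable filtration_measure"
proof (rule measurableI)
  fix B :: "real set" assume "B \<in> sets borel"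
  then have "{w \<in> cadlag_paths. w s \<in> B} \<in> natural_filtration 1"
    unfolding natural_filtration_def using assms by (intro sigma_sets.Basic) blast
  moreover have "(\<lambda>w. w s) -` B \<inter> space filtration_measure = {w \<in> cadlag_paths. w s \<in> B}"
    by (auto simp: space_filtration_measure)
  ultimately show "(\<lambda>w. w s) -` B \<inter> space filtration_measure \<in> sets filtration_measure"
    by (simp add: sets_filtration_measure)
qed simp

lemma filtration_subset: "natural_filtration 1 \<subseteq> sets path_space"
  unfolding natural_filtration_def
proof (rule sigma_sets_le_sets_iff[THEN iffD2, of _ path_space, unfolded space_path_space])
  show "{{w \<in> cadlag_paths. w s \<in> B} |s B. 0 \<le> s \<and> s \<le> 1 \<and> B \<in> sets borel} \<subseteq> sets path_space"
  proof safe
    fix s :: real and B :: "real set" assume "0 \<le> s" "B \<in> sets borel"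
    from measurable_sets[OF measurable_path_eval[OF this(1)] this(2)]
    show "{w \<in> cadlag_paths. w s \<in> B} \<in> sets path_space"
      by (simp add: space_path_space vimage_def Int_def conj_commute)
  qed
qed

text \<open>Only times in [0, 1] are evaluated, so the \<sigma>-algebra of the path up to time 1 is
  covered together with the full one.\<close>

lemma unit_integral_measurable:
  fixes f :: "real \<Rightarrow> real"
  assumes N: "\<And>s. 0 \<le> s \<Longrightarrow> s \<le> 1 \<Longrightarrow> (\<lambda>w. w s) \<in> borel_measurable N" "space N \<subseteq> cadlag_paths"
    and f: "f \<in> borel_measurable borel"
  shows "(\<lambda>w. LINT r:{0..1}|lborel. f (w r)) \<in> borel_measurable N"
proof -
  have "(\<lambda>(w, s). w (max 0 (min 1 s))) \<in> borel_measurable (N \<Otimes>\<^sub>M (borel :: real measure))"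
    by (rule path_eval_joint_measurable) (use N in auto)
  then have [measurable]: "(\<lambda>x. fst x (max 0 (min 1 (snd x)))) \<in> borel_measurable (N \<Otimes>\<^sub>M (borel :: real measure))"
    by (simp add: case_prod_beta)
  note [measurable] = f
  have "(\<lambda>x. indicator {0..1} (snd x) *\<^sub>R f (fst x (max 0 (min 1 (snd x))))) \<in> borel_measurable (N \<Otimes>\<^sub>M (borel :: real measure))"
    by measurable
  then have "(\<lambda>(w, r). indicator {0..1} r *\<^sub>R f (w (max 0 (min 1 r)))) \<in> borel_measurable (N \<Otimes>\<^sub>M lborel)"
    by (subst measurable_cong_sets[OF sets_pair_measure_cong[OF refl sets_lborel] refl]) (simp add: case_prod_beta)
  from sigma_finite_measure.borel_measurable_lebesgue_integral[OF sigma_finite_lborel this]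
  have "(\<lambda>w. LINT r|lborel. indicator {0..1} r *\<^sub>R f (w (max 0 (min 1 r)))) \<in> borel_measurable N" .
  moreover have "(LINT r|lborel. indicator {0..1} r *\<^sub>R f (w (max 0 (min 1 r)))) = (LINT r:{0..1}|lborel. f (w r))" for w :: "real \<Rightarrow> real"
    unfolding set_lebesgue_integral_def
  proof (rule Bochner_Integration.integral_cong[OF refl])
    fix r :: real
    have "max 0 (min 1 r) = r" if "r \<in> {0..1}" using that by auto
    then show "indicator {0..1} r *\<^sub>R f (w (max 0 (min 1 r))) = indicator {0..1} r *\<^sub>R f (w r)"
      by (cases "r \<in> {0..1}") (simp_all only: indicator_simps, simp_all)
  qed
  ultimately show ?thesis by (simp only:)
qed

text \<open>Zeros after time 1 could accumulate at 1 and make the infimum equal to 1. Right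
  continuity together with a nonzero value at 1 keeps the path away from 0 slightly beyond
  1.\<close>

lemma nonzero_on_unit_iff:
  assumes w: "cadlag w"
  shows "ereal 1 < hitting_time_zero w \<longleftrightarrow> (\<forall>r\<in>{0..1}. w r \<noteq> 0)"
proof
  assume a: "ereal 1 < hitting_time_zero w"
  show "\<forall>r\<in>{0..1}. w r \<noteq> 0"
  proof
    fix r :: real assume r: "r \<in> {0..1}"
    show "w r \<noteq> 0"
    proof
      assume "w r = 0"
      then have "hitting_time_zero w \<le> ereal r" unfolding hitting_time_zero_def using r by (intro Inf_lower) auto
      also have "\<dots> \<le> ereal 1" using r by simp
      finally show False using a by simp
    qed
  qed
next
  assume nz: "\<forall>r\<in>{0..1}. w r \<noteq> 0"
  have "(w \<longlongrightarrow> w 1) (at_right 1)" using w by (simp add: cadlag_def)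
  moreover have "w 1 \<noteq> 0" using nz by simp
  ultimately have "\<forall>\<^sub>F r in at_right 1. w r \<noteq> 0" by (rule tendsto_imp_eventually_ne)
  then obtain b where b: "b > 1" "\<And>r. 1 < r \<Longrightarrow> r < b \<Longrightarrow> w r \<noteq> 0"
    unfolding eventually_at_right_field by blast
  have "ereal b \<le> hitting_time_zero w"
    unfolding hitting_time_zero_def
  proof (rule Inf_greatest)
    fix e assume "e \<in> ereal ` {t. 0 \<le> t \<and> w t = 0}"
    then obtain r where r: "e = ereal r" "0 \<le> r" "w r = 0" by auto
    then have "\<not> r < b" using nz b(2)[of r] by (cases "r \<le> 1") auto
    then show "ereal b \<le> e" using r by simp
  qed
  then show "ereal 1 < hitting_time_zero w" using b(1) by (meson ereal_less_le less_ereal.simps(1) order_less_le_trans)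
qed

text \<open>At the infimum \<tau> of the nonpositive times, right continuity gives w(\<tau>) \<le> 0
  and the absence of negative jumps gives w(\<tau>) \<ge> 0, so \<tau> would be a zero.\<close>

lemma positive_before_hitting:
  assumes w: "cadlag w" and nn: "no_negative_jumps w" and w0: "0 < w 0" and nz: "\<And>r. r \<in> {0..t} \<Longrightarrow> w r \<noteq> 0"
    and s: "s \<in> {0..t}"
  shows "0 < w s"
proof (rule ccontr)
  assume "\<not> 0 < w s"
  define S where "S = {r. 0 \<le> r \<and> r \<le> s \<and> w r \<le> 0}"
  have ne: "S \<noteq> {}" using \<open>\<not> 0 < w s\<close> s by (auto simp: S_def)
  have bb: "bdd_below S" unfolding S_def by (rule bdd_belowI[of _ 0]) auto
  define \<tau> where "\<tau> = Inf S"
  have \<tau>0: "0 \<le> \<tau>" unfolding \<tau>_def by (rule cInf_greatest[OF ne]) (auto simp: S_def)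
  have \<tau>le: "\<tau> \<le> r" if "r \<in> S" for r unfolding \<tau>_def by (rule cInf_lower[OF that bb])
  have \<tau>s: "\<tau> \<le> s" using \<tau>le ne by (force simp: S_def)
  have up: "w \<tau> \<le> 0"
  proof (rule ccontr)
    assume "\<not> w \<tau> \<le> 0"
    moreover have "(w \<longlongrightarrow> w \<tau>) (at_right \<tau>)" using w \<tau>0 by (auto simp: cadlag_def)
    ultimately have "\<forall>\<^sub>F r in at_right \<tau>. 0 < w r" by (intro order_tendstoD(1)) auto
    then obtain b where b: "b > \<tau>" "\<And>r. \<tau> < r \<Longrightarrow> r < b \<Longrightarrow> 0 < w r" unfolding eventually_at_right_field by blast
    obtain r where r: "r \<in> S" "r < b" using cInf_less_iff[OF ne bb] b(1) unfolding \<tau>_def by blast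
    then show False using b(2)[of r] \<tau>le[OF r(1)] \<open>\<not> w \<tau> \<le> 0\<close> by (cases "r = \<tau>") (auto simp: S_def)
  qed
  have "\<tau> \<noteq> 0" using up w0 by auto
  then have \<tau>p: "0 < \<tau>" using \<tau>0 by simp
  then obtain l where l: "(w \<longlongrightarrow> l) (at_left \<tau>)" using w unfolding cadlag_def by blast
  have "Lim (at_left \<tau>) w = l" by (rule tendsto_Lim[OF _ l]) simp
  then have "l \<le> w \<tau>" using nn \<tau>p unfolding no_negative_jumps_def by auto
  moreover have "0 \<le> l"
  proof (rule tendsto_lowerbound[OF l])
    show "\<forall>\<^sub>F r in at_left \<tau>. 0 \<le> w r"
      unfolding eventually_at_left_field
    proof (intro exI[of _ 0] conjI \<tau>p allI impI)
      fix r assume r: "0 < r" "r < \<tau>"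
      then have "r \<notin> S" using \<tau>le[of r] by auto
      then show "0 \<le> w r" using r \<tau>s by (auto simp: S_def)
    qed
  qed simp
  ultimately have "w \<tau> = 0" using up by linarith
  then show False using nz[of \<tau>] \<tau>0 \<tau>s s by auto
qed

context spectrally_positive_stable
begin

definition killed_mean :: "real \<Rightarrow> real \<Rightarrow> real \<Rightarrow> real \<Rightarrow> ennreal" where
  "killed_mean s x y t = (\<integral>\<^sup>+w. area_functional s x y t w \<partial>P)"

text \<open>Time is stretched by c and space by k = c^(1/\<alpha>), hence the area by c k =
  c^(1+1/\<alpha>); the position weight contributes the factor k in front.\<close>

lemma killed_mean_scaling:
  assumes c: "c > 0"
  defines "k \<equiv> c powr (1 / \<alpha>)"
  shows "killed_mean 1 (x * k) (y * k) c = ennreal k * killed_mean (c powr (1 + 1 / \<alpha>)) x y 1"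
proof -
  have k: "k > 0" using c by (simp add: k_def)
  have ck: "c * k = c powr (1 + 1 / \<alpha>)" using c unfolding k_def by (simp add: powr_mult_base)
  have pw: "area_functional 1 (x * k) (y * k) c (path_scaling c w) = ennreal k * area_functional (c powr (1 + 1 / \<alpha>)) x y 1 w" for w
  proof -
    have S: "path_scaling c w r = k * w (r / c)" if "0 \<le> r" for r using that by (simp add: path_scaling_def k_def)
    have al: "alive (y * k) (path_scaling c w) c \<longleftrightarrow> alive y w 1"
    proof
      assume a: "alive (y * k) (path_scaling c w) c"
      show "alive y w 1" unfolding alive_def
      proof
        fix r :: real assume r: "r \<in> {0..1}"
        then have "0 \<le> y * k + path_scaling c w (c * r)" using a c by (auto simp: alive_def mult_left_le)
        also have "\<dots> = k * (y + w r)" using r c by (subst S) (auto simp: algebra_simps)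
        finally show "0 \<le> y + w r" using k by (simp add: zero_le_mult_iff)
      qed
    next
      assume a: "alive y w 1"
      show "alive (y * k) (path_scaling c w) c" unfolding alive_def
      proof
        fix r assume r: "r \<in> {0..c}"
        then have "0 \<le> k * (y + w (r / c))" using a c k by (auto simp: alive_def intro!: mult_nonneg_nonneg)
        also have "\<dots> = y * k + path_scaling c w r" using r by (subst S) (auto simp: algebra_simps)
        finally show "0 \<le> y * k + path_scaling c w r" .
      qed
    qed
    have "(LINT r:{0..c}|lborel. x * k + path_scaling c w r) = (LINT r|lborel. indicator {0..c} r * (k * (x + w (r / c))))"
      unfolding set_lebesgue_integral_def
      by (intro Bochner_Integration.integral_cong) (auto simp: indicator_def S algebra_simps)
    also have "\<dots> = \<bar>c\<bar> *\<^sub>R (LINT r|lborel. indicator {0..c} (0 + c * r) * (k * (x + w ((0 + c * r) / c))))"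
      by (rule lborel_integral_real_affine) (use c in simp)
    also have "(\<lambda>r. indicator {0..c} (0 + c * r) * (k * (x + w ((0 + c * r) / c)))) = (\<lambda>r. k * (indicator {0..1} r *\<^sub>R (x + w r)))"
      using c by (auto simp: fun_eq_iff indicator_def zero_le_mult_iff mult_le_cancel_left1)
    also have "\<bar>c\<bar> *\<^sub>R (LINT r|lborel. k * (indicator {0..1} r *\<^sub>R (x + w r))) = c * (LINT r|lborel. k * (indicator {0..1} r *\<^sub>R (x + w r)))"
      using c by simp
    also have "\<dots> = c * k * (LINT r:{0..1}|lborel. x + w r)" unfolding set_lebesgue_integral_def by simp
    finally have I: "(LINT r:{0..c}|lborel. x * k + path_scaling c w r) = c powr (1 + 1 / \<alpha>) * (LINT r:{0..1}|lborel. x + w r)"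
      unfolding ck .
    have "x * k + path_scaling c w c = k * (x + w 1)" using c S[of c] by (simp add: algebra_simps)
    then show ?thesis
      unfolding area_functional_def I using k
      by (auto simp: al indicator_def ennreal_mult'[symmetric] mult.assoc)
  qed
  have "killed_mean 1 (x * k) (y * k) c = (\<integral>\<^sup>+w. area_functional 1 (x * k) (y * k) c w \<partial>distr P path_space (path_scaling c))"
    unfolding killed_mean_def law_scaling_invariant[OF c] ..
  also have "\<dots> = (\<integral>\<^sup>+w. area_functional 1 (x * k) (y * k) c (path_scaling c w) \<partial>P)"
    by (rule nn_integral_distr[OF path_scaling_measurable[OF c]]) (use area_functional_measurable c in simp)
  also have "\<dots> = ennreal k * killed_mean (c powr (1 + 1 / \<alpha>)) x y 1"
    unfolding pw killed_mean_def
    by (rule nn_integral_cmult) (use area_functional_measurable[of 1] measurable_cong_sets[OF sets_P refl] in auto)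
  finally show ?thesis .
qed

lemma start_shift_measurable: "(\<lambda>w. \<lambda>t\<in>{0..}. x + w t) \<in> measurable path_space path_space"
  using path_affine_measurable[of 1 x 1] by simp

lemma nn_integral_law_started_at:
  assumes f: "f \<in> borel_measurable path_space"
  shows "(\<integral>\<^sup>+w. f w \<partial>law_started_at P x) = (\<integral>\<^sup>+w. f (\<lambda>t\<in>{0..}. x + w t) \<partial>P)"
  unfolding law_started_at_def
proof (rule nn_integral_distr)
  show "(\<lambda>w. \<lambda>t\<in>{0..}. x + w t) \<in> measurable P path_space"
    unfolding measurable_cong_sets[OF sets_P refl] by (rule start_shift_measurable)
qed (use f in simp)

lemma sets_law_started_at: "sets (law_started_at P x) = sets path_space" "space (law_started_at P x) = cadlag_paths"
  by (simp_all add: law_started_at_def space_path_space)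

lemma no_negative_jumps_started:
  assumes w: "w \<in> cadlag_paths" and "no_negative_jumps (\<lambda>t\<in>{0..}. - x + w t)"
  shows "no_negative_jumps w"
  unfolding no_negative_jumps_def
proof (intro allI impI)
  fix t :: real assume t: "0 < t"
  then obtain l where l: "(w \<longlongrightarrow> l) (at_left t)" using w by (auto simp: cadlag_paths_def cadlag_def)
  have "((\<lambda>t. - x + w t) \<longlongrightarrow> - x + l) (at_left t)" by (intro tendsto_intros l)
  then have "((\<lambda>t\<in>{0..}. - x + w t) \<longlongrightarrow> - x + l) (at_left t)"
    by (rule Lim_transform_eventually) (use t in \<open>auto simp: eventually_at_left_field intro!: exI[of _ 0]\<close>)
  then have "Lim (at_left t) (\<lambda>t\<in>{0..}. - x + w t) = - x + l" by (rule tendsto_Lim[rotated]) simp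
  moreover have "Lim (at_left t) w = l" by (rule tendsto_Lim[OF _ l]) simp
  ultimately show "Lim (at_left t) w \<le> w t" using assms(2) t unfolding no_negative_jumps_def by auto
qed

text \<open>The shift by -x maps the started law back to P. Pulling an almost sure statement back
  along a measurable map does not require the event to be measurable, which is unclear for
  \<open>no_negative_jumps\<close>.\<close>

lemma AE_law_started_at:
  "AE w in law_started_at P x. w 0 = x \<and> no_negative_jumps w"
proof -
  have m: "(\<lambda>w. \<lambda>t\<in>{0..}. - x + w t) \<in> measurable (law_started_at P x) path_space"
    using start_shift_measurable[of "- x"] measurable_cong_sets[OF sets_law_started_at(1) refl] by blast
  have mP: "(\<lambda>w. \<lambda>t\<in>{0..}. x + w t) \<in> measurable P path_space"
    using start_shift_measurable measurable_cong_sets[OF sets_P refl] by blast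
  have "distr (law_started_at P x) path_space (\<lambda>w. \<lambda>t\<in>{0..}. - x + w t) = distr P path_space (\<lambda>w. w)"
    unfolding law_started_at_def
  proof (subst distr_distr[OF start_shift_measurable mP], rule distr_cong[OF refl refl])
    fix w assume "w \<in> space P"
    then have "w \<in> extensional {0..}" by (simp add: space_P cadlag_paths_def)
    then show "((\<lambda>w. \<lambda>t\<in>{0..}. - x + w t) \<circ> (\<lambda>w. \<lambda>t\<in>{0..}. x + w t)) w = w"
      by (auto simp: fun_eq_iff extensional_def)
  qed
  also have "\<dots> = P" by (rule distr_id2) (simp add: sets_P)
  finally have D: "distr (law_started_at P x) path_space (\<lambda>w. \<lambda>t\<in>{0..}. - x + w t) = P" .
  have "AE w in distr (law_started_at P x) path_space (\<lambda>w. \<lambda>t\<in>{0..}. - x + w t). w 0 = 0 \<and> no_negative_jumps w"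
    unfolding D using start_zero AE_no_negative_jumps by eventually_elim simp
  from AE_distrD[OF m this] AE_space show ?thesis
  proof eventually_elim
    case (elim w)
    then show ?case using no_negative_jumps_started[of w x] by (simp add: sets_law_started_at)
  qed
qed

text \<open>On events up to time 1 the defining formula says that Q has density w(1)/x on nonhitting
  paths with respect to the started law. Agreement on a \<sigma>-algebra extends to functions
  measurable for it. The density is measurable for the completion, so the comparison measure is
  built there.\<close>

lemma conditioned_nn_integral:
  assumes x: "x > 0" and Q: "conditioned_positive_law P x Q" and f: "f \<in> borel_measurable filtration_measure"
  shows "(\<integral>\<^sup>+w. f w \<partial>Q) = (\<integral>\<^sup>+w. ennreal (1 / x) * (ennreal (w 1 * indicator {w. ereal 1 < hitting_time_zero w} w) * f w) \<partial>law_started_at P x)"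
proof -
  define R where "R = completion (law_started_at P x)"
  define g where "g w = w 1 * indicator {w. ereal 1 < hitting_time_zero w} w" for w :: "real \<Rightarrow> real"
  have Qp: "prob_space Q" "sets Q = sets path_space" using Q by (auto simp: conditioned_positive_law_def path_law_def)
  interpret Q: prob_space Q by fact
  have spQ: "space Q = cadlag_paths" using sets_eq_imp_space_eq[OF Qp(2)] by (simp add: space_path_space)
  have spR: "space R = cadlag_paths" by (simp add: R_def sets_law_started_at)
  have setsR: "sets path_space \<subseteq> sets R" using sets_completionI_sets[of _ "law_started_at P x"] by (auto simp: R_def sets_law_started_at)
  have HQ: "measure Q \<Lambda> = 1 / x * (\<integral>w. g w * indicator \<Lambda> w \<partial>R)" if "\<Lambda> \<in> natural_filtration 1" for \<Lambda>
  proof -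
    have "measure Q \<Lambda> = 1 / x * (\<integral>w. w 1 * indicator \<Lambda> w * indicator {w. ereal 1 < hitting_time_zero w} w \<partial>R)"
      using Q that unfolding conditioned_positive_law_def R_def by auto
    also have "(\<integral>w. w 1 * indicator \<Lambda> w * indicator {w. ereal 1 < hitting_time_zero w} w \<partial>R) = (\<integral>w. g w * indicator \<Lambda> w \<partial>R)"
      by (intro Bochner_Integration.integral_cong) (auto simp: g_def)
    finally show ?thesis .
  qed
  have top: "cadlag_paths \<in> natural_filtration 1" using sets.top[of filtration_measure] by (simp add: sets_filtration_measure space_filtration_measure)
  \<comment> \<open>Otherwise the Bochner integral would be 0 by convention, while the formula for
    the whole path space must give mass 1.\<close>
  have gi: "integrable R g"
  proof (rule ccontr)
    assume "\<not> integrable R g"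
    then have "(\<integral>w. g w * indicator cadlag_paths w \<partial>R) = 0"
      using not_integrable_integral_eq[of R g] Bochner_Integration.integral_cong[of R R "\<lambda>w. g w * indicator cadlag_paths w" g]
      by (simp add: spR)
    then show False using HQ[OF top] Q.prob_space by (simp add: spQ)
  qed
  have gm [measurable]: "g \<in> borel_measurable R" using gi by (rule borel_measurable_integrable)
  have g0: "AE w in R. 0 \<le> g w"
  proof -
    have "AE w in law_started_at P x. 0 \<le> g w"
      using AE_law_started_at AE_space
    proof eventually_elim
      case (elim w)
      then have w: "cadlag w" by (simp add: sets_law_started_at cadlag_paths_def)
      show ?case
      proof (cases "ereal 1 < hitting_time_zero w")
        case True
        have "0 < w 1"
          by (rule positive_before_hitting[OF w, of 1]) (use elim x True nonzero_on_unit_iff[OF w] in auto)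
        then show ?thesis by (simp add: g_def)
      qed (simp add: g_def)
    qed
    then show ?thesis unfolding R_def by (rule AE_completion)
  qed
  define Q' where "Q' = density R (\<lambda>w. ennreal (g w / x))"
  have spQ': "space Q' = cadlag_paths" by (simp add: Q'_def spR)
  have setsF: "sets filtration_measure \<subseteq> sets Q" "sets filtration_measure \<subseteq> sets Q'"
    using filtration_subset setsR by (auto simp: sets_filtration_measure Qp(2) Q'_def)
  have eq: "emeasure Q \<Lambda> = emeasure Q' \<Lambda>" if L: "\<Lambda> \<in> sets filtration_measure" for \<Lambda>
  proof -
    have LR: "\<Lambda> \<in> sets R" using L setsF(2) by (auto simp: Q'_def)
    have gL: "integrable R (\<lambda>w. g w * indicator \<Lambda> w)"
      using integrable_real_mult_indicator[OF LR gi] by (simp add: mult.commute)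
    have "emeasure Q' \<Lambda> = (\<integral>\<^sup>+w. ennreal (g w / x) * indicator \<Lambda> w \<partial>R)"
      unfolding Q'_def using LR by (intro emeasure_density) auto
    also have "\<dots> = (\<integral>\<^sup>+w. ennreal (1 / x * (g w * indicator \<Lambda> w)) \<partial>R)"
      by (intro nn_integral_cong) (auto simp: indicator_def)
    also have "\<dots> = ennreal (\<integral>w. 1 / x * (g w * indicator \<Lambda> w) \<partial>R)"
    proof (rule nn_integral_eq_integral)
      show "integrable R (\<lambda>w. 1 / x * (g w * indicator \<Lambda> w))" using gL by (rule integrable_mult_right)
      show "AE w in R. 0 \<le> 1 / x * (g w * indicator \<Lambda> w)"
        using g0 by eventually_elim (use x in auto)
    qed
    also have "(\<integral>w. 1 / x * (g w * indicator \<Lambda> w) \<partial>R) = measure Q \<Lambda>"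
      using HQ[of \<Lambda>] L by (simp add: sets_filtration_measure)
    also have "ennreal (measure Q \<Lambda>) = emeasure Q \<Lambda>" by (simp add: Q.emeasure_eq_measure)
    finally show ?thesis ..
  qed
  have sub: "subalgebra Q filtration_measure"
    unfolding subalgebra_def using setsF(1) by (simp add: spQ space_filtration_measure)
  \<comment> \<open>Both measures are reduced to the restriction of Q to the events up to time
    1.\<close>
  define N where "N = restr_to_subalg Q filtration_measure"
  have setsN: "sets N = sets filtration_measure" unfolding N_def by (rule sets_restr_to_subalg[OF sub])
  have spN: "space N = cadlag_paths" unfolding N_def by (simp add: space_restr_to_subalg spQ)
  have fN: "f \<in> borel_measurable N" using f measurable_cong_sets[OF setsN refl] by blast
  have emN: "emeasure N A = emeasure Q A" if "A \<in> sets N" for A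
    unfolding N_def by (rule emeasure_restr_to_subalg[OF sub]) (use that setsN in simp)
  have "(\<integral>\<^sup>+w. f w \<partial>Q) = (\<integral>\<^sup>+w. f w \<partial>N)"
    by (rule nn_integral_subalgebra[symmetric, OF fN]) (use setsF(1) setsN spN spQ emN in auto)
  also have "\<dots> = (\<integral>\<^sup>+w. f w \<partial>Q')"
    by (rule nn_integral_subalgebra[OF fN]) (use setsF(2) setsN spN spQ' emN eq in auto)
  also have "\<dots> = (\<integral>\<^sup>+w. ennreal (g w / x) * f w \<partial>R)"
  proof -
    have "f \<in> borel_measurable R"
      using f setsF(2) spR by (auto simp: measurable_def space_filtration_measure Q'_def)
    then show ?thesis unfolding Q'_def by (intro nn_integral_density) auto
  qed
  also have "\<dots> = (\<integral>\<^sup>+w. ennreal (g w / x) * f w \<partial>law_started_at P x)"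
    unfolding R_def by (rule nn_integral_completion)
  also have "\<dots> = (\<integral>\<^sup>+w. ennreal (1 / x) * (ennreal (g w) * f w) \<partial>law_started_at P x)"
    using x by (intro nn_integral_cong) (simp add: ennreal_mult'[symmetric] mult.assoc[symmetric])
  finally show ?thesis unfolding g_def .
qed

text \<open>On paths with nonzero weight there is no zero in [0, 1] and the start is x > 0, so the
  negative part vanishes there.\<close>

lemma conditioned_negative_part:
  assumes x: "x > 0" and Q: "conditioned_positive_law P x Q"
  shows "(\<integral>w. negative_part_area w \<partial>Q) = 0"
proof -
  have fm: "(\<lambda>w. ennreal (negative_part_area w)) \<in> borel_measurable filtration_measure"
    unfolding negative_part_area_def
    by (intro measurable_compose[OF unit_integral_measurable measurable_ennreal] eval_filtration_measurable)
      (auto simp: space_filtration_measure)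
  have "(\<integral>\<^sup>+w. ennreal (negative_part_area w) \<partial>Q) = (\<integral>\<^sup>+w. ennreal (1 / x) * (ennreal (w 1 * indicator {w. ereal 1 < hitting_time_zero w} w) * ennreal (negative_part_area w)) \<partial>law_started_at P x)"
    by (rule conditioned_nn_integral[OF x Q fm])
  also have "\<dots> = (\<integral>\<^sup>+w. 0 \<partial>law_started_at P x)"
  proof (rule nn_integral_cong_AE)
    show "AE w in law_started_at P x. ennreal (1 / x) * (ennreal (w 1 * indicator {w. ereal 1 < hitting_time_zero w} w) * ennreal (negative_part_area w)) = 0"
      using AE_law_started_at AE_space
    proof eventually_elim
      case (elim w)
      then have w: "cadlag w" by (simp add: sets_law_started_at cadlag_paths_def)
      show ?case
      proof (cases "ereal 1 < hitting_time_zero w")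
        case True
        have pos: "0 < w r" if "r \<in> {0..1}" for r
          by (rule positive_before_hitting[OF w, of 1]) (use elim x True nonzero_on_unit_iff[OF w] that in auto)
        have "indicator {0..1} r *\<^sub>R min 1 (max (- w r) 0) = 0" for r
          using pos[of r] by (cases "r \<in> {0..1}") (auto simp: max_def)
        then have "negative_part_area w = 0"
          unfolding negative_part_area_def set_lebesgue_integral_def by (simp only: Bochner_Integration.integral_zero)
        then show ?thesis by simp
      qed simp
    qed
  qed
  finally have z: "(\<integral>\<^sup>+w. ennreal (negative_part_area w) \<partial>Q) = 0" by simp
  have nn: "0 \<le> negative_part_area w" for w
    unfolding negative_part_area_def set_lebesgue_integral_def by (intro Bochner_Integration.integral_nonneg) auto
  have setsQ: "sets Q = sets path_space" using Q by (simp add: conditioned_positive_law_def path_law_def)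
  have "negative_part_area \<in> borel_measurable Q"
    unfolding measurable_cong_sets[OF setsQ refl] negative_part_area_def[abs_def]
    by (rule unit_integral_measurable[OF measurable_path_eval]) (simp_all add: space_path_space)
  then show ?thesis using z by (subst integral_eq_nn_integral) (simp_all add: nn)
qed

text \<open>Up to null sets the event that zero is hit after time 1 lies between staying above x - y, for y < x, and
  staying nonnegative. Killing at a level rather than at the hitting time keeps everything measurable.\<close>

lemma conditioned_area_sandwich:
  assumes x: "x > 0" and Q: "conditioned_positive_law P x Q" and s: "s \<ge> 0"
  defines "E \<equiv> (\<integral>\<^sup>+w. ennreal (exp (- (s * clipped_area w))) \<partial>Q)"
  shows "E \<le> ennreal (1 / x) * killed_mean s x x 1"
    and "\<And>y. y < x \<Longrightarrow> ennreal (1 / x) * killed_mean s x y 1 \<le> E"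
proof -
  have ca: "clipped_area \<in> borel_measurable filtration_measure"
    unfolding clipped_area_def[abs_def]
    by (intro unit_integral_measurable eval_filtration_measurable) (auto simp: space_filtration_measure)
  have fm: "(\<lambda>w. ennreal (exp (- (s * clipped_area w)))) \<in> borel_measurable filtration_measure"
    using ca by measurable
  have E: "E = (\<integral>\<^sup>+w. ennreal (1 / x) * (ennreal (w 1 * indicator {w. ereal 1 < hitting_time_zero w} w) * ennreal (exp (- (s * clipped_area w)))) \<partial>law_started_at P x)"
    unfolding E_def by (rule conditioned_nn_integral[OF x Q fm])
  \<comment> \<open>Passing to the started law absorbs x into the path; the survival level y becomes
    y - x.\<close>
  have km: "killed_mean s x y 1 = (\<integral>\<^sup>+w. area_functional s 0 (y - x) 1 w \<partial>law_started_at P x)" for y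
  proof -
    have pw: "area_functional s 0 (y - x) 1 (\<lambda>t\<in>{0..}. x + w t) = area_functional s x y 1 w" for w
    proof -
      have "(LINT r:{0..1}|lborel. 0 + (\<lambda>t\<in>{0..}. x + w t) r) = (LINT r:{0..1}|lborel. x + w r)"
        by (rule set_lebesgue_integral_cong) auto
      moreover have "alive (y - x) (\<lambda>t\<in>{0..}. x + w t) 1 \<longleftrightarrow> alive y w 1" by (auto simp: alive_def)
      ultimately show ?thesis by (simp add: area_functional_def indicator_def)
    qed
    show ?thesis
      unfolding killed_mean_def by (subst nn_integral_law_started_at[OF area_functional_measurable]) (simp_all add: pw)
  qed
  have am: "area_functional s 0 y 1 \<in> borel_measurable (law_started_at P x)" for y
    unfolding measurable_cong_sets[OF sets_law_started_at(1) refl] by (rule area_functional_measurable) simp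
  have clip: "clipped_area w = (LINT r:{0..1}|lborel. 0 + w r)" if "\<And>r. r \<in> {0..1} \<Longrightarrow> 0 \<le> w r" for w
    unfolding clipped_area_def
  proof (rule set_lebesgue_integral_cong)
    have "max (w r) 0 = 0 + w r" if "r \<in> {0..1}" for r using \<open>\<And>r. r \<in> {0..1} \<Longrightarrow> 0 \<le> w r\<close>[OF that] by simp
    then show "\<forall>r. r \<in> {0..1} \<longrightarrow> max (w r) 0 = 0 + w r" by blast
  qed simp
  show "E \<le> ennreal (1 / x) * killed_mean s x x 1"
    unfolding E km nn_integral_cmult[OF am, symmetric]
  proof (rule nn_integral_mono_AE)
    show "AE w in law_started_at P x. ennreal (1 / x) * (ennreal (w 1 * indicator {w. ereal 1 < hitting_time_zero w} w) * ennreal (exp (- (s * clipped_area w))))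
       \<le> ennreal (1 / x) * area_functional s 0 (x - x) 1 w"
      using AE_law_started_at AE_space
    proof eventually_elim
      case (elim w)
      then have w: "cadlag w" by (simp add: sets_law_started_at cadlag_paths_def)
      show ?case
      proof (cases "ereal 1 < hitting_time_zero w")
        case True
        have pos: "0 < w r" if "r \<in> {0..1}" for r
          by (rule positive_before_hitting[OF w, of 1]) (use elim x True nonzero_on_unit_iff[OF w] that in auto)
        have "alive 0 w 1" using pos by (auto simp: alive_def less_imp_le)
        moreover have "clipped_area w = (LINT r:{0..1}|lborel. 0 + w r)" by (rule clip) (use pos in \<open>auto simp: less_imp_le\<close>)
        ultimately show ?thesis using True pos[of 1] by (simp add: area_functional_def ennreal_mult')
      qed simp
    qed
  qed
  fix y assume y: "y < x"
  show "ennreal (1 / x) * killed_mean s x y 1 \<le> E"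
    unfolding E km nn_integral_cmult[OF am, symmetric]
  proof (rule nn_integral_mono_AE)
    show "AE w in law_started_at P x. ennreal (1 / x) * area_functional s 0 (y - x) 1 w \<le>
       ennreal (1 / x) * (ennreal (w 1 * indicator {w. ereal 1 < hitting_time_zero w} w) * ennreal (exp (- (s * clipped_area w))))"
      using AE_space
    proof eventually_elim
      case (elim w)
      then have w: "cadlag w" by (simp add: sets_law_started_at cadlag_paths_def)
      show ?case
      proof (cases "alive (y - x) w 1")
        case True
        then have pos: "0 < w r" if "r \<in> {0..1}" for r using that y by (force simp: alive_def)
        have "ereal 1 < hitting_time_zero w" unfolding nonzero_on_unit_iff[OF w] using pos by force
        moreover have "clipped_area w = (LINT r:{0..1}|lborel. 0 + w r)" by (rule clip) (use pos in \<open>auto simp: less_imp_le\<close>)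
        ultimately show ?thesis using True pos[of 1] by (simp add: area_functional_def ennreal_mult')
      qed (simp add: area_functional_def)
    qed
  qed
qed

end

section \<open>From Laplace transforms to tails\<close>

lemma exp_bounded_integrable:
  fixes s C :: real
  assumes s: "s > 0" and f: "f \<in> borel_measurable borel" and C: "\<And>t. 0 \<le> t \<Longrightarrow> \<bar>f t\<bar> \<le> C"
  shows "set_integrable lborel {0..} (\<lambda>t. exp (- s * t) * f t)"
proof -
  note [measurable] = f
  have i: "set_integrable lborel {0..} (\<lambda>t. C * exp (- (s * t)))"
    using exp_laplace_integral(1)[OF s] by simp
  show ?thesis unfolding set_integrable_def
  proof (rule Bochner_Integration.integrable_bound[OF i[unfolded set_integrable_def]])
    show "(\<lambda>t. indicator {0..} t *\<^sub>R (exp (- s * t) * f t)) \<in> borel_measurable lborel" by measurable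
    show "AE t in lborel. norm (indicator {0..} t *\<^sub>R (exp (- s * t) * f t)) \<le> norm (indicator {0..} t *\<^sub>R (C * exp (- (s * t))))"
      using C by (intro AE_I2) (auto simp: indicator_def abs_mult mult.commute intro!: mult_left_mono order_trans[OF C])
  qed
qed

lemma laplace_rescale:
  fixes c s :: real and f :: "real \<Rightarrow> real"
  assumes c: "c > 0"
  shows "(LINT t:{0..}|lborel. exp (- s * t) * f (c * t)) = (LINT t:{0..}|lborel. exp (- (s / c) * t) * f t) / c"
proof -
  have "(LINT t|lborel. indicator {0..} t *\<^sub>R (exp (- (s / c) * t) * f t)) =
     \<bar>c\<bar> *\<^sub>R (LINT t|lborel. indicator {0..} (0 + c * t) *\<^sub>R (exp (- (s / c) * (0 + c * t)) * f (0 + c * t)))"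
    by (rule lborel_integral_real_affine) (use c in simp)
  also have "(\<lambda>t. indicator {0..} (0 + c * t) *\<^sub>R (exp (- (s / c) * (0 + c * t)) * f (0 + c * t))) =
     (\<lambda>t. indicator {0..} t *\<^sub>R (exp (- s * t) * f (c * t)))"
    using c by (auto simp: fun_eq_iff indicator_def zero_le_mult_iff)
  finally show ?thesis using c by (simp add: set_lebesgue_integral_def field_simps)
qed

lemma exp_truncated_nn_integral:
  fixes s a :: real
  assumes s: "s > 0" and a: "0 \<le> a"
  shows "(\<integral>\<^sup>+t. ennreal (exp (- (s * t))) * indicator {0..<a} t \<partial>lborel) = ennreal ((1 - exp (- (s * a))) / s)"
proof -
  have "(\<integral>\<^sup>+t. ennreal (exp (- (s * t))) * indicator {0..<a} t \<partial>lborel) = (\<integral>\<^sup>+t. ennreal (exp (- (s * t))) * indicator {0..a} t \<partial>lborel)"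
  proof (rule nn_integral_cong_AE)
    show "AE t in lborel. ennreal (exp (- (s * t))) * indicator {0..<a} t = ennreal (exp (- (s * t))) * indicator {0..a} t"
      using AE_lborel_singleton[of a] by eventually_elim (auto simp: indicator_def)
  qed
  also have "\<dots> = ennreal (- exp (- (s * a)) / s - (- exp (- (s * 0)) / s))"
  proof (rule nn_integral_FTC_Icc)
    show "((\<lambda>t. - exp (- (s * t)) / s) has_real_derivative exp (- (s * t))) (at t)" for t
      using s by (auto intro!: derivative_eq_intros)
  qed (use a in auto)
  also have "- exp (- (s * a)) / s - (- exp (- (s * 0)) / s) = (1 - exp (- (s * a))) / s"
    using s by (simp add: field_simps)
  finally show ?thesis .
qed

context prob_space
begin

lemma tail_measurable:
  fixes A :: "'a \<Rightarrow> real"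
  assumes "random_variable borel A"
  shows "(\<lambda>t. prob {\<omega> \<in> space M. A \<omega> > t}) \<in> borel_measurable borel"
proof -
  note [measurable] = assms
  have "mono (\<lambda>t. - prob {\<omega> \<in> space M. A \<omega> > t})"
    by (intro monoI le_imp_neg_le finite_measure_mono) auto
  then have "(\<lambda>t. - (- prob {\<omega> \<in> space M. A \<omega> > t})) \<in> borel_measurable borel"
    by (intro borel_measurable_uminus borel_measurable_mono)
  then show ?thesis by simp
qed

text \<open>Fubini on the region 0 \<le> t < A, with the elementary integral of exp(-st) up to
  A.\<close>

lemma tail_laplace:
  fixes A :: "'a \<Rightarrow> real"
  assumes A: "random_variable borel A" and nn: "AE \<omega> in M. 0 \<le> A \<omega>" and s: "s > 0"
  shows "(LINT t:{0..}|lborel. exp (- s * t) * prob {\<omega> \<in> space M. A \<omega> > t}) = (1 - expectation (\<lambda>\<omega>. exp (- (s * A \<omega>)))) / s"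
proof -
  note [measurable] = A tail_measurable[OF A]
  define g where "g p = ennreal (exp (- (s * snd p))) * indicator {p. 0 \<le> snd p \<and> snd p < A (fst p)} p" for p :: "'a \<times> real"
  have gm: "g \<in> borel_measurable (M \<Otimes>\<^sub>M lborel)" unfolding g_def[abs_def] by measurable
  interpret pair_sigma_finite M lborel by unfold_locales
  have int: "integrable M (\<lambda>\<omega>. exp (- (s * A \<omega>)))"
    by (rule integrable_const_bound[where B=1]) (use nn s in auto)
  have "(\<integral>\<^sup>+t. ennreal (indicator {0..} t *\<^sub>R (exp (- s * t) * prob {\<omega> \<in> space M. A \<omega> > t})) \<partial>lborel) = (\<integral>\<^sup>+t. (\<integral>\<^sup>+\<omega>. g (\<omega>, t) \<partial>M) \<partial>lborel)"
  proof (rule nn_integral_cong)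
    fix t :: real
    have "(\<integral>\<^sup>+\<omega>. g (\<omega>, t) \<partial>M) = (\<integral>\<^sup>+\<omega>. ennreal (indicator {0..} t *\<^sub>R exp (- s * t)) * indicator {\<omega> \<in> space M. A \<omega> > t} \<omega> \<partial>M)"
      by (intro nn_integral_cong) (auto simp: g_def indicator_def)
    also have "\<dots> = ennreal (indicator {0..} t *\<^sub>R exp (- s * t)) * emeasure M {\<omega> \<in> space M. A \<omega> > t}"
      by (rule nn_integral_cmult_indicator) measurable
    also have "\<dots> = ennreal (indicator {0..} t *\<^sub>R (exp (- s * t) * prob {\<omega> \<in> space M. A \<omega> > t}))"
      by (simp add: emeasure_eq_measure ennreal_mult'[symmetric] mult.assoc)
    finally show "ennreal (indicator {0..} t *\<^sub>R (exp (- s * t) * prob {\<omega> \<in> space M. A \<omega> > t})) = (\<integral>\<^sup>+\<omega>. g (\<omega>, t) \<partial>M)" ..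
  qed
  also have "\<dots> = (\<integral>\<^sup>+\<omega>. (\<integral>\<^sup>+t. g (\<omega>, t) \<partial>lborel) \<partial>M)" by (rule Fubini[OF gm])
  also have "\<dots> = (\<integral>\<^sup>+\<omega>. ennreal ((1 - exp (- (s * A \<omega>))) / s) \<partial>M)"
  proof (rule nn_integral_cong_AE, use nn in eventually_elim)
    fix \<omega> assume "0 \<le> A \<omega>"
    have "(\<integral>\<^sup>+t. g (\<omega>, t) \<partial>lborel) = (\<integral>\<^sup>+t. ennreal (exp (- (s * t))) * indicator {0..<A \<omega>} t \<partial>lborel)"
      by (intro nn_integral_cong) (auto simp: g_def indicator_def)
    then show "(\<integral>\<^sup>+t. g (\<omega>, t) \<partial>lborel) = ennreal ((1 - exp (- (s * A \<omega>))) / s)"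
      using exp_truncated_nn_integral[OF s \<open>0 \<le> A \<omega>\<close>] by simp
  qed
  also have "\<dots> = ennreal (expectation (\<lambda>\<omega>. (1 - exp (- (s * A \<omega>))) / s))"
    by (rule nn_integral_eq_integral) (use int nn s in auto)
  also have "expectation (\<lambda>\<omega>. (1 - exp (- (s * A \<omega>))) / s) = (1 - expectation (\<lambda>\<omega>. exp (- (s * A \<omega>)))) / s"
    using int by (simp add: prob_space)
  finally have n: "(\<integral>\<^sup>+t. ennreal (indicator {0..} t *\<^sub>R (exp (- s * t) * prob {\<omega> \<in> space M. A \<omega> > t})) \<partial>lborel) =
    ennreal ((1 - expectation (\<lambda>\<omega>. exp (- (s * A \<omega>)))) / s)" .
  have "expectation (\<lambda>\<omega>. exp (- (s * A \<omega>))) \<le> expectation (\<lambda>\<omega>. 1)"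
    by (rule integral_mono_AE) (use int nn s in auto)
  then have "0 \<le> (1 - expectation (\<lambda>\<omega>. exp (- (s * A \<omega>)))) / s" using s by (simp add: prob_space)
  then show ?thesis unfolding set_lebesgue_integral_def
    by (subst integral_eq_nn_integral) (use n in \<open>auto simp: enn2real_ennreal\<close>)
qed

text \<open>The hypothesis is an asymptotic for the transform of the increasing function 1 -
  \<phi>(t^(1+1/\<alpha>)); the Tauberian theorem yields how \<phi> leaves 1 near 0. By
  \<open>tail_laplace\<close> this is an asymptotic for the transform of the decreasing tail, and
  the theorem applies once more.\<close>

lemma laplace_tail_asymptotics:
  fixes A :: "'a \<Rightarrow> real" and \<alpha> :: real
  assumes A: "random_variable borel A" and nn: "AE \<omega> in M. 0 \<le> A \<omega>" and \<alpha>: "1 < \<alpha>" "\<alpha> < 2"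
  defines "\<phi> \<equiv> \<lambda>s. expectation (\<lambda>\<omega>. exp (- (s * A \<omega>)))"
  assumes lim: "((\<lambda>q. (1 / q - (LINT t:{0..}|lborel. exp (- q * t) * \<phi> (t powr (1 + 1 / \<alpha>)))) * q powr (\<alpha> + 1 - 1 / \<alpha>)) \<longlongrightarrow> Gamma (\<alpha> + 1)) at_top"
  shows "(\<lambda>x. prob {\<omega> \<in> space M. A \<omega> > x}) \<sim>[at_top]
           (\<lambda>x. Gamma (1 + \<alpha>) / (Gamma (1 + \<alpha> - 1 / \<alpha>) * Gamma (2 - \<alpha>)) * x powr (1 - \<alpha>))"
proof -
  note [measurable] = A
  \<comment> \<open>The transform of 1 - \<phi>(t^\<gamma>) decays like q^(-\<beta>-1), so this
    function will behave like t^\<beta> near 0; in the variable s = t^\<gamma> the exponent is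
    \<beta>/\<gamma> = \<alpha> - 1.\<close>
  define \<beta> where "\<beta> = \<alpha> - 1 / \<alpha>"
  define \<gamma> where "\<gamma> = 1 + 1 / \<alpha>"
  have i\<alpha>: "0 < 1 / \<alpha>" "1 / \<alpha> < 1" using \<alpha> by auto
  then have \<beta>: "0 < \<beta>" and \<gamma>: "0 < \<gamma>" using \<alpha> by (simp_all only: \<beta>_def \<gamma>_def)
  have \<beta>\<gamma>: "\<beta> = \<gamma> * (\<alpha> - 1)" using \<alpha> by (simp add: \<beta>_def \<gamma>_def field_simps)
  have int: "integrable M (\<lambda>\<omega>. exp (- (s * A \<omega>)))" if "s \<ge> 0" for s
    by (rule integrable_const_bound[where B=1]) (use nn that in auto)
  have \<phi>0: "0 \<le> \<phi> s" for s unfolding \<phi>_def by simp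
  have \<phi>anti: "\<phi> t \<le> \<phi> s" if "0 \<le> s" "s \<le> t" for s t
    unfolding \<phi>_def using nn that
    by (intro integral_mono_AE int) (auto elim!: eventually_mono intro!: mult_right_mono)
  have \<phi>1: "\<phi> s \<le> 1" if "0 \<le> s" for s
    using \<phi>anti[of 0 s] that by (simp add: \<phi>_def prob_space)
  have [measurable]: "\<phi> \<in> borel_measurable borel" unfolding \<phi>_def by measurable

  define C where "C = Gamma (\<alpha> + 1) / Gamma (\<beta> + 1)"
  have G: "Gamma (\<alpha> + 1) > 0" "Gamma (\<beta> + 1) > 0" "Gamma (2 - \<alpha>) > 0"
    using \<alpha> \<beta> by (auto intro!: Gamma_real_pos)
  \<comment> \<open>At t = 1 this is q^\<beta> (1 - \<phi>(q^(-\<gamma>))), so q \<rightarrow>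
    \<infinity> explores \<phi> near 0.\<close>
  define U where "U q t = q powr \<beta> * (1 - \<phi> ((t / q) powr \<gamma>))" for q t :: real
  have "((\<lambda>q. U q 1) \<longlongrightarrow> C) at_top"
  proof (rule monotone_density_tauberian[of \<beta>])
    show "\<forall>\<^sub>F q in at_top. set_integrable lborel {0..} (\<lambda>t. exp (- t) * U q t) \<and> (\<forall>t\<ge>0. 0 \<le> U q t)"
      using eventually_gt_at_top[of 0]
    proof eventually_elim
      case (elim q)
      have "set_integrable lborel {0..} (\<lambda>t. exp (- 1 * t) * U q t)"
        by (rule exp_bounded_integrable[where C="q powr \<beta>"])
          (use \<phi>0 \<phi>1 in \<open>auto simp: U_def abs_mult intro!: mult_left_le\<close>)
      then show ?case using \<phi>1 by (simp add: U_def)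
    qed
    have "mono_on {0..} (U q)" if "q > 0" for q
      unfolding mono_on_def U_def using that \<gamma>
      by (auto intro!: mult_left_mono \<phi>anti powr_mono2 divide_right_mono)
    then show "(\<forall>\<^sub>F q in at_top. mono_on {0..} (U q)) \<or> (\<forall>\<^sub>F q in at_top. antimono_on {0..} (U q))"
      by (intro disjI1 eventually_mono[OF eventually_gt_at_top[of 0]])
    fix s :: real assume s: "s > 0"
    define F where "F q = (LINT t:{0..}|lborel. exp (- q * t) * \<phi> (t powr \<gamma>))" for q
    have L: "(LINT t:{0..}|lborel. exp (- s * t) * U q t) = s powr (- \<beta> - 1) * ((1 / (s * q) - F (s * q)) * (s * q) powr (\<beta> + 1))" if q: "q > 0" for q
    proof -
      have iF: "set_integrable lborel {0..} (\<lambda>t. exp (- (s * q) * t) * \<phi> (t powr \<gamma>))"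
        by (rule exp_bounded_integrable[where C=1]) (use \<phi>0 \<phi>1 s q in auto)
      have "(LINT t:{0..}|lborel. exp (- s * t) * U q t) = (LINT t:{0..}|lborel. exp (- s * t) * (q powr \<beta> * (1 - \<phi> (((1 / q) * t) powr \<gamma>))))"
        by (simp add: U_def)
      also have "\<dots> = (LINT t:{0..}|lborel. exp (- (s / (1 / q)) * t) * (q powr \<beta> * (1 - \<phi> (t powr \<gamma>)))) / (1 / q)"
        by (rule laplace_rescale[where f="\<lambda>t. q powr \<beta> * (1 - \<phi> (t powr \<gamma>))"]) (use q in simp)
      also have "(LINT t:{0..}|lborel. exp (- (s / (1 / q)) * t) * (q powr \<beta> * (1 - \<phi> (t powr \<gamma>)))) =
          (LINT t:{0..}|lborel. q powr \<beta> * (exp (- (s * q * t)) - exp (- (s * q) * t) * \<phi> (t powr \<gamma>)))"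
        by (simp add: algebra_simps)
      also have "\<dots> = q powr \<beta> * (1 / (s * q) - F (s * q))"
        using exp_laplace_integral[of "s * q"] s q iF unfolding F_def
        by (simp only: set_integral_mult_right) (subst set_integral_diff(2), auto)
      finally have "(LINT t:{0..}|lborel. exp (- s * t) * U q t) = q powr \<beta> * (1 / (s * q) - F (s * q)) / (1 / q)" .
      also have "q powr \<beta> * z / (1 / q) = s powr (- \<beta> - 1) * (z * (s * q) powr (\<beta> + 1))" for z
        using q s by (simp add: powr_add powr_mult powr_minus powr_diff field_simps)
      finally show ?thesis .
    qed
    have "((\<lambda>q. (1 / q - F q) * q powr (\<beta> + 1)) \<longlongrightarrow> Gamma (\<alpha> + 1)) at_top"
      using lim by (simp add: F_def \<beta>_def \<gamma>_def algebra_simps)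
    moreover have "filterlim (\<lambda>q. s * q) at_top at_top"
      by (rule filterlim_tendsto_pos_mult_at_top[OF tendsto_const s filterlim_ident])
    ultimately have "((\<lambda>q. (1 / (s * q) - F (s * q)) * (s * q) powr (\<beta> + 1)) \<longlongrightarrow> Gamma (\<alpha> + 1)) at_top"
      by (rule filterlim_compose)
    then have "((\<lambda>q. s powr (- \<beta> - 1) * ((1 / (s * q) - F (s * q)) * (s * q) powr (\<beta> + 1))) \<longlongrightarrow> s powr (- \<beta> - 1) * Gamma (\<alpha> + 1)) at_top"
      by (intro tendsto_intros)
    then have "((\<lambda>q. LINT t:{0..}|lborel. exp (- s * t) * U q t) \<longlongrightarrow> s powr (- \<beta> - 1) * Gamma (\<alpha> + 1)) at_top"
      by (rule Lim_transform_eventually) (use eventually_gt_at_top[of 0] in eventually_elim, simp only: L)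
    then show "((\<lambda>q. LINT t:{0..}|lborel. exp (- s * t) * U q t) \<longlongrightarrow> C * Gamma (\<beta> + 1) * s powr (- \<beta> - 1)) at_top"
      using G by (simp add: C_def mult.commute)
  qed (use \<beta> G in \<open>auto simp: C_def\<close>)
  moreover have "filterlim (\<lambda>x. x powr (1 / \<gamma>)) at_top at_top"
    using \<gamma> by real_asymp
  ultimately have "((\<lambda>x. U (x powr (1 / \<gamma>)) 1) \<longlongrightarrow> C) at_top" by (rule filterlim_compose)
  then have small: "((\<lambda>x. x powr (\<alpha> - 1) * (1 - \<phi> (1 / x))) \<longlongrightarrow> C) at_top"
  proof (rule Lim_transform_eventually, use eventually_gt_at_top[of 0] in eventually_elim)
    fix x :: real assume x: "0 < x"
    have "(1 / x powr (1 / \<gamma>)) powr \<gamma> = 1 / x" using x \<gamma> by (simp add: powr_divide powr_powr)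
    moreover have "(x powr (1 / \<gamma>)) powr \<beta> = x powr (\<alpha> - 1)" using \<gamma> by (simp add: powr_powr \<beta>\<gamma>)
    ultimately show "U (x powr (1 / \<gamma>)) 1 = x powr (\<alpha> - 1) * (1 - \<phi> (1 / x))" by (simp add: U_def)
  qed

  \<comment> \<open>The second application has b = 1 - \<alpha>, so its constant is divided by
    Gamma(b + 1); the requirement b > -1 is where \<alpha> < 2 enters.\<close>
  define D where "D = C / Gamma (2 - \<alpha>)"
  have D: "D > 0" using G by (simp add: D_def C_def)
  define V where "V x t = x powr (\<alpha> - 1) * prob {\<omega> \<in> space M. A \<omega> > x * t}" for x t :: real
  have "((\<lambda>x. V x 1) \<longlongrightarrow> D) at_top"
  proof (rule monotone_density_tauberian[of "1 - \<alpha>"])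
    show "\<forall>\<^sub>F x in at_top. set_integrable lborel {0..} (\<lambda>t. exp (- t) * V x t) \<and> (\<forall>t\<ge>0. 0 \<le> V x t)"
      using eventually_gt_at_top[of 0]
    proof eventually_elim
      case (elim x)
      have "set_integrable lborel {0..} (\<lambda>t. exp (- 1 * t) * V x t)"
      proof (rule exp_bounded_integrable[where C="x powr (\<alpha> - 1)"])
        have "(\<lambda>t. prob {\<omega> \<in> space M. A \<omega> > x * t}) \<in> borel_measurable borel"
          by (rule measurable_compose[OF _ tail_measurable[OF A], of "\<lambda>t. x * t"]) simp
        then show "V x \<in> borel_measurable borel" unfolding V_def[abs_def] by measurable
      qed (auto simp: V_def abs_mult mult_left_le)
      then show ?case by (simp add: V_def)
    qed
    have "antimono_on {0..} (V x)" if "x > 0" for x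
      unfolding monotone_on_def V_def using that
      by (auto intro!: mult_left_mono finite_measure_mono) (meson mult_left_mono less_eq_real_def order_le_less_trans)
    then show "(\<forall>\<^sub>F x in at_top. mono_on {0..} (V x)) \<or> (\<forall>\<^sub>F x in at_top. antimono_on {0..} (V x))"
      by (intro disjI2 eventually_mono[OF eventually_gt_at_top[of 0]])
    fix s :: real assume s: "s > 0"
    have L: "(LINT t:{0..}|lborel. exp (- s * t) * V x t) = s powr (\<alpha> - 2) * ((x / s) powr (\<alpha> - 1) * (1 - \<phi> (1 / (x / s))))" if x: "x > 0" for x
    proof -
      have "(LINT t:{0..}|lborel. exp (- s * t) * V x t) = x powr (\<alpha> - 1) * (LINT t:{0..}|lborel. exp (- s * t) * prob {\<omega> \<in> space M. A \<omega> > x * t})"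
        unfolding V_def set_integral_mult_right[symmetric] by (simp add: mult_ac)
      also have "(LINT t:{0..}|lborel. exp (- s * t) * prob {\<omega> \<in> space M. A \<omega> > x * t}) = (LINT t:{0..}|lborel. exp (- (s / x) * t) * prob {\<omega> \<in> space M. A \<omega> > t}) / x"
        by (rule laplace_rescale[OF x])
      also have "\<dots> = (1 - \<phi> (s / x)) / s"
        by (subst tail_laplace[OF A nn]) (use s x in \<open>auto simp: \<phi>_def\<close>)
      finally have "(LINT t:{0..}|lborel. exp (- s * t) * V x t) = x powr (\<alpha> - 1) * ((1 - \<phi> (1 / (x / s))) / s)" by simp
      also have "x powr (\<alpha> - 1) * (z / s) = s powr (\<alpha> - 2) * ((x / s) powr (\<alpha> - 1) * z)" for z
        using s x by (simp add: powr_diff powr_divide power2_eq_square field_simps)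
      finally show ?thesis .
    qed
    have "filterlim (\<lambda>x. x * (1 / s)) at_top at_top"
      by (rule filterlim_at_top_mult_tendsto_pos[OF tendsto_const _ filterlim_ident]) (use s in simp)
    then have "filterlim (\<lambda>x. x / s) at_top at_top" by simp
    from filterlim_compose[OF small this]
    have "((\<lambda>x. s powr (\<alpha> - 2) * ((x / s) powr (\<alpha> - 1) * (1 - \<phi> (1 / (x / s))))) \<longlongrightarrow> s powr (\<alpha> - 2) * C) at_top"
      by (intro tendsto_intros)
    then have "((\<lambda>x. LINT t:{0..}|lborel. exp (- s * t) * V x t) \<longlongrightarrow> s powr (\<alpha> - 2) * C) at_top"
      by (rule Lim_transform_eventually) (use eventually_gt_at_top[of 0] in eventually_elim, simp only: L)
    then show "((\<lambda>x. LINT t:{0..}|lborel. exp (- s * t) * V x t) \<longlongrightarrow> D * Gamma (1 - \<alpha> + 1) * s powr (- (1 - \<alpha>) - 1)) at_top"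
      using G by (simp add: D_def mult.commute)
  qed (use \<alpha> D in auto)
  then have "((\<lambda>x. V x 1 / D) \<longlongrightarrow> D / D) at_top" by (intro tendsto_intros) (use D in auto)
  then have "((\<lambda>x. prob {\<omega> \<in> space M. A \<omega> > x} / (D * x powr (1 - \<alpha>))) \<longlongrightarrow> 1) at_top"
  proof (rule Lim_transform_eventually[of _ "D / D" for D, THEN back_subst[where P="\<lambda>z. (_ \<longlongrightarrow> z) _"]])
    show "\<forall>\<^sub>F x in at_top. V x 1 / D = prob {\<omega> \<in> space M. A \<omega> > x} / (D * x powr (1 - \<alpha>))"
      using eventually_gt_at_top[of 0]
      by eventually_elim (use D in \<open>simp add: V_def powr_diff field_simps\<close>)
    show "D / D = 1" using D by simp
  qed
  moreover have "D = Gamma (1 + \<alpha>) / (Gamma (1 + \<alpha> - 1 / \<alpha>) * Gamma (2 - \<alpha>))"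
    by (simp add: D_def C_def \<beta>_def add.commute add_diff_eq)
  ultimately show ?thesis by (intro asymp_equivI') simp
qed

end

section \<open>Starting points tending to zero\<close>

context spectrally_positive_stable
begin

text \<open>With start Y and rate q + X - Y the total discount rate is q + X + w. Thus killing
  follows the path started at Y while the area is counted from X, and the known formulas cover two
  separate levels.\<close>

lemma survival_density_area_functional:
  assumes w: "w \<in> space P" and t: "0 \<le> t"
  shows "ennreal (survival_density (q + X - Y) Y (w, t)) * ennreal (X + w (max 0 t)) =
    ennreal (exp (- (q * t))) * area_functional 1 X Y t w"
proof -
  have "set_integrable lborel {0..t} w"
    by (rule cadlag_set_integrable) (use cadlag_P w in blast)
  moreover have c: "set_integrable lborel {0..t} (\<lambda>r. c)" for c :: real
    unfolding set_integrable_def by (intro integrable_scaleR_left) (use integrable_real_indicator[of "{0..t}" lborel] t in simp)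
  ultimately have i: "set_integrable lborel {0..t} (\<lambda>r. X + w r)" by (intro set_integral_add)
  have "(LINT r:{0..t}|lborel. q + X - Y + Y + w r) = (LINT r:{0..t}|lborel. q + (X + w r))" by (simp add: add.assoc)
  also have "\<dots> = (LINT r:{0..t}|lborel. q) + (LINT r:{0..t}|lborel. X + w r)"
    by (rule set_integral_add(2)) (use i c in auto)
  also have "(LINT r:{0..t}|lborel. q) = q * t" using t by (simp add: set_lebesgue_integral_def)
  finally have d: "discount (q + X - Y) Y w t = exp (- (q * t)) * exp (- (LINT r:{0..t}|lborel. X + w r))"
    by (simp add: discount_def exp_diff exp_minus divide_inverse)
  show ?thesis
    using t by (simp add: survival_density_def area_functional_def d indicator_def ennreal_mult'[symmetric] ennreal_mult''[symmetric] mult_ac)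
qed

definition discounted_killed_mean :: "real \<Rightarrow> real \<Rightarrow> real \<Rightarrow> real \<Rightarrow> ennreal" where
  "discounted_killed_mean q X Y t = ennreal (exp (- (q * t))) * indicator {0..} t * killed_mean 1 X Y t"

text \<open>Fubini; the weight X + w is X - Y plus the position of the path started at Y, which is
  the variable of the occupation measure.\<close>

lemma discounted_killed_mean_laplace:
  shows "discounted_killed_mean q X Y \<in> borel_measurable borel"
    and "(\<integral>\<^sup>+t. discounted_killed_mean q X Y t \<partial>lborel) = (\<integral>\<^sup>+y. ennreal (X - Y + y) \<partial>occupation (q + X - Y) Y)"
proof -
  interpret PL: pair_sigma_finite P lborel by (rule pair_P)
  define G where "G p = ennreal (survival_density (q + X - Y) Y p) * ennreal (X + fst p (max 0 (snd p)))" for p :: "(real \<Rightarrow> real) \<times> real"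
  have Xm: "(\<lambda>p. X + fst p (max 0 (snd p))) \<in> borel_measurable (P \<Otimes>\<^sub>M lborel)"
    by (intro borel_measurable_add borel_measurable_const eval_joint)
  have Gm: "G \<in> borel_measurable (P \<Otimes>\<^sub>M lborel)"
    unfolding G_def[abs_def]
    by (intro borel_measurable_times_ennreal measurable_compose[OF survival_density_measurable measurable_ennreal] measurable_compose[OF Xm measurable_ennreal])
  have eq: "discounted_killed_mean q X Y t = (\<integral>\<^sup>+w. G (w, t) \<partial>P)" for t
  proof (cases "0 \<le> t")
    case True
    have "area_functional 1 X Y t \<in> borel_measurable P"
      unfolding measurable_cong_sets[OF sets_P refl] by (rule area_functional_measurable[OF True])
    then have "discounted_killed_mean q X Y t = (\<integral>\<^sup>+w. ennreal (exp (- (q * t))) * area_functional 1 X Y t w \<partial>P)"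
      using True by (simp add: discounted_killed_mean_def killed_mean_def nn_integral_cmult)
    also have "\<dots> = (\<integral>\<^sup>+w. G (w, t) \<partial>P)"
      by (rule nn_integral_cong) (simp only: G_def fst_conv snd_conv survival_density_area_functional[OF _ True])
    finally show ?thesis .
  next
    case False
    then have "G (w, t) = 0" for w by (simp add: G_def survival_density_def)
    then show ?thesis using False by (simp add: discounted_killed_mean_def)
  qed
  have "(\<lambda>(t, w). G (w, t)) \<in> borel_measurable (lborel \<Otimes>\<^sub>M P)"
    using measurable_pair_swap[OF Gm] by (simp add: case_prod_beta)
  from borel_measurable_nn_integral[OF this]
  have "(\<lambda>t. \<integral>\<^sup>+w. G (w, t) \<partial>P) \<in> borel_measurable lborel" .
  then show "discounted_killed_mean q X Y \<in> borel_measurable borel" unfolding eq[abs_def, symmetric] by simp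
  have "(\<integral>\<^sup>+t. discounted_killed_mean q X Y t \<partial>lborel) = (\<integral>\<^sup>+w. (\<integral>\<^sup>+t. G (w, t) \<partial>lborel) \<partial>P)"
    unfolding eq by (rule PL.Fubini[OF Gm])
  also have "\<dots> = (\<integral>\<^sup>+w. (\<integral>\<^sup>+t. ennreal (survival_density (q + X - Y) Y (w, t)) * ennreal (X - Y + (Y + w (max 0 t))) \<partial>lborel) \<partial>P)"
    unfolding G_def by simp
  also have "\<dots> = (\<integral>\<^sup>+y. ennreal (X - Y + y) \<partial>occupation (q + X - Y) Y)"
    by (rule nn_integral_occupation[symmetric]) measurable
  finally show "(\<integral>\<^sup>+t. discounted_killed_mean q X Y t \<partial>lborel) = (\<integral>\<^sup>+y. ennreal (X - Y + y) \<partial>occupation (q + X - Y) Y)" .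
qed

text \<open>With Q = q + X - Y one has Y + Q = X + q, so Y enters only through the argument q + X -
  Y of \<open>Phi\<close> and \<open>Psi\<close>; the formula is therefore continuous in Y up to Y =
  X.\<close>

lemma discounted_killed_mean_integral:
  assumes q: "q > 0" and Y: "0 < Y" "Y \<le> X"
  defines "p \<equiv> Phi \<alpha> (X + q) / Phi \<alpha> (q + X - Y)"
  shows "(\<integral>\<^sup>+t. discounted_killed_mean q X Y t \<partial>lborel) =
    ennreal (1 - p - q * (pi * Psi \<alpha> (X + q) - pi * Psi \<alpha> (q + X - Y) * p))"
proof -
  define Q where "Q = q + X - Y"
  have Q: "Q > 0" using q Y by (simp add: Q_def)
  interpret fin: finite_measure "occupation Q Y" by (rule occupation_integrable(2)[OF Q])
  have e: "X + q = Y + Q" by (simp add: Q_def)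
  have pQ: "passage_transform Q Y = p" unfolding passage_transform_Phi(1)[OF Q Y(1)] p_def e[symmetric] by (simp add: Q_def add.commute)
  have XY: "X - Y = Q - q" by (simp add: Q_def)
  have "(\<integral>\<^sup>+y. ennreal (X - Y + y) \<partial>occupation Q Y) = ennreal (LINT y|occupation Q Y. X - Y + y)"
  proof (rule nn_integral_eq_integral)
    show "integrable (occupation Q Y) (\<lambda>y. X - Y + y)" using occupation_id_integrable[OF Q] by simp
    show "AE y in occupation Q Y. 0 \<le> X - Y + y" using AE_occupation_nonneg by eventually_elim (use Y in simp)
  qed
  also have "(LINT y|occupation Q Y. X - Y + y) = (LINT y|occupation Q Y. X - Y) + occupation_mean Q Y"
    unfolding occupation_mean_def by (rule Bochner_Integration.integral_add) (use occupation_id_integrable[OF Q] in auto)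
  also have "\<dots> = 1 - p - q * occupation_mass Q Y"
    unfolding integral_occupation_const[OF Q] occupation_mean_eq[OF Q] pQ XY by (simp add: algebra_simps)
  also have "\<dots> = 1 - p - q * (pi * Psi \<alpha> (X + q) - pi * Psi \<alpha> (q + X - Y) * p)"
    unfolding passage_transform_Phi(2)[OF Q Y(1)] p_def e[symmetric] by (simp add: Q_def add.commute)
  finally show ?thesis unfolding discounted_killed_mean_laplace(2) Q_def .
qed

lemma killed_mean_mono: "y \<le> y' \<Longrightarrow> killed_mean s x y t \<le> killed_mean s x y' t"
  unfolding killed_mean_def area_functional_def
  by (intro nn_integral_mono) (force simp: alive_def indicator_def)

text \<open>The left limit is a lower bound by monotonicity, and by continuity of the explicit formula it has the
  same Laplace transform in t; hence equality, but only for almost every t.\<close>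

lemma killed_mean_left_limit:
  assumes X: "X > 0"
  shows "AE t in lborel. 0 \<le> t \<longrightarrow> killed_mean 1 X X t \<le> (SUP n. killed_mean 1 X (X - X / real (n + 2)) t)"
proof -
  \<comment> \<open>One rate suffices: one function dominates the other, so equality of a single
    finite transform forces equality almost everywhere.\<close>
  define q :: real where "q = 1"
  have q: "q > 0" by (simp add: q_def)
  \<comment> \<open>Increases to X, and is positive because n + 2 \<ge> 2.\<close>
  define Y where "Y n = X - X / real (n + 2)" for n
  have Y: "0 < Y n" "Y n \<le> X" for n using X by (auto simp: Y_def field_simps intro!: add_pos_nonneg)
  have Ymono: "Y m \<le> Y n" if "m \<le> n" for m n using X that by (auto simp: Y_def intro!: divide_left_mono)
  define L where "L y = 1 - Phi \<alpha> (X + q) / Phi \<alpha> (q + X - y) -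
     q * (pi * Psi \<alpha> (X + q) - pi * Psi \<alpha> (q + X - y) * (Phi \<alpha> (X + q) / Phi \<alpha> (q + X - y)))" for y
  have int: "(\<integral>\<^sup>+t. discounted_killed_mean q X y t \<partial>lborel) = ennreal (L y)" if "0 < y" "y \<le> X" for y
    using discounted_killed_mean_integral[OF q that] by (simp add: L_def)
  note [measurable] = discounted_killed_mean_laplace(1)
  define S where "S t = (SUP n. discounted_killed_mean q X (Y n) t)" for t
  have Sm [measurable]: "S \<in> borel_measurable borel" unfolding S_def[abs_def] by measurable
  have inc: "incseq (\<lambda>n. discounted_killed_mean q X (Y n))"
    unfolding incseq_def le_fun_def discounted_killed_mean_def
    by (intro allI impI mult_left_mono killed_mean_mono Ymono) auto
  have Sle: "S t \<le> discounted_killed_mean q X X t" for t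
    unfolding S_def discounted_killed_mean_def by (intro SUP_least mult_left_mono killed_mean_mono Y) auto
  have "(\<integral>\<^sup>+t. S t \<partial>lborel) = (SUP n. \<integral>\<^sup>+t. discounted_killed_mean q X (Y n) t \<partial>lborel)"
    unfolding S_def by (rule nn_integral_monotone_convergence_SUP[OF inc]) simp
  also have "\<dots> = (SUP n. ennreal (L (Y n)))" using int Y by simp
  also have "\<dots> = ennreal (L X)"
  proof (rule LIMSEQ_unique[OF LIMSEQ_SUP])
    show "incseq (\<lambda>n. ennreal (L (Y n)))"
    proof (rule incseq_SucI)
      fix n show "ennreal (L (Y n)) \<le> ennreal (L (Y (Suc n)))"
        unfolding int[OF Y, symmetric] by (intro nn_integral_mono) (use inc in \<open>simp add: incseq_Suc_iff le_fun_def\<close>)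
    qed
    have Ylim: "Y \<longlonglongrightarrow> X" unfolding Y_def[abs_def] by real_asymp
    have "isCont L X"
    proof -
      have P: "isCont (Phi \<alpha>) q" "isCont (Psi \<alpha>) q" using Phi_Psi_differentiable[OF \<alpha>] by (auto intro: DERIV_isCont)
      have "isCont (\<lambda>y. Phi \<alpha> (q + X - y)) X" by (rule isCont_o2[where g="Phi \<alpha>"]) (use P in auto)
      moreover have "isCont (\<lambda>y. Psi \<alpha> (q + X - y)) X" by (rule isCont_o2[where g="Psi \<alpha>"]) (use P in auto)
      ultimately show ?thesis unfolding L_def[abs_def] by (intro continuous_intros) (use Phi_nonzero[OF q] in auto)
    qed
    from isCont_tendsto_compose[OF this Ylim]
    show "(\<lambda>n. ennreal (L (Y n))) \<longlonglongrightarrow> ennreal (L X)" by (rule tendsto_ennrealI)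
  qed
  finally have eqI: "(\<integral>\<^sup>+t. S t \<partial>lborel) = (\<integral>\<^sup>+t. discounted_killed_mean q X X t \<partial>lborel)" using int X by simp
  \<comment> \<open>S is dominated by the other function and has the same finite integral.\<close>
  have "AE t in lborel. discounted_killed_mean q X X t \<le> S t"
  proof (rule ccontr)
    assume "\<not> ?thesis"
    then have "(\<integral>\<^sup>+t. S t \<partial>lborel) < (\<integral>\<^sup>+t. discounted_killed_mean q X X t \<partial>lborel)"
      by (intro nn_integral_less) (use Sle int[of X] X in \<open>auto simp: eqI\<close>)
    then show False using eqI by simp
  qed
  then show ?thesis
  proof eventually_elim
    case (elim t)
    show ?case
    proof
      assume t: "0 \<le> t"
      have "S t = ennreal (exp (- (q * t))) * (SUP n. killed_mean 1 X (Y n) t)"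
        using t unfolding S_def discounted_killed_mean_def by (simp add: SUP_mult_left_ennreal)
      then have "ennreal (exp (- (q * t))) * killed_mean 1 X X t \<le> ennreal (exp (- (q * t))) * (SUP n. killed_mean 1 X (Y n) t)"
        using elim t by (simp add: discounted_killed_mean_def)
      then have "killed_mean 1 X X t \<le> (SUP n. killed_mean 1 X (Y n) t)"
        by (subst (asm) ennreal_mult_le_mult_iff) auto
      then show "killed_mean 1 X X t \<le> (SUP n. killed_mean 1 X (X - X / real (n + 2)) t)" by (simp add: Y_def)
    qed
  qed
qed

text \<open>By scaling, the start X t^(-1/\<alpha>) observed until time 1 corresponds to the start X
  observed until time t. The starting point moves with t precisely so that X stays fixed on the
  right, where the transform in t is known.\<close>

lemma conditioned_area_laplace:
  assumes X: "X > 0" and Q: "\<And>x. x > 0 \<Longrightarrow> conditioned_positive_law P x (Pup x)"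
  shows "AE t in lborel. 0 < t \<longrightarrow>
    (\<integral>\<^sup>+w. ennreal (exp (- (t powr (1 + 1 / \<alpha>) * clipped_area w))) \<partial>Pup (X * t powr (- 1 / \<alpha>))) =
    ennreal (1 / X) * killed_mean 1 X X t"
  using killed_mean_left_limit[OF X]
proof eventually_elim
  case (elim t)
  show ?case
  proof
    assume t: "0 < t"
    define k where "k = t powr (1 / \<alpha>)"
    have k: "k > 0" using t by (simp add: k_def)
    define s where "s = t powr (1 + 1 / \<alpha>)"
    define x where "x = X / k"
    have x: "x > 0" using X k by (simp add: x_def)
    have xe: "X * t powr (- 1 / \<alpha>) = x" by (simp add: x_def k_def powr_minus divide_inverse)
    define E where "E = (\<integral>\<^sup>+w. ennreal (exp (- (s * clipped_area w))) \<partial>Pup x)"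
    have sc: "ennreal (1 / x) * killed_mean s x (y / k) 1 = ennreal (1 / X) * killed_mean 1 X y t" for y
    proof -
      have "killed_mean 1 X y t = ennreal k * killed_mean s x (y / k) 1"
        using killed_mean_scaling[OF t, of x "y / k"] k by (simp add: x_def s_def k_def[symmetric])
      then have "ennreal (1 / X) * killed_mean 1 X y t = ennreal (1 / X) * ennreal k * killed_mean s x (y / k) 1"
        by (simp only: mult.assoc)
      also have "ennreal (1 / X) * ennreal k = ennreal (1 / x)"
        using k X by (simp add: ennreal_mult'[symmetric] x_def)
      finally show ?thesis ..
    qed
    have s0: "0 \<le> s" by (simp add: s_def)
    note sw = conditioned_area_sandwich[OF x Q[OF x] s0]
    have up: "E \<le> ennreal (1 / X) * killed_mean 1 X X t"
      using sw(1) sc[of X] by (simp only: E_def x_def)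
    have "ennreal (1 / X) * killed_mean 1 X (X - X / real (n + 2)) t \<le> E" for n
    proof -
      have "(X - X / real (n + 2)) / k < x" unfolding x_def using X k by (intro divide_strict_right_mono) auto
      from sw(2)[OF this] show ?thesis unfolding sc E_def .
    qed
    then have "ennreal (1 / X) * (SUP n. killed_mean 1 X (X - X / real (n + 2)) t) \<le> E"
      by (simp add: SUP_mult_left_ennreal SUP_le_iff)
    moreover have "ennreal (1 / X) * killed_mean 1 X X t \<le> ennreal (1 / X) * (SUP n. killed_mean 1 X (X - X / real (n + 2)) t)"
      using elim t by (intro mult_left_mono) auto
    ultimately have "ennreal (1 / X) * killed_mean 1 X X t \<le> E" by (rule order_trans[rotated])
    with up have "E = ennreal (1 / X) * killed_mean 1 X X t" by (rule antisym)
    then show "(\<integral>\<^sup>+w. ennreal (exp (- (t powr (1 + 1 / \<alpha>) * clipped_area w))) \<partial>Pup (X * t powr (- 1 / \<alpha>))) =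
      ennreal (1 / X) * killed_mean 1 X X t"
      unfolding xe E_def s_def .
  qed
qed

lemma clipped_area_nonneg: "0 \<le> clipped_area w"
  unfolding clipped_area_def set_lebesgue_integral_def by (intro Bochner_Integration.integral_nonneg) auto

lemma clipped_area_measurable:
  assumes "sets N = sets path_space" shows "clipped_area \<in> borel_measurable N"
  unfolding measurable_cong_sets[OF assms refl] clipped_area_def[abs_def]
  by (rule unit_integral_measurable[OF measurable_path_eval]) (simp_all add: space_path_space)

text \<open>For fixed X the transform of the conditioned expectations is the mean of \<nu> divided
  by X, which tends to \<open>area_resolvent\<close> as X \<rightarrow> 0. For each t > 0 the starts
  X t^(-1/\<alpha>) tend to 0 from the right, so weak convergence identifies the limit of the
  integrand, dominated by exp(-q t).\<close>

lemma limit_area_laplace: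
  assumes q: "q > 0" and Q: "\<And>x. x > 0 \<Longrightarrow> conditioned_positive_law P x (Pup x)"
    and P0: "path_law P0" and conv: "skorokhod_weak_conv Pup P0 (at_right 0)"
  shows "(LINT t:{0..}|lborel. exp (- q * t) * (LINT w|P0. exp (- (t powr (1 + 1 / \<alpha>) * clipped_area w)))) = area_resolvent q"
proof -
  interpret P0: prob_space P0 using P0 by (simp add: path_law_def)
  have setsP0: "sets P0 = sets path_space" using P0 by (simp add: path_law_def)
  define X where "X n = 1 / real (n + 1)" for n
  have X: "X n > 0" for n by (simp add: X_def)
  have X0: "filterlim X (at_right 0) sequentially" unfolding X_def[abs_def] by real_asymp
  define e where "e n t = (LINT w|Pup (X n * t powr (- 1 / \<alpha>)). exp (- (t powr (1 + 1 / \<alpha>) * clipped_area w)))" for n t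
  define e0 where "e0 t = (LINT w|P0. exp (- (t powr (1 + 1 / \<alpha>) * clipped_area w)))" for t
  have Qp: "prob_space (Pup x)" "sets (Pup x) = sets path_space" if "x > 0" for x
    using Q[OF that] by (auto simp: conditioned_positive_law_def path_law_def)
  have bd: "\<bar>exp (- (t powr (1 + 1 / \<alpha>) * clipped_area w))\<bar> \<le> 1" for t w
    using clipped_area_nonneg[of w] by simp
  have en: "ennreal (e n t) = (\<integral>\<^sup>+w. ennreal (exp (- (t powr (1 + 1 / \<alpha>) * clipped_area w))) \<partial>Pup (X n * t powr (- 1 / \<alpha>)))"
    and e1: "0 \<le> e n t" "e n t \<le> 1" if t: "0 < t" for n t
  proof -
    have x: "X n * t powr (- 1 / \<alpha>) > 0" using X t by simp
    interpret Q: prob_space "Pup (X n * t powr (- 1 / \<alpha>))" by (rule Qp[OF x])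
    have m: "(\<lambda>w. exp (- (t powr (1 + 1 / \<alpha>) * clipped_area w))) \<in> borel_measurable (Pup (X n * t powr (- 1 / \<alpha>)))"
      by (rule measurable_compose[OF clipped_area_measurable[OF Qp(2)[OF x]], of "\<lambda>y. exp (- (t powr (1 + 1 / \<alpha>) * y))"]) measurable
    have i: "integrable (Pup (X n * t powr (- 1 / \<alpha>))) (\<lambda>w. exp (- (t powr (1 + 1 / \<alpha>) * clipped_area w)))"
      by (rule Q.integrable_const_bound[OF AE_I2 m, where B=1]) (simp only: real_norm_def bd)
    show "ennreal (e n t) = (\<integral>\<^sup>+w. ennreal (exp (- (t powr (1 + 1 / \<alpha>) * clipped_area w))) \<partial>Pup (X n * t powr (- 1 / \<alpha>)))"
      unfolding e_def by (rule nn_integral_eq_integral[symmetric, OF i]) simp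
    show "0 \<le> e n t" unfolding e_def by simp
    have "e n t \<le> (LINT w|Pup (X n * t powr (- 1 / \<alpha>)). 1)"
      unfolding e_def using bd by (intro integral_mono[OF i] Q.integrable_const) simp
    then show "e n t \<le> 1" by (simp only: lebesgue_integral_const Q.prob_space scaleR_one)
  qed
  \<comment> \<open>A version written with killed means, measurable in t. For \<open>e n\<close>
    this is unclear, since no regularity of \<open>Pup x\<close> in x is available.\<close>
  define f where "f n t = enn2real (discounted_killed_mean q (X n) (X n) t) / X n" for n t
  have fm [measurable]: "f n \<in> borel_measurable borel" for n
    unfolding f_def[abs_def] by (intro borel_measurable_divide borel_measurable_const borel_measurable_enn2real discounted_killed_mean_laplace(1))
  have ca: "AE t in lborel. 0 < t \<longrightarrow>
    (\<integral>\<^sup>+w. ennreal (exp (- (t powr (1 + 1 / \<alpha>) * clipped_area w))) \<partial>Pup (X n * t powr (- 1 / \<alpha>))) =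
    ennreal (1 / X n) * killed_mean 1 (X n) (X n) t" for n
    by (rule conditioned_area_laplace[OF X]) (rule Q)
  have fe: "AE t in lborel. f n t = indicator {0..} t * (exp (- q * t) * e n t)" for n
    using ca[of n] AE_lborel_singleton[of 0]
  proof eventually_elim
    case (elim t)
    show ?case
    proof (cases "0 < t")
      case True
      have "ennreal (1 / X n) * discounted_killed_mean q (X n) (X n) t = ennreal (exp (- (q * t))) * (ennreal (1 / X n) * killed_mean 1 (X n) (X n) t)"
        using True by (simp add: discounted_killed_mean_def mult_ac)
      also have "\<dots> = ennreal (exp (- (q * t)) * e n t)"
        using elim(1) True en[OF True, of n] by (simp add: ennreal_mult')
      finally have "enn2real (ennreal (1 / X n) * discounted_killed_mean q (X n) (X n) t) = exp (- (q * t)) * e n t"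
        using e1(1)[OF True] by simp
      then show ?thesis using True X[of n] by (simp add: f_def enn2real_mult)
    next
      case False
      then show ?thesis using elim(2) by (simp add: f_def discounted_killed_mean_def)
    qed
  qed
  have If: "(LINT t|lborel. f n t) = occupation_mean q (X n) / X n" for n
  proof -
    have z: "(\<integral>\<^sup>+t. discounted_killed_mean q (X n) (X n) t \<partial>lborel) = ennreal (occupation_mean q (X n))"
      using discounted_killed_mean_integral[OF q X order_refl] occupation_mean_Phi_Psi[OF q X] by simp
    have fin: "AE t in lborel. discounted_killed_mean q (X n) (X n) t \<noteq> \<infinity>"
      by (rule nn_integral_PInf_AE) (use discounted_killed_mean_laplace(1) z in auto)
    have "0 \<le> occupation_mean q (X n)"
      unfolding occupation_mean_def using AE_occupation_nonneg by (rule integral_nonneg_AE)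
    have "(LINT t|lborel. enn2real (discounted_killed_mean q (X n) (X n) t)) = enn2real (\<integral>\<^sup>+t. ennreal (enn2real (discounted_killed_mean q (X n) (X n) t)) \<partial>lborel)"
      by (rule integral_eq_nn_integral) (use borel_measurable_enn2real[OF discounted_killed_mean_laplace(1), of q "X n" "X n"] in auto)
    also have "(\<integral>\<^sup>+t. ennreal (enn2real (discounted_killed_mean q (X n) (X n) t)) \<partial>lborel) = (\<integral>\<^sup>+t. discounted_killed_mean q (X n) (X n) t \<partial>lborel)"
      by (rule nn_integral_cong_AE) (use fin in \<open>eventually_elim, simp add: less_top\<close>)
    finally show ?thesis unfolding z using \<open>0 \<le> occupation_mean q (X n)\<close> by (simp add: f_def[abs_def])
  qed
  note [measurable] = clipped_area_measurable[OF setsP0]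
  have e0m [measurable]: "e0 \<in> borel_measurable borel" unfolding e0_def[abs_def] by measurable
  have lim: "(\<lambda>n. e n t) \<longlonglongrightarrow> e0 t" if t: "0 < t" for t
  proof -
    define F where "F w = exp (- (t powr (1 + 1 / \<alpha>) * clipped_area w))" for w
    have "continuous_map skorokhod_topology euclideanreal F"
      unfolding F_def[abs_def] clipped_area_def
      by (rule skorokhod_integral_continuous_map[of "\<lambda>y. max y 0" "\<lambda>y. exp (- (t powr (1 + 1 / \<alpha>) * y))"]) (intro continuous_intros)+
    moreover have "bounded (F ` cadlag_paths)" unfolding F_def by (rule boundedI[of _ 1]) (use bd in auto)
    ultimately have "((\<lambda>x. integral\<^sup>L (Pup x) F) \<longlongrightarrow> integral\<^sup>L P0 F) (at_right 0)"
      using conv unfolding skorokhod_weak_conv_def by blast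
    moreover have "filterlim (\<lambda>n. X n * t powr (- 1 / \<alpha>)) (at_right 0) sequentially"
      using t unfolding X_def by real_asymp
    ultimately show ?thesis unfolding e_def e0_def F_def by (rule filterlim_compose)
  qed
  have "(\<lambda>n. LINT t|lborel. f n t) \<longlonglongrightarrow> (LINT t|lborel. indicator {0..} t * (exp (- q * t) * e0 t))"
  proof (rule integral_dominated_convergence)
    show "integrable lborel (\<lambda>t. indicator {0..} t * exp (- (q * t)))"
      using exp_laplace_integral(1)[OF q] by (simp add: set_integrable_def)
    have "AE t in lborel. \<forall>n. f n t = indicator {0..} t * (exp (- q * t) * e n t)" using fe by (simp add: AE_all_countable)
    then show "AE t in lborel. (\<lambda>n. f n t) \<longlonglongrightarrow> indicator {0..} t * (exp (- q * t) * e0 t)"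
      using AE_lborel_singleton[of 0]
    proof eventually_elim
      case (elim t)
      show ?case unfolding elim(1)[rule_format]
      proof (cases "0 < t")
        case True
        then show "(\<lambda>n. indicator {0..} t * (exp (- q * t) * e n t)) \<longlonglongrightarrow> indicator {0..} t * (exp (- q * t) * e0 t)"
          by (intro tendsto_intros lim)
      next
        case False
        then show "(\<lambda>n. indicator {0..} t * (exp (- q * t) * e n t)) \<longlonglongrightarrow> indicator {0..} t * (exp (- q * t) * e0 t)"
          using elim(2) by simp
      qed
    qed
    show "AE t in lborel. norm (f n t) \<le> indicator {0..} t * exp (- (q * t))" for n
      using fe[of n] AE_lborel_singleton[of 0]
    proof eventually_elim
      case (elim t)
      then show ?case using e1[of t n] by (cases "0 < t") (auto simp: abs_mult)
    qed
  qed measurable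
  moreover have "(\<lambda>n. LINT t|lborel. f n t) \<longlonglongrightarrow> area_resolvent q"
    unfolding If by (rule filterlim_compose[OF passage_transform_derivative(2)[OF q] X0])
  ultimately have "(LINT t|lborel. indicator {0..} t * (exp (- q * t) * e0 t)) = area_resolvent q" by (rule LIMSEQ_unique)
  then show ?thesis by (simp add: e0_def set_lebesgue_integral_def)
qed

text \<open>Weak convergence carries the vanishing mean of \<open>negative_part_area\<close> to the
  limit law; path by path, w then equals its positive part at almost every time.\<close>

lemma limit_area_nonneg:
  assumes Q: "\<And>x. x > 0 \<Longrightarrow> conditioned_positive_law P x (Pup x)"
    and P0: "path_law P0" and conv: "skorokhod_weak_conv Pup P0 (at_right 0)"
  shows "AE w in P0. path_area w = clipped_area w"
proof -
  interpret P0: prob_space P0 using P0 by (simp add: path_law_def)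
  have setsP0: "sets P0 = sets path_space" using P0 by (simp add: path_law_def)
  have spP0: "space P0 = cadlag_paths" using sets_eq_imp_space_eq[OF setsP0] by (simp add: space_path_space)
  have m [measurable]: "negative_part_area \<in> borel_measurable P0"
    unfolding measurable_cong_sets[OF setsP0 refl] negative_part_area_def[abs_def]
    by (rule unit_integral_measurable[OF measurable_path_eval]) (simp_all add: space_path_space)
  have nn: "0 \<le> negative_part_area w" for w
    unfolding negative_part_area_def set_lebesgue_integral_def by (intro Bochner_Integration.integral_nonneg) auto
  have bi: "set_integrable lborel {0..1} (\<lambda>r. min 1 (max (- w r) 0))" if w: "cadlag w" for w :: "real \<Rightarrow> real"
  proof -
    have "integrable lborel (\<lambda>r. indicator {0..1} r *\<^sub>R w r)"
      using cadlag_set_integrable[OF w] by (simp add: set_integrable_def)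
    then have "integrable lborel (\<lambda>r. min (indicator {0..1} r) (max (- (indicator {0..1} r *\<^sub>R w r)) 0))"
      by (intro integrable_min integrable_max) auto
    then show ?thesis unfolding set_integrable_def
      by (rule back_subst[where P="integrable lborel"]) (auto simp: fun_eq_iff indicator_def)
  qed
  have le1: "negative_part_area w \<le> 1" if w: "cadlag w" for w
  proof -
    have "negative_part_area w \<le> (LINT r:{0..1::real}|lborel. 1)"
      unfolding negative_part_area_def by (rule set_integral_mono[OF bi[OF w]]) (auto simp: set_integrable_def)
    then show ?thesis by (simp add: set_lebesgue_integral_def)
  qed
  have "continuous_map skorokhod_topology euclideanreal negative_part_area"
    unfolding negative_part_area_def[abs_def]
    by (rule skorokhod_integral_continuous_map[of "\<lambda>y. min 1 (max (- y) 0)" "\<lambda>y. y"]) (intro continuous_intros)+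
  moreover have "bounded (negative_part_area ` cadlag_paths)"
    by (rule boundedI[of _ 1]) (use nn le1 in \<open>auto simp: cadlag_paths_def\<close>)
  ultimately have "((\<lambda>x. integral\<^sup>L (Pup x) negative_part_area) \<longlongrightarrow> integral\<^sup>L P0 negative_part_area) (at_right 0)"
    using conv unfolding skorokhod_weak_conv_def by blast
  moreover have "((\<lambda>x. integral\<^sup>L (Pup x) negative_part_area) \<longlongrightarrow> 0) (at_right 0)"
    by (rule tendsto_eventually) (use conditioned_negative_part Q in \<open>auto simp: eventually_at_right_field intro!: exI[of _ 1]\<close>)
  ultimately have "integral\<^sup>L P0 negative_part_area = 0"
    by (rule tendsto_unique[rotated]) simp
  moreover have "integrable P0 negative_part_area"
    by (rule P0.integrable_const_bound[where B=1]) (use nn le1 spP0 in \<open>auto simp: cadlag_paths_def\<close>)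
  ultimately have "AE w in P0. negative_part_area w = 0"
    using integral_nonneg_eq_0_iff_AE[of P0 negative_part_area] nn by simp
  then show ?thesis using AE_space
  proof eventually_elim
    case (elim w)
    then have w: "cadlag w" by (simp add: spP0 cadlag_paths_def)
    have "AE r in lborel. indicator {0..1} r *\<^sub>R min 1 (max (- w r) 0) = 0"
      using integral_nonneg_eq_0_iff_AE[OF bi[OF w, unfolded set_integrable_def]] elim(1)
      by (simp add: negative_part_area_def set_lebesgue_integral_def)
    then have ae: "AE r in lborel. indicator {0..1} r *\<^sub>R w r = indicator {0..1} r *\<^sub>R max (w r) 0"
      by eventually_elim (auto simp: indicator_def min_def max_def split: if_splits)
    have "(\<lambda>r. indicator {0..1} r *\<^sub>R w r) \<in> borel_measurable lborel"
      using cadlag_set_integrable[OF w] unfolding set_integrable_def by (rule borel_measurable_integrable)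
    moreover from this have "(\<lambda>r. max (indicator {0..1} r *\<^sub>R w r) 0) \<in> borel_measurable lborel" by measurable
    moreover have "(\<lambda>r. max (indicator {0..1} r *\<^sub>R w r) 0) = (\<lambda>r. indicator {0..1} r *\<^sub>R max (w r) 0)"
      by (auto simp: fun_eq_iff indicator_def)
    ultimately show ?case unfolding path_area_def clipped_area_def set_lebesgue_integral_def
      using ae by (intro integral_cong_AE) (simp_all only:)
  qed
qed

end

theorem theorem5:
  fixes \<alpha> :: real
    and P P0 :: "(real \<Rightarrow> real) measure"
    and Pup :: "real \<Rightarrow> (real \<Rightarrow> real) measure"
    and M :: "'a measure"
    and Lup :: "'a \<Rightarrow> real \<Rightarrow> real"
  assumes "1 < \<alpha>" and "\<alpha> \<le> 2"
    and "normalized_spectrally_positive_stable_law \<alpha> P"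
    and "\<And>x. x > 0 \<Longrightarrow> conditioned_positive_law P x (Pup x)"
    and "path_law P0" and "skorokhod_weak_conv Pup P0 (at_right 0)"
    and "prob_space M" and "Lup \<in> M \<rightarrow>\<^sub>M path_space" and "distr M path_space Lup = P0"
  shows "(\<forall>l>0.
           (LINT t:{0..}|lborel.
              exp (- l * t) * (LINT \<omega>|M. exp (- (t powr (1 + 1 / \<alpha>)) * path_area (Lup \<omega>)))) =
           pi * l * ((deriv (Phi \<alpha>) l * Psi \<alpha> l - deriv (Psi \<alpha>) l * Phi \<alpha> l) / Phi \<alpha> l)
             - deriv (Phi \<alpha>) l / Phi \<alpha> l) \<and>
         (\<alpha> < 2 \<longrightarrow>
           (\<lambda>x. measure M {\<omega> \<in> space M. path_area (Lup \<omega>) > x}) \<sim>[at_top]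
           (\<lambda>x. Gamma (1 + \<alpha>) / (Gamma (1 + \<alpha> - 1 / \<alpha>) * Gamma (2 - \<alpha>)) * x powr (1 - \<alpha>)))"
proof -
  have "prob_space P"
    using assms(3) by (simp add: normalized_spectrally_positive_stable_law_def stable_law_def levy_law_def path_law_def)
  then interpret spectrally_positive_stable P \<alpha>
    using assms(1-3) by (simp add: spectrally_positive_stable_def spectrally_positive_stable_axioms_def)
  interpret M: prob_space M by fact
  define A where "A \<omega> = path_area (Lup \<omega>)" for \<omega>
  have "path_area \<in> borel_measurable path_space"
    unfolding path_area_def[abs_def]
    by (rule unit_integral_measurable[OF measurable_path_eval, of "\<lambda>y. y"]) (simp_all add: space_path_space)
  from measurable_compose[OF assms(8) this]
  have Am [measurable]: "A \<in> borel_measurable M" by (simp add: A_def[abs_def])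
  have cm: "(\<lambda>\<omega>. clipped_area (Lup \<omega>)) \<in> borel_measurable M"
    by (rule measurable_compose[OF assms(8) clipped_area_measurable]) simp
  \<comment> \<open>The limit results are proved for the clipped area; this transfers them to the
    area and makes it nonnegative almost surely, as the tail argument demands.\<close>
  have "AE w in distr M path_space Lup. path_area w = clipped_area w"
    unfolding assms(9) by (rule limit_area_nonneg[OF assms(4-6)])
  from AE_distrD[OF assms(8) this] have ae: "AE \<omega> in M. A \<omega> = clipped_area (Lup \<omega>)"
    by (simp add: A_def)
  then have A0: "AE \<omega> in M. 0 \<le> A \<omega>" by eventually_elim (simp add: clipped_area_nonneg)
  have tr: "(LINT \<omega>|M. exp (- (s * A \<omega>))) = (LINT w|P0. exp (- (s * clipped_area w)))" for s
  proof -
    have "(LINT w|P0. exp (- (s * clipped_area w))) = (LINT \<omega>|M. exp (- (s * clipped_area (Lup \<omega>))))"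
      unfolding assms(9)[symmetric]
    proof (rule integral_distr[OF assms(8)])
      show "(\<lambda>w. exp (- (s * clipped_area w))) \<in> borel_measurable path_space"
        by (rule measurable_compose[OF clipped_area_measurable[OF refl], of "\<lambda>y. exp (- (s * y))"]) measurable
    qed
    also have "\<dots> = (LINT \<omega>|M. exp (- (s * A \<omega>)))"
    proof (rule integral_cong_AE)
      show "(\<lambda>\<omega>. exp (- (s * clipped_area (Lup \<omega>)))) \<in> borel_measurable M"
        by (rule measurable_compose[OF cm, of "\<lambda>y. exp (- (s * y))"]) measurable
      show "AE \<omega> in M. exp (- (s * clipped_area (Lup \<omega>))) = exp (- (s * A \<omega>))"
        using ae by eventually_elim simp
    qed measurable
    finally show ?thesis ..
  qed
  have res: "(LINT t:{0..}|lborel. exp (- q * t) * (LINT \<omega>|M. exp (- (t powr (1 + 1 / \<alpha>) * A \<omega>)))) = area_resolvent q"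
    if "q > 0" for q
    unfolding tr by (rule limit_area_laplace[OF that assms(4-6)])
  have tail: "(\<lambda>x. M.prob {\<omega> \<in> space M. A \<omega> > x}) \<sim>[at_top]
      (\<lambda>x. Gamma (1 + \<alpha>) / (Gamma (1 + \<alpha> - 1 / \<alpha>) * Gamma (2 - \<alpha>)) * x powr (1 - \<alpha>))" if "\<alpha> < 2"
  proof (rule M.laplace_tail_asymptotics[OF Am A0 assms(1) that])
    show "((\<lambda>q. (1 / q - (LINT t:{0..}|lborel. exp (- q * t) * (LINT \<omega>|M. exp (- (t powr (1 + 1 / \<alpha>) * A \<omega>))))) * q powr (\<alpha> + 1 - 1 / \<alpha>)) \<longlongrightarrow> Gamma (\<alpha> + 1)) at_top"
    proof (rule Lim_transform_eventually[OF area_resolvent_asymptotics])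
      show "\<forall>\<^sub>F q in at_top. (1 / q - area_resolvent q) * q powr (\<alpha> + 1 - 1 / \<alpha>) =
        (1 / q - (LINT t:{0..}|lborel. exp (- q * t) * (LINT \<omega>|M. exp (- (t powr (1 + 1 / \<alpha>) * A \<omega>))))) * q powr (\<alpha> + 1 - 1 / \<alpha>)"
        using eventually_gt_at_top[of 0] by eventually_elim (simp only: res)
    qed
  qed
  show ?thesis
    using res tail unfolding area_resolvent_def A_def mult_minus_left by blast
qed

end
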